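(* Let $H$ be a densely defined selfadjoint operator on a separable infinite-dimensional Hilbert space $\mathscr{H}$ with non-negative spectrum containing $0$, and assume that $0$ lies in the discrete spectrum of $H$ (i.e., $0$ is an isolated eigenvalue of finite multiplicity). Let $V:\mathscr{H}_+\to\mathscr{H}_-$ be a bounded operator whose quadratic form $Q_V$ is symmetric and $H$-form compact. Assume that $V\ge0$ and that $H^{-\frac12}VH^{-\frac12}$ is a Weyl operator in $\mathscr{L}_{1,\infty}$. Then the operator $H^{-\frac12}VH^{-\frac12}$ is strongly measurable, and $$\lim_{h\to0^+}h^2N^-\big(h^2H-V\big)=\int\!\!\!\!\!\!-\;H^{-\frac12}VH^{-\frac12}.$$
   Context: $\mathscr{H}_+$ is the form domain $\operatorname{dom}(H+1)^{1/2}$ with the Hilbert norm $\|\xi\|_+=\|(1+H)^{1/2}\xi\|$, and $\mathscr{H}_-$ is the Hilbert space of continuous anti-linear functionals on $\mathscr{H}_+$; $\mathscr{H}$ embeds in $\mathscr{H}_-$ via $\xi\mapsto\langle\xi|\cdot\rangle$. The operator $(H+1)^{-1/2}$ is unitary from $\mathscr{H}$ onto $\mathscr{H}_+$ and, by duality, extends to a unitary from $\mathscr{H}_-$ onto $\mathscr{H}$. The quadratic form of $V$ is $Q_V(\xi,\eta)=\langle V\xi,\eta\rangle$, $\xi,\eta\in\mathscr{H}_+$. It is $H$-form compact if $V:\mathscr{H}_+\to\mathscr{H}_-$ is compact, equivalently $(H+1)^{-1/2}V(H+1)^{-1/2}$ is compact on $\mathscr{H}$. $V\ge0$ means $Q_V(\xi,\xi)\ge0$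 for all $\xi\in\mathscr{H}_+$. $H^{-1/2}$ is the partial inverse of $H^{1/2}$ (zero on $\ker H$, inverse of $H^{1/2}$ on $(\ker H)^\perp$); it maps $\mathscr{H}$ boundedly to $\mathscr{H}_+$ and by duality extends to a bounded operator $\mathscr{H}_-\to\mathscr{H}$, so $H^{-1/2}VH^{-1/2}$ is a selfadjoint compact operator on $\mathscr{H}$. For $h>0$, $h^2H-V$ is the bounded-from-below selfadjoint operator on $\mathscr{H}$ defined as a form sum (quadratic form $h^2Q_H-Q_V$ on $\mathscr{H}_+$, where $Q_H$ is the quadratic form of $H$); $N^-(h^2H-V)$ is the number of its negative eigenvalues counted with multiplicity. For a compact operator $T$ on $\mathscr{H}$, $\mu_j(T)$ ($j\ge 0$) is the $(j+1)$-th eigenvalue of $|T|=\sqrt{T^*T}$, in non-increasing order counted with multiplicity. $\mathscr{L}_{1,\infty}$ is the ideal of compact operators with $\mu_j(T)=O(j^{-1})$. A positive operator $A\in\mathscr{L}_{1,\infty}$ is a Weyl operator if $\lim_{j\to\infty}j\lambda_j(A)$ exists, where $\lambda_0(A)\ge\lambda_1(A)\ge\cdots$ are its eigenvalues counted with multiplicity. For general compact $A$, $(\lambda_j(A))_{j\ge 0}$ denotes any sequence listing its eigenvalues with algebraic multiplicity (completed by $0$'s if needed) in order of non-increasing modulus. An extended limit $\lim_\omega$ is a state on the $C^*$-algebra $\ell_\infty$ of bounded complex sequences $(a_N)_{N\ge1}$ that vanishes on sequences converging to $0$. By convention $(\log N)^{-1}=0$ for $N=1$. The Dixmier trace is $\operatorname{Tr}_\omega(A)=\lim_\omega\frac{1}{\log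 N}\sum_{j<N}\lambda_j(A)$, $A\in\mathscr{L}_{1,\infty}$. $A$ is measurable if $\operatorname{Tr}_\omega(A)$ is independent of the extended limit; this common value is the NC integral $\int\!\!\!\!\!\!-\;A$. A trace on $\mathscr{L}_{1,\infty}$ is a linear functional vanishing on all commutators $[S,T]$ with $S$ bounded and $T\in\mathscr{L}_{1,\infty}$; it is positive if non-negative on positive operators, and normalized if it equals $1$ at a positive operator $T_0$ with eigenvalues $(j+1)^{-1}$, $j\ge0$. $A\in\mathscr{L}_{1,\infty}$ is strongly measurable if all positive normalized traces on $\mathscr{L}_{1,\infty}$ take the same value at $A$; this implies measurability. *)

theory Defs
  imports "HOL-Analysis.Analysis" "HOL-Library.Landau_Symbols"
begin

text \<open>The inner product is linear in the first and anti-linear in the second argument.\<close>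

class chilbert_space = banach +
  fixes scaleC :: "complex \<Rightarrow> 'a \<Rightarrow> 'a"  (infixr "*\<^sub>C" 75)
    and cinner :: "'a \<Rightarrow> 'a \<Rightarrow> complex"
  assumes scaleC_add_right: "a *\<^sub>C (x + y) = a *\<^sub>C x + a *\<^sub>C y"
    and scaleC_add_left: "(a + b) *\<^sub>C x = a *\<^sub>C x + b *\<^sub>C x"
    and scaleC_scaleC: "a *\<^sub>C (b *\<^sub>C x) = (a * b) *\<^sub>C x"
    and scaleC_of_real: "complex_of_real r *\<^sub>C x = r *\<^sub>R x"
    and cinner_add_left: "cinner (x + y) z = cinner x z + cinner y z"
    and cinner_scaleC_left: "cinner (a *\<^sub>C x) y = a * cinner x y"
    and cinner_commute: "cinner x y = cnj (cinner y x)"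
    and cinner_self: "cinner x x = complex_of_real ((norm x)\<^sup>2)"

lemma scaleC_one: "1 *\<^sub>C (x :: 'a::chilbert_space) = x"
  using scaleC_of_real[of 1 x] by simp

interpretation complex_vector:
  vector_space "scaleC :: complex \<Rightarrow> 'a \<Rightarrow> 'a::chilbert_space"
  by unfold_locales (simp_all add: scaleC_add_right scaleC_add_left scaleC_scaleC scaleC_one)

abbreviation clinear :: "('a::chilbert_space \<Rightarrow> 'b::chilbert_space) \<Rightarrow> bool" where
  "clinear \<equiv> Vector_Spaces.linear scaleC scaleC"

definition cfinite_dim :: "'a::chilbert_space set \<Rightarrow> bool" where
  "cfinite_dim S \<longleftrightarrow> (\<exists>B. finite B \<and> S \<subseteq> complex_vector.span B)"

definition cdim_enat :: "'a::chilbert_space set \<Rightarrow> enat" where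
  "cdim_enat S = (if cfinite_dim S then enat (complex_vector.dim S) else \<infinity>)"

definition orth_compl :: "'a::chilbert_space set \<Rightarrow> 'a set" where
  "orth_compl S = {x. \<forall>y\<in>S. cinner x y = 0}"

text \<open>An unbounded operator is a partial function \<open>T\<close>, with domain \<open>dom T\<close>. Hence
  \<open>S \<circ>\<^sub>m T\<close> is the composition on its natural domain
  \<open>{x \<in> dom T. the (T x) \<in> dom S}\<close>.\<close>

definition linear_op :: "('a::chilbert_space \<rightharpoonup> 'a) \<Rightarrow> bool" where
  "linear_op T \<longleftrightarrow> complex_vector.subspace (dom T) \<and>
     (\<forall>x\<in>dom T. \<forall>y\<in>dom T. the (T (x + y)) = the (T x) + the (T y)) \<and>
     (\<forall>c. \<forall>x\<in>dom T. the (T (c *\<^sub>C x)) = c *\<^sub>C the (T x))"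

definition densely_defined :: "('a::chilbert_space \<rightharpoonup> 'a) \<Rightarrow> bool" where
  "densely_defined T \<longleftrightarrow> closure (dom T) = UNIV"

definition adjoint_op :: "('a::chilbert_space \<rightharpoonup> 'a) \<Rightarrow> ('a \<rightharpoonup> 'a)" where
  "adjoint_op T = (\<lambda>y.
     if \<exists>z. \<forall>x\<in>dom T. cinner (the (T x)) y = cinner x z
     then Some (THE z. \<forall>x\<in>dom T. cinner (the (T x)) y = cinner x z)
     else None)"

definition selfadjoint_op :: "('a::chilbert_space \<rightharpoonup> 'a) \<Rightarrow> bool" where
  "selfadjoint_op T \<longleftrightarrow> linear_op T \<and> densely_defined T \<and> adjoint_op T = T"

definition shift_op :: "('a::chilbert_space \<rightharpoonup> 'a) \<Rightarrow> complex \<Rightarrow> ('a \<rightharpoonup> 'a)" where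
  "shift_op T c = (\<lambda>x. map_option (\<lambda>y. y + c *\<^sub>C x) (T x))"

definition eigenspace :: "('a::chilbert_space \<rightharpoonup> 'a) \<Rightarrow> complex \<Rightarrow> 'a set" where
  "eigenspace T c = {x \<in> dom T. the (T x) = c *\<^sub>C x}"

abbreviation ker_op :: "('a::chilbert_space \<rightharpoonup> 'a) \<Rightarrow> 'a set" where
  "ker_op T \<equiv> {x \<in> dom T. the (T x) = 0}"

text \<open>The bound on the inverse is automatic for closed \<open>T\<close>.\<close>

definition resolvent_set :: "('a::chilbert_space \<rightharpoonup> 'a) \<Rightarrow> complex set" where
  "resolvent_set T = {c. bij_betw (\<lambda>x. the (T x) - c *\<^sub>C x) (dom T) UNIV \<and>
     (\<exists>K. \<forall>x\<in>dom T. norm x \<le> K * norm (the (T x) - c *\<^sub>C x))}"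

definition spectrum :: "('a::chilbert_space \<rightharpoonup> 'a) \<Rightarrow> complex set" where
  "spectrum T = - resolvent_set T"

definition discrete_spectrum :: "('a::chilbert_space \<rightharpoonup> 'a) \<Rightarrow> complex set" where
  "discrete_spectrum T = {c. c isolated_in spectrum T \<and>
     eigenspace T c \<noteq> {0} \<and> cfinite_dim (eigenspace T c)}"

text \<open>A positive selfadjoint operator has exactly one positive selfadjoint square root.\<close>

definition sqrt_op :: "('a::chilbert_space \<rightharpoonup> 'a) \<Rightarrow> ('a \<rightharpoonup> 'a)" where
  "sqrt_op T = (THE S. selfadjoint_op S \<and>
     (\<forall>x\<in>dom S. cinner (the (S x)) x \<in> \<real>\<^sub>\<ge>\<^sub>0) \<and> S \<circ>\<^sub>m S = T)"

definition Hplus :: "('a::chilbert_space \<rightharpoonup> 'a) \<Rightarrow> 'a set" where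
  "Hplus H = dom (sqrt_op (shift_op H 1))"

definition norm_plus :: "('a::chilbert_space \<rightharpoonup> 'a) \<Rightarrow> 'a \<Rightarrow> real" where
  "norm_plus H \<xi> = norm (the (sqrt_op (shift_op H 1) \<xi>))"

text \<open>A functional on \<^term>\<open>Hplus H\<close> is represented by a function on the whole type; its values
  outside \<^term>\<open>Hplus H\<close> are irrelevant and never used.\<close>

definition Hminus :: "('a::chilbert_space \<rightharpoonup> 'a) \<Rightarrow> ('a \<Rightarrow> complex) set" where
  "Hminus H = {f.
     (\<forall>\<eta>\<in>Hplus H. \<forall>\<eta>'\<in>Hplus H. f (\<eta> + \<eta>') = f \<eta> + f \<eta>') \<and>
     (\<forall>c. \<forall>\<eta>\<in>Hplus H. f (c *\<^sub>C \<eta>) = cnj c * f \<eta>) \<and>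
     (\<exists>K. \<forall>\<eta>\<in>Hplus H. cmod (f \<eta>) \<le> K * norm_plus H \<eta>)}"

definition norm_minus :: "('a::chilbert_space \<rightharpoonup> 'a) \<Rightarrow> ('a \<Rightarrow> complex) \<Rightarrow> real" where
  "norm_minus H f = (SUP \<eta>\<in>{\<eta>\<in>Hplus H. norm_plus H \<eta> \<le> 1}. cmod (f \<eta>))"

text \<open>Bounded linear operators \<open>V\<close> from \<^term>\<open>Hplus H\<close> to \<^term>\<open>Hminus H\<close>. Since \<open>V \<xi>\<close> is an
  anti-linear functional, the quadratic form \<open>Q\<^sub>V(\<xi>,\<eta>) = \<langle>V\<xi>,\<eta>\<rangle>\<close> is \<open>V \<xi> \<eta>\<close>.\<close>

definition bounded_plus_minus ::
  "('a::chilbert_space \<rightharpoonup> 'a) \<Rightarrow> ('a \<Rightarrow> 'a \<Rightarrow> complex) \<Rightarrow> bool" where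
  "bounded_plus_minus H V \<longleftrightarrow>
     (\<forall>\<xi>\<in>Hplus H. V \<xi> \<in> Hminus H) \<and>
     (\<forall>\<xi>\<in>Hplus H. \<forall>\<xi>'\<in>Hplus H. \<forall>\<eta>\<in>Hplus H. V (\<xi> + \<xi>') \<eta> = V \<xi> \<eta> + V \<xi>' \<eta>) \<and>
     (\<forall>c. \<forall>\<xi>\<in>Hplus H. \<forall>\<eta>\<in>Hplus H. V (c *\<^sub>C \<xi>) \<eta> = c * V \<xi> \<eta>) \<and>
     (\<exists>K. \<forall>\<xi>\<in>Hplus H. norm_minus H (V \<xi>) \<le> K * norm_plus H \<xi>)"

definition symmetric_form ::
  "('a::chilbert_space \<rightharpoonup> 'a) \<Rightarrow> ('a \<Rightarrow> 'a \<Rightarrow> complex) \<Rightarrow> bool" where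
  "symmetric_form H V \<longleftrightarrow> (\<forall>\<xi>\<in>Hplus H. \<forall>\<eta>\<in>Hplus H. V \<xi> \<eta> = cnj (V \<eta> \<xi>))"

definition nonneg_form ::
  "('a::chilbert_space \<rightharpoonup> 'a) \<Rightarrow> ('a \<Rightarrow> 'a \<Rightarrow> complex) \<Rightarrow> bool" where
  "nonneg_form H V \<longleftrightarrow> (\<forall>\<xi>\<in>Hplus H. V \<xi> \<xi> \<in> \<real>\<^sub>\<ge>\<^sub>0)"

text \<open>Compactness of \<open>V\<close> as an operator from \<^term>\<open>Hplus H\<close> to \<^term>\<open>Hminus H\<close>: images of
  bounded sequences have convergent subsequences.\<close>

definition form_compact ::
  "('a::chilbert_space \<rightharpoonup> 'a) \<Rightarrow> ('a \<Rightarrow> 'a \<Rightarrow> complex) \<Rightarrow> bool" where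
  "form_compact H V \<longleftrightarrow>
     (\<forall>\<xi> :: nat \<Rightarrow> 'a. (\<forall>n. \<xi> n \<in> Hplus H) \<and> (\<exists>K. \<forall>n. norm_plus H (\<xi> n) \<le> K) \<longrightarrow>
       (\<exists>r f. strict_mono r \<and> f \<in> Hminus H \<and>
          (\<lambda>n. norm_minus H (\<lambda>\<eta>. V (\<xi> (r n)) \<eta> - f \<eta>)) \<longlonglongrightarrow> 0))"

text \<open>The partial inverse \<open>H\<^sup>-\<^sup>1\<^sup>/\<^sup>2\<close>; it is
  everywhere defined if 0 is not an accumulation point of the spectrum.\<close>

definition inv_sqrt :: "('a::chilbert_space \<rightharpoonup> 'a) \<Rightarrow> 'a \<Rightarrow> 'a" where
  "inv_sqrt H = (THE P. clinear P \<and> (\<forall>x\<in>ker_op H. P x = 0) \<and>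
     (\<forall>x\<in>orth_compl (ker_op H).
        P x \<in> orth_compl (ker_op H) \<and> sqrt_op H (P x) = Some x))"

text \<open>The extension to \<open>H\<^sub>-\<close>, by duality, of a selfadjoint bounded operator \<open>P\<close> that maps
  into \<open>H\<^sub>+\<close>: it sends a functional \<open>f\<close> to the vector representing \<open>\<eta> \<mapsto> f (P \<eta>)\<close>.\<close>

definition dual_ext :: "('a::chilbert_space \<Rightarrow> 'a) \<Rightarrow> ('a \<Rightarrow> complex) \<Rightarrow> 'a" where
  "dual_ext P f = (THE \<zeta>. \<forall>\<eta>. cinner \<zeta> \<eta> = f (P \<eta>))"

text \<open>\<open>H\<^sup>-\<^sup>1\<^sup>/\<^sup>2 V H\<^sup>-\<^sup>1\<^sup>/\<^sup>2\<close>, whose left factor is the extension to \<open>H\<^sub>-\<close>.\<close>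

definition birman_schwinger ::
  "('a::chilbert_space \<rightharpoonup> 'a) \<Rightarrow> ('a \<Rightarrow> 'a \<Rightarrow> complex) \<Rightarrow> 'a \<Rightarrow> 'a" where
  "birman_schwinger H V = (\<lambda>\<xi>. dual_ext (inv_sqrt H) (V (inv_sqrt H \<xi>)))"

definition form_op ::
  "'a::chilbert_space set \<Rightarrow> ('a \<Rightarrow> 'a \<Rightarrow> complex) \<Rightarrow> ('a \<rightharpoonup> 'a)" where
  "form_op D q = (\<lambda>\<xi>.
     if \<xi> \<in> D \<and> (\<exists>\<zeta>. \<forall>\<eta>\<in>D. q \<xi> \<eta> = cinner \<zeta> \<eta>)
     then Some (THE \<zeta>. \<forall>\<eta>\<in>D. q \<xi> \<eta> = cinner \<zeta> \<eta>)
     else None)"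

text \<open>The quadratic form of \<open>H\<close>; note that \<open>H\<^sup>1\<^sup>/\<^sup>2\<close> and \<open>(H + 1)\<^sup>1\<^sup>/\<^sup>2\<close> have the same domain.\<close>

definition Q_op :: "('a::chilbert_space \<rightharpoonup> 'a) \<Rightarrow> 'a \<Rightarrow> 'a \<Rightarrow> complex" where
  "Q_op H \<xi> \<eta> = cinner (the (sqrt_op H \<xi>)) (the (sqrt_op H \<eta>))"

definition schroedinger ::
  "('a::chilbert_space \<rightharpoonup> 'a) \<Rightarrow> ('a \<Rightarrow> 'a \<Rightarrow> complex) \<Rightarrow> real \<Rightarrow> ('a \<rightharpoonup> 'a)" where
  "schroedinger H V h =
     form_op (Hplus H) (\<lambda>\<xi> \<eta>. complex_of_real (h\<^sup>2) * Q_op H \<xi> \<eta> - V \<xi> \<eta>)"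

text \<open>The number of negative eigenvalues counted with multiplicity, a priori possibly infinite.
  Sums of extended natural numbers always exist.\<close>

definition N_minus :: "('a::chilbert_space \<rightharpoonup> 'a) \<Rightarrow> enat" where
  "N_minus T = (\<Sum>\<^sub>\<infinity>t\<in>{..<0::real}. cdim_enat (eigenspace T (complex_of_real t)))"

definition bounded_op :: "('a::chilbert_space \<Rightarrow> 'a) \<Rightarrow> bool" where
  "bounded_op A \<longleftrightarrow> clinear A \<and> (\<exists>K. \<forall>x. norm (A x) \<le> K * norm x)"

definition compact_op :: "('a::chilbert_space \<Rightarrow> 'a) \<Rightarrow> bool" where
  "compact_op A \<longleftrightarrow> clinear A \<and> compact (closure (A ` cball 0 1))"

definition positive_op :: "('a::chilbert_space \<Rightarrow> 'a) \<Rightarrow> bool" where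
  "positive_op A \<longleftrightarrow> bounded_op A \<and> (\<forall>x. cinner (A x) x \<in> \<real>\<^sub>\<ge>\<^sub>0)"

definition bounded_adjoint :: "('a::chilbert_space \<Rightarrow> 'a) \<Rightarrow> 'a \<Rightarrow> 'a" where
  "bounded_adjoint A = (\<lambda>y. THE z. \<forall>x. cinner (A x) y = cinner x z)"

definition abs_op :: "('a::chilbert_space \<Rightarrow> 'a) \<Rightarrow> 'a \<Rightarrow> 'a" where
  "abs_op A = (THE S. positive_op S \<and> S \<circ> S = bounded_adjoint A \<circ> A)"

definition generalized_eigenspace :: "('a::chilbert_space \<Rightarrow> 'a) \<Rightarrow> complex \<Rightarrow> 'a set" where
  "generalized_eigenspace A c = {x. \<exists>k. ((\<lambda>y. A y - c *\<^sub>C y) ^^ k) x = 0}"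

text \<open>\<open>l\<close> lists the nonzero eigenvalues of \<open>A\<close> with algebraic multiplicity, by non-increasing
  modulus, and is completed by zeros if there are only finitely many.\<close>

definition eigenvalue_sequence ::
  "('a::chilbert_space \<Rightarrow> 'a) \<Rightarrow> (nat \<Rightarrow> complex) \<Rightarrow> bool" where
  "eigenvalue_sequence A l \<longleftrightarrow> antimono (\<lambda>j. cmod (l j)) \<and>
     (\<forall>c. c \<noteq> 0 \<longrightarrow> finite {j. l j = c} \<and>
        enat (card {j. l j = c}) = cdim_enat (generalized_eigenspace A c))"

text \<open>Any choice of such a sequence; it is unique if \<open>A\<close> is positive.\<close>

definition eigenvalue_seq :: "('a::chilbert_space \<Rightarrow> 'a) \<Rightarrow> nat \<Rightarrow> complex" where
  "eigenvalue_seq A = (SOME l. eigenvalue_sequence A l)"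

definition singular_value :: "('a::chilbert_space \<Rightarrow> 'a) \<Rightarrow> nat \<Rightarrow> real" where
  "singular_value A j = Re (eigenvalue_seq (abs_op A) j)"

definition weak_trace_class :: "('a::chilbert_space \<Rightarrow> 'a) set"  ("\<L>\<^sub>1\<^sub>\<infinity>") where
  "\<L>\<^sub>1\<^sub>\<infinity> = {A. compact_op A \<and> singular_value A \<in> O(\<lambda>j. 1 / real j)}"

definition weyl_operator :: "('a::chilbert_space \<Rightarrow> 'a) \<Rightarrow> bool" where
  "weyl_operator A \<longleftrightarrow> positive_op A \<and> A \<in> \<L>\<^sub>1\<^sub>\<infinity> \<and>
     convergent (\<lambda>j. of_nat j * eigenvalue_seq A j)"

text \<open>Sequences \<open>(a\<^sub>N)\<close>, \<open>N \<ge> 1\<close>, are represented by \<open>\<lambda>n. a\<^sub>n\<^sub>+\<^sub>1\<close>. A state is a positive linear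
  functional taking the value 1 at the unit; only the values of \<open>\<omega>\<close> at bounded sequences
  matter.\<close>

definition extended_limit :: "((nat \<Rightarrow> complex) \<Rightarrow> complex) \<Rightarrow> bool" where
  "extended_limit \<omega> \<longleftrightarrow>
     (\<forall>a b. Bseq a \<and> Bseq b \<longrightarrow> \<omega> (\<lambda>n. a n + b n) = \<omega> a + \<omega> b) \<and>
     (\<forall>c a. Bseq a \<longrightarrow> \<omega> (\<lambda>n. c * a n) = c * \<omega> a) \<and>
     (\<forall>a. Bseq a \<and> (\<forall>n. a n \<in> \<real>\<^sub>\<ge>\<^sub>0) \<longrightarrow> \<omega> a \<in> \<real>\<^sub>\<ge>\<^sub>0) \<and>
     \<omega> (\<lambda>n. 1) = 1 \<and>
     (\<forall>a. a \<longlonglongrightarrow> 0 \<longrightarrow> \<omega> a = 0)"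

text \<open>For \<open>N = 1\<close> the quotient is 0, because \<open>ln 1 = 0\<close> and division by 0 gives 0.\<close>

definition dixmier_trace ::
  "((nat \<Rightarrow> complex) \<Rightarrow> complex) \<Rightarrow> ('a::chilbert_space \<Rightarrow> 'a) \<Rightarrow> complex" where
  "dixmier_trace \<omega> A =
     \<omega> (\<lambda>n. (\<Sum>j<Suc n. eigenvalue_seq A j) / complex_of_real (ln (real (Suc n))))"

definition measurable_op :: "('a::chilbert_space \<Rightarrow> 'a) \<Rightarrow> bool" where
  "measurable_op A \<longleftrightarrow> A \<in> \<L>\<^sub>1\<^sub>\<infinity> \<and> (\<exists>c. \<forall>\<omega>. extended_limit \<omega> \<longrightarrow> dixmier_trace \<omega> A = c)"

text \<open>The NC integral, meaningful for measurable operators.\<close>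

definition nc_integral :: "('a::chilbert_space \<Rightarrow> 'a) \<Rightarrow> complex" where
  "nc_integral A = (THE c. \<forall>\<omega>. extended_limit \<omega> \<longrightarrow> dixmier_trace \<omega> A = c)"

text \<open>Only the values of \<open>\<tau>\<close> on \<open>\<L>\<^sub>1\<^sub>\<infinity>\<close> matter.\<close>

definition trace_functional :: "(('a::chilbert_space \<Rightarrow> 'a) \<Rightarrow> complex) \<Rightarrow> bool" where
  "trace_functional \<tau> \<longleftrightarrow>
     (\<forall>S\<in>\<L>\<^sub>1\<^sub>\<infinity>. \<forall>T\<in>\<L>\<^sub>1\<^sub>\<infinity>. \<tau> (\<lambda>x. S x + T x) = \<tau> S + \<tau> T) \<and>
     (\<forall>c. \<forall>T\<in>\<L>\<^sub>1\<^sub>\<infinity>. \<tau> (\<lambda>x. c *\<^sub>C T x) = c * \<tau> T) \<and>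
     (\<forall>S T. bounded_op S \<and> T \<in> \<L>\<^sub>1\<^sub>\<infinity> \<longrightarrow> \<tau> (\<lambda>x. S (T x) - T (S x)) = 0)"

definition positive_trace :: "(('a::chilbert_space \<Rightarrow> 'a) \<Rightarrow> complex) \<Rightarrow> bool" where
  "positive_trace \<tau> \<longleftrightarrow> trace_functional \<tau> \<and>
     (\<forall>T\<in>\<L>\<^sub>1\<^sub>\<infinity>. positive_op T \<longrightarrow> \<tau> T \<in> \<real>\<^sub>\<ge>\<^sub>0)"

definition normalized_trace :: "(('a::chilbert_space \<Rightarrow> 'a) \<Rightarrow> complex) \<Rightarrow> bool" where
  "normalized_trace \<tau> \<longleftrightarrow>
     (\<exists>T0. T0 \<in> \<L>\<^sub>1\<^sub>\<infinity> \<and> positive_op T0 \<and>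
        eigenvalue_sequence T0 (\<lambda>j. complex_of_real (1 / real (j + 1))) \<and> \<tau> T0 = 1)"

definition strongly_measurable :: "('a::chilbert_space \<Rightarrow> 'a) \<Rightarrow> bool" where
  "strongly_measurable A \<longleftrightarrow> A \<in> \<L>\<^sub>1\<^sub>\<infinity> \<and>
     (\<exists>c. \<forall>\<tau>. positive_trace \<tau> \<and> normalized_trace \<tau> \<longrightarrow> \<tau> A = c)"

end

theory Submission
  imports Defs
begin

text \<open>
  The eigenvalues of the compact positive operator \<open>A = H\<^bsup>-1/2\<^esup> V H\<^bsup>-1/2\<^esup>\<close> satisfy
  \<open>j \<lambda>\<^sub>j \<longrightarrow> c\<close>. In the eigenbasis of a normalizing operator \<open>T\<^sub>0\<close>, \<open>A\<close> becomes, up to a commutator, diagonal and lies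
  between \<open>(c \<plusminus> \<epsilon>) T\<^sub>0\<close> up to finite rank operators, on which positive traces vanish; hence every
  positive normalized trace takes the value \<open>c\<close>, and so does every Dixmier trace, being a limit of
  logarithmic means.

  By the Birman-Schwinger principle, \<open>N\<^sup>-(h\<^sup>2H - V)\<close> differs from the number of eigenvalues of \<open>A\<close>
  above \<open>h\<^sup>2\<close> by at most \<open>dim ker H\<close>: the substitution \<open>\<eta> = H\<^bsup>1/2\<^esup> \<xi>\<close> turns \<open>h\<^sup>2Q\<^sub>H - Q\<^sub>V\<close> on
  \<open>(ker H)\<^sup>\<bottom>\<close> into the form of \<open>h\<^sup>2 - A\<close>. That a subspace on which \<open>h\<^sup>2Q\<^sub>H - Q\<^sub>V\<close> is negative forces
  as many negative eigenvalues is a variational argument, the compactness of \<open>V\<close> ensuring that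
  infima below \<open>0\<close> are attained.
\<close>

section \<open>Hilbert space geometry\<close>

text \<open>Unbounded operators are handled through the bounded operator
  \<open>R = (H + 1)^(-1)\<close>. Since \<open>sqrt_op\<close>, \<open>inv_sqrt\<close> and
  \<open>form_op\<close> are definite descriptions, each denotes something only once existence and
  uniqueness are established; the resolvent reduces both questions about the square root to bounded
  positive operators. Beyond the existence of resolvents and the finite dimension of the kernel, the
  spectrum enters in one way: an interval \<open>(c - d, c + d)\<close> of resolvent points forces
  \<open>|T x - c x| \<ge> d |x|\<close>. At negative \<open>c\<close> this yields
  \<open>H \<ge> 0\<close>; in the gap above \<open>0\<close> it yields invertibility of the square
  root off the kernel. Negative eigenvalues of the form sum are counted as the largest length of an
  orthonormal family of eigenvectors, and every dimension count is the solvability of a homogeneous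
  linear system. The kernel causes a bounded error only, which the factor \<open>h^2\<close> sends
  to \<open>0\<close>.\<close>

lemma cinner_add_right: "cinner x (y + z) = cinner x y + cinner x z"
  using cinner_commute[of x "y + z"] cinner_commute[of x y] cinner_commute[of x z]
  by (simp add: cinner_add_left)

lemma cinner_scaleC_right: "cinner x (a *\<^sub>C y) = cnj a * cinner x y"
  using cinner_commute[of x "a *\<^sub>C y"] cinner_commute[of x y]
  by (simp add: cinner_scaleC_left)

lemma cinner_scaleR_left: "cinner (r *\<^sub>R x) y = r *\<^sub>R cinner x y"
  using cinner_scaleC_left[of "complex_of_real r" x y] by (simp add: scaleC_of_real scaleR_conv_of_real)

lemma cinner_scaleR_right: "cinner x (r *\<^sub>R y) = r *\<^sub>R cinner x y"
  using cinner_scaleC_right[of x "complex_of_real r" y] by (simp add: scaleC_of_real scaleR_conv_of_real)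

lemma Re_cinner_self: "Re (cinner x x) = (norm x)\<^sup>2"
  by (simp add: cinner_self)

lemma cinner_swap_zero: "cinner x y = 0 \<longleftrightarrow> cinner y x = 0"
  by (metis cinner_commute complex_cnj_zero)

text \<open>Stated on a subspace and without definiteness, so that one Cauchy-Schwarz inequality
  serves the inner product, the form of an operator on an invariant subspace, and later
  \<open>q - m\<close> on a part of the form domain.\<close>

definition psd_form_on :: "'a::chilbert_space set \<Rightarrow> ('a \<Rightarrow> 'a \<Rightarrow> complex) \<Rightarrow> bool" where
  "psd_form_on D b \<longleftrightarrow> complex_vector.subspace D \<and>
     (\<forall>x\<in>D. \<forall>y\<in>D. \<forall>z\<in>D. b (x + y) z = b x z + b y z) \<and>
     (\<forall>a. \<forall>x\<in>D. \<forall>y\<in>D. b (a *\<^sub>C x) y = a * b x y) \<and>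
     (\<forall>x\<in>D. \<forall>y\<in>D. b x y = cnj (b y x)) \<and> (\<forall>x\<in>D. 0 \<le> Re (b x x))"

text \<open>A quadratic polynomial in a real variable \<open>s\<close> is nonnegative: the form is
  evaluated at \<open>x - s b(x,y) y\<close>, where the factor \<open>b(x,y)\<close> aligns the
  phases so that both cross terms are real.\<close>

lemma psd_form_Cauchy_Schwarz:
  assumes b: "psd_form_on D b" and x: "x \<in> D" and y: "y \<in> D"
  shows "(cmod (b x y))\<^sup>2 \<le> Re (b x x) * Re (b y y)"
proof -
  have D: "complex_vector.subspace D"
    and add: "\<And>u v w. u \<in> D \<Longrightarrow> v \<in> D \<Longrightarrow> w \<in> D \<Longrightarrow> b (u + v) w = b u w + b v w"
    and scl: "\<And>a u v. u \<in> D \<Longrightarrow> v \<in> D \<Longrightarrow> b (a *\<^sub>C u) v = a * b u v"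
    and herm: "\<And>u v. u \<in> D \<Longrightarrow> v \<in> D \<Longrightarrow> b u v = cnj (b v u)"
    and pos: "\<And>u. u \<in> D \<Longrightarrow> 0 \<le> Re (b u u)"
    using b unfolding psd_form_on_def by blast+
  have addr: "b u (v + w) = b u v + b u w" if "u \<in> D" "v \<in> D" "w \<in> D" for u v w
    using that herm[of u "v + w"] herm[of u v] herm[of u w] add[of v w u] D
    by (simp add: complex_vector.subspace_add)
  have sclr: "b u (a *\<^sub>C v) = cnj a * b u v" if "u \<in> D" "v \<in> D" for a u v
    using that herm[of u "a *\<^sub>C v"] herm[of u v] scl[of v u a] D
    by (simp add: complex_vector.subspace_scale)
  define \<beta> where "\<beta> = b x y"
  define a where "a = Re (b x x)"
  define c where "c = Re (b y y)"
  have quad: "0 \<le> a - 2 * s * (cmod \<beta>)\<^sup>2 + s\<^sup>2 * (cmod \<beta>)\<^sup>2 * c" for s :: real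
  proof -
    define k where "k = - (complex_of_real s * \<beta>)"
    have ky: "k *\<^sub>C y \<in> D" using D y by (simp add: complex_vector.subspace_scale)
    have xk: "x + k *\<^sub>C y \<in> D" using D x ky by (simp add: complex_vector.subspace_add)
    have "b (x + k *\<^sub>C y) (x + k *\<^sub>C y) = b x x + cnj k * b x y + k * b y x + k * cnj k * b y y"
      unfolding add[OF x ky xk] addr[OF x x ky] addr[OF ky x ky] scl[OF y x] scl[OF y ky]
        sclr[OF x y] sclr[OF y y] by (simp add: mult.assoc)
    also have "b y x = cnj \<beta>" using herm[OF y x] \<beta>_def by simp
    finally have "Re (b (x + k *\<^sub>C y) (x + k *\<^sub>C y))
        = Re (b x x) + Re (cnj k * \<beta>) + Re (k * cnj \<beta>) + Re (k * cnj k * b y y)"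
      by (simp only: \<beta>_def plus_complex.sel)
    moreover have n: "\<beta> * cnj \<beta> = complex_of_real ((cmod \<beta>)\<^sup>2)"
      using complex_norm_square[of \<beta>] by (rule sym)
    have "cnj k * \<beta> = - complex_of_real s * (\<beta> * cnj \<beta>)"
      "k * cnj \<beta> = - complex_of_real s * (\<beta> * cnj \<beta>)"
      "k * cnj k = complex_of_real s * complex_of_real s * (\<beta> * cnj \<beta>)"
      by (simp_all add: k_def ac_simps)
    then have f: "cnj k * \<beta> = complex_of_real (- s * (cmod \<beta>)\<^sup>2)"
      "k * cnj \<beta> = complex_of_real (- s * (cmod \<beta>)\<^sup>2)"
      "k * cnj k = complex_of_real (s\<^sup>2 * (cmod \<beta>)\<^sup>2)"
      unfolding n by (simp_all add: power2_eq_square)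
    have "Re (cnj k * \<beta>) = - s * (cmod \<beta>)\<^sup>2" "Re (k * cnj \<beta>) = - s * (cmod \<beta>)\<^sup>2"
      "Re (k * cnj k * b y y) = s\<^sup>2 * (cmod \<beta>)\<^sup>2 * Re (b y y)"
      unfolding f by (simp_all only: Re_complex_of_real Im_complex_of_real times_complex.sel mult_zero_left diff_zero)
    ultimately have "Re (b (x + k *\<^sub>C y) (x + k *\<^sub>C y)) = a - 2 * s * (cmod \<beta>)\<^sup>2 + s\<^sup>2 * (cmod \<beta>)\<^sup>2 * c"
      unfolding a_def c_def by linarith
    then show ?thesis using pos[OF xk] by simp
  qed
  have "(cmod \<beta>)\<^sup>2 \<le> a * c"
  proof (cases "c = 0")
    case True
    show ?thesis
    proof (rule ccontr)
      assume "\<not> ?thesis"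
      then have p: "(cmod \<beta>)\<^sup>2 > 0" using True by simp
      \<comment> \<open>For \<open>c = 0\<close> the polynomial is affine in \<open>s\<close>; at
        this \<open>s\<close> it takes the value \<open>-1\<close>.\<close>
      have "2 * ((a + 1) / (2 * (cmod \<beta>)\<^sup>2)) * (cmod \<beta>)\<^sup>2 = a + 1" using p by simp
      then show False using quad[of "(a + 1) / (2 * (cmod \<beta>)\<^sup>2)"] True by simp
    qed
  next
    case False
    then have c: "c > 0" using pos[OF y] c_def by simp
    have "(1 / c)\<^sup>2 * (cmod \<beta>)\<^sup>2 * c = (cmod \<beta>)\<^sup>2 / c" using c by (simp add: power2_eq_square)
    then have "(cmod \<beta>)\<^sup>2 / c \<le> a" using quad[of "1 / c"] by simp
    then show ?thesis using c by (simp add: pos_divide_le_eq)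
  qed
  then show ?thesis by (simp add: \<beta>_def a_def c_def)
qed

lemma cinner_psd: "psd_form_on UNIV cinner"
  unfolding psd_form_on_def
  by (intro conjI ballI allI cinner_commute)
    (auto simp: cinner_add_left cinner_scaleC_left Re_cinner_self)

lemma cinner_Cauchy_Schwarz: "cmod (cinner x y) \<le> norm x * norm y"
proof -
  have "(cmod (cinner x y))\<^sup>2 \<le> (norm x * norm y)\<^sup>2"
    using psd_form_Cauchy_Schwarz[OF cinner_psd, of x y] by (simp add: Re_cinner_self power_mult_distrib)
  then show ?thesis by (rule power2_le_imp_le) simp
qed

lemma norm_scaleC: "norm (a *\<^sub>C (x::'a::chilbert_space)) = cmod a * norm x"
proof -
  have "complex_of_real ((norm (a *\<^sub>C x))\<^sup>2) = a * cnj a * complex_of_real ((norm x)\<^sup>2)"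
    by (simp only: cinner_self[symmetric] cinner_scaleC_left cinner_scaleC_right mult.assoc mult.left_commute)
  also have "\<dots> = complex_of_real ((cmod a * norm x)\<^sup>2)"
    by (simp add: complex_norm_square[symmetric] power_mult_distrib)
  finally have "(norm (a *\<^sub>C x))\<^sup>2 = (cmod a * norm x)\<^sup>2" by (metis of_real_eq_iff)
  then show ?thesis by (metis power2_eq_iff_nonneg norm_ge_zero mult_nonneg_nonneg)
qed

lemma bounded_bilinear_cinner: "bounded_bilinear cinner"
proof
  show "\<exists>K. \<forall>a b. norm (cinner a b) \<le> norm a * norm b * K"
    using cinner_Cauchy_Schwarz by (intro exI[of _ 1]) auto
qed (simp_all add: cinner_add_left cinner_add_right cinner_scaleR_left cinner_scaleR_right)

interpretation cinner: bounded_bilinear cinner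
  by (rule bounded_bilinear_cinner)

lemma bounded_bilinear_scaleC: "bounded_bilinear (scaleC :: complex \<Rightarrow> 'a \<Rightarrow> 'a::chilbert_space)"
proof
  fix r :: real and a :: complex and b :: 'a
  show "(r *\<^sub>R a) *\<^sub>C b = r *\<^sub>R a *\<^sub>C b"
    by (simp add: scaleC_of_real[symmetric] scaleC_scaleC scaleR_conv_of_real)
  show "a *\<^sub>C r *\<^sub>R b = r *\<^sub>R a *\<^sub>C b"
    by (simp add: scaleC_of_real[symmetric] scaleC_scaleC mult.commute)
next
  show "\<exists>K. \<forall>a (b::'a). norm (a *\<^sub>C b) \<le> norm a * norm b * K"
    using norm_scaleC by (intro exI[of _ 1]) (auto simp: norm_scaleC)
qed (simp_all add: scaleC_add_right scaleC_add_left)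

interpretation scaleC: bounded_bilinear "scaleC :: complex \<Rightarrow> 'a \<Rightarrow> 'a::chilbert_space"
  by (rule bounded_bilinear_scaleC)

lemmas cinner_simps = cinner_add_left cinner_add_right cinner.diff_left cinner.diff_right
  cinner_scaleC_left cinner_scaleC_right cinner.minus_left cinner.minus_right

lemma cinner_all_eq:
  assumes "\<And>z. cinner x z = cinner y z"
  shows "x = y"
proof -
  have "cinner (x - y) (x - y) = 0" using assms by (simp add: cinner.diff_left)
  then show ?thesis by (simp add: cinner_self)
qed

lemma cinner_all_eq_right: "(\<And>z. cinner z x = cinner z y) \<Longrightarrow> x = y"
  by (rule cinner_all_eq) (metis cinner_commute)

lemma cinner_eq_dense:
  assumes "closure D = UNIV" and "\<And>z. z \<in> D \<Longrightarrow> cinner x z = cinner y z"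
  shows "x = y"
proof (rule cinner_all_eq)
  fix z
  have "closed {z. cinner x z - cinner y z = 0}"
    by (intro closed_Collect_eq continuous_intros cinner.continuous_on)
  then have "closure D \<subseteq> {z. cinner x z - cinner y z = 0}"
    using assms(2) by (intro closure_minimal) auto
  then show "cinner x z = cinner y z" using assms(1) by auto
qed

lemma norm_add_sq: "(norm (x + y))\<^sup>2 = (norm x)\<^sup>2 + 2 * Re (cinner x y) + (norm (y::'a::chilbert_space))\<^sup>2"
proof -
  have "Re (cinner y x) = Re (cinner x y)" using cinner_commute[of y x] by simp
  then show ?thesis by (simp add: Re_cinner_self[symmetric] cinner_add_left cinner_add_right)
qed

lemma norm_diff_sq: "(norm (x - y))\<^sup>2 = (norm x)\<^sup>2 - 2 * Re (cinner x y) + (norm (y::'a::chilbert_space))\<^sup>2"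
  using norm_add_sq[of x "- y"] by (simp add: cinner.minus_right)

lemma parallelogram: "(norm (x + y))\<^sup>2 + (norm (x - y))\<^sup>2 = 2 * (norm x)\<^sup>2 + 2 * (norm (y::'a::chilbert_space))\<^sup>2"
  by (simp add: norm_add_sq norm_diff_sq)

section \<open>Orthogonal complements, projections and Riesz representation\<close>

lemma subspace_orth_compl: "complex_vector.subspace (orth_compl S)"
  by (auto simp: complex_vector.subspace_def orth_compl_def cinner_simps cinner.zero_left)

lemma closed_orth_compl: "closed (orth_compl S)"
proof -
  have "orth_compl S = (\<Inter>y\<in>S. {x. cinner x y = 0})" by (auto simp: orth_compl_def)
  moreover have "closed {x. cinner x y = 0}" for y
    by (intro closed_Collect_eq continuous_intros cinner.continuous_on)
  ultimately show ?thesis by auto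
qed

lemma closure_subspaceC:
  assumes "complex_vector.subspace (D::'a::chilbert_space set)"
  shows "complex_vector.subspace (closure D)"
  unfolding complex_vector.subspace_def
proof (intro conjI ballI allI)
  show "0 \<in> closure D" using assms complex_vector.subspace_0 closure_subset by blast
next
  fix x y assume "x \<in> closure D" "y \<in> closure D"
  then obtain f g where "\<And>n. f n \<in> D" "f \<longlonglongrightarrow> x" "\<And>n. g n \<in> D" "g \<longlonglongrightarrow> y"
    unfolding closure_sequential by blast
  then show "x + y \<in> closure D"
    unfolding closure_sequential using assms
    by (intro exI[of _ "\<lambda>n. f n + g n"]) (auto intro: tendsto_add complex_vector.subspace_add)
next
  fix c x assume "x \<in> closure D"
  then obtain f where "\<And>n. f n \<in> D" "f \<longlonglongrightarrow> x"
    unfolding closure_sequential by blast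
  then show "c *\<^sub>C x \<in> closure D"
    unfolding closure_sequential using assms
    by (intro exI[of _ "\<lambda>n. c *\<^sub>C f n"])
      (auto intro: scaleC.tendsto[OF tendsto_const] complex_vector.subspace_scale)
qed

text \<open>A minimizing sequence for the distance to \<open>x\<close> is Cauchy by the
  parallelogram law, since midpoints stay in \<open>M\<close>. Its limit \<open>p\<close> is the
  foot of the perpendicular, because any correlation of \<open>x - p\<close> with a vector of
  \<open>M\<close> would allow a shorter distance.\<close>

theorem orthogonal_projection_exists:
  assumes M: "complex_vector.subspace M" and cl: "closed M"
  shows "\<exists>m\<in>M. x - m \<in> orth_compl M"
proof -
  define d where "d = (INF m\<in>M. norm (x - m))"
  have bdd: "bdd_below ((\<lambda>m. norm (x - m)) ` M)" by (intro bdd_belowI[of _ 0]) auto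
  have ne: "M \<noteq> {}" using M complex_vector.subspace_0 by blast
  have dle: "d \<le> norm (x - m)" if "m \<in> M" for m
    unfolding d_def using bdd that by (rule cINF_lower)
  have d0: "0 \<le> d" unfolding d_def using ne by (intro cINF_greatest) auto
  have "\<exists>m\<in>M. norm (x - m) < d + 1 / real (Suc n)" for n
    using cINF_less_iff[OF ne bdd, of "d + 1 / real (Suc n)"] by (simp add: d_def)
  then obtain m where m: "\<And>n. m n \<in> M" "\<And>n. norm (x - m n) < d + 1 / real (Suc n)"
    by metis
  have lim: "(\<lambda>n. norm (x - m n)) \<longlonglongrightarrow> d"
  proof (rule tendsto_sandwich[of "\<lambda>_. d" _ _ "\<lambda>n. d + 1 / real (Suc n)"])
    show "(\<lambda>n. d + 1 / real (Suc n)) \<longlonglongrightarrow> d"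
      using tendsto_add[OF tendsto_const lim_inverse_n'[THEN LIMSEQ_Suc], of d] by simp
    show "\<forall>\<^sub>F n in sequentially. d \<le> norm (x - m n)" using dle m(1) by simp
    show "\<forall>\<^sub>F n in sequentially. norm (x - m n) \<le> d + 1 / real (Suc n)"
      using m(2) by (intro always_eventually allI less_imp_le)
  qed simp
  have mid: "(norm (u - v))\<^sup>2 \<le> 2 * (norm (x - u))\<^sup>2 + 2 * (norm (x - v))\<^sup>2 - 4 * d\<^sup>2"
    if "u \<in> M" "v \<in> M" for u v
  proof -
    have w: "(1/2::complex) *\<^sub>C (u + v) \<in> M"
      using M that by (simp add: complex_vector.subspace_add complex_vector.subspace_scale)
    have "(2::complex) *\<^sub>C (x - (1/2::complex) *\<^sub>C (u + v)) = (x - u) + (x - v)"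
      using scaleC_add_left[of 1 1 x]
      by (simp add: complex_vector.scale_right_diff_distrib scaleC_scaleC scaleC_one)
    then have "norm ((x - u) + (x - v)) = 2 * norm (x - (1/2::complex) *\<^sub>C (u + v))"
      by (metis norm_scaleC norm_numeral)
    then have "norm ((x - u) + (x - v)) \<ge> 2 * d" using dle[OF w] by simp
    then have "(norm ((x - u) + (x - v)))\<^sup>2 \<ge> (2 * d)\<^sup>2" using d0 by (intro power_mono) auto
    moreover have "norm ((x - u) - (x - v)) = norm (u - v)"
      using norm_minus_commute[of u v] by (simp add: algebra_simps)
    ultimately show ?thesis using parallelogram[of "x - u" "x - v"] by (simp add: power_mult_distrib)
  qed
  have "Cauchy m"
  proof (rule metric_CauchyI)
    fix e :: real assume e: "e > 0"
    have "(\<lambda>n. (norm (x - m n))\<^sup>2 - d\<^sup>2) \<longlonglongrightarrow> 0"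
      using tendsto_diff[OF tendsto_power[OF lim, of 2] tendsto_const, of "d\<^sup>2"] by simp
    then have "\<forall>\<^sub>F n in sequentially. (norm (x - m n))\<^sup>2 - d\<^sup>2 < e\<^sup>2 / 4"
      using e by (intro order_tendstoD) auto
    then obtain N where N: "\<And>n. n \<ge> N \<Longrightarrow> (norm (x - m n))\<^sup>2 - d\<^sup>2 < e\<^sup>2 / 4"
      unfolding eventually_sequentially by auto
    show "\<exists>N. \<forall>i\<ge>N. \<forall>j\<ge>N. dist (m i) (m j) < e"
    proof (intro exI allI impI)
      fix i j assume "N \<le> i" "N \<le> j"
      then have "(norm (m i - m j))\<^sup>2 < e\<^sup>2"
        using mid[OF m(1) m(1), of i j] N[of i] N[of j] by simp
      then show "dist (m i) (m j) < e" using e by (simp add: dist_norm power2_less_imp_less)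
    qed
  qed
  then obtain p where p: "m \<longlonglongrightarrow> p" using Cauchy_convergent convergent_def by blast
  have pM: "p \<in> M" using cl p m(1) closed_sequentially by blast
  have "(\<lambda>n. norm (x - m n)) \<longlonglongrightarrow> norm (x - p)" by (intro tendsto_intros p)
  then have pd: "norm (x - p) = d" using lim LIMSEQ_unique by blast
  have "cinner (x - p) y = 0" if y: "y \<in> M" for y
  proof (rule ccontr)
    assume ne0: "cinner (x - p) y \<noteq> 0"
    then have y0: "y \<noteq> 0" by (auto simp: cinner.zero_right)
    \<comment> \<open>The coefficient of \<open>x - p\<close> along \<open>y\<close>: moving from
      \<open>p\<close> to \<open>p + k y\<close> lowers the squared distance by
      \<open>|k|^2 |y|^2\<close>.\<close>
    define k where "k = cinner (x - p) y / complex_of_real ((norm y)\<^sup>2)"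
    have "p + k *\<^sub>C y \<in> M" using M pM y by (simp add: complex_vector.subspace_add complex_vector.subspace_scale)
    then have "d\<^sup>2 \<le> (norm ((x - p) - k *\<^sub>C y))\<^sup>2"
      using dle[of "p + k *\<^sub>C y"] d0 by (simp add: power_mono diff_diff_eq)
    also have "\<dots> = d\<^sup>2 - 2 * Re (cnj k * cinner (x - p) y) + (cmod k)\<^sup>2 * (norm y)\<^sup>2"
      by (simp add: norm_diff_sq pd cinner_scaleC_right norm_scaleC power_mult_distrib)
    also have "cnj k * cinner (x - p) y = complex_of_real ((cmod k)\<^sup>2 * (norm y)\<^sup>2)"
    proof -
      have "cinner (x - p) y = k * complex_of_real ((norm y)\<^sup>2)" using y0 by (simp add: k_def)
      then show ?thesis using complex_norm_square[of k] by (simp add: mult.commute mult.left_commute)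
    qed
    finally have "(cmod k)\<^sup>2 * (norm y)\<^sup>2 \<le> 0" by (simp add: mult.commute)
    moreover have "k \<noteq> 0" using ne0 y0 by (simp add: k_def)
    ultimately show False using y0 by (simp add: mult_le_0_iff)
  qed
  then show ?thesis using pM unfolding orth_compl_def by auto
qed

lemma mem_orth_complD: "x \<in> orth_compl S \<Longrightarrow> y \<in> S \<Longrightarrow> cinner x y = 0"
  by (simp add: orth_compl_def)

lemma orth_compl_Int: "x \<in> S \<Longrightarrow> x \<in> orth_compl S \<Longrightarrow> x = 0"
  using mem_orth_complD[of x S x] by (simp add: cinner_self)

text \<open>A vector \<open>z\<close> orthogonal to the kernel of \<open>f\<close> represents
  \<open>f\<close> up to a factor. The inner product is anti-linear in its second slot, hence the
  anti-linear functional and the representing vector in the first slot.\<close>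

theorem Riesz_antilinear:
  assumes add: "\<And>x y. f (x + y) = f x + f y" and scl: "\<And>c x. f (c *\<^sub>C x) = cnj c * f x"
    and bd: "\<And>x. cmod (f x) \<le> K * norm x"
  shows "\<exists>\<zeta>::'a::chilbert_space. \<forall>\<eta>. cinner \<zeta> \<eta> = f \<eta>"
proof (cases "\<forall>x. f x = 0")
  case True
  then show ?thesis by (intro exI[of _ 0]) (simp add: cinner.zero_left)
next
  case False
  then obtain x0 where x0: "f x0 \<noteq> 0" by auto
  have f0: "f 0 = 0" using scl[of 0 0] by simp
  have fd: "f (x - y) = f x - f y" for x y
    using add[of x "- y"] add[of y "- y"] f0 by (simp add: add_eq_0_iff)
  define M where "M = {x. f x = 0}"
  have M: "complex_vector.subspace M" using f0 add scl by (auto simp: complex_vector.subspace_def M_def)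
  have "closed M"
    unfolding closed_sequential_limits
  proof (intro allI impI)
    fix x l assume A: "(\<forall>n. x n \<in> M) \<and> x \<longlonglongrightarrow> l"
    have "cmod (f l) \<le> K * norm (l - x n)" for n
      using bd[of "l - x n"] fd[of l "x n"] A by (simp add: M_def)
    moreover have "(\<lambda>n. K * norm (l - x n)) \<longlonglongrightarrow> K * norm (l - l)"
      using A by (intro tendsto_intros) auto
    ultimately have "cmod (f l) \<le> K * norm (l - l)" by (intro LIMSEQ_le_const) auto
    then show "l \<in> M" by (simp add: M_def)
  qed
  then obtain m where m: "m \<in> M" "x0 - m \<in> orth_compl M"
    using orthogonal_projection_exists[OF M] by blast
  define z where "z = x0 - m"
  have fz: "f z \<noteq> 0" using x0 m(1) by (simp add: z_def fd M_def)
  then have z0: "z \<noteq> 0" using f0 by auto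
  show ?thesis
  proof (intro exI allI)
    fix \<eta>
    define a where "a = cnj (f \<eta> / f z)"
    have "f (\<eta> - a *\<^sub>C z) = 0" using fz by (simp add: fd scl a_def)
    then have "cinner z (\<eta> - a *\<^sub>C z) = 0"
      using m(2) mem_orth_complD unfolding z_def[symmetric] by (auto simp: M_def)
    then have "cinner z \<eta> = f \<eta> / f z * complex_of_real ((norm z)\<^sup>2)"
      by (simp add: cinner_simps cinner_self a_def)
    then show "cinner ((f z / complex_of_real ((norm z)\<^sup>2)) *\<^sub>C z) \<eta> = f \<eta>"
      using fz z0 by (simp add: cinner_scaleC_left)
  qed
qed

section \<open>Bounded positive operators\<close>

lemma clinear_iff: "clinear A \<longleftrightarrow> (\<forall>x y. A (x + y) = A x + A y) \<and> (\<forall>c x. A (c *\<^sub>C x) = c *\<^sub>C A x)"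
  for A :: "'a::chilbert_space \<Rightarrow> 'b::chilbert_space"
  by (auto simp: Vector_Spaces.linear_iff intro: complex_vector.vector_space_axioms)

lemma clinear_simps:
  assumes "clinear A"
  shows "A (x + y) = A x + A y" "A (c *\<^sub>C x) = c *\<^sub>C A x" "A 0 = 0" "A (x - y) = A x - A y" "A (- x) = - A x"
proof -
  show a: "A (x + y) = A x + A y" and s: "A (c *\<^sub>C x) = c *\<^sub>C A x" for x y c
    using assms by (auto simp: clinear_iff)
  show z: "A 0 = 0" using s[of 0 0] by simp
  show m: "A (- x) = - A x" for x using a[of x "- x"] z by (simp add: add_eq_0_iff)
  show "A (x - y) = A x - A y" using a[of x "- y"] m by simp
qed

lemma bounded_opI:
  assumes "\<And>x y. A (x + y) = A x + A y" "\<And>c x. A (c *\<^sub>C x) = c *\<^sub>C A x" "\<And>x. norm (A x) \<le> K * norm x"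
  shows "bounded_op A"
  unfolding bounded_op_def clinear_iff using assms by blast

lemma bounded_op_clinear: "bounded_op A \<Longrightarrow> clinear A"
  by (simp add: bounded_op_def)

lemma bounded_op_simps:
  assumes "bounded_op A"
  shows "A (x + y) = A x + A y" "A (c *\<^sub>C x) = c *\<^sub>C A x" "A 0 = 0" "A (x - y) = A x - A y" "A (- x) = - A x"
  using clinear_simps[OF bounded_op_clinear[OF assms]] by auto

lemma bounded_op_pos_bound:
  assumes "bounded_op A" obtains K where "K > 0" "\<And>x. norm (A x) \<le> K * norm x"
proof -
  obtain K where "\<And>x. norm (A x) \<le> K * norm x" using assms bounded_op_def by blast
  then have "norm (A x) \<le> (\<bar>K\<bar> + 1) * norm x" for x
    by (smt (verit) mult_right_mono norm_ge_zero)
  then show ?thesis using that[of "\<bar>K\<bar> + 1"] by auto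
qed

lemma bounded_op_bounded_linear: "bounded_op A \<Longrightarrow> bounded_linear A"
proof (rule bounded_op_pos_bound)
  fix K assume A: "bounded_op A" and K: "\<And>x. norm (A x) \<le> K * norm x"
  show "bounded_linear A"
  proof (rule bounded_linear_intro[where K = K])
    fix r x show "A (r *\<^sub>R x) = r *\<^sub>R A x"
      using bounded_op_simps(2)[OF A, of "complex_of_real r" x] by (simp add: scaleC_of_real)
  qed (use K bounded_op_simps(1)[OF A] in \<open>auto simp: mult.commute\<close>)
qed

lemma bounded_op_tendsto: "bounded_op A \<Longrightarrow> (f \<longlongrightarrow> l) F \<Longrightarrow> ((\<lambda>x. A (f x)) \<longlongrightarrow> A l) F"
  by (rule bounded_linear.tendsto[OF bounded_op_bounded_linear])

lemma bounded_op_compose: "bounded_op A \<Longrightarrow> bounded_op B \<Longrightarrow> bounded_op (\<lambda>x. A (B x))"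
proof -
  assume A: "bounded_op A" and B: "bounded_op B"
  obtain K where K: "K > 0" "\<And>x. norm (A x) \<le> K * norm x" using bounded_op_pos_bound[OF A] by blast
  obtain L where L: "L > 0" "\<And>x. norm (B x) \<le> L * norm x" using bounded_op_pos_bound[OF B] by blast
  show ?thesis
  proof (rule bounded_opI[where K = "K * L"])
    fix x show "norm (A (B x)) \<le> K * L * norm x"
      using order_trans[OF K(2)[of "B x"] mult_left_mono[OF L(2)[of x], of K]] K(1) by (simp add: mult.assoc)
  qed (simp_all add: bounded_op_simps[OF A] bounded_op_simps[OF B])
qed

lemma bounded_op_add: "bounded_op A \<Longrightarrow> bounded_op B \<Longrightarrow> bounded_op (\<lambda>x. A x + B x)"
proof -
  assume A: "bounded_op A" and B: "bounded_op B"
  obtain K where K: "K > 0" "\<And>x. norm (A x) \<le> K * norm x" using bounded_op_pos_bound[OF A] by blast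
  obtain L where L: "L > 0" "\<And>x. norm (B x) \<le> L * norm x" using bounded_op_pos_bound[OF B] by blast
  show ?thesis
  proof (rule bounded_opI[where K = "K + L"])
    fix x show "norm (A x + B x) \<le> (K + L) * norm x"
      using K(2)[of "x"] L(2)[of x] norm_triangle_ineq[of "A x" "B x"] by (simp add: algebra_simps)
  qed (simp_all add: bounded_op_simps[OF A] bounded_op_simps[OF B] scaleC_add_right)
qed

lemma bounded_op_scaleC: "bounded_op A \<Longrightarrow> bounded_op (\<lambda>x. c *\<^sub>C A x)"
proof -
  assume A: "bounded_op A"
  obtain K where K: "K > 0" "\<And>x. norm (A x) \<le> K * norm x" using bounded_op_pos_bound[OF A] by blast
  show ?thesis
  proof (rule bounded_opI[where K = "cmod c * K"])
    fix x show "norm (c *\<^sub>C A x) \<le> cmod c * K * norm x"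
      using mult_left_mono[OF K(2)[of "x"], of "cmod c"] by (simp add: norm_scaleC mult.assoc)
  qed (simp_all add: bounded_op_simps[OF A] scaleC_add_right scaleC_scaleC mult.commute)
qed

lemma bounded_op_id: "bounded_op (\<lambda>x. x)"
  by (rule bounded_opI[where K = 1]) auto

lemma bounded_op_diff: "bounded_op A \<Longrightarrow> bounded_op B \<Longrightarrow> bounded_op (\<lambda>x. A x - B x)"
  using bounded_op_add[OF _ bounded_op_scaleC[of B "-1"], of A] by (simp add: scaleC_one)

lemma nonneg_Reals_Im_Re: "z \<in> \<real>\<^sub>\<ge>\<^sub>0 \<Longrightarrow> Im z = 0 \<and> 0 \<le> Re z"
  by (auto simp: complex_nonneg_Reals_iff)

text \<open>Polarization: reality at \<open>x + y\<close> relates the imaginary parts, reality at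
  \<open>x + \<i> y\<close> the real parts of \<open>cinner (A x) y\<close> and
  \<open>cinner (A y) x\<close>.\<close>

lemma cinner_self_real_imp_symmetric:
  assumes D: "complex_vector.subspace D"
    and lin: "\<And>x y. x \<in> D \<Longrightarrow> y \<in> D \<Longrightarrow> A (x + y) = A x + A y" "\<And>c x. x \<in> D \<Longrightarrow> A (c *\<^sub>C x) = c *\<^sub>C A x"
    and re: "\<And>x. x \<in> D \<Longrightarrow> Im (cinner (A x) x) = 0" and x: "x \<in> D" and y: "y \<in> D"
  shows "cinner (A x) y = cinner x (A y)"
proof -
  have iy: "\<i> *\<^sub>C y \<in> D" using D y by (rule complex_vector.subspace_scale)
  have "Im (cinner (A x) y + cinner (A y) x) = 0"
    using re[of "x + y"] re[OF x] re[OF y] x y D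
    by (simp add: complex_vector.subspace_add lin cinner_simps)
  moreover have "Im (cinner (A x) (\<i> *\<^sub>C y) + cinner (A (\<i> *\<^sub>C y)) x) = 0"
    using re[of "x + \<i> *\<^sub>C y"] re[OF x] re[OF iy] x iy D
    by (simp add: complex_vector.subspace_add lin cinner_add_left cinner_add_right)
  then have "Re (cinner (A y) x) = Re (cinner (A x) y)"
    using y by (simp add: lin cinner_simps)
  ultimately have "cinner (A x) y = cnj (cinner (A y) x)" by (simp add: complex_eq_iff)
  then show ?thesis using cinner_commute[of x "A y"] by simp
qed

lemma positive_op_bounded: "positive_op A \<Longrightarrow> bounded_op A"
  by (simp add: positive_op_def)

lemma positive_op_nonneg: "positive_op A \<Longrightarrow> 0 \<le> Re (cinner (A x) x)"
  using nonneg_Reals_Im_Re by (auto simp: positive_op_def)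

lemma positive_op_symmetric:
  assumes "positive_op A" shows "cinner (A x) y = cinner x (A y)"
  using assms bounded_op_simps[OF positive_op_bounded[OF assms]]
  by (intro cinner_self_real_imp_symmetric[of UNIV])
    (auto simp: positive_op_def dest: nonneg_Reals_Im_Re)

lemma cinner_symmetric_real:
  assumes "cinner (A x) x = cinner x (A x)" shows "Im (cinner (A x) x) = 0"
proof -
  have "cinner (A x) x = cnj (cinner (A x) x)" using assms cinner_commute by metis
  then show ?thesis by (metis cnj.simps(2) neg_equal_zero)
qed

lemma positive_opI:
  assumes "bounded_op A" "\<And>x y. cinner (A x) y = cinner x (A y)" "\<And>x. 0 \<le> Re (cinner (A x) x)"
  shows "positive_op A"
  using assms cinner_symmetric_real[of A] unfolding positive_op_def
  by (auto simp: complex_nonneg_Reals_iff)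

lemma psd_form_on_operator:
  assumes A: "bounded_op A" and sym: "\<And>x y. cinner (A x) y = cinner x (A y)"
    and M: "complex_vector.subspace M" and pos: "\<And>x. x \<in> M \<Longrightarrow> 0 \<le> Re (cinner (A x) x)"
  shows "psd_form_on M (\<lambda>x y. cinner (A x) y)"
  unfolding psd_form_on_def
proof (intro conjI ballI allI)
  fix x y
  show "cinner (A x) y = cnj (cinner (A y) x)" using sym[of x y] cinner_commute[of x "A y"] by simp
qed (use M pos in \<open>auto simp: bounded_op_simps[OF A] cinner_simps\<close>)

text \<open>Cauchy-Schwarz for the form of \<open>A\<close> at the pair \<open>x\<close>,
  \<open>A x\<close>, divided by \<open>|A x|^2\<close>. This is the device that turns smallness of
  a quadratic form into smallness of a vector; it is applied to operators such as
  \<open>1 - N\<close>, \<open>l - A\<close> and \<open>\<mu>^2 - A^2\<close>.\<close>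

lemma psd_operator_norm_sq_le:
  assumes A: "bounded_op A" and sym: "\<And>x y. cinner (A x) y = cinner x (A y)"
    and M: "complex_vector.subspace M" and inv: "\<And>x. x \<in> M \<Longrightarrow> A x \<in> M"
    and pos: "\<And>x. x \<in> M \<Longrightarrow> 0 \<le> Re (cinner (A x) x)"
    and up: "\<And>x. x \<in> M \<Longrightarrow> Re (cinner (A x) x) \<le> s * (norm x)\<^sup>2" and x: "x \<in> M"
  shows "(norm (A x))\<^sup>2 \<le> s * Re (cinner (A x) x)"
proof (cases "A x = 0")
  case True
  then show ?thesis by (simp add: cinner.zero_left)
next
  case False
  have "((norm (A x))\<^sup>2)\<^sup>2 = (cmod (cinner (A x) (A x)))\<^sup>2" by (simp add: cinner_self norm_power)
  also have "\<dots> \<le> Re (cinner (A x) x) * Re (cinner (A (A x)) (A x))"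
    by (rule psd_form_Cauchy_Schwarz[OF psd_form_on_operator[OF A sym M pos]]) (use x inv in auto)
  also have "\<dots> \<le> Re (cinner (A x) x) * (s * (norm (A x))\<^sup>2)"
    using pos[OF x] up[OF inv[OF x]] by (rule mult_left_mono[rotated])
  finally have "(norm (A x))\<^sup>2 * (norm (A x))\<^sup>2 \<le> (s * Re (cinner (A x) x)) * (norm (A x))\<^sup>2"
    unfolding power2_eq_square[of "(norm (A x))\<^sup>2"] by (simp only: ac_simps)
  then show ?thesis using False by (simp only: mult_le_cancel_right) auto
qed

lemma positive_op_bound:
  assumes A: "positive_op A"
  shows "\<exists>s>0. \<forall>x. Re (cinner (A x) x) \<le> s * (norm x)\<^sup>2"
proof -
  obtain K where K: "K > 0" "\<And>x. norm (A x) \<le> K * norm x"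
    using bounded_op_pos_bound[OF positive_op_bounded[OF A]] by blast
  have "Re (cinner (A x) x) \<le> K * (norm x)\<^sup>2" for x
  proof -
    have "Re (cinner (A x) x) \<le> norm (A x) * norm x"
      using complex_Re_le_cmod cinner_Cauchy_Schwarz order_trans by blast
    also have "\<dots> \<le> K * norm x * norm x" using K(2) by (intro mult_right_mono) auto
    finally show ?thesis by (simp add: power2_eq_square mult.assoc)
  qed
  then show ?thesis using K(1) by blast
qed

lemma positive_op_cinner_zero:
  assumes A: "positive_op A" and "Re (cinner (A x) x) = 0" shows "A x = 0"
proof -
  obtain s where s: "s > 0" "\<And>x. Re (cinner (A x) x) \<le> s * (norm x)\<^sup>2" using positive_op_bound[OF A] by blast
  have "(norm (A x))\<^sup>2 \<le> s * Re (cinner (A x) x)"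
    by (rule psd_operator_norm_sq_le[OF positive_op_bounded[OF A] positive_op_symmetric[OF A]
          complex_vector.subspace_UNIV UNIV_I positive_op_nonneg[OF A] s(2) UNIV_I])
  then show ?thesis using assms(2) by simp
qed

text \<open>For \<open>y = (X - Y) x\<close> commutation gives
  \<open>(X + Y) y = X^2 x - Y^2 x = 0\<close>. Two nonnegative forms that add up to
  \<open>0\<close> vanish, so \<open>X y = Y y = 0\<close>, and then \<open>|y|^2\<close>, the inner
  product of \<open>(X - Y) x\<close> with \<open>y\<close>, is \<open>0\<close>.\<close>

lemma positive_sqrt_unique_commuting:
  assumes X: "positive_op X" and Y: "positive_op Y" and sq: "\<And>x. X (X x) = Y (Y x)"
    and comm: "\<And>x. X (Y x) = Y (X x)"
  shows "X = Y"
proof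
  fix x
  note Xs = bounded_op_simps[OF positive_op_bounded[OF X]]
  note Ys = bounded_op_simps[OF positive_op_bounded[OF Y]]
  define y where "y = X x - Y x"
  have "X y + Y y = 0" using sq[of x] comm[of x] by (simp add: y_def Xs Ys)
  then have "Re (cinner (X y) y) + Re (cinner (Y y) y) = 0"
    using cinner_add_left[of "X y" "Y y" y]
    by (simp only: cinner.zero_left plus_complex.sel(1)[symmetric] zero_complex.sel(1))
  then have "Re (cinner (X y) y) = 0" "Re (cinner (Y y) y) = 0"
    using positive_op_nonneg[OF X, of y] positive_op_nonneg[OF Y, of y] by auto
  then have "X y = 0" "Y y = 0" using positive_op_cinner_zero X Y by auto
  then have "cinner (X x) y = 0" "cinner (Y x) y = 0"
    using positive_op_symmetric[OF X, of x y] positive_op_symmetric[OF Y, of x y]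
    by (simp_all add: cinner.zero_right)
  then have "cinner (X x - Y x) y = 0" by (simp add: cinner.diff_left)
  then have "cinner y y = 0" by (simp only: y_def)
  then show "X x = Y x" by (simp add: cinner_self y_def)
qed

subsection \<open>Square roots\<close>

primrec sqrt_iter :: "('a::chilbert_space \<Rightarrow> 'a) \<Rightarrow> nat \<Rightarrow> 'a \<Rightarrow> 'a" where
  "sqrt_iter M 0 = (\<lambda>x. 0)"
| "sqrt_iter M (Suc n) = (\<lambda>x. (1/2::complex) *\<^sub>C (M x + sqrt_iter M n (sqrt_iter M n x)))"

primrec sqrt_iter_bound :: "nat \<Rightarrow> real" where
  "sqrt_iter_bound 0 = 0"
| "sqrt_iter_bound (Suc n) = (1 + (sqrt_iter_bound n)\<^sup>2) / 2"

lemma sqrt_iter_bound_nonneg: "0 \<le> sqrt_iter_bound n"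
  by (cases n) auto

lemma sqrt_iter_bound_le_1: "sqrt_iter_bound n \<le> 1"
proof (induction n)
  case (Suc n)
  then show ?case using power_le_one[OF sqrt_iter_bound_nonneg[of n] Suc, of 2] by simp
qed simp

lemma sqrt_iter_bound_Suc: "sqrt_iter_bound n \<le> sqrt_iter_bound (Suc n)"
proof -
  have "0 \<le> (1 - sqrt_iter_bound n)\<^sup>2" by simp
  then show ?thesis by (simp add: power2_diff)
qed

lemma sqrt_iter_bounded_op:
  assumes "bounded_op M" shows "bounded_op (sqrt_iter M n)"
proof (induction n)
  case 0
  show ?case by (rule bounded_opI[where K = 0]) (auto simp: complex_vector.scale_zero_right)
next
  case (Suc n)
  show ?case using bounded_op_scaleC[OF bounded_op_add[OF assms bounded_op_compose[OF Suc Suc]], of "1/2"] by simp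
qed

lemma sqrt_iter_commute:
  assumes "bounded_op B" "\<And>x. B (M x) = M (B x)"
  shows "B (sqrt_iter M n x) = sqrt_iter M n (B x)"
proof (induction n arbitrary: x)
  case 0
  show ?case by (simp add: bounded_op_simps[OF assms(1)])
next
  case (Suc n)
  then show ?case by (simp add: bounded_op_simps[OF assms(1)] assms(2))
qed

lemma sqrt_iter_symmetric:
  assumes "\<And>x y. cinner (M x) y = cinner x (M y)"
  shows "cinner (sqrt_iter M n x) y = cinner x (sqrt_iter M n y)"
proof (induction n arbitrary: x y)
  case (Suc n)
  then show ?case by (simp add: cinner_simps assms)
qed (simp add: cinner.zero_left cinner.zero_right)

lemma sqrt_iter_norm:
  assumes "\<And>x. norm (M x) \<le> norm x"
  shows "norm (sqrt_iter M n x) \<le> sqrt_iter_bound n * norm x"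
proof (induction n arbitrary: x)
  case (Suc n)
  have "norm (sqrt_iter M n (sqrt_iter M n x)) \<le> sqrt_iter_bound n * norm (sqrt_iter M n x)"
    by (rule Suc)
  also have "\<dots> \<le> sqrt_iter_bound n * (sqrt_iter_bound n * norm x)"
    by (intro mult_left_mono Suc sqrt_iter_bound_nonneg)
  finally have "norm (M x + sqrt_iter M n (sqrt_iter M n x)) \<le> norm x + (sqrt_iter_bound n)\<^sup>2 * norm x"
    using norm_triangle_mono[OF assms[of x]] by (simp add: power2_eq_square)
  then show ?case unfolding sqrt_iter.simps norm_scaleC by (simp add: algebra_simps)
qed simp

text \<open>Consecutive iterates \<open>Y\<close>, \<open>Z\<close> commute, so
  \<open>Z^2 - Y^2 = (Z - Y)(Z + Y)\<close>. The scalar iteration factors in the same way, and the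
  increments of the operators stay below those of a bounded monotone sequence.\<close>

lemma sqrt_iter_norm_diff:
  assumes M: "bounded_op M" "\<And>x. norm (M x) \<le> norm x"
  shows "norm (sqrt_iter M (Suc n) x - sqrt_iter M n x)
    \<le> (sqrt_iter_bound (Suc n) - sqrt_iter_bound n) * norm x"
proof (induction n arbitrary: x)
  case 0
  show ?case using M(2)[of x] by (simp add: norm_scaleC bounded_op_simps[OF M(1)])
next
  case (Suc n)
  define Y where "Y = sqrt_iter M n"
  define Z where "Z = sqrt_iter M (Suc n)"
  define y where "y = sqrt_iter_bound n"
  define z where "z = sqrt_iter_bound (Suc n)"
  have YZ: "bounded_op Y" "bounded_op Z" unfolding Y_def Z_def by (simp_all only: sqrt_iter_bounded_op[OF M(1)])
  have ZM: "Z (M x) = M (Z x)" for x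
    unfolding Z_def by (rule sqrt_iter_commute[where B = M and M = M, OF M(1) refl, symmetric])
  have comm: "Z (Y x) = Y (Z x)" for x unfolding Y_def by (rule sqrt_iter_commute[where B = Z and M = M, OF YZ(2) ZM])
  have "sqrt_iter M (Suc (Suc n)) x - Z x = (1/2::complex) *\<^sub>C (Z (Z x) - Y (Y x))"
    unfolding sqrt_iter.simps(2)[of M "Suc n"] Z_def[symmetric]
    unfolding Z_def sqrt_iter.simps(2)[of M n] Y_def
    by (simp add: scaleC.diff_right scaleC_add_right)
  also have "Z (Z x) - Y (Y x) = Z (Z x + Y x) - Y (Z x + Y x)"
    by (simp add: bounded_op_simps[OF YZ(1)] bounded_op_simps[OF YZ(2)] comm)
  finally have e: "norm (sqrt_iter M (Suc (Suc n)) x - Z x) = norm (Z (Z x + Y x) - Y (Z x + Y x)) / 2"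
    by (simp add: norm_scaleC)
  have "norm (Z (Z x + Y x) - Y (Z x + Y x)) \<le> (z - y) * norm (Z x + Y x)"
    unfolding Z_def Y_def z_def y_def by (rule Suc)
  also have "norm (Z x + Y x) \<le> z * norm x + y * norm x"
    unfolding Z_def Y_def z_def y_def by (intro norm_triangle_mono sqrt_iter_norm M)
  also have "(z - y) * (z * norm x + y * norm x) = (z\<^sup>2 - y\<^sup>2) * norm x"
    by (simp add: power2_eq_square algebra_simps)
  finally have d: "norm (Z (Z x + Y x) - Y (Z x + Y x)) \<le> (z\<^sup>2 - y\<^sup>2) * norm x"
    using sqrt_iter_bound_Suc[of n] by (simp add: mult_left_mono z_def y_def)
  have b: "sqrt_iter_bound (Suc (Suc n)) - z = (z\<^sup>2 - y\<^sup>2) / 2"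
    unfolding sqrt_iter_bound.simps(2)[of "Suc n"] z_def[symmetric]
    unfolding z_def sqrt_iter_bound.simps(2)[of n] y_def by (simp add: field_simps)
  show ?case unfolding Z_def[symmetric] z_def[symmetric] e b using d by simp
qed

text \<open>The iteration \<open>Y\<^bsub>n+1\<^esub> = (M + Y\<^sub>n\<^sup>2) / 2\<close> with \<open>M = 1 - N\<close> is dominated by its scalar counterpart
  at \<open>M = 1\<close>, hence converges to some \<open>Y\<close> with \<open>(1 - Y)\<^sup>2 = N\<close>.\<close>

lemma positive_contraction_sqrt:
  assumes N: "positive_op N" and N1: "\<And>x. Re (cinner (N x) x) \<le> (norm x)\<^sup>2"
  shows "\<exists>X. positive_op X \<and> (\<forall>x. X (X x) = N x) \<and>
    (\<forall>B. bounded_op B \<and> (\<forall>x. B (N x) = N (B x)) \<longrightarrow> (\<forall>x. B (X x) = X (B x)))"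
proof -
  note Nb = positive_op_bounded[OF N]
  define M where "M = (\<lambda>x. x - N x)"
  have Mb: "bounded_op M" unfolding M_def by (intro bounded_op_diff bounded_op_id Nb)
  have Msym: "cinner (M x) y = cinner x (M y)" for x y
    by (simp add: M_def cinner_simps positive_op_symmetric[OF N])
  have M1: "norm (M x) \<le> norm x" for x
  proof -
    have "(norm (M x))\<^sup>2 \<le> 1 * Re (cinner (M x) x)"
      by (rule psd_operator_norm_sq_le[OF Mb Msym complex_vector.subspace_UNIV UNIV_I])
        (use N1 positive_op_nonneg[OF N] in \<open>simp_all add: M_def cinner_simps Re_cinner_self\<close>)
    also have "\<dots> \<le> (norm x)\<^sup>2"
      using positive_op_nonneg[OF N, of x] by (simp add: M_def cinner_simps Re_cinner_self)
    finally show ?thesis by (rule power2_le_imp_le) simp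
  qed
  define Y where "Y = sqrt_iter M"
  define y where "y = sqrt_iter_bound"
  have Yb: "bounded_op (Y n)" for n unfolding Y_def by (rule sqrt_iter_bounded_op[OF Mb])
  have Yn: "norm (Y n x) \<le> norm x" for n x
    using sqrt_iter_norm[of M n x, OF M1] mult_right_mono[OF sqrt_iter_bound_le_1[of n], of "norm x"]
    by (simp add: Y_def)
  have ymono: "incseq y" unfolding y_def by (intro incseq_SucI sqrt_iter_bound_Suc)
  have diff: "norm (Y m x - Y n x) \<le> (y m - y n) * norm x" if "n \<le> m" for m n x
    using that
  proof (induction m rule: dec_induct)
    case (step m)
    have "norm (Y (Suc m) x - Y n x) \<le> norm (Y (Suc m) x - Y m x) + norm (Y m x - Y n x)"
      using norm_triangle_ineq[of "Y (Suc m) x - Y m x" "Y m x - Y n x"] by simp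
    also have "norm (Y (Suc m) x - Y m x) \<le> (y (Suc m) - y m) * norm x"
      unfolding Y_def y_def by (rule sqrt_iter_norm_diff[OF Mb M1])
    finally show ?case using step.IH by (simp add: algebra_simps)
  qed simp
  have "convergent y"
    by (rule Bseq_mono_convergent[OF BseqI'[where K = 1]])
      (use ymono sqrt_iter_bound_nonneg sqrt_iter_bound_le_1 in \<open>auto simp: y_def incseq_def\<close>)
  then have Cy: "Cauchy y" by (rule convergent_Cauchy)
  have "Cauchy (\<lambda>n. Y n x)" for x
  proof (rule CauchyI)
    fix e :: real assume e: "e > 0"
    then have "0 < e / (norm x + 1)" by (simp add: add_nonneg_pos)
    then obtain K where K: "\<And>m n. m \<ge> K \<Longrightarrow> n \<ge> K \<Longrightarrow> norm (y m - y n) < e / (norm x + 1)"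
      using Cy unfolding Cauchy_iff by meson
    have *: "norm (Y m x - Y n x) < e" if "K \<le> n" "n \<le> m" for m n
    proof -
      have "y m - y n < e / (norm x + 1)" using K[of m n] that by auto
      then have "(y m - y n) * (norm x + 1) < e" by (simp add: pos_less_divide_eq add_nonneg_pos)
      moreover have "y n \<le> y m" using ymono that by (auto simp: incseq_def)
      ultimately show ?thesis using diff[OF that(2), of x] by (simp add: algebra_simps)
    qed
    show "\<exists>K. \<forall>m\<ge>K. \<forall>n\<ge>K. norm (Y m x - Y n x) < e"
    proof (intro exI[of _ K] allI impI)
      fix m n assume "K \<le> m" "K \<le> n"
      then show "norm (Y m x - Y n x) < e"
        using *[of n m] *[of m n] by (cases "n \<le> m") (auto simp: norm_minus_commute)
    qed
  qed
  then have "\<exists>l. (\<lambda>n. Y n x) \<longlonglongrightarrow> l" for x using Cauchy_convergent convergent_def by blast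
  then obtain L where L: "\<And>x. (\<lambda>n. Y n x) \<longlonglongrightarrow> L x" by metis
  have Ln: "norm (L x) \<le> norm x" for x
    using Lim_bounded[OF tendsto_norm[OF L[of x]], of 0 "norm x"] Yn by blast
  have Lb: "bounded_op L"
  proof (rule bounded_opI[where K = 1])
    fix a b c show "L (a + b) = L a + L b"
      using LIMSEQ_unique[OF L[of "a + b"]] tendsto_add[OF L[of a] L[of b]] by (simp add: bounded_op_simps[OF Yb])
    show "L (c *\<^sub>C a) = c *\<^sub>C L a"
      using LIMSEQ_unique[OF L[of "c *\<^sub>C a"]] scaleC.tendsto[OF tendsto_const L[of a], of c]
      by (simp add: bounded_op_simps[OF Yb])
  qed (use Ln in simp)
  have Lsym: "cinner (L a) b = cinner a (L b)" for a b
    using LIMSEQ_unique[OF cinner.tendsto[OF L[of a] tendsto_const[of b]]]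
      cinner.tendsto[OF tendsto_const[of a] L[of b]] sqrt_iter_symmetric[of M, OF Msym] by (simp add: Y_def)
  have Lcomm: "B (L x) = L (B x)" if B: "bounded_op B" "\<And>x. B (N x) = N (B x)" for B x
  proof -
    have BM: "B (M x) = M (B x)" for x by (simp add: M_def bounded_op_simps[OF B(1)] B(2))
    have "(\<lambda>n. B (Y n x)) = (\<lambda>n. Y n (B x))"
      unfolding Y_def by (simp add: sqrt_iter_commute[where B = B and M = M, OF B(1) BM])
    then show ?thesis using LIMSEQ_unique[OF bounded_op_tendsto[OF B(1) L[of x]]] L[of "B x"] by simp
  qed
  \<comment> \<open>Strong limits may be composed here because the \<open>Y n\<close> are uniformly
    contractive.\<close>
  have "(\<lambda>n. Y n (Y n x)) \<longlonglongrightarrow> L (L x)" for x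
  proof -
    have "(\<lambda>n. Y n (Y n x - L x)) \<longlonglongrightarrow> 0"
    proof (rule Lim_null_comparison)
      show "\<forall>\<^sub>F n in sequentially. norm (Y n (Y n x - L x)) \<le> norm (Y n x - L x)" using Yn by simp
      show "(\<lambda>n. norm (Y n x - L x)) \<longlonglongrightarrow> 0" using L[of x] by (simp add: LIM_zero tendsto_norm_zero)
    qed
    from tendsto_add[OF this L[of "L x"]] show ?thesis by (simp add: bounded_op_simps[OF Yb])
  qed
  then have "(\<lambda>n. Y (Suc n) x) \<longlonglongrightarrow> (1/2::complex) *\<^sub>C (M x + L (L x))" for x
    unfolding Y_def sqrt_iter.simps(2) by (intro scaleC.tendsto tendsto_intros)
  then have LL: "L x = (1/2::complex) *\<^sub>C (M x + L (L x))" for x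
    using LIMSEQ_unique[OF LIMSEQ_Suc[OF L[of x]]] by blast
  have L2: "L x + L x = M x + L (L x)" for x
  proof -
    have "L x + L x = (1/2 + 1/2 :: complex) *\<^sub>C (M x + L (L x))" 
      by (subst (1 2) LL[of x]) (simp only: scaleC_add_left)
    then show ?thesis by (simp add: scaleC_one)
  qed
  \<comment> \<open>The fixed point equation \<open>2 L = M + L^2\<close> says
    \<open>(1 - L)^2 = 1 - M = N\<close>.\<close>
  define X where "X = (\<lambda>x. x - L x)"
  have Xb: "bounded_op X" unfolding X_def by (intro bounded_op_diff bounded_op_id Lb)
  have "positive_op X"
  proof (rule positive_opI[OF Xb])
    fix a b
    show "cinner (X a) b = cinner a (X b)" by (simp add: X_def cinner_simps Lsym)
    have "Re (cinner (L a) a) \<le> norm (L a) * norm a"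
      using complex_Re_le_cmod cinner_Cauchy_Schwarz order_trans by blast
    also have "\<dots> \<le> norm a * norm a" by (intro mult_right_mono Ln) auto
    finally show "0 \<le> Re (cinner (X a) a)" by (simp add: X_def cinner_simps Re_cinner_self power2_eq_square)
  qed
  moreover have "X (X x) = N x" for x
  proof -
    have "X (X x) = x - (L x + L x) + L (L x)" by (simp add: X_def bounded_op_simps[OF Lb])
    then show ?thesis by (simp only: L2) (simp add: M_def)
  qed
  moreover have "B (X x) = X (B x)" if "bounded_op B" "\<And>x. B (N x) = N (B x)" for B x
    using Lcomm[OF that] by (simp add: X_def bounded_op_simps[OF that(1)])
  ultimately show ?thesis by blast
qed

text \<open>Division by an upper bound \<open>s\<close> of the form of \<open>N\<close> reduces to a
  contraction, whose root is multiplied by \<open>sqrt s\<close>. The clause on commuting operators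
  is what uniqueness rests on.\<close>

theorem positive_sqrt_exists:
  assumes N: "positive_op N"
  shows "\<exists>X. positive_op X \<and> (\<forall>x. X (X x) = N x) \<and>
    (\<forall>B. bounded_op B \<and> (\<forall>x. B (N x) = N (B x)) \<longrightarrow> (\<forall>x. B (X x) = X (B x)))"
proof -
  obtain s where s: "s > 0" "\<And>x. Re (cinner (N x) x) \<le> s * (norm x)\<^sup>2"
    using positive_op_bound[OF N] by blast
  define c where "c = complex_of_real (1 / s)"
  define d where "d = complex_of_real (sqrt s)"
  have scale_pos: "positive_op (\<lambda>x. complex_of_real r *\<^sub>C A x)" if "positive_op A" "0 \<le> r" for A :: "'a \<Rightarrow> 'a" and r
    by (rule positive_opI[OF bounded_op_scaleC[OF positive_op_bounded[OF that(1)]]])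
      (use positive_op_symmetric[OF that(1)] positive_op_nonneg[OF that(1)] that(2) in
        \<open>simp_all add: cinner_simps\<close>)
  have "positive_op (\<lambda>x. c *\<^sub>C N x)" unfolding c_def using s(1) by (intro scale_pos[OF N]) simp
  moreover have "Re (cinner (c *\<^sub>C N x) x) \<le> (norm x)\<^sup>2" for x
    using s(1) s(2)[of x] by (simp add: c_def cinner_scaleC_left pos_divide_le_eq mult.commute)
  ultimately obtain X where X: "positive_op X" "\<And>x. X (X x) = c *\<^sub>C N x"
    "\<And>B. bounded_op B \<Longrightarrow> (\<forall>x. B (c *\<^sub>C N x) = c *\<^sub>C N (B x)) \<Longrightarrow> \<forall>x. B (X x) = X (B x)"
    using positive_contraction_sqrt[of "\<lambda>x. c *\<^sub>C N x"] by blast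
  note Xs = bounded_op_simps[OF positive_op_bounded[OF X(1)]]
  have dc: "d * (d * c) = 1"
    using s(1) unfolding d_def c_def of_real_mult[symmetric] by (simp add: mult.assoc[symmetric])
  have "positive_op (\<lambda>x. d *\<^sub>C X x)" unfolding d_def using s(1) by (intro scale_pos[OF X(1)]) simp
  moreover have "d *\<^sub>C X (d *\<^sub>C X x) = N x" for x
    using dc by (simp add: Xs X(2) scaleC_scaleC scaleC_one)
  moreover have "B (d *\<^sub>C X x) = d *\<^sub>C X (B x)" if B: "bounded_op B" "\<forall>x. B (N x) = N (B x)" for B x
    using X(3)[OF B(1)] B(2) by (simp add: bounded_op_simps[OF B(1)])
  ultimately show ?thesis by blast
qed

text \<open>Any positive root of \<open>N\<close> commutes with \<open>N\<close>, hence with the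
  constructed root \<open>Z\<close>; the commuting case identifies both \<open>X\<close> and
  \<open>Y\<close> with \<open>Z\<close>.\<close>

theorem positive_sqrt_unique:
  assumes X: "positive_op X" and Y: "positive_op Y" and sq: "\<And>x. X (X x) = Y (Y x)"
  shows "X = Y"
proof -
  note Xb = positive_op_bounded[OF X] note Yb = positive_op_bounded[OF Y]
  define N where "N = (\<lambda>x. X (X x))"
  have "positive_op N"
    unfolding N_def
    by (rule positive_opI[OF bounded_op_compose[OF Xb Xb]])
      (simp_all only: positive_op_symmetric[OF X, of "X _"] positive_op_symmetric[OF X, of _ "X _", symmetric]
        Re_cinner_self zero_le_power2)
  then obtain Z where Z: "positive_op Z" "\<And>x. Z (Z x) = N x"
    and comm: "\<And>B. bounded_op B \<Longrightarrow> (\<forall>x. B (N x) = N (B x)) \<Longrightarrow> \<forall>x. B (Z x) = Z (B x)"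
    using positive_sqrt_exists[of N] by blast
  have "X = Z"
    by (rule positive_sqrt_unique_commuting[OF X Z(1)]) (use Z(2) comm[OF Xb] in \<open>auto simp: N_def\<close>)
  moreover have "Y = Z"
    by (rule positive_sqrt_unique_commuting[OF Y Z(1)]) (use Z(2) comm[OF Yb] sq in \<open>auto simp: N_def\<close>)
  ultimately show ?thesis by simp
qed

section \<open>Compact positive operators\<close>

lemma compact_op_subseq:
  assumes A: "compact_op A" and x: "\<And>n::nat. norm (x n) \<le> K"
  shows "\<exists>l r. strict_mono r \<and> (\<lambda>n. A (x (r n))) \<longlonglongrightarrow> l"
proof -
  have cl: "clinear A" using A by (simp add: compact_op_def)
  define L where "L = \<bar>K\<bar> + 1"
  have L: "L > 0" "norm (x n) \<le> L" for n using x[of n] by (auto simp: L_def)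
  define y where "y n = complex_of_real (1 / L) *\<^sub>C x n" for n
  have "norm (y n) \<le> 1" for n
    using L by (simp add: y_def norm_scaleC norm_divide pos_divide_le_eq)
  then have mem: "A (y n) \<in> closure (A ` cball 0 1)" for n
    by (intro subsetD[OF closure_subset] imageI) simp
  have "compact (closure (A ` cball 0 1))" using A by (simp add: compact_op_def)
  then have "\<exists>l\<in>closure (A ` cball 0 1). \<exists>r. strict_mono r \<and> ((\<lambda>n. A (y n)) \<circ> r) \<longlonglongrightarrow> l"
    unfolding compact_def using mem by (elim allE[of _ "\<lambda>n. A (y n)"]) simp
  then obtain l r where r: "strict_mono r" "(\<lambda>n. A (y (r n))) \<longlonglongrightarrow> l"
    by (auto simp: comp_def)
  have "(\<lambda>n. complex_of_real L *\<^sub>C A (y (r n))) \<longlonglongrightarrow> complex_of_real L *\<^sub>C l"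
    by (intro scaleC.tendsto tendsto_const r(2))
  moreover have "complex_of_real L *\<^sub>C A (y (r n)) = A (x (r n))" for n
    using L(1) unfolding y_def clinear_simps(2)[OF cl] scaleC_scaleC of_real_mult[symmetric]
    by (simp add: scaleC_one)
  ultimately show ?thesis using r(1) by auto
qed

text \<open>The form of \<open>A\<close> is maximized on the unit sphere of \<open>M\<close>. Along
  a maximizing sequence the form of \<open>B = l - A\<close> tends to \<open>0\<close>, and as
  \<open>B\<close> is nonnegative on \<open>M\<close>, so does \<open>B (x n)\<close> in norm: the
  \<open>x n\<close> are approximate eigenvectors. The pair \<open>e = 0\<close>,
  \<open>l = 0\<close> is returned when the form vanishes on \<open>M\<close>.\<close>

lemma compact_positive_top_eigenvector:
  assumes A: "positive_op A" "compact_op A" and M: "complex_vector.subspace M" "closed M"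
    and inv: "\<And>x. x \<in> M \<Longrightarrow> A x \<in> M"
  shows "\<exists>e\<in>M. \<exists>l\<ge>0. A e = complex_of_real l *\<^sub>C e \<and> (norm e = 1 \<or> e = 0 \<and> l = 0) \<and>
    (\<forall>x\<in>M. Re (cinner (A x) x) \<le> l * (norm x)\<^sup>2)"
proof (cases "\<forall>x\<in>M. Re (cinner (A x) x) \<le> 0")
  case True
  then show ?thesis using complex_vector.subspace_0[OF M(1)] bounded_op_simps(3)[OF positive_op_bounded[OF A(1)]]
    by (intro bexI[of _ 0] exI[of _ 0]) (auto simp: complex_vector.scale_zero_right)
next
  case False
  note Ab = positive_op_bounded[OF A(1)] note As = bounded_op_simps[OF Ab]
  obtain K where K: "K > 0" "\<And>x. Re (cinner (A x) x) \<le> K * (norm x)\<^sup>2" using positive_op_bound[OF A(1)] by blast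
  define q where "q x = Re (cinner (A x) x)" for x
  define U where "U = {x \<in> M. norm x = 1}"
  have qs: "q (complex_of_real c *\<^sub>C x) = c\<^sup>2 * q x" for c x
    by (simp add: q_def As cinner_scaleC_left cinner_scaleC_right power2_eq_square)
  define u where "u x = complex_of_real (1 / norm x) *\<^sub>C x" for x :: 'a
  have uU: "u x \<in> U" if "x \<in> M" "x \<noteq> 0" for x
    using that complex_vector.subspace_scale[OF M(1)] by (simp add: U_def u_def norm_scaleC norm_divide)
  have qu: "q (u x) = q x / (norm x)\<^sup>2" for x unfolding u_def qs by (simp add: power_divide)
  obtain x0 where x0: "x0 \<in> M" "q x0 > 0" using False by (auto simp: q_def not_le)
  then have x00: "x0 \<noteq> 0" by (auto simp: q_def cinner.zero_right)
  define l where "l = (SUP x\<in>U. q x)"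
  have bdd: "bdd_above (q ` U)" 
  proof (rule bdd_aboveI2)
    fix x assume "x \<in> U"
    then show "q x \<le> K" using K(2)[of x] by (simp add: U_def q_def)
  qed
  have ne: "U \<noteq> {}" using uU[OF x0(1) x00] by auto
  have lU: "q x \<le> l" if "x \<in> U" for x unfolding l_def using bdd that by (rule cSUP_upper2) auto
  have l0: "l > 0"
  proof -
    have "0 < q (u x0)" using x0 x00 by (simp add: qu)
    then show ?thesis using lU[OF uU[OF x0(1) x00]] by simp
  qed
  have lM: "q x \<le> l * (norm x)\<^sup>2" if "x \<in> M" for x
  proof (cases "x = 0")
    case False
    then show ?thesis using lU[OF uU[OF that False]] by (simp add: qu pos_divide_le_eq)
  qed (simp add: q_def cinner.zero_right)
  have "\<exists>x\<in>U. l - 1 / real (Suc n) < q x" for n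
    using less_cSUP_iff[OF ne bdd, of "l - 1 / real (Suc n)"] by (simp add: l_def)
  then obtain x where x: "\<And>n. x n \<in> U" "\<And>n. l - 1 / real (Suc n) < q (x n)" by metis
  define B where "B = (\<lambda>x. complex_of_real l *\<^sub>C x - A x)"
  have Bb: "bounded_op B" unfolding B_def by (intro bounded_op_diff bounded_op_scaleC bounded_op_id Ab)
  have Bsym: "cinner (B v) w = cinner v (B w)" for v w
    by (simp add: B_def cinner_simps positive_op_symmetric[OF A(1)])
  have Bq: "Re (cinner (B v) v) = l * (norm v)\<^sup>2 - q v" for v
    by (simp add: B_def cinner_simps Re_cinner_self q_def)
  have "(norm (B (x n)))\<^sup>2 \<le> l * Re (cinner (B (x n)) (x n))" for n
  proof (rule psd_operator_norm_sq_le[OF Bb Bsym M(1)])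
    fix v assume "v \<in> M"
    then show "B v \<in> M" unfolding B_def using M(1) inv
      by (intro complex_vector.subspace_diff complex_vector.subspace_scale)
    show "0 \<le> Re (cinner (B v) v)" using lM[OF \<open>v \<in> M\<close>] by (simp add: Bq)
    show "Re (cinner (B v) v) \<le> l * (norm v)\<^sup>2" using positive_op_nonneg[OF A(1), of v] by (simp add: Bq q_def)
  qed (use x in \<open>simp add: U_def\<close>)
  also have "Re (cinner (B (x n)) (x n)) \<le> 1 / real (Suc n)" for n
    using x(2)[of n] x(1)[of n] by (simp add: Bq U_def)
  finally have Bx: "(norm (B (x n)))\<^sup>2 \<le> l * (1 / real (Suc n))" for n using l0 by (simp add: mult_left_mono)
  have "(\<lambda>n. (norm (B (x n)))\<^sup>2) \<longlonglongrightarrow> 0"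
  proof (rule tendsto_sandwich[of "\<lambda>_. 0"])
    show "(\<lambda>n. l * (1 / real (Suc n))) \<longlonglongrightarrow> 0"
      using tendsto_mult[OF tendsto_const lim_inverse_n'[THEN LIMSEQ_Suc], of l] by simp
  qed (use Bx in auto)
  then have "(\<lambda>n. sqrt ((norm (B (x n)))\<^sup>2)) \<longlonglongrightarrow> sqrt 0" by (intro tendsto_real_sqrt)
  then have Blim: "(\<lambda>n. B (x n)) \<longlonglongrightarrow> 0" by (simp add: tendsto_norm_zero_iff)
  obtain y r where r: "strict_mono r" "(\<lambda>n. A (x (r n))) \<longlonglongrightarrow> y"
    using compact_op_subseq[OF A(2), of x 1] x(1) by (auto simp: U_def)
  \<comment> \<open>Because \<open>x = (B x + A x) / l\<close>, convergence of the images under the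
    compact operator passes to the vectors themselves.\<close>
  have "(\<lambda>n. complex_of_real (1 / l) *\<^sub>C (B (x (r n)) + A (x (r n)))) \<longlonglongrightarrow> complex_of_real (1 / l) *\<^sub>C (0 + y)"
    using LIMSEQ_subseq_LIMSEQ[OF Blim r(1)] r(2) by (intro scaleC.tendsto tendsto_add tendsto_const) (simp_all add: comp_def)
  moreover have "complex_of_real (1 / l) *\<^sub>C (B v + A v) = v" for v
    using l0 scaleC_scaleC[of "complex_of_real (1/l)" "complex_of_real l" v] by (simp add: B_def scaleC_one)
  ultimately obtain e where e: "(\<lambda>n. x (r n)) \<longlonglongrightarrow> e" by auto
  have eM: "e \<in> M" using closed_sequentially[OF M(2) _ e] x(1) by (simp add: U_def)
  have "norm e = 1" using LIMSEQ_unique[OF tendsto_norm[OF e]] x(1) by (simp add: U_def)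
  moreover have "B e = 0"
    using LIMSEQ_unique[OF bounded_op_tendsto[OF Bb e]] LIMSEQ_subseq_LIMSEQ[OF Blim r(1)] by (simp add: comp_def)
  then have "A e = complex_of_real l *\<^sub>C e" by (simp add: B_def)
  ultimately show ?thesis using eM l0 lM by (intro bexI[of _ e] exI[of _ l]) (auto simp: q_def)
qed

definition orthonormal_or_zero :: "(nat \<Rightarrow> 'a::chilbert_space) \<Rightarrow> bool" where
  "orthonormal_or_zero e \<longleftrightarrow> (\<forall>i j. i \<noteq> j \<longrightarrow> cinner (e i) (e j) = 0) \<and> (\<forall>i. norm (e i) = 1 \<or> e i = 0)"

text \<open>Padding with \<open>e\<^sub>n = 0\<close>, \<open>l\<^sub>n = 0\<close> covers operators of finite rank, including those on
  finite-dimensional spaces.\<close>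

definition diagonalizes :: "('a::chilbert_space \<Rightarrow> 'a) \<Rightarrow> (nat \<Rightarrow> 'a) \<Rightarrow> (nat \<Rightarrow> real) \<Rightarrow> bool" where
  "diagonalizes A e l \<longleftrightarrow> orthonormal_or_zero e \<and> (\<forall>n. A (e n) = complex_of_real (l n) *\<^sub>C e n) \<and>
     (\<forall>n. 0 \<le> l n) \<and> antimono l \<and> l \<longlonglongrightarrow> 0 \<and> (\<forall>n. e n = 0 \<longrightarrow> l n = 0) \<and>
     (\<forall>n x. (\<forall>i<n. cinner x (e i) = 0) \<longrightarrow> Re (cinner (A x) x) \<le> l n * (norm x)\<^sup>2)"

text \<open>Top eigenvectors are split off one after another, each on the orthogonal complement of
  its predecessors, which is invariant because \<open>A\<close> is symmetric.\<close>

theorem compact_positive_diagonalizable: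
  assumes A: "positive_op A" "compact_op A"
  shows "\<exists>e l. diagonalizes A e l"
proof -
  \<comment> \<open>The state of the recursion: \<open>E\<close> collects the eigenvectors found so
    far, \<open>e\<close> and \<open>l\<close> are the next one and its eigenvalue.\<close>
  define P where "P = (\<lambda>(E, e, l). e \<in> orth_compl E \<and> 0 \<le> l \<and> A e = complex_of_real l *\<^sub>C e \<and>
    (norm e = 1 \<or> e = 0 \<and> l = 0) \<and> (\<forall>x\<in>orth_compl E. Re (cinner (A x) x) \<le> l * (norm x)\<^sup>2) \<and>
    (\<forall>y\<in>E. \<exists>c. A y = c *\<^sub>C y))"
  have ex: "\<exists>e l. P (E, e, l)" if E: "\<forall>y\<in>E. \<exists>c. A y = c *\<^sub>C y" for E
  proof -
    have "A x \<in> orth_compl E" if "x \<in> orth_compl E" for x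
      unfolding orth_compl_def
    proof (intro CollectI ballI)
      fix y assume y: "y \<in> E"
      then obtain c where "A y = c *\<^sub>C y" using E by blast
      then show "cinner (A x) y = 0" using mem_orth_complD[OF that y]
        by (simp add: positive_op_symmetric[OF A(1), of x y] cinner_scaleC_right)
    qed
    from compact_positive_top_eigenvector[OF A subspace_orth_compl closed_orth_compl this]
    show ?thesis using E unfolding P_def by auto
  qed
  have "\<exists>f. \<forall>n. (P (f n) \<and> (n = 0 \<longrightarrow> fst (f n) = {})) \<and>
      fst (f (Suc n)) = insert (fst (snd (f n))) (fst (f n))"
  proof (rule dependent_nat_choice)
    show "\<exists>x. P x \<and> (0 = (0::nat) \<longrightarrow> fst x = {})" using ex[of "{}"] by auto
    fix x and n :: nat assume "P x \<and> (n = 0 \<longrightarrow> fst x = {})"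
    then have "\<forall>y\<in>insert (fst (snd x)) (fst x). \<exists>c. A y = c *\<^sub>C y"
      by (auto simp: P_def split: prod.splits)
    from ex[OF this] show "\<exists>y. (P y \<and> (Suc n = 0 \<longrightarrow> fst y = {})) \<and> fst y = insert (fst (snd x)) (fst x)"
      by auto
  qed
  then obtain f where f: "\<And>n. P (f n)" "fst (f 0) = {}"
    "\<And>n. fst (f (Suc n)) = insert (fst (snd (f n))) (fst (f n))" by auto
  define e where "e n = fst (snd (f n))" for n
  define l where "l n = snd (snd (f n))" for n
  have E: "fst (f n) = e ` {..<n}" for n
    by (induction n) (auto simp: f lessThan_Suc e_def)
  have Pn: "e n \<in> orth_compl (e ` {..<n})" "0 \<le> l n" "A (e n) = complex_of_real (l n) *\<^sub>C e n"
    "norm (e n) = 1 \<or> e n = 0 \<and> l n = 0"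
    "\<And>x. x \<in> orth_compl (e ` {..<n}) \<Longrightarrow> Re (cinner (A x) x) \<le> l n * (norm x)\<^sup>2" for n
    using f(1)[of n] unfolding P_def E[symmetric] e_def l_def by (auto simp: split_beta)
  have orth: "cinner (e i) (e j) = 0" if "i \<noteq> j" for i j
  proof (cases "j < i")
    case True
    then show ?thesis using Pn(1)[of i] by (auto simp: orth_compl_def)
  next
    case False
    then have "cinner (e j) (e i) = 0" using Pn(1)[of j] that by (auto simp: orth_compl_def)
    then show ?thesis using cinner_swap_zero by blast
  qed
  have desc: "l (Suc n) \<le> l n" for n
  proof (cases "e (Suc n) = 0")
    case True
    then show ?thesis using Pn(4)[of "Suc n"] Pn(2)[of n] by auto
  next
    case False
    \<comment> \<open>The next eigenvector was already a competitor in the maximum at stage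
      \<open>n\<close>.\<close>
    have "e (Suc n) \<in> orth_compl (e ` {..<n})" using Pn(1)[of "Suc n"] by (auto simp: orth_compl_def)
    from Pn(5)[OF this] show ?thesis using Pn(4)[of "Suc n"] False
      by (simp add: Pn(3) cinner_scaleC_left Re_cinner_self)
  qed
  then have anti: "antimono l" by (intro decseq_SucI) 
  have "l \<longlonglongrightarrow> 0"
  proof (rule ccontr)
    \<comment> \<open>Eigenvalues staying above some \<open>c > 0\<close> would keep the vectors
      \<open>A (e n)\<close> at mutual distance at least \<open>c\<close>, against
      compactness.\<close>
    assume "\<not> ?thesis"
    obtain c where c: "l \<longlonglongrightarrow> c" "\<And>n. c \<le> l n" using decseq_convergent[OF anti, of 0] Pn(2) by auto
    have "0 \<le> c" using LIMSEQ_le_const[OF c(1)] Pn(2) by auto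
    then have c0: "c > 0" using c(1) \<open>\<not> l \<longlonglongrightarrow> 0\<close> by (cases "c = 0") auto
    have unit: "norm (e n) = 1" for n using Pn(4)[of n] c(2)[of n] c0 by auto
    obtain y r where r: "strict_mono r" "(\<lambda>n. A (e (r n))) \<longlonglongrightarrow> y"
      using compact_op_subseq[OF A(2), of e 1] unit by auto
    from r(2) have "Cauchy (\<lambda>n. A (e (r n)))" by (simp add: LIMSEQ_imp_Cauchy)
    then obtain N where N: "\<And>m n. m \<ge> N \<Longrightarrow> n \<ge> N \<Longrightarrow> norm (A (e (r m)) - A (e (r n))) < c"
      using CauchyD c0 by metis
    define i where "i = r N" define j where "j = r (Suc N)"
    have ij: "i \<noteq> j" using r(1) by (simp add: i_def j_def strict_mono_eq)
    have "(norm (A (e i) - A (e j)))\<^sup>2 = (l i)\<^sup>2 + (l j)\<^sup>2"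
      using orth[OF ij] unit Pn(2)[of i] Pn(2)[of j]
      by (simp add: norm_diff_sq Pn(3) norm_scaleC cinner_scaleC_left cinner_scaleC_right)
    moreover have "c\<^sup>2 \<le> (l i)\<^sup>2" using c(2) c0 by (intro power_mono) auto
    ultimately have "c\<^sup>2 \<le> (norm (A (e i) - A (e j)))\<^sup>2" by (simp add: add_increasing2)
    then have "c \<le> norm (A (e i) - A (e j))" by (rule power2_le_imp_le) simp
    then show False using N[of N "Suc N"] by (simp add: i_def j_def)
  qed
  then have "diagonalizes A e l"
    unfolding diagonalizes_def orthonormal_or_zero_def
  proof (intro conjI allI impI)
    show "norm (e i) = 1 \<or> e i = 0" for i using Pn(4)[of i] by blast
    show "l n = 0" if "e n = 0" for n using Pn(4)[of n] that by auto
    show "Re (cinner (A x) x) \<le> l n * (norm x)\<^sup>2" if "\<forall>i<n. cinner x (e i) = 0" for n x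
      using that by (intro Pn(5)) (auto simp: orth_compl_def)
  qed (use orth Pn(2,3) anti in auto)
  then show ?thesis by blast
qed

text \<open>The tail bounds \<open>l n |x|^2\<close> tend to \<open>0\<close>, and a positive
  operator whose form vanishes at \<open>x\<close> annihilates \<open>x\<close>.\<close>

lemma diagonalizes_kernel:
  assumes A: "positive_op A" and d: "diagonalizes A e l" and x: "\<And>i. cinner x (e i) = 0"
  shows "A x = 0"
proof -
  have "Re (cinner (A x) x) \<le> l n * (norm x)\<^sup>2" for n using d x by (auto simp: diagonalizes_def)
  moreover have "(\<lambda>n. l n * (norm x)\<^sup>2) \<longlonglongrightarrow> 0 * (norm x)\<^sup>2"
    using d by (intro tendsto_intros) (auto simp: diagonalizes_def)
  ultimately have "Re (cinner (A x) x) \<le> 0 * (norm x)\<^sup>2" by (intro LIMSEQ_le_const) auto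
  then show ?thesis using positive_op_nonneg[OF A, of x] positive_op_cinner_zero[OF A] by force
qed

section \<open>Eigenvalue sequences counted with multiplicity\<close>

lemma orthonormal_family_dim:
  assumes I: "finite I" and orth: "\<And>i j. i \<in> I \<Longrightarrow> j \<in> I \<Longrightarrow> i \<noteq> j \<Longrightarrow> cinner (e i) (e j) = 0"
    and unit: "\<And>i. i \<in> I \<Longrightarrow> norm (e i) = 1"
  shows "cdim_enat (complex_vector.span (e ` I)) = enat (card I)"
proof -
  have inj: "inj_on e I"
  proof (rule inj_onI, rule ccontr)
    fix i j assume ij: "i \<in> I" "j \<in> I" "e i = e j" "i \<noteq> j"
    then have "cinner (e i) (e i) = 0" using orth[of i j] by simp
    then show False using unit[OF ij(1)] by (simp add: cinner_self)
  qed
  have "complex_vector.independent (e ` I)"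
  proof (rule complex_vector.independent_if_scalars_zero)
    show "finite (e ` I)" using I by simp
    fix f x assume s: "(\<Sum>x\<in>e ` I. f x *\<^sub>C x) = 0" and "x \<in> e ` I"
    then obtain j where j: "j \<in> I" "x = e j" by auto
    have "0 = cinner (\<Sum>i\<in>I. f (e i) *\<^sub>C e i) (e j)"
      using s inj by (simp add: sum.reindex cinner.zero_left)
    also have "\<dots> = (\<Sum>i\<in>I. f (e i) * cinner (e i) (e j))" by (simp add: cinner.sum_left cinner_scaleC_left)
    also have "\<dots> = (\<Sum>i\<in>I. if i = j then f (e j) else 0)"
      using orth j unit by (intro sum.cong) (auto simp: cinner_self)
    finally show "f x = 0" using I j by simp
  qed
  then have "complex_vector.dim (complex_vector.span (e ` I)) = card I"
    using complex_vector.dim_span_eq_card_independent card_image[OF inj] by metis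
  moreover have "cfinite_dim (complex_vector.span (e ` I))"
    using I by (auto simp: cfinite_dim_def)
  ultimately show ?thesis by (simp add: cdim_enat_def)
qed

lemma orthonormal_sum_coeff:
  assumes "finite I" "\<And>i j. i \<noteq> j \<Longrightarrow> cinner (e i) (e j) = 0" "\<And>i. norm (e i) = 1 \<or> e i = 0"
  shows "cinner (\<Sum>i\<in>I. c i *\<^sub>C e i) (e j) = (if j \<in> I \<and> e j \<noteq> 0 then c j else 0)"
proof -
  have "cinner (\<Sum>i\<in>I. c i *\<^sub>C e i) (e j) = (\<Sum>i\<in>I. if i = j then c j * cinner (e j) (e j) else 0)"
    unfolding cinner.sum_left cinner_scaleC_left using assms(2) by (intro sum.cong) auto
  also have "\<dots> = (if j \<in> I then c j * cinner (e j) (e j) else 0)" using assms(1) by simp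
  also have "\<dots> = (if j \<in> I \<and> e j \<noteq> 0 then c j else 0)"
    using assms(3)[of j] by (auto simp: cinner_self)
  finally show ?thesis .
qed

lemma diagonalizes_finite:
  assumes d: "diagonalizes A e l" and t: "t > 0"
  shows "finite {j. t \<le> l j}"
proof -
  have "\<forall>\<^sub>F j in sequentially. l j < t" using d t by (intro order_tendstoD) (auto simp: diagonalizes_def)
  then obtain N where "\<And>j. j \<ge> N \<Longrightarrow> l j < t" by (auto simp: eventually_sequentially)
  then have "{j. t \<le> l j} \<subseteq> {..<N}" by (auto simp: not_le[symmetric])
  then show ?thesis by (rule finite_subset) simp
qed

text \<open>By symmetry the coefficients of \<open>(A - c)^k x\<close> are
  \<open>(l j - c)^k\<close> times those of \<open>x\<close>. A generalized eigenvector thus has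
  coefficients only where \<open>l j = c\<close>; what remains of it lies in the kernel of
  \<open>A\<close>, where \<open>A - c\<close> is multiplication by \<open>-c\<close> and hence
  injective.\<close>

lemma diagonalizes_eigenvalue_sequence:
  assumes A: "positive_op A" and d: "diagonalizes A e l"
  shows "eigenvalue_sequence A (\<lambda>j. complex_of_real (l j))"
proof -
  note As = bounded_op_simps[OF positive_op_bounded[OF A]]
  have Ae: "\<And>n. A (e n) = complex_of_real (l n) *\<^sub>C e n" and l0: "\<And>n. 0 \<le> l n" and anti: "antimono l"
    and ez: "\<And>n. e n = 0 \<Longrightarrow> l n = 0" and orth: "\<And>i j. i \<noteq> j \<Longrightarrow> cinner (e i) (e j) = 0"
    and unit: "\<And>i. norm (e i) = 1 \<or> e i = 0"
    using d by (auto simp: diagonalizes_def orthonormal_or_zero_def)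
  have "finite {j. complex_of_real (l j) = c} \<and>
      enat (card {j. complex_of_real (l j) = c}) = cdim_enat (generalized_eigenspace A c)" if c: "c \<noteq> 0" for c
  proof -
    define J where "J = {j. complex_of_real (l j) = c}"
    have fin: "finite J"
    proof (rule finite_subset)
      show "finite {j. cmod c \<le> l j}" using c by (intro diagonalizes_finite[OF d]) simp
      show "J \<subseteq> {j. cmod c \<le> l j}" using l0 by (auto simp: J_def)
    qed
    define B where "B = (\<lambda>y. A y - c *\<^sub>C y)"
    have Bb: "bounded_op B" unfolding B_def
      by (intro bounded_op_diff bounded_op_scaleC bounded_op_id positive_op_bounded A)
    note Bs = bounded_op_simps[OF Bb]
    have Bk: "(B ^^ k) (x + y) = (B ^^ k) x + (B ^^ k) y" "(B ^^ k) (a *\<^sub>C x) = a *\<^sub>C (B ^^ k) x" for k x y a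
      by (induction k) (simp_all add: Bs)
    have "generalized_eigenspace A c = complex_vector.span (e ` J)"
    proof (intro equalityI subsetI)
      fix x assume "x \<in> generalized_eigenspace A c"
      then obtain k where k: "(B ^^ k) x = 0" by (auto simp: generalized_eigenspace_def B_def)
      have coef: "cinner ((B ^^ k) x) (e j) = (complex_of_real (l j) - c) ^ k * cinner x (e j)" for j k
        by (induction k) (simp_all add: B_def cinner_simps positive_op_symmetric[OF A] Ae algebra_simps)
      have off: "cinner x (e j) = 0" if "j \<notin> J" for j
        using coef[of k j] k that by (auto simp: J_def cinner.zero_left)
      define p where "p = (\<Sum>j\<in>J. cinner x (e j) *\<^sub>C e j)"
      have "cinner (x - p) (e j) = 0" for j
      proof -
        have "cinner p (e j) = (if j \<in> J \<and> e j \<noteq> 0 then cinner x (e j) else 0)"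
          unfolding p_def by (rule orthonormal_sum_coeff[OF fin orth unit])
        then show ?thesis using off[of j] by (cases "j \<in> J") (auto simp: cinner.diff_left cinner.zero_right)
      qed
      then have Axp: "A (x - p) = 0" by (rule diagonalizes_kernel[OF A d])
      have "B p = (\<Sum>j\<in>J. cinner x (e j) *\<^sub>C B (e j))"
        unfolding p_def using fin by (induction J) (auto simp: Bs)
      also have "\<dots> = 0" by (intro sum.neutral) (auto simp: J_def B_def Ae)
      finally have Bp: "B p = 0" .
      show "x \<in> complex_vector.span (e ` J)"
      proof (cases k)
        case 0
        then show ?thesis using k by (simp add: complex_vector.span_zero)
      next
        case (Suc m)
        have "(B ^^ k) p = 0" unfolding Suc funpow_Suc_right comp_def Bp using Bk(2)[of m 0 0] by simp
        then have Bkxp: "(B ^^ k) (x - p) = 0" using k Bk(1)[of k "x - p" p] by simp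
        have Bxp: "B (x - p) = (- c) *\<^sub>C (x - p)"
          unfolding B_def Axp by (simp only: diff_0 scaleC.minus_left)
        have "(B ^^ m) (x - p) = (- c) ^ m *\<^sub>C (x - p)" for m
        proof (induction m)
          case (Suc m)
          then show ?case by (simp only: funpow.simps comp_def Bs(2) Bxp scaleC_scaleC power_Suc2)
        qed (simp add: scaleC_one)
        then have "(- c) ^ k *\<^sub>C (x - p) = 0" using Bkxp by simp
        then have "x = p" using c by simp
        moreover have "p \<in> complex_vector.span (e ` J)" unfolding p_def
          by (intro complex_vector.span_sum complex_vector.span_scale complex_vector.span_base imageI)
        ultimately show ?thesis by simp
      qed
    next
      fix x assume x: "x \<in> complex_vector.span (e ` J)"
      have "complex_vector.subspace {x. B x = 0}"
        by (auto simp: complex_vector.subspace_def Bs)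
      moreover have "e ` J \<subseteq> {x. B x = 0}" by (auto simp: J_def B_def Ae)
      ultimately have "complex_vector.span (e ` J) \<subseteq> {x. B x = 0}" by (intro complex_vector.span_minimal)
      then have "(B ^^ 1) x = 0" using x by auto
      then show "x \<in> generalized_eigenspace A c" unfolding generalized_eigenspace_def B_def by blast
    qed
    moreover have "e j \<noteq> 0" if "j \<in> J" for j using that ez c by (auto simp: J_def)
    then have "norm (e j) = 1" if "j \<in> J" for j using unit that by auto
    ultimately show ?thesis
      using orthonormal_family_dim[OF fin, of e] orth fin by (simp add: J_def)
  qed
  then show ?thesis using anti l0 by (auto simp: eigenvalue_sequence_def antimono_def)
qed

text \<open>Equal multiplicities give superlevel sets of equal finite size, so the moduli agree.
  Every nonzero \<open>l' j\<close> occurs among the nonnegative eigenvalues \<open>l i\<close>, so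
  it is determined by its modulus.\<close>

lemma eigenvalue_sequence_unique:
  assumes A: "positive_op A" and d: "diagonalizes A e l" and l': "eigenvalue_sequence A l'"
  shows "l' = (\<lambda>j. complex_of_real (l j))"
proof -
  define k where "k = (\<lambda>j. complex_of_real (l j))"
  have l0: "\<And>n. 0 \<le> l n" using d by (auto simp: diagonalizes_def)
  have ck: "cmod (k j) = l j" for j using l0 by (simp add: k_def)
  have k: "eigenvalue_sequence A k" unfolding k_def by (rule diagonalizes_eigenvalue_sequence[OF A d])
  have fin: "finite {j. k j = c}" "finite {j. l' j = c}" if "c \<noteq> 0" for c
    using k l' that by (auto simp: eigenvalue_sequence_def)
  have card: "card {j. k j = c} = card {j. l' j = c}" if "c \<noteq> 0" for c
    using k l' that unfolding eigenvalue_sequence_def by (metis enat.inject)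
  have val: "\<exists>i. k i = l' j" if "l' j \<noteq> 0" for j
  proof -
    have "card {i. l' i = l' j} > 0" using fin(2)[OF that] by (auto simp: card_gt_0_iff)
    then have "{i. k i = l' j} \<noteq> {}" unfolding card[OF that, symmetric] by (auto simp: card_gt_0_iff)
    then show ?thesis by blast
  qed
  have eqset: "{j. t \<le> cmod (k j)} = {j. t \<le> cmod (l' j)}" if t: "t > 0" for t
  proof -
    define S where "S = {j. t \<le> cmod (k j)}" define S' where "S' = {j. t \<le> cmod (l' j)}"
    have fS: "finite S" unfolding S_def ck by (rule diagonalizes_finite[OF d t])
    define C where "C = k ` S"
    have fC: "finite C" using fS by (simp add: C_def)
    have C0: "c \<noteq> 0" "t \<le> cmod c" if "c \<in> C" for c using that t by (auto simp: C_def S_def)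
    have S: "S = (\<Union>c\<in>C. {j. k j = c})"
    proof (intro equalityI subsetI)
      fix j assume "j \<in> (\<Union>c\<in>C. {j. k j = c})"
      then have "k j \<in> C" by auto
      from C0(2)[OF this] show "j \<in> S" by (simp add: S_def)
    qed (auto simp: C_def)
    have S': "S' = (\<Union>c\<in>C. {j. l' j = c})"
    proof (intro equalityI subsetI)
      fix j assume j: "j \<in> S'"
      then have "l' j \<noteq> 0" using t by (auto simp: S'_def)
      from val[OF this] obtain i where i: "k i = l' j" by blast
      then have "i \<in> S" using j by (simp add: S_def S'_def)
      then have "l' j \<in> C" unfolding C_def i[symmetric] by (rule imageI)
      then show "j \<in> (\<Union>c\<in>C. {j. l' j = c})" by blast
    next
      fix j assume "j \<in> (\<Union>c\<in>C. {j. l' j = c})"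
      then have "l' j \<in> C" by auto
      from C0(2)[OF this] show "j \<in> S'" by (simp add: S'_def)
    qed
    have cS: "card S = (\<Sum>c\<in>C. card {j. k j = c})"
      unfolding S using fC fin C0 by (intro card_UN_disjoint) auto
    have cS': "card S' = (\<Sum>c\<in>C. card {j. l' j = c})"
      unfolding S' using fC fin C0 by (intro card_UN_disjoint) auto
    have fS': "finite S'" unfolding S' using fC fin C0 by auto
    have cc: "card S = card S'" unfolding cS cS' using card C0 by (intro sum.cong) auto
    \<comment> \<open>Superlevel sets of two non-increasing sequences are nested, so equal finite
      cardinality makes them equal.\<close>
    have down: "S \<subseteq> S' \<or> S' \<subseteq> S"
    proof (rule ccontr)
      assume "\<not> ?thesis"
      then obtain i j where ij: "i \<in> S" "i \<notin> S'" "j \<in> S'" "j \<notin> S" by auto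
      show False
      proof (cases "i \<le> j")
        case True
        then have "cmod (l' j) \<le> cmod (l' i)" using l' by (auto simp: eigenvalue_sequence_def antimono_def)
        then show ?thesis using ij by (auto simp: S'_def)
      next
        case False
        then have "cmod (k i) \<le> cmod (k j)" using k by (auto simp: eigenvalue_sequence_def antimono_def)
        then show ?thesis using ij by (auto simp: S_def)
      qed
    qed
    then have "S = S'" using cc fS fS' card_subset_eq by metis
    then show ?thesis by (simp add: S_def S'_def)
  qed
  have eqmod: "cmod (l' j) = cmod (k j)" for j
  proof (rule antisym)
    show "cmod (l' j) \<le> cmod (k j)"
      using eqset[of "cmod (l' j)"] by (cases "l' j = 0") auto
    show "cmod (k j) \<le> cmod (l' j)"
      using eqset[of "cmod (k j)"] by (cases "k j = 0") auto
  qed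
  show ?thesis
  proof
    fix j
    show "l' j = complex_of_real (l j)"
    proof (cases "l' j = 0")
      case True
      then show ?thesis using eqmod[of j] by (simp add: k_def)
    next
      case False
      from val[OF this] obtain i where "k i = l' j" by blast
      then have i: "l' j = complex_of_real (l i)" by (simp add: k_def)
      then have "l i = l j" using eqmod[of j] l0 by (simp add: k_def)
      then show ?thesis using i by simp
    qed
  qed
qed

lemma eigenvalue_seq_diagonalizes:
  assumes A: "positive_op A" and d: "diagonalizes A e l"
  shows "eigenvalue_seq A = (\<lambda>j. complex_of_real (l j))"
  unfolding eigenvalue_seq_def
  using diagonalizes_eigenvalue_sequence[OF A d] eigenvalue_sequence_unique[OF A d] by (rule some_equality)

text \<open>Gaussian elimination, by induction on the set of equations. This is the dimension count
  of all variational arguments below: a nontrivial combination of \<open>card I\<close> vectors can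
  satisfy fewer than \<open>card I\<close> linear conditions.\<close>

lemma homogeneous_system_nontrivial:
  fixes a :: "'i \<Rightarrow> 'j \<Rightarrow> complex"
  assumes "finite J" "finite I" "card J < card I"
  shows "\<exists>c. (\<exists>i\<in>I. c i \<noteq> 0) \<and> (\<forall>j\<in>J. (\<Sum>i\<in>I. c i * a i j) = 0)"
  using assms
proof (induction J arbitrary: I a rule: finite_induct)
  case empty
  then obtain i where "i \<in> I" by fastforce
  then show ?case by (intro exI[of _ "\<lambda>_. 1"]) auto
next
  case (insert j0 J)
  show ?case
  proof (cases "\<forall>i\<in>I. a i j0 = 0")
    case True
    have "card J < card I" using insert.prems insert.hyps by simp
    from insert.IH[OF insert.prems(1) this, of a]
    obtain c where c: "\<exists>i\<in>I. c i \<noteq> 0" "\<And>j. j \<in> J \<Longrightarrow> (\<Sum>i\<in>I. c i * a i j) = 0" by blast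
    have "(\<Sum>i\<in>I. c i * a i j0) = 0" using True by (intro sum.neutral) simp
    then show ?thesis using c by (intro exI[of _ c] conjI ballI) (auto elim: insertE)
  next
    case False
    then obtain i0 where i0: "i0 \<in> I" "a i0 j0 \<noteq> 0" by auto
    define I' where "I' = I - {i0}"
    have I: "I = insert i0 I'" "i0 \<notin> I'" "finite I'" using i0 insert.prems by (auto simp: I'_def)
    have "card J < card I'" using insert.prems insert.hyps i0 by (simp add: I'_def card_Diff_singleton)
    from insert.IH[OF I(3) this, of "\<lambda>i j. a i j - a i j0 / a i0 j0 * a i0 j"]
    obtain c where c: "\<exists>i\<in>I'. c i \<noteq> 0"
      "\<And>j. j \<in> J \<Longrightarrow> (\<Sum>i\<in>I'. c i * (a i j - a i j0 / a i0 j0 * a i0 j)) = 0" by blast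
    define s where "s = (\<Sum>i\<in>I'. c i * a i j0)"
    \<comment> \<open>The unknown \<open>i0\<close> is solved from equation \<open>j0\<close>; the
      reduced system takes care of the other equations.\<close>
    define d where "d = (\<lambda>i. if i = i0 then - s / a i0 j0 else c i)"
    have sumd: "(\<Sum>i\<in>I. d i * a i j) = - s / a i0 j0 * a i0 j + (\<Sum>i\<in>I'. c i * a i j)" for j
    proof -
      have "(\<Sum>i\<in>I'. d i * a i j) = (\<Sum>i\<in>I'. c i * a i j)"
        using I(2) by (intro sum.cong) (auto simp: d_def)
      then show ?thesis using I by (simp add: d_def)
    qed
    have "(\<Sum>i\<in>I. d i * a i j) = 0" if j: "j \<in> J" for j
    proof -
      have "(\<Sum>i\<in>I'. c i * (a i j - a i j0 / a i0 j0 * a i0 j))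
          = (\<Sum>i\<in>I'. c i * a i j) - (\<Sum>i\<in>I'. (c i * a i j0) * (a i0 j / a i0 j0))"
        unfolding sum_subtractf[symmetric] by (intro sum.cong) (auto simp: algebra_simps)
      also have "\<dots> = (\<Sum>i\<in>I'. c i * a i j) - s * (a i0 j / a i0 j0)"
        by (simp only: s_def sum_distrib_right)
      finally show ?thesis using c(2)[OF j] sumd[of j] by simp
    qed
    moreover have "(\<Sum>i\<in>I. d i * a i j0) = 0" using sumd[of j0] i0 by (simp add: s_def)
    moreover have "\<exists>i\<in>I. d i \<noteq> 0" using c(1) I by (auto simp: d_def)
    ultimately show ?thesis by (intro exI[of _ d] conjI ballI) (auto elim: insertE)
  qed
qed

subsection \<open>Diagonal operators\<close>

text \<open>With two systems the family contains partial isometries (\<open>x = 1\<close>) as well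
  as diagonal operators (\<open>e = f\<close>), so that a change of basis can be written as a
  commutator within it.\<close>

definition diag_op :: "(nat \<Rightarrow> real) \<Rightarrow> (nat \<Rightarrow> 'a) \<Rightarrow> (nat \<Rightarrow> 'a) \<Rightarrow> 'a \<Rightarrow> 'a::chilbert_space" where
  "diag_op x e f v = (\<Sum>n. (complex_of_real (x n) * cinner v (e n)) *\<^sub>C f n)"

lemma orthonormal_or_zeroD:
  assumes "orthonormal_or_zero e"
  shows "i \<noteq> j \<Longrightarrow> cinner (e i) (e j) = 0" "norm (e i) = 1 \<or> e i = 0" "norm (e i) \<le> 1"
    "e i \<noteq> 0 \<Longrightarrow> cinner (e i) (e i) = 1"
proof -
  show *: "norm (e i) = 1 \<or> e i = 0" for i using assms by (auto simp: orthonormal_or_zero_def)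
  show "norm (e i) \<le> 1" using *[of i] by auto
  show "cinner (e i) (e i) = 1" if "e i \<noteq> 0" using *[of i] that by (auto simp: cinner_self)
qed (use assms in \<open>auto simp: orthonormal_or_zero_def\<close>)

lemma orthonormal_or_zero_subfamily:
  assumes "orthonormal_or_zero e" "inj g" shows "orthonormal_or_zero (\<lambda>n. e (g n))"
  using assms by (auto simp: orthonormal_or_zero_def inj_eq)

lemma norm_sq_orthonormal_sum:
  assumes e: "orthonormal_or_zero e" and I: "finite I"
  shows "(norm (\<Sum>i\<in>I. c i *\<^sub>C e i))\<^sup>2 \<le> (\<Sum>i\<in>I. (cmod (c i))\<^sup>2)"
    and "(\<And>i. i \<in> I \<Longrightarrow> e i \<noteq> 0) \<Longrightarrow> (norm (\<Sum>i\<in>I. c i *\<^sub>C e i))\<^sup>2 = (\<Sum>i\<in>I. (cmod (c i))\<^sup>2)"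
proof -
  define s where "s = (\<Sum>i\<in>I. c i *\<^sub>C e i)"
  have co: "cinner s (e j) = (if j \<in> I \<and> e j \<noteq> 0 then c j else 0)" for j
    unfolding s_def using orthonormal_or_zeroD[OF e] by (intro orthonormal_sum_coeff[OF I]) auto
  have "cinner s s = (\<Sum>i\<in>I. cnj (c i) * cinner s (e i))"
    by (subst (2) s_def) (simp add: cinner.sum_right cinner_scaleC_right)
  also have "\<dots> = (\<Sum>i\<in>I. complex_of_real (if e i \<noteq> 0 then (cmod (c i))\<^sup>2 else 0))"
    unfolding co by (intro sum.cong refl) (simp add: complex_norm_square[symmetric] mult.commute del: of_real_power)
  finally have "complex_of_real ((norm s)\<^sup>2) = complex_of_real (\<Sum>i\<in>I. if e i \<noteq> 0 then (cmod (c i))\<^sup>2 else 0)"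
    by (simp only: cinner_self of_real_sum)
  then have n: "(norm s)\<^sup>2 = (\<Sum>i\<in>I. if e i \<noteq> 0 then (cmod (c i))\<^sup>2 else 0)" by (simp only: of_real_eq_iff)
  show "(norm (\<Sum>i\<in>I. c i *\<^sub>C e i))\<^sup>2 \<le> (\<Sum>i\<in>I. (cmod (c i))\<^sup>2)"
    unfolding s_def[symmetric] n by (intro sum_mono) auto
  show "(norm (\<Sum>i\<in>I. c i *\<^sub>C e i))\<^sup>2 = (\<Sum>i\<in>I. (cmod (c i))\<^sup>2)" if "\<And>i. i \<in> I \<Longrightarrow> e i \<noteq> 0"
    unfolding s_def[symmetric] n using that by (intro sum.cong) auto
qed

lemma Bessel_finite:
  assumes e: "orthonormal_or_zero e" and I: "finite I"
  shows "(\<Sum>i\<in>I. (cmod (cinner v (e i)))\<^sup>2) \<le> (norm v)\<^sup>2"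
proof -
  define s where "s = (\<Sum>i\<in>I. cinner v (e i) *\<^sub>C e i)"
  have "cinner v s = (\<Sum>i\<in>I. cnj (cinner v (e i)) * cinner v (e i))"
    by (simp add: s_def cinner.sum_right cinner_scaleC_right)
  also have "\<dots> = (\<Sum>i\<in>I. complex_of_real ((cmod (cinner v (e i)))\<^sup>2))"
    by (intro sum.cong refl) (simp only: complex_norm_square mult.commute)
  finally have "Re (cinner v s) = (\<Sum>i\<in>I. (cmod (cinner v (e i)))\<^sup>2)" by (simp only: of_real_sum[symmetric] Re_complex_of_real)
  moreover have "(norm s)\<^sup>2 \<le> (\<Sum>i\<in>I. (cmod (cinner v (e i)))\<^sup>2)"
    unfolding s_def by (rule norm_sq_orthonormal_sum(1)[OF e I])
  moreover have "0 \<le> (norm (v - s))\<^sup>2" by simp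
  ultimately show ?thesis unfolding norm_diff_sq by linarith
qed

lemma Bessel_summable:
  assumes e: "orthonormal_or_zero e"
  shows "summable (\<lambda>i. (cmod (cinner v (e i)))\<^sup>2)" "(\<Sum>i. (cmod (cinner v (e i)))\<^sup>2) \<le> (norm v)\<^sup>2"
proof -
  show s: "summable (\<lambda>i. (cmod (cinner v (e i)))\<^sup>2)"
    by (rule summableI_nonneg_bounded[where x = "(norm v)\<^sup>2"]) (use Bessel_finite[OF e] in auto)
  show "(\<Sum>i. (cmod (cinner v (e i)))\<^sup>2) \<le> (norm v)\<^sup>2"
    using s Bessel_finite[OF e] by (intro suminf_le_const) auto
qed

lemma orthonormal_series:
  assumes e: "orthonormal_or_zero e" and c: "summable (\<lambda>i. (cmod (c i))\<^sup>2)"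
  shows "summable (\<lambda>i. c i *\<^sub>C e i)" "(norm (\<Sum>i. c i *\<^sub>C e i))\<^sup>2 \<le> (\<Sum>i. (cmod (c i))\<^sup>2)"
proof -
  show s: "summable (\<lambda>i. c i *\<^sub>C e i)"
    unfolding summable_Cauchy
  proof (intro allI impI)
    fix r :: real assume r: "r > 0"
    then have "r\<^sup>2 > 0" by simp
    then obtain N where N: "\<And>m n. m \<ge> N \<Longrightarrow> norm (\<Sum>i\<in>{m..<n}. (cmod (c i))\<^sup>2) < r\<^sup>2"
      using c unfolding summable_Cauchy by meson
    have "norm (\<Sum>i\<in>{m..<n}. c i *\<^sub>C e i) < r" if "m \<ge> N" for m n
    proof -
      have "(norm (\<Sum>i\<in>{m..<n}. c i *\<^sub>C e i))\<^sup>2 \<le> (\<Sum>i\<in>{m..<n}. (cmod (c i))\<^sup>2)"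
        by (rule norm_sq_orthonormal_sum(1)[OF e]) simp
      also have "\<dots> < r\<^sup>2" using N[OF that, of n] by simp
      finally show ?thesis using r by (simp add: power2_less_imp_less)
    qed
    then show "\<exists>N. \<forall>m\<ge>N. \<forall>n. norm (\<Sum>i\<in>{m..<n}. c i *\<^sub>C e i) < r" by blast
  qed
  have "(\<lambda>n. (norm (\<Sum>i<n. c i *\<^sub>C e i))\<^sup>2) \<longlonglongrightarrow> (norm (\<Sum>i. c i *\<^sub>C e i))\<^sup>2"
    by (intro tendsto_intros summable_LIMSEQ s)
  moreover have "(norm (\<Sum>i<n. c i *\<^sub>C e i))\<^sup>2 \<le> (\<Sum>i. (cmod (c i))\<^sup>2)" for n
    using norm_sq_orthonormal_sum(1)[OF e, of "{..<n}" c] sum_le_suminf[OF c, of "{..<n}"] by simp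
  ultimately show "(norm (\<Sum>i. c i *\<^sub>C e i))\<^sup>2 \<le> (\<Sum>i. (cmod (c i))\<^sup>2)" by (intro LIMSEQ_le_const2) auto
qed

lemma diag_coeff_summable:
  assumes e: "orthonormal_or_zero e" and x: "\<forall>n. \<bar>x n\<bar> \<le> K"
  shows "summable (\<lambda>i. (cmod (complex_of_real (x i) * cinner v (e i)))\<^sup>2)"
    "(\<Sum>i. (cmod (complex_of_real (x i) * cinner v (e i)))\<^sup>2) \<le> K\<^sup>2 * (norm v)\<^sup>2"
proof -
  have K: "0 \<le> K" using x[rule_format, of 0] by simp
  have le: "(cmod (complex_of_real (x i) * cinner v (e i)))\<^sup>2 \<le> K\<^sup>2 * (cmod (cinner v (e i)))\<^sup>2" for i
    unfolding norm_mult power_mult_distrib using x[rule_format, of i] K by (intro mult_right_mono) (auto simp: abs_le_square_iff[symmetric])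
  have s: "summable (\<lambda>i. K\<^sup>2 * (cmod (cinner v (e i)))\<^sup>2)" by (intro summable_mult Bessel_summable e)
  show t: "summable (\<lambda>i. (cmod (complex_of_real (x i) * cinner v (e i)))\<^sup>2)"
    by (rule summable_comparison_test'[OF s, of 0]) (use le in simp)
  have "(\<Sum>i. (cmod (complex_of_real (x i) * cinner v (e i)))\<^sup>2) \<le> (\<Sum>i. K\<^sup>2 * (cmod (cinner v (e i)))\<^sup>2)"
    by (intro suminf_le le s t)
  also have "\<dots> = K\<^sup>2 * (\<Sum>i. (cmod (cinner v (e i)))\<^sup>2)" by (intro suminf_mult Bessel_summable e)
  also have "\<dots> \<le> K\<^sup>2 * (norm v)\<^sup>2" by (intro mult_left_mono Bessel_summable e) simp
  finally show "(\<Sum>i. (cmod (complex_of_real (x i) * cinner v (e i)))\<^sup>2) \<le> K\<^sup>2 * (norm v)\<^sup>2" .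
qed

lemma diag_op_sums:
  assumes "orthonormal_or_zero e" "orthonormal_or_zero f" "\<forall>n. \<bar>x n\<bar> \<le> K"
  shows "(\<lambda>n. (complex_of_real (x n) * cinner v (e n)) *\<^sub>C f n) sums diag_op x e f v"
  unfolding diag_op_def
  by (intro summable_sums orthonormal_series(1)[OF assms(2)] diag_coeff_summable(1)[OF assms(1,3)])

lemma diag_op_bound:
  assumes "orthonormal_or_zero e" "orthonormal_or_zero f" "\<forall>n. \<bar>x n\<bar> \<le> K"
  shows "norm (diag_op x e f v) \<le> K * norm v"
proof -
  have "(norm (diag_op x e f v))\<^sup>2 \<le> K\<^sup>2 * (norm v)\<^sup>2"
    using orthonormal_series(2)[OF assms(2) diag_coeff_summable(1)[OF assms(1,3), of v]]
      diag_coeff_summable(2)[OF assms(1,3), of v] by (simp add: diag_op_def)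
  then have "(norm (diag_op x e f v))\<^sup>2 \<le> (K * norm v)\<^sup>2" by (simp add: power_mult_distrib)
  moreover have "0 \<le> K" using assms(3)[rule_format, of 0] by linarith
  ultimately show ?thesis using power2_le_imp_le[of "norm (diag_op x e f v)" "K * norm v"] by simp
qed

lemma diag_op_bounded_op:
  assumes "orthonormal_or_zero e" "orthonormal_or_zero f" "\<forall>n. \<bar>x n\<bar> \<le> K"
  shows "bounded_op (diag_op x e f)"
proof (rule bounded_opI[where K = K])
  note s = diag_op_sums[OF assms]
  fix u v c
  have "(\<lambda>n. (complex_of_real (x n) * cinner (u + v) (e n)) *\<^sub>C f n) sums (diag_op x e f u + diag_op x e f v)"
    using sums_add[OF s[of u] s[of v]] by (simp add: cinner_add_left distrib_left scaleC_add_left)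
  then show "diag_op x e f (u + v) = diag_op x e f u + diag_op x e f v" using sums_unique2 s by blast
  have "(\<lambda>n. c *\<^sub>C ((complex_of_real (x n) * cinner u (e n)) *\<^sub>C f n)) sums (c *\<^sub>C diag_op x e f u)"
    by (rule bounded_linear.sums[OF scaleC.bounded_linear_right s])
  then have "(\<lambda>n. (complex_of_real (x n) * cinner (c *\<^sub>C u) (e n)) *\<^sub>C f n) sums (c *\<^sub>C diag_op x e f u)"
    by (simp add: cinner_scaleC_left scaleC_scaleC ac_simps)
  then show "diag_op x e f (c *\<^sub>C u) = c *\<^sub>C diag_op x e f u" using sums_unique2 s by blast
qed (rule diag_op_bound[OF assms])

lemma diag_op_cinner_sums:
  assumes "orthonormal_or_zero e" "orthonormal_or_zero f" "\<forall>n. \<bar>x n\<bar> \<le> K"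
  shows "(\<lambda>n. complex_of_real (x n) * cinner v (e n) * cinner (f n) w) sums cinner (diag_op x e f v) w"
  using bounded_linear.sums[OF cinner.bounded_linear_left diag_op_sums[OF assms, of v], of w]
  by (simp add: cinner_scaleC_left)

lemma diag_op_adjoint:
  assumes "orthonormal_or_zero e" "orthonormal_or_zero f" "\<forall>n. \<bar>x n\<bar> \<le> K"
  shows "cinner (diag_op x e f v) w = cinner v (diag_op x f e w)"
proof -
  have "(\<lambda>n. complex_of_real (x n) * cinner v (e n) * cinner (f n) w) sums cinner v (diag_op x f e w)"
    using bounded_linear.sums[OF cinner.bounded_linear_right diag_op_sums[OF assms(2,1,3), of w], of v]
      cinner_commute[of w "f _"]
    by (simp add: cinner_scaleC_right ac_simps)
  then show ?thesis using diag_op_cinner_sums[OF assms, of v w] sums_unique2 by blast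
qed

lemma diag_op_coeff:
  assumes "orthonormal_or_zero e" "orthonormal_or_zero f" "\<forall>n. \<bar>x n\<bar> \<le> K"
  shows "cinner (diag_op x e f v) (f j) = (if f j = 0 then 0 else complex_of_real (x j) * cinner v (e j))"
proof (cases "f j = 0")
  case False
  have "(\<lambda>n. complex_of_real (x n) * cinner v (e n) * cinner (f n) (f j)) =
      (\<lambda>n. if n = j then complex_of_real (x j) * cinner v (e j) else 0)"
    using orthonormal_or_zeroD[OF assms(2)] False by auto
  then show ?thesis
    using sums_unique2[OF diag_op_cinner_sums[OF assms, of v "f j"]] sums_single[of j "\<lambda>_. complex_of_real (x j) * cinner v (e j)"]
      False by simp
qed (simp add: cinner.zero_right)

text \<open>A zero vector in the middle system erases its coefficient; the support condition
  restricts such losses to indices where the product of the weights is \<open>0\<close>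
  anyway.\<close>

lemma diag_op_compose:
  assumes "orthonormal_or_zero e" "orthonormal_or_zero f" "orthonormal_or_zero g"
    "\<forall>n. \<bar>x n\<bar> \<le> K" and supp: "\<And>n. y n * x n \<noteq> 0 \<Longrightarrow> f n \<noteq> 0"
  shows "diag_op y f g (diag_op x e f v) = diag_op (\<lambda>n. y n * x n) e g v"
  unfolding diag_op_def[of y] diag_op_def[of "\<lambda>n. y n * x n"] diag_op_coeff[OF assms(1,2,4)]
  using supp by (intro suminf_cong) auto

lemma diag_op_add:
  assumes "orthonormal_or_zero e" "orthonormal_or_zero f" "\<forall>n. \<bar>x n\<bar> \<le> K" "\<forall>n. \<bar>y n\<bar> \<le> L"
  shows "diag_op (\<lambda>n. x n + y n) e f v = diag_op x e f v + diag_op y e f v"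
  unfolding diag_op_def[of "\<lambda>n. x n + y n"]
  using sums_unique[OF sums_add[OF diag_op_sums[OF assms(1,2,3), of v] diag_op_sums[OF assms(1,2,4), of v]]]
  by (simp add: distrib_right scaleC_add_left)

lemma diag_op_scale:
  assumes "orthonormal_or_zero e" "orthonormal_or_zero f" "\<forall>n. \<bar>x n\<bar> \<le> K"
  shows "diag_op (\<lambda>n. r * x n) e f v = complex_of_real r *\<^sub>C diag_op x e f v"
  unfolding diag_op_def[of "\<lambda>n. r * x n"]
  using sums_unique[OF bounded_linear.sums[OF scaleC.bounded_linear_right diag_op_sums[OF assms, of v], of "complex_of_real r"]]
  by (simp add: scaleC_scaleC ac_simps)

lemma diag_op_single: "diag_op (\<lambda>n. if n = j then r else 0) e f v = (complex_of_real r * cinner v (e j)) *\<^sub>C f j"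
proof -
  have "(\<lambda>n. (complex_of_real (if n = j then r else 0) * cinner v (e n)) *\<^sub>C f n) =
      (\<lambda>n. if n = j then (complex_of_real r * cinner v (e j)) *\<^sub>C f j else 0)" by auto
  then show ?thesis unfolding diag_op_def
    using sums_unique[OF sums_single[of j "\<lambda>_. (complex_of_real r * cinner v (e j)) *\<^sub>C f j"]] by simp
qed

text \<open>Only indices with nonzero coefficient matter, so that vectors orthogonal to the first
  few \<open>e n\<close> obey a smaller bound. The sign of \<open>s\<close> enters because Bessel's
  inequality may be strict.\<close>

lemma diag_op_quadratic_le:
  assumes e: "orthonormal_or_zero e" and x: "\<forall>n. \<bar>x n\<bar> \<le> K" and s: "0 \<le> s"
    and le: "\<And>n. cinner v (e n) \<noteq> 0 \<Longrightarrow> x n \<le> s"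
  shows "Re (cinner (diag_op x e e v) v) \<le> s * (norm v)\<^sup>2"
proof -
  have "complex_of_real (x n) * cinner v (e n) * cinner (e n) v = complex_of_real (x n * (cmod (cinner v (e n)))\<^sup>2)" for n
    unfolding of_real_mult complex_norm_square using cinner_commute[of "e n" v] by simp
  then have s1: "(\<lambda>n. x n * (cmod (cinner v (e n)))\<^sup>2) sums Re (cinner (diag_op x e e v) v)"
    using sums_Re[OF diag_op_cinner_sums[OF e e x, of v v]] by (simp only: Re_complex_of_real)
  have s2: "(\<lambda>n. s * (cmod (cinner v (e n)))\<^sup>2) sums (s * (\<Sum>n. (cmod (cinner v (e n)))\<^sup>2))"
    by (intro sums_mult summable_sums Bessel_summable e)
  have s3: "x n * (cmod (cinner v (e n)))\<^sup>2 \<le> s * (cmod (cinner v (e n)))\<^sup>2" for n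
    using le[of n] by (cases "cinner v (e n) = 0") (auto intro: mult_right_mono)
  have "Re (cinner (diag_op x e e v) v) \<le> s * (\<Sum>n. (cmod (cinner v (e n)))\<^sup>2)"
    by (rule sums_le[OF s3 s1 s2])
  also have "\<dots> \<le> s * (norm v)\<^sup>2" using s by (intro mult_left_mono Bessel_summable e)
  finally show ?thesis .
qed

lemma diag_op_positive:
  assumes e: "orthonormal_or_zero e" and x: "\<forall>n. \<bar>x n\<bar> \<le> K" "\<And>n. 0 \<le> x n"
  shows "positive_op (diag_op x e e)"
proof (rule positive_opI[OF diag_op_bounded_op[OF e e x(1)] diag_op_adjoint[OF e e x(1)]])
  fix v
  have "diag_op (\<lambda>n. - 1 * x n) e e v = - diag_op x e e v"
    using diag_op_scale[OF e e x(1), of "-1" v] by (simp add: scaleC.minus_left scaleC_one)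
  moreover have "Re (cinner (diag_op (\<lambda>n. - 1 * x n) e e v) v) \<le> 0 * (norm v)\<^sup>2"
    by (rule diag_op_quadratic_le[OF e, of _ K]) (use x in auto)
  ultimately show "0 \<le> Re (cinner (diag_op x e e v) v)" by (simp add: cinner.minus_left)
qed

lemma compact_finite_sum_discs:
  "compact {\<Sum>i<n. c i *\<^sub>C f i | c. \<forall>i<n. cmod (c i) \<le> K}" for f :: "nat \<Rightarrow> 'a::chilbert_space"
proof (induction n)
  case 0
  have "{\<Sum>i<0. c i *\<^sub>C f i | c. \<forall>i<0. cmod (c i) \<le> K} = {0}" by auto
  then show ?case by simp
next
  case (Suc n)
  let ?S = "{\<Sum>i<n. c i *\<^sub>C f i | c. \<forall>i<n. cmod (c i) \<le> K}" and ?T = "(\<lambda>a. a *\<^sub>C f n) ` cball 0 K"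
  have "compact ?T"
    by (intro compact_continuous_image scaleC.continuous_on continuous_intros compact_cball)
  then have "compact {x + y | x y. x \<in> ?S \<and> y \<in> ?T}" using Suc by (intro compact_sums)
  moreover have "{x + y | x y. x \<in> ?S \<and> y \<in> ?T} = {\<Sum>i<Suc n. c i *\<^sub>C f i | c. \<forall>i<Suc n. cmod (c i) \<le> K}"
  proof (intro equalityI subsetI)
    fix z assume "z \<in> {x + y | x y. x \<in> ?S \<and> y \<in> ?T}"
    then obtain c a where c: "\<forall>i<n. cmod (c i) \<le> K" "cmod a \<le> K" "z = (\<Sum>i<n. c i *\<^sub>C f i) + a *\<^sub>C f n" by auto
    have "z = (\<Sum>i<Suc n. (c(n := a)) i *\<^sub>C f i)" using c(3) by simp
    moreover have "\<forall>i<Suc n. cmod ((c(n := a)) i) \<le> K" using c by (auto simp: less_Suc_eq)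
    ultimately show "z \<in> {\<Sum>i<Suc n. c i *\<^sub>C f i | c. \<forall>i<Suc n. cmod (c i) \<le> K}" by blast
  next
    fix z assume "z \<in> {\<Sum>i<Suc n. c i *\<^sub>C f i | c. \<forall>i<Suc n. cmod (c i) \<le> K}"
    then obtain c where c: "\<forall>i<Suc n. cmod (c i) \<le> K" "z = (\<Sum>i<n. c i *\<^sub>C f i) + c n *\<^sub>C f n" by auto
    then show "z \<in> {x + y | x y. x \<in> ?S \<and> y \<in> ?T}" by fastforce
  qed
  ultimately show ?case by simp
qed

text \<open>On the unit ball the head of the series ranges in a compact set of finite sums, and the
  tail has norm at most \<open>r / 4\<close>; a finite \<open>r / 4\<close>-net for the head is thus
  an \<open>r / 2\<close>-net for the image.\<close>

lemma diag_op_compact: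
  assumes e: "orthonormal_or_zero e" and f: "orthonormal_or_zero f" and x: "x \<longlonglongrightarrow> 0"
  shows "compact_op (diag_op x e f)"
proof -
  obtain K where K: "\<forall>n. \<bar>x n\<bar> \<le> K" using convergent_imp_Bseq[OF convergentI[OF x]] by (auto simp: Bseq_def)
  have b: "bounded_op (diag_op x e f)" by (rule diag_op_bounded_op[OF e f K])
  let ?S = "diag_op x e f ` cball 0 1"
  have "\<exists>k. finite k \<and> closure ?S \<subseteq> (\<Union>z\<in>k. ball z r)" if r: "r > 0" for r
  proof -
    have r4: "r / 4 > 0" using r by simp
    then obtain n where n: "\<And>i. i \<ge> n \<Longrightarrow> \<bar>x i\<bar> < r / 4"
      using LIMSEQ_D[OF x r4] by auto
    let ?C = "{\<Sum>i<n. c i *\<^sub>C f i | c. \<forall>i<n. cmod (c i) \<le> K}"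
    have "\<exists>k. finite k \<and> ?C \<subseteq> (\<Union>z\<in>k. ball z (r / 4))"
      by (rule conjunct2[OF compact_finite_sum_discs[unfolded compact_eq_totally_bounded], rule_format, OF r4])
    then obtain k where k: "finite k" "?C \<subseteq> (\<Union>z\<in>k. ball z (r / 4))" by blast
    have "?S \<subseteq> (\<Union>z\<in>k. cball z (r / 2))"
    proof
      fix w assume "w \<in> ?S"
      then obtain v where v: "norm v \<le> 1" "w = diag_op x e f v" by auto
      define y where "y = (\<lambda>i. if i < n then x i else 0)"
      define z where "z = (\<lambda>i. if i < n then 0 else x i)"
      have y: "\<forall>i. \<bar>y i\<bar> \<le> K" and z: "\<forall>i. \<bar>z i\<bar> \<le> r / 4"
        using K K[rule_format, of 0] n r by (auto simp: y_def z_def intro: less_imp_le)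
      have "(\<lambda>i. y i + z i) = x" by (auto simp: y_def z_def)
      then have w: "w = diag_op y e f v + diag_op z e f v"
        unfolding v(2) using diag_op_add[OF e f y z, of v] by simp
      have "diag_op y e f v = (\<Sum>i<n. (complex_of_real (x i) * cinner v (e i)) *\<^sub>C f i)"
        unfolding diag_op_def by (subst suminf_finite[of "{..<n}"]) (auto simp: y_def)
      moreover have "cmod (complex_of_real (x i) * cinner v (e i)) \<le> K" for i
      proof -
        have "cmod (cinner v (e i)) \<le> 1 * 1"
          using cinner_Cauchy_Schwarz[of v "e i"] mult_mono[OF v(1) orthonormal_or_zeroD(3)[OF e, of i]] by simp
        then show ?thesis using mult_mono[OF K[rule_format, of i], of "cmod (cinner v (e i))" 1] K[rule_format, of i] by (simp add: norm_mult)
      qed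
      ultimately have "diag_op y e f v \<in> ?C"
        by (intro CollectI exI[of _ "\<lambda>i. complex_of_real (x i) * cinner v (e i)"]) simp
      then obtain p where p: "p \<in> k" "dist p (diag_op y e f v) < r / 4" using k(2) by auto
      have "norm (diag_op z e f v) \<le> r / 4 * 1"
        using order_trans[OF diag_op_bound[OF e f z, of v] mult_left_mono[OF v(1), of "r / 4"]] r by simp
      then have "dist (diag_op y e f v) w \<le> r / 4" by (simp add: w dist_norm)
      then have "dist p w \<le> r / 2" using dist_triangle[of p w "diag_op y e f v"] p(2) by simp
      then show "w \<in> (\<Union>z\<in>k. cball z (r / 2))" using p(1) by auto
    qed
    then have "closure ?S \<subseteq> (\<Union>z\<in>k. cball z (r / 2))" using k(1) by (intro closure_minimal closed_UN) auto
    also have "\<dots> \<subseteq> (\<Union>z\<in>k. ball z r)" using r by (intro UN_mono) (auto simp: cball_subset_ball_iff)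
    finally show ?thesis using k(1) by blast
  qed
  then have "compact (closure ?S)"
    unfolding compact_eq_totally_bounded by (auto simp: complete_eq_closed)
  then show ?thesis using b by (simp add: compact_op_def bounded_op_def)
qed

text \<open>Subtracting from \<open>v\<close> its projection \<open>p\<close> onto the closed span
  of the \<open>e n\<close> leaves a vector in the kernel of \<open>A\<close>.\<close>

lemma diagonalizes_diag_op:
  assumes A: "positive_op A" and d: "diagonalizes A e l"
  shows "A = diag_op l e e"
proof
  fix v
  have e: "orthonormal_or_zero e" and Ae: "\<And>n. A (e n) = complex_of_real (l n) *\<^sub>C e n"
    using d by (auto simp: diagonalizes_def)
  define p where "p = diag_op (\<lambda>_. 1) e e v"
  have ps: "(\<lambda>n. cinner v (e n) *\<^sub>C e n) sums p"
    using diag_op_sums[OF e e, of "\<lambda>_. 1" 1 v] by (simp add: p_def)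
  have "cinner (v - p) (e j) = 0" for j
    using diag_op_coeff[OF e e, of "\<lambda>_. 1" 1 v j] by (auto simp: p_def cinner.diff_left cinner.zero_right)
  then have "A (v - p) = 0" by (rule diagonalizes_kernel[OF A d])
  then have "A v = A p" by (simp add: bounded_op_simps[OF positive_op_bounded[OF A]])
  moreover have "(\<lambda>n. A (cinner v (e n) *\<^sub>C e n)) sums A p"
    by (rule bounded_linear.sums[OF bounded_op_bounded_linear[OF positive_op_bounded[OF A]] ps])
  then have "(\<lambda>n. (complex_of_real (l n) * cinner v (e n)) *\<^sub>C e n) sums A p"
    by (simp add: bounded_op_simps[OF positive_op_bounded[OF A]] Ae scaleC_scaleC mult.commute)
  ultimately show "A v = diag_op l e e v" unfolding diag_op_def using sums_unique by metis
qed

section \<open>Singular values of diagonal operators\<close>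

lemma bounded_adjoint_eqI:
  assumes "\<And>x y. cinner (A x) y = cinner x (B y)" shows "bounded_adjoint A = B"
proof
  fix y show "bounded_adjoint A y = B y"
    unfolding bounded_adjoint_def
  proof (rule the_equality)
    fix z assume "\<forall>x. cinner (A x) y = cinner x z"
    then show "z = B y" using assms by (intro cinner_all_eq_right) metis
  qed (use assms in blast)
qed

lemma abs_op_eqI:
  assumes "positive_op P" "P \<circ> P = bounded_adjoint A \<circ> A" shows "abs_op A = P"
  unfolding abs_op_def
proof (rule the_equality)
  fix S assume S: "positive_op S \<and> S \<circ> S = bounded_adjoint A \<circ> A"
  then show "S = P" using assms by (intro positive_sqrt_unique) (metis comp_apply)+
qed (use assms in blast)

lemma diagonalizes_quadratic_ge:
  assumes "orthonormal_or_zero e" "diagonalizes A e l" "positive_op A" "finite I" "\<And>i. i \<in> I \<Longrightarrow> e i \<noteq> 0"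
    "\<And>i. i \<in> I \<Longrightarrow> s \<le> l i"
  shows "s * (norm (\<Sum>i\<in>I. c i *\<^sub>C e i))\<^sup>2 \<le> Re (cinner (A (\<Sum>i\<in>I. c i *\<^sub>C e i)) (\<Sum>i\<in>I. c i *\<^sub>C e i))"
proof -
  define v where "v = (\<Sum>i\<in>I. c i *\<^sub>C e i)"
  have Ae: "A (e i) = complex_of_real (l i) *\<^sub>C e i" for i using assms(2) by (auto simp: diagonalizes_def)
  have co: "cinner v (e j) = (if j \<in> I \<and> e j \<noteq> 0 then c j else 0)" for j
    unfolding v_def using orthonormal_or_zeroD[OF assms(1)] by (intro orthonormal_sum_coeff[OF assms(4)]) auto
  have "cinner (A v) v = (\<Sum>i\<in>I. cnj (c i) * (complex_of_real (l i) * cinner v (e i)))"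
    by (subst (2) v_def)
      (simp add: cinner.sum_right cinner_scaleC_right positive_op_symmetric[OF assms(3)] Ae)
  also have "\<dots> = (\<Sum>i\<in>I. complex_of_real (l i * (cmod (c i))\<^sup>2))"
    unfolding co of_real_mult complex_norm_square using assms(5) by (intro sum.cong refl) simp
  finally have "Re (cinner (A v) v) = (\<Sum>i\<in>I. l i * (cmod (c i))\<^sup>2)"
    by (simp only: of_real_sum[symmetric] Re_complex_of_real)
  moreover have "s * (norm v)\<^sup>2 = (\<Sum>i\<in>I. s * (cmod (c i))\<^sup>2)"
    unfolding v_def using norm_sq_orthonormal_sum(2)[OF assms(1,4,5)] by (simp add: sum_distrib_left)
  moreover have "\<dots> \<le> (\<Sum>i\<in>I. l i * (cmod (c i))\<^sup>2)" using assms(6) by (intro sum_mono mult_right_mono) auto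
  ultimately show ?thesis unfolding v_def by simp
qed

text \<open>The weights are not sorted, so the eigenvalues may appear in another order. If
  \<open>l n\<close> exceeded \<open>C / (n + 1)\<close>, the form would exceed this value on the
  span of \<open>n + 1\<close> eigenvectors; but a nonzero vector of that span is orthogonal to
  \<open>e 0, ..., e (n - 1)\<close>, and there the form is at most
  \<open>C / (n + 1)\<close>.\<close>

lemma eigenvalue_le_diag_op_bound:
  assumes e: "orthonormal_or_zero e" and x: "\<And>n. 0 \<le> x n" "\<And>n. x n \<le> C / (real n + 1)" "0 \<le> C"
    and d: "diagonalizes (diag_op x e e) e' l"
  shows "l n \<le> C / (real n + 1)"
proof (rule ccontr)
  assume "\<not> ?thesis"
  then have ln: "C / (real n + 1) < l n" by simp
  have dec: "C / (real j + 1) \<le> C / (real i + 1)" if "i \<le> j" for i j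
    using that x(3) by (intro divide_left_mono) auto
  have xC: "\<forall>j. \<bar>x j\<bar> \<le> C"
  proof
    fix j show "\<bar>x j\<bar> \<le> C" using x(1,2)[of j] dec[of 0 j] by simp
  qed
  have pos: "positive_op (diag_op x e e)" by (rule diag_op_positive[OF e xC x(1)])
  have "0 \<le> C / (real n + 1)" using x(3) by simp
  then have ln0: "l n > 0" using ln by simp
  have li: "l n \<le> l i" if "i \<in> {..n}" for i using d that by (auto simp: diagonalizes_def antimono_def)
  have e'0: "e' i \<noteq> 0" if "i \<in> {..n}" for i using li[OF that] ln0 d by (force simp: diagonalizes_def)
  have e': "orthonormal_or_zero e'" using d by (simp add: diagonalizes_def)
  obtain c where c: "\<exists>i\<in>{..n}. c i \<noteq> 0" "\<And>j. j < n \<Longrightarrow> (\<Sum>i\<in>{..n}. c i * cinner (e' i) (e j)) = 0"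
    using homogeneous_system_nontrivial[of "{..<n}" "{..n}" "\<lambda>i j. cinner (e' i) (e j)"] by auto
  define v where "v = (\<Sum>i\<in>{..n}. c i *\<^sub>C e' i)"
  have "cinner v (e j) = 0" if "j < n" for j
    using c(2)[OF that] by (simp add: v_def cinner.sum_left cinner_scaleC_left)
  then have "Re (cinner (diag_op x e e v) v) \<le> C / (real n + 1) * (norm v)\<^sup>2"
  proof (intro diag_op_quadratic_le[OF e xC])
    fix j assume "cinner v (e j) \<noteq> 0"
    then have "n \<le> j" using \<open>\<And>j. j < n \<Longrightarrow> cinner v (e j) = 0\<close> by (meson not_le)
    then show "x j \<le> C / (real n + 1)" using x(2)[of j] dec order_trans by blast
  qed (use x(3) in simp)
  moreover have "l n * (norm v)\<^sup>2 \<le> Re (cinner (diag_op x e e v) v)"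
    unfolding v_def using e'0 li by (intro diagonalizes_quadratic_ge[OF e' d pos]) auto
  moreover have "(norm v)\<^sup>2 = (\<Sum>i\<in>{..n}. (cmod (c i))\<^sup>2)"
    unfolding v_def using e'0 by (intro norm_sq_orthonormal_sum(2)[OF e']) auto
  moreover obtain i where "i \<in> {..n}" "c i \<noteq> 0" using c(1) by blast
  then have "(\<Sum>i\<in>{..n}. (cmod (c i))\<^sup>2) > 0" by (intro sum_pos2[of _ i]) auto
  ultimately show False using ln mult_strict_right_mono[OF ln, of "(norm v)\<^sup>2"] by simp
qed

lemma inverse_bound_tendsto_0:
  assumes "\<And>n. \<bar>x n\<bar> \<le> C / (real n + 1)" shows "x \<longlonglongrightarrow> 0"
proof (rule Lim_null_comparison)
  show "\<forall>\<^sub>F n in sequentially. norm (x n) \<le> C / (real n + 1)" using assms by simp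
  show "(\<lambda>n. C / (real n + 1)) \<longlonglongrightarrow> 0" 
    using tendsto_mult[OF tendsto_const LIMSEQ_inverse_real_of_nat, of C] by (simp add: divide_inverse add.commute)
qed

lemma inverse_bound_const:
  assumes "\<And>n. \<bar>x n\<bar> \<le> C / (real n + 1)" shows "\<forall>n. \<bar>x n\<bar> \<le> C"
proof
  fix n
  have "0 \<le> C" using assms[of 0] by simp
  then have "C / (real n + 1) \<le> C / 1" by (intro divide_left_mono) auto
  then show "\<bar>x n\<bar> \<le> C" using assms[of n] by simp
qed

text \<open>The absolute value of \<open>diag_op x e f\<close> is the diagonal operator with weights
  \<open>|x n|\<close> in the system \<open>e\<close>, whose eigenvalues inherit the bound on the
  weights.\<close>

lemma diag_op_weak_trace_class:
  assumes e: "orthonormal_or_zero e" and f: "orthonormal_or_zero f"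
    and x: "\<And>n. \<bar>x n\<bar> \<le> C / (real n + 1)" and supp: "\<And>n. x n \<noteq> 0 \<Longrightarrow> e n \<noteq> 0 \<and> f n \<noteq> 0"
  shows "diag_op x e f \<in> \<L>\<^sub>1\<^sub>\<infinity>"
proof -
  have C: "0 \<le> C" using x[of 0] by simp
  note xC = inverse_bound_const[OF x]
  have lim: "x \<longlonglongrightarrow> 0" "(\<lambda>n. \<bar>x n\<bar>) \<longlonglongrightarrow> 0" using x by (auto intro!: inverse_bound_tendsto_0[where C = C])
  define P where "P = diag_op (\<lambda>n. \<bar>x n\<bar>) e e"
  have P: "positive_op P" unfolding P_def by (rule diag_op_positive[OF e, of _ C]) (use xC in auto)
  have adj: "bounded_adjoint (diag_op x e f) = diag_op x f e"
    by (rule bounded_adjoint_eqI) (rule diag_op_adjoint[OF e f xC])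
  have "P (P v) = diag_op x f e (diag_op x e f v)" for v
  proof -
    have "P (P v) = diag_op (\<lambda>n. \<bar>x n\<bar> * \<bar>x n\<bar>) e e v"
      unfolding P_def by (rule diag_op_compose[OF e e e, of _ C]) (use xC supp in auto)
    moreover have "diag_op x f e (diag_op x e f v) = diag_op (\<lambda>n. x n * x n) e e v"
      by (rule diag_op_compose[OF e f e xC]) (use supp in auto)
    ultimately show ?thesis by (simp add: abs_mult[symmetric])
  qed
  then have abs: "abs_op (diag_op x e f) = P"
    by (intro abs_op_eqI[OF P]) (auto simp: adj)
  have Pc: "compact_op P" unfolding P_def by (rule diag_op_compact[OF e e lim(2)])
  obtain e' l where d: "diagonalizes P e' l" using compact_positive_diagonalizable[OF P Pc] by blast
  have "singular_value (diag_op x e f) = l"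
    unfolding singular_value_def abs eigenvalue_seq_diagonalizes[OF P d] by simp
  moreover have "l n \<le> C / (real n + 1)" for n
    by (rule eigenvalue_le_diag_op_bound[OF e _ _ C d[unfolded P_def]]) (use x in auto)
  moreover have "C / (real n + 1) \<le> C * (1 / real n)" if "n \<ge> 1" for n
    using C that by (simp add: divide_left_mono)
  moreover have "0 \<le> l n" for n using d by (auto simp: diagonalizes_def)
  ultimately have "\<forall>\<^sub>F n in sequentially. norm (singular_value (diag_op x e f) n) \<le> C * norm (1 / real n)"
    by (intro eventually_sequentiallyI[of 1]) (use order_trans in \<open>fastforce simp del: times_divide_eq_right mult_1_right\<close>)
  then have "singular_value (diag_op x e f) \<in> O(\<lambda>j. 1 / real j)" by (rule bigoI)
  then show ?thesis using diag_op_compact[OF e f lim(1)] by (simp add: weak_trace_class_def)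
qed

section \<open>Traces\<close>

lemma trace_functionalD:
  assumes "trace_functional \<tau>"
  shows "S \<in> \<L>\<^sub>1\<^sub>\<infinity> \<Longrightarrow> T \<in> \<L>\<^sub>1\<^sub>\<infinity> \<Longrightarrow> \<tau> (\<lambda>x. S x + T x) = \<tau> S + \<tau> T"
    and "T \<in> \<L>\<^sub>1\<^sub>\<infinity> \<Longrightarrow> \<tau> (\<lambda>x. c *\<^sub>C T x) = c * \<tau> T"
    and "bounded_op B \<Longrightarrow> T \<in> \<L>\<^sub>1\<^sub>\<infinity> \<Longrightarrow> \<tau> (\<lambda>x. B (T x) - T (B x)) = 0"
  using assms unfolding trace_functional_def by simp_all

text \<open>With the partial isometry \<open>S\<close> sending \<open>f n\<close> to
  \<open>e n\<close> and the weighted operator \<open>T\<close> sending \<open>e n\<close> to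
  \<open>x n\<close> times \<open>f n\<close>, one has \<open>S T = diag_op x e e\<close> and
  \<open>T S = diag_op x f f\<close>, so the two operators differ by a commutator.\<close>

lemma trace_diag_op_transport:
  assumes \<tau>: "trace_functional \<tau>" and e: "orthonormal_or_zero e" and f: "orthonormal_or_zero f"
    and x: "\<And>n. \<bar>x n\<bar> \<le> C / (real n + 1)" and supp: "\<And>n. x n \<noteq> 0 \<Longrightarrow> e n \<noteq> 0 \<and> f n \<noteq> 0"
  shows "\<tau> (diag_op x e e) = \<tau> (diag_op x f f)"
proof -
  note xC = inverse_bound_const[OF x]
  define S where "S = diag_op (\<lambda>_. 1) f e"
  define T where "T = diag_op x e f"
  have one: "\<forall>n. \<bar>1::real\<bar> \<le> 1" by simp
  have S: "bounded_op S" unfolding S_def by (rule diag_op_bounded_op[OF f e one])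
  have T: "T \<in> \<L>\<^sub>1\<^sub>\<infinity>" unfolding T_def by (rule diag_op_weak_trace_class[OF e f x supp])
  have mem: "diag_op x e e \<in> \<L>\<^sub>1\<^sub>\<infinity>" "diag_op x f f \<in> \<L>\<^sub>1\<^sub>\<infinity>"
    using supp by (auto intro!: diag_op_weak_trace_class[OF _ _ x] e f)
  have neg: "(\<lambda>v. (-1) *\<^sub>C diag_op x f f v) = diag_op (\<lambda>n. - 1 * x n) f f"
    using diag_op_scale[OF f f xC, of "-1"] by auto
  have memn: "(\<lambda>v. (-1) *\<^sub>C diag_op x f f v) \<in> \<L>\<^sub>1\<^sub>\<infinity>"
    unfolding neg by (rule diag_op_weak_trace_class[OF f f, of _ C]) (use x supp in auto)
  have ST: "S (T v) = diag_op x e e v" for v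
    unfolding S_def T_def using diag_op_compose[OF e f e xC, of "\<lambda>_. 1"] supp by simp
  have TS: "T (S v) = diag_op x f f v" for v
    unfolding S_def T_def using diag_op_compose[OF f e f one, of x] supp by simp
  have "0 = \<tau> (\<lambda>v. S (T v) - T (S v))" using trace_functionalD(3)[OF \<tau> S T] by simp
  also have "(\<lambda>v. S (T v) - T (S v)) = (\<lambda>v. diag_op x e e v + (-1) *\<^sub>C diag_op x f f v)"
    by (simp add: ST TS scaleC.minus_left scaleC_one)
  also have "\<tau> \<dots> = \<tau> (diag_op x e e) + \<tau> (\<lambda>v. (-1) *\<^sub>C diag_op x f f v)"
    by (rule trace_functionalD(1)[OF \<tau> mem(1) memn])
  also have "\<tau> (\<lambda>v. (-1) *\<^sub>C diag_op x f f v) = - 1 * \<tau> (diag_op x f f)"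
    by (rule trace_functionalD(2)[OF \<tau> mem(2)])
  finally show ?thesis by simp
qed

section \<open>A positive trace as a functional on real sequences of order
  \<open>1/n\<close>\<close>

context
  fixes \<tau> :: "('a::chilbert_space \<Rightarrow> 'a) \<Rightarrow> complex" and f :: "nat \<Rightarrow> 'a"
  assumes \<tau>: "positive_trace \<tau>" and f: "orthonormal_or_zero f" and f0: "\<And>n. f n \<noteq> 0"
begin

lemma trace_diag_add:
  assumes x: "\<And>n. \<bar>x n\<bar> \<le> C / (real n + 1)" and y: "\<And>n. \<bar>y n\<bar> \<le> D / (real n + 1)"
  shows "\<tau> (diag_op (\<lambda>n. x n + y n) f f) = \<tau> (diag_op x f f) + \<tau> (diag_op y f f)"
proof -
  have "diag_op x f f \<in> \<L>\<^sub>1\<^sub>\<infinity>" "diag_op y f f \<in> \<L>\<^sub>1\<^sub>\<infinity>"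
    using f0 by (auto intro: diag_op_weak_trace_class[OF f f x] diag_op_weak_trace_class[OF f f y])
  moreover have "diag_op (\<lambda>n. x n + y n) f f = (\<lambda>v. diag_op x f f v + diag_op y f f v)"
    using diag_op_add[OF f f inverse_bound_const[OF x] inverse_bound_const[OF y]] by auto
  ultimately show ?thesis using \<tau> unfolding positive_trace_def trace_functional_def by simp
qed

lemma trace_diag_scale:
  assumes x: "\<And>n. \<bar>x n\<bar> \<le> C / (real n + 1)"
  shows "\<tau> (diag_op (\<lambda>n. r * x n) f f) = complex_of_real r * \<tau> (diag_op x f f)"
proof -
  have "diag_op x f f \<in> \<L>\<^sub>1\<^sub>\<infinity>" using f0 by (auto intro: diag_op_weak_trace_class[OF f f x])
  moreover have "diag_op (\<lambda>n. r * x n) f f = (\<lambda>v. complex_of_real r *\<^sub>C diag_op x f f v)"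
    using diag_op_scale[OF f f inverse_bound_const[OF x]] by auto
  ultimately show ?thesis using \<tau> unfolding positive_trace_def trace_functional_def by simp
qed

lemma trace_diag_nonneg:
  assumes x: "\<And>n. \<bar>x n\<bar> \<le> C / (real n + 1)" "\<And>n. 0 \<le> x n"
  shows "\<tau> (diag_op x f f) \<in> \<real>\<^sub>\<ge>\<^sub>0"
proof -
  have "diag_op x f f \<in> \<L>\<^sub>1\<^sub>\<infinity>" using f0 by (auto intro: diag_op_weak_trace_class[OF f f x(1)])
  moreover have "positive_op (diag_op x f f)" by (rule diag_op_positive[OF f inverse_bound_const[OF x(1)] x(2)])
  ultimately show ?thesis using \<tau> unfolding positive_trace_def by simp
qed

text \<open>With \<open>b\<^sub>n = 1/(n+1)\<close>, splitting \<open>f\<close> into two halves gives \<open>\<tau>(b\<^bsub>n div 2\<^esub>) = 2 \<tau>(b)\<close>. As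
  \<open>2b\<^sub>n - b\<^bsub>n div 2\<^esub> \<ge> 0\<close> is \<open>1\<close> at \<open>n = 0\<close>, the trace vanishes on rank one projections.\<close>

lemma trace_diag_first: "\<tau> (diag_op (\<lambda>n. if n = 0 then 1 else 0) f f) = 0"
proof -
  have tr: "trace_functional \<tau>" using \<tau> by (simp add: positive_trace_def)
  define b where "b n = 1 / (real n + 1)" for n
  have bb: "\<bar>b n\<bar> \<le> 1 / (real n + 1)" for n by (simp add: b_def)
  define c where "c n = b (n div 2)" for n
  have n2: "real n + 1 \<le> 2 * (real (n div 2) + 1)" for n
  proof -
    have "n + 1 \<le> 2 * (n div 2 + 1)" by presburger
    then have "real (n + 1) \<le> real (2 * (n div 2 + 1))" by (rule of_nat_mono)
    then show ?thesis by simp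
  qed
  have c2: "c n \<le> 2 * b n" for n using n2[of n] by (simp add: c_def b_def field_simps)
  have cc: "\<bar>c n\<bar> \<le> 2 / (real n + 1)" for n using c2[of n] by (simp add: c_def b_def)
  \<comment> \<open>Terms \<open>2 n\<close> and \<open>2 n + 1\<close> carry the same weight
    \<open>b n\<close>, so the series splits into copies of \<open>b\<close> along the even and the
    odd vectors.\<close>
  have half: "diag_op c f f v = diag_op b (\<lambda>n. f (2 * n)) (\<lambda>n. f (2 * n)) v
      + diag_op b (\<lambda>n. f (2 * n + 1)) (\<lambda>n. f (2 * n + 1)) v" for v
  proof -
    define g where "g n = (complex_of_real (c n) * cinner v (f n)) *\<^sub>C f n" for n
    have "g sums diag_op c f f v" unfolding g_def by (rule diag_op_sums[OF f f inverse_bound_const[OF cc]])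
    then have "(\<lambda>n. sum g {n * 2..<n * 2 + 2}) sums diag_op c f f v" by (rule sums_group) simp
    moreover have "sum g {n * 2..<n * 2 + 2} = g (2 * n) + g (2 * n + 1)" for n
    proof -
      have "{n * 2..<n * 2 + 2} = {2 * n, 2 * n + 1}" by auto
      then show ?thesis by simp
    qed
    ultimately have 1: "(\<lambda>n. g (2 * n) + g (2 * n + 1)) sums diag_op c f f v" by simp
    have "(\<lambda>n. g (2 * n)) sums diag_op b (\<lambda>n. f (2 * n)) (\<lambda>n. f (2 * n)) v"
      using diag_op_sums[OF orthonormal_or_zero_subfamily[OF f] orthonormal_or_zero_subfamily[OF f] inverse_bound_const[OF bb],
          of "\<lambda>n. 2 * n" "\<lambda>n. 2 * n" v] by (simp add: g_def c_def inj_def)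
    moreover have "(\<lambda>n. g (2 * n + 1)) sums diag_op b (\<lambda>n. f (2 * n + 1)) (\<lambda>n. f (2 * n + 1)) v"
      using diag_op_sums[OF orthonormal_or_zero_subfamily[OF f] orthonormal_or_zero_subfamily[OF f] inverse_bound_const[OF bb],
          of "\<lambda>n. 2 * n + 1" "\<lambda>n. 2 * n + 1" v] by (simp add: g_def c_def inj_def)
    ultimately show ?thesis using 1 sums_unique2 sums_add by blast
  qed
  have sub: "\<tau> (diag_op b (\<lambda>n. f (g n)) (\<lambda>n. f (g n))) = \<tau> (diag_op b f f)"
    "diag_op b (\<lambda>n. f (g n)) (\<lambda>n. f (g n)) \<in> \<L>\<^sub>1\<^sub>\<infinity>" if "inj g" for g :: "nat \<Rightarrow> nat"
    using f0 trace_diag_op_transport[OF tr orthonormal_or_zero_subfamily[OF f that] f bb]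
      diag_op_weak_trace_class[OF orthonormal_or_zero_subfamily[OF f that] orthonormal_or_zero_subfamily[OF f that] bb] by auto
  have "\<tau> (diag_op c f f) = \<tau> (diag_op b (\<lambda>n. f (2 * n)) (\<lambda>n. f (2 * n))) + \<tau> (diag_op b (\<lambda>n. f (2 * n + 1)) (\<lambda>n. f (2 * n + 1)))"
  proof -
    have "diag_op c f f = (\<lambda>v. diag_op b (\<lambda>n. f (2 * n)) (\<lambda>n. f (2 * n)) v
      + diag_op b (\<lambda>n. f (2 * n + 1)) (\<lambda>n. f (2 * n + 1)) v)" by (rule ext) (rule half)
    then show ?thesis using tr sub(2)[of "\<lambda>n. 2 * n"] sub(2)[of "\<lambda>n. 2 * n + 1"]
      unfolding trace_functional_def by (simp add: inj_def)
  qed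
  then have c2b: "\<tau> (diag_op c f f) = 2 * \<tau> (diag_op b f f)"
    using sub(1)[of "\<lambda>n. 2 * n"] sub(1)[of "\<lambda>n. 2 * n + 1"] by (simp add: inj_def)
  \<comment> \<open>The nonnegative rest in \<open>2 b = c + \<delta> + d\<close>. Both
    \<open>\<delta>\<close> and \<open>d\<close> have nonnegative trace, and the two traces add up
    to \<open>0\<close>.\<close>
  define d where "d n = 2 * b n - c n - (if n = 0 then 1 else 0)" for n
  define \<delta> where "\<delta> n = (if n = 0 then 1 else 0 :: real)" for n :: nat
  have d0: "0 \<le> d n" for n using c2[of n] by (simp add: d_def c_def b_def)
  have dd: "\<bar>d n\<bar> \<le> 2 / (real n + 1)" for n
  proof -
    have "0 \<le> c n" by (simp add: c_def b_def)
    then have "d n \<le> 2 * b n" by (cases "n = 0") (auto simp: d_def)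
    then show ?thesis using d0[of n] by (simp add: b_def)
  qed
  have \<delta>\<delta>: "\<bar>\<delta> n\<bar> \<le> 1 / (real n + 1)" for n by (simp add: \<delta>_def)
  have cd: "\<bar>c n + \<delta> n\<bar> \<le> 3 / (real n + 1)" for n
  proof -
    have "\<bar>c n + \<delta> n\<bar> \<le> \<bar>c n\<bar> + \<bar>\<delta> n\<bar>" by (rule abs_triangle_ineq)
    also have "\<dots> \<le> 2 / (real n + 1) + 1 / (real n + 1)" by (intro add_mono cc \<delta>\<delta>)
    also have "\<dots> = 3 / (real n + 1)" by (simp add: add_divide_distrib[symmetric])
    finally show ?thesis .
  qed
  have "(\<lambda>n. 2 * b n) = (\<lambda>n. (c n + \<delta> n) + d n)" by (simp add: d_def \<delta>_def)
  then have "2 * \<tau> (diag_op b f f) = \<tau> (diag_op (\<lambda>n. (c n + \<delta> n) + d n) f f)"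
    using trace_diag_scale[OF bb, of 2] by simp
  also have "\<dots> = \<tau> (diag_op c f f) + \<tau> (diag_op \<delta> f f) + \<tau> (diag_op d f f)"
    by (simp add: trace_diag_add[OF cd dd] trace_diag_add[OF cc \<delta>\<delta>])
  finally have "\<tau> (diag_op \<delta> f f) + \<tau> (diag_op d f f) = 0" using c2b by simp
  moreover have "\<tau> (diag_op \<delta> f f) \<in> \<real>\<^sub>\<ge>\<^sub>0" by (rule trace_diag_nonneg[OF \<delta>\<delta>]) (simp add: \<delta>_def)
  moreover have "\<tau> (diag_op d f f) \<in> \<real>\<^sub>\<ge>\<^sub>0" by (rule trace_diag_nonneg[OF dd d0])
  ultimately have "\<tau> (diag_op \<delta> f f) = 0" by (auto simp: complex_nonneg_Reals_iff complex_eq_iff)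
  then show ?thesis by (simp add: \<delta>_def[abs_def])
qed

text \<open>In the system \<open>e\<close>, which is \<open>f\<close> with the indices
  \<open>0\<close> and \<open>j\<close> exchanged, the projection sits at index \<open>0\<close>;
  transport back to \<open>f\<close> reduces to the first vector.\<close>

lemma trace_diag_single: "\<tau> (diag_op (\<lambda>n. if n = j then 1 else 0) f f) = 0"
proof -
  define e where "e n = f (if n = 0 then j else if n = j then 0 else n)" for n
  have e: "orthonormal_or_zero e"
    unfolding e_def by (rule orthonormal_or_zero_subfamily[OF f]) (auto simp: inj_def split: if_splits)
  have tr: "trace_functional \<tau>" using \<tau> by (simp add: positive_trace_def)
  have "diag_op (\<lambda>n. if n = j then 1 else 0) f f = diag_op (\<lambda>n. if n = 0 then 1 else 0) e e"
    by (rule ext) (simp add: diag_op_single e_def)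
  then have "\<tau> (diag_op (\<lambda>n. if n = j then 1 else 0) f f) = \<tau> (diag_op (\<lambda>n. if n = 0 then 1 else 0) e e)"
    by simp
  also have "\<dots> = \<tau> (diag_op (\<lambda>n. if n = 0 then 1 else 0) f f)"
    by (rule trace_diag_op_transport[OF tr e f, where C = 1]) (auto simp: e_def f0)
  finally show ?thesis by (simp add: trace_diag_first)
qed

lemma trace_diag_finite: "\<tau> (diag_op (\<lambda>n. if n < N then r else 0) f f) = 0"
proof (induction N)
  case 0
  have "\<tau> (diag_op (\<lambda>n. 0 * 0) f f) = 0"
    using trace_diag_scale[of "\<lambda>_. 0" 0 0] by simp
  then show ?case by simp
next
  case (Suc N)
  have b1: "\<bar>if n < N then r else 0\<bar> \<le> (\<bar>r\<bar> * (real N + 1)) / (real n + 1)" for n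
  proof (cases "n < N")
    case True
    then have "\<bar>r\<bar> * (real n + 1) \<le> \<bar>r\<bar> * (real N + 1)" by (intro mult_left_mono) auto
    then show ?thesis using True by (simp add: pos_le_divide_eq)
  qed simp
  have b2: "\<bar>if n = N then 1 else 0\<bar> \<le> (real N + 1) / (real n + 1)" for n by simp
  have b3: "\<bar>r * (if n = N then 1 else 0)\<bar> \<le> (\<bar>r\<bar> * (real N + 1)) / (real n + 1)" for n by simp
  have "(\<lambda>n. if n < Suc N then r else 0) = (\<lambda>n. (if n < N then r else 0) + r * (if n = N then 1 else 0))" by auto
  then show ?case
    using Suc trace_diag_add[OF b1 b3] trace_diag_scale[OF b2, of r] trace_diag_single[of N] by simp
qed

text \<open>Finitely many violations of \<open>x n \<le> y n\<close> are repaired by adding to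
  \<open>y\<close> a finitely supported sequence, on which the trace vanishes.\<close>

lemma trace_diag_Re_mono:
  assumes x: "\<And>n. \<bar>x n\<bar> \<le> C / (real n + 1)" and y: "\<And>n. \<bar>y n\<bar> \<le> D / (real n + 1)"
    and le: "\<And>n. n \<ge> N \<Longrightarrow> x n \<le> y n"
  shows "Re (\<tau> (diag_op x f f)) \<le> Re (\<tau> (diag_op y f f))"
proof -
  \<comment> \<open>On all indices \<open>|x n| \<le> C\<close> and \<open>|y n| \<le> D\<close>, so
    \<open>y n + r - x n\<close> is nonnegative.\<close>
  define r where "r = C + D"
  have C: "0 \<le> C" "0 \<le> D" using x[of 0] y[of 0] by auto
  define z where "z n = (if n < N then r else 0)" for n
  have zb: "\<bar>z n\<bar> \<le> (r * (real N + 1)) / (real n + 1)" for n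
  proof (cases "n < N")
    case True
    then have "r * (real n + 1) \<le> r * (real N + 1)" using C by (intro mult_left_mono) (auto simp: r_def)
    then show ?thesis using True C by (simp add: pos_le_divide_eq z_def r_def)
  qed (use C in \<open>simp add: z_def r_def\<close>)
  define w where "w n = y n + z n - x n" for n
  have yz: "\<bar>y n + z n\<bar> \<le> (D + r * (real N + 1)) / (real n + 1)" for n
    using abs_triangle_ineq[of "y n" "z n"] y[of n] zb[of n] unfolding add_divide_distrib by linarith
  have wb: "\<bar>w n\<bar> \<le> (D + r * (real N + 1) + C) / (real n + 1)" for n
    using abs_triangle_ineq4[of "y n + z n" "x n"] yz[of n] x[of n] unfolding add_divide_distrib[of _ C] w_def by linarith
  have w0: "0 \<le> w n" for n
  proof (cases "n < N")
    case True
    then show ?thesis using inverse_bound_const[OF x, rule_format, of n] inverse_bound_const[OF y, rule_format, of n]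
      by (simp add: w_def z_def r_def)
  qed (use le in \<open>simp add: w_def z_def\<close>)
  have "(\<lambda>n. y n + z n) = (\<lambda>n. x n + w n)" by (simp add: w_def)
  then have "\<tau> (diag_op y f f) + \<tau> (diag_op z f f) = \<tau> (diag_op x f f) + \<tau> (diag_op w f f)"
    using trace_diag_add[OF y zb] trace_diag_add[OF x wb] by simp
  moreover have "\<tau> (diag_op z f f) = 0" unfolding z_def by (rule trace_diag_finite)
  moreover have "0 \<le> Re (\<tau> (diag_op w f f))"
    using trace_diag_nonneg[OF wb w0] by (simp add: complex_nonneg_Reals_iff)
  ultimately show ?thesis by (metis add.right_neutral le_add_same_cancel1 plus_complex.sel(1))
qed

end

text \<open>Passing from the weight \<open>j\<close> to \<open>j + 1\<close> adds
  \<open>l j\<close>, which tends to \<open>0\<close>; the shifted weight matches the normalizing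
  sequence \<open>1 / (n + 1)\<close> and gives information at index \<open>0\<close> too.\<close>

lemma inverse_bound_of_convergent:
  assumes "(\<lambda>j. real j * l j) \<longlonglongrightarrow> c" "l \<longlonglongrightarrow> 0"
  shows "(\<lambda>j. (real j + 1) * l j) \<longlonglongrightarrow> c" "\<exists>C. \<forall>j. \<bar>l j\<bar> \<le> C / (real j + 1)"
proof -
  show *: "(\<lambda>j. (real j + 1) * l j) \<longlonglongrightarrow> c"
    using tendsto_add[OF assms] by (simp add: distrib_right)
  obtain C where "\<And>j. norm ((real j + 1) * l j) \<le> C"
    using convergent_imp_Bseq[OF convergentI[OF *]] by (auto simp: Bseq_def)
  then have "\<bar>l j\<bar> \<le> C / (real j + 1)" for j
    by (simp add: pos_le_divide_eq abs_mult mult.commute)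
  then show "\<exists>C. \<forall>j. \<bar>l j\<bar> \<le> C / (real j + 1)" by blast
qed

theorem trace_of_Weyl_operator:
  assumes \<tau>: "positive_trace \<tau>" "normalized_trace \<tau>"
    and A: "positive_op A" and d: "diagonalizes A e l" and lim: "(\<lambda>j. real j * l j) \<longlonglongrightarrow> c"
  shows "\<tau> A = complex_of_real c"
proof -
  have tr: "trace_functional \<tau>" using \<tau> by (simp add: positive_trace_def)
  obtain T0 where T0: "T0 \<in> \<L>\<^sub>1\<^sub>\<infinity>" "positive_op T0"
    "eigenvalue_sequence T0 (\<lambda>j. complex_of_real (1 / real (j + 1)))" "\<tau> T0 = 1"
    using \<tau>(2) unfolding normalized_trace_def by blast
  obtain f b where db: "diagonalizes T0 f b"
    using compact_positive_diagonalizable[OF T0(2)] T0(1) by (auto simp: weak_trace_class_def)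
  have b: "b n = 1 / (real n + 1)" for n
    using fun_cong[OF eigenvalue_sequence_unique[OF T0(2) db T0(3)], of n]
    by (simp only: of_real_eq_iff) (simp add: add.commute)
  have f: "orthonormal_or_zero f" using db by (simp add: diagonalizes_def)
  \<comment> \<open>The eigenvalues of \<open>T0\<close> never vanish, so \<open>f\<close> is a
    genuine orthonormal sequence, onto which \<open>A\<close> can be transported even if its own
    system contains zeros.\<close>
  have f0: "f n \<noteq> 0" for n
  proof
    assume "f n = 0"
    then have "b n = 0" using db by (simp add: diagonalizes_def)
    then show False by (simp add: b)
  qed
  have e: "orthonormal_or_zero e" and el: "\<And>n. e n = 0 \<Longrightarrow> l n = 0" and l0: "\<And>n. 0 \<le> l n" and ll: "l \<longlonglongrightarrow> 0"
    using d by (auto simp: diagonalizes_def)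
  obtain C where C: "\<And>j. \<bar>l j\<bar> \<le> C / (real j + 1)" using inverse_bound_of_convergent(2)[OF lim ll] by blast
  have bb: "\<bar>b n\<bar> \<le> 1 / (real n + 1)" for n by (simp add: b)
  have T0b: "\<tau> (diag_op b f f) = 1" using T0(4) diagonalizes_diag_op[OF T0(2) db] by simp
  have Al: "\<tau> A = \<tau> (diag_op l f f)"
    using trace_diag_op_transport[OF tr e f C] el f0 diagonalizes_diag_op[OF A d] by metis
  note ctx = \<tau>(1) f f0
  have "\<tau> (diag_op l f f) \<in> \<real>\<^sub>\<ge>\<^sub>0" by (rule trace_diag_nonneg[OF ctx C l0])
  then have im: "Im (\<tau> (diag_op l f f)) = 0" by (simp add: complex_nonneg_Reals_iff)
  have sc: "Re (\<tau> (diag_op (\<lambda>n. r * b n) f f)) = r" for r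
    using trace_diag_scale[OF ctx bb, of r] T0b by simp
  have scb: "\<bar>r * b n\<bar> \<le> \<bar>r\<bar> / (real n + 1)" for r n by (simp add: b abs_mult)
  have near: "\<exists>N. \<forall>n\<ge>N. \<bar>(real n + 1) * l n - c\<bar> < \<epsilon>" if "\<epsilon> > 0" for \<epsilon>
    using inverse_bound_of_convergent(1)[OF lim ll] that unfolding LIMSEQ_def dist_real_def by blast
  have "\<bar>Re (\<tau> (diag_op l f f)) - c\<bar> \<le> \<epsilon>" if \<epsilon>: "\<epsilon> > 0" for \<epsilon>
  proof -
    obtain N where N: "\<And>n. n \<ge> N \<Longrightarrow> \<bar>(real n + 1) * l n - c\<bar> < \<epsilon>" using near[OF \<epsilon>] by blast
    have up: "l n \<le> (c + \<epsilon>) * b n" if "n \<ge> N" for n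
    proof -
      have "(real n + 1) * l n \<le> c + \<epsilon>" using N[OF that] by linarith
      then show ?thesis by (simp add: b pos_le_divide_eq mult.commute)
    qed
    have lo: "(c - \<epsilon>) * b n \<le> l n" if "n \<ge> N" for n
    proof -
      have "(real n + 1) * l n \<ge> c - \<epsilon>" using N[OF that] by linarith
      then show ?thesis by (simp add: b pos_divide_le_eq mult.commute)
    qed
    show ?thesis
      using trace_diag_Re_mono[OF ctx C scb up] trace_diag_Re_mono[OF ctx scb C lo] sc by force
  qed
  then have "\<bar>Re (\<tau> (diag_op l f f)) - c\<bar> \<le> 0" by (rule field_le_epsilon) simp
  then show ?thesis using im Al by (simp add: complex_eq_iff)
qed

subsection \<open>Extended limits\<close>

text \<open>An extended limit is a cluster point of the evaluations \<open>a \<mapsto> a\<^sub>n\<close> in a product of discs,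
  which is compact by Tychonoff's theorem.\<close>

theorem extended_limit_exists: "\<exists>\<omega>. extended_limit \<omega>"
proof -
  \<comment> \<open>The radius of the disc of a bounded sequence is some bound of it; unbounded
    sequences get the radius \<open>0\<close>, so that every factor of the product is
    compact.\<close>
  define r where "r a = (if Bseq a then SOME K. \<forall>n. cmod (a n) \<le> K else 0)" for a :: "nat \<Rightarrow> complex"
  have r: "cmod (a n) \<le> r a" if "Bseq a" for a n
  proof -
    have "\<exists>K. \<forall>n. cmod (a n) \<le> K" using that by (auto simp: Bseq_def)
    then have "\<forall>n. cmod (a n) \<le> (SOME K. \<forall>n. cmod (a n) \<le> K)" by (rule someI_ex)
    then show ?thesis using that by (simp add: r_def)
  qed
  define ev where "ev n a = (if Bseq a then a n else 0)" for n and a :: "nat \<Rightarrow> complex"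
  let ?P = "PiE UNIV (\<lambda>a. cball 0 (r a)) :: ((nat \<Rightarrow> complex) \<Rightarrow> complex) set"
  have "compactin (product_topology (\<lambda>_. euclidean) UNIV) ?P"
    by (subst compactin_PiE) auto
  then have cpt: "compact ?P" by (simp add: euclidean_product_topology)
  have evP: "ev n \<in> ?P" for n using r by (auto simp: ev_def r_def)
  define F where "F = filtermap ev sequentially"
  have "F \<noteq> bot" by (simp add: F_def filtermap_bot_iff)
  moreover have "eventually (\<lambda>\<omega>. \<omega> \<in> ?P) F" using evP by (simp add: F_def eventually_filtermap)
  ultimately obtain \<omega> where \<omega>: "inf (nhds \<omega>) F \<noteq> bot"
    using cpt unfolding compact_filter by blast
  \<comment> \<open>Closed conditions that hold along the evaluations eventually pass to
    \<open>\<omega>\<close>. Each axiom involves finitely many coordinates and is closed; vanishing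
    on null sequences follows from the closed conditions
    \<open>|\<omega> a| \<le> \<epsilon>\<close>.\<close>
  have cluster: "\<omega> \<in> S" if "closed S" "\<forall>\<^sub>F n in sequentially. ev n \<in> S" for S
  proof (rule ccontr)
    assume "\<omega> \<notin> S"
    then have "eventually (\<lambda>x. x \<in> - S) (nhds \<omega>)" using that(1) by (intro eventually_nhds_in_open) auto
    moreover have "eventually (\<lambda>x. x \<in> S) F" using that(2) by (simp add: F_def eventually_filtermap)
    ultimately have "eventually (\<lambda>x. False) (inf (nhds \<omega>) F)"
      unfolding eventually_inf by (intro exI conjI) auto
    then show False using \<omega> by (simp add: trivial_limit_def[symmetric] eventually_False)
  qed
  have cont: "continuous_on UNIV (\<lambda>\<omega>::(nat \<Rightarrow> complex) \<Rightarrow> complex. \<omega> a)" for a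
    by (rule continuous_on_product_coordinates)
  have "extended_limit \<omega>"
    unfolding extended_limit_def
  proof (intro conjI allI impI)
    fix a b :: "nat \<Rightarrow> complex" assume ab: "Bseq a \<and> Bseq b"
    then obtain K L where KL: "\<And>n. norm (a n) \<le> K" "\<And>n. norm (b n) \<le> L" unfolding Bseq_def by blast
    have "norm (a n + b n) \<le> K + L" for n by (intro norm_triangle_mono KL)
    then have "Bseq (\<lambda>n. a n + b n)" by (rule BseqI')
    then have "\<omega> \<in> {\<omega>. \<omega> (\<lambda>n. a n + b n) = \<omega> a + \<omega> b}"
      using ab by (intro cluster closed_Collect_eq continuous_intros cont) (auto simp: ev_def)
    then show "\<omega> (\<lambda>n. a n + b n) = \<omega> a + \<omega> b" by simp
  next
    fix c and a :: "nat \<Rightarrow> complex" assume a: "Bseq a"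
    then have "Bseq (\<lambda>n. c * a n)" by (intro Bseq_mult) (auto intro: BseqI')
    then have "\<omega> \<in> {\<omega>. \<omega> (\<lambda>n. c * a n) = c * \<omega> a}"
      using a by (intro cluster closed_Collect_eq continuous_intros cont) (auto simp: ev_def)
    then show "\<omega> (\<lambda>n. c * a n) = c * \<omega> a" by simp
  next
    fix a :: "nat \<Rightarrow> complex" assume a: "Bseq a \<and> (\<forall>n. a n \<in> \<real>\<^sub>\<ge>\<^sub>0)"
    then have "\<omega> \<in> {\<omega>. Im (\<omega> a) = 0} \<inter> {\<omega>. 0 \<le> Re (\<omega> a)}"
      by (intro cluster closed_Int closed_Collect_eq closed_Collect_le continuous_intros cont)
        (auto simp: ev_def complex_nonneg_Reals_iff)
    then show "\<omega> a \<in> \<real>\<^sub>\<ge>\<^sub>0" by (simp add: complex_nonneg_Reals_iff)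
  next
    have "\<omega> \<in> {\<omega>. \<omega> (\<lambda>n. 1) = 1}"
      by (intro cluster closed_Collect_eq continuous_intros cont) (auto simp: ev_def)
    then show "\<omega> (\<lambda>n. 1) = 1" by simp
  next
    fix a :: "nat \<Rightarrow> complex" assume a: "a \<longlonglongrightarrow> 0"
    then have B: "Bseq a" using convergent_imp_Bseq convergentI by blast
    have "cmod (\<omega> a) \<le> \<epsilon>" if "\<epsilon> > 0" for \<epsilon>
    proof -
      have "\<forall>\<^sub>F n in sequentially. cmod (a n) < \<epsilon>" using a that by (auto simp: tendsto_iff)
      then have "\<forall>\<^sub>F n in sequentially. ev n \<in> {\<omega>. cmod (\<omega> a) \<le> \<epsilon>}"
        by eventually_elim (use B in \<open>simp add: ev_def\<close>)
      then have "\<omega> \<in> {\<omega>. cmod (\<omega> a) \<le> \<epsilon>}"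
        by (intro cluster closed_Collect_le continuous_intros cont)
      then show ?thesis by simp
    qed
    then have "cmod (\<omega> a) \<le> 0" by (rule field_le_epsilon) simp
    then show "\<omega> a = 0" by simp
  qed
  then show ?thesis by blast
qed

lemma extended_limit_convergent:
  assumes \<omega>: "extended_limit \<omega>" and a: "a \<longlonglongrightarrow> c"
  shows "\<omega> a = c"
proof -
  have 0: "(\<lambda>n. a n - c) \<longlonglongrightarrow> 0" using a by (simp add: LIM_zero)
  have one: "\<omega> (\<lambda>n. c * 1) = c * \<omega> (\<lambda>n. 1)"
    using \<omega> unfolding extended_limit_def by (elim conjE) (blast intro: convergent_imp_Bseq convergent_const)
  have "\<omega> (\<lambda>n. (a n - c) + c) = \<omega> (\<lambda>n. a n - c) + \<omega> (\<lambda>n. c)"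
    using \<omega> convergent_imp_Bseq[OF convergentI[OF 0]] convergent_imp_Bseq[OF convergent_const[of c]]
    unfolding extended_limit_def by blast
  moreover have "\<omega> (\<lambda>n. a n - c) = 0" using \<omega> 0 unfolding extended_limit_def by blast
  moreover have "\<omega> (\<lambda>n. 1) = 1" using \<omega> unfolding extended_limit_def by blast
  ultimately show ?thesis using one by simp
qed

section \<open>Logarithmic means\<close>

lemma harm_ln_ratio: "(\<lambda>n. harm (Suc n) / ln (real (Suc n)) :: real) \<longlonglongrightarrow> 1"
proof -
  have lnT: "filterlim (\<lambda>n. ln (real (Suc n))) at_top sequentially"
    by (intro filterlim_compose[OF ln_at_top] filterlim_compose[OF filterlim_real_sequentially filterlim_Suc])
  have "(\<lambda>n. (harm (Suc n) - ln (real (Suc n))) / ln (real (Suc n)) :: real) \<longlonglongrightarrow> 0"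
    by (rule tendsto_divide_0[OF LIMSEQ_Suc[OF euler_mascheroni_LIMSEQ] filterlim_at_top_imp_at_infinity[OF lnT]])
  then have h: "(\<lambda>n. (harm (Suc n) - ln (real (Suc n))) / ln (real (Suc n)) + 1 :: real) \<longlonglongrightarrow> 0 + 1"
    by (intro tendsto_intros)
  have ev: "\<forall>\<^sub>F n in sequentially. (harm (Suc n) - ln (real (Suc n))) / ln (real (Suc n)) + 1
      = harm (Suc n) / (ln (real (Suc n)) :: real)"
    by (intro eventually_sequentiallyI[of 1]) (simp add: field_simps)
  show ?thesis using Lim_transform_eventually[OF h ev] by simp
qed

text \<open>After subtracting \<open>c / (j + 1)\<close>, whose sums are harmonic numbers, the rest
  \<open>m j\<close> is \<open>o(1/j)\<close>: its head is a constant, and its tail is a small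
  multiple of a harmonic number.\<close>

lemma log_mean_convergent:
  fixes l :: "nat \<Rightarrow> real"
  assumes "(\<lambda>j. (real j + 1) * l j) \<longlonglongrightarrow> c"
  shows "(\<lambda>n. (\<Sum>j<Suc n. l j) / ln (real (Suc n))) \<longlonglongrightarrow> c"
proof -
  define m where "m j = l j - c / (real j + 1)" for j
  have mlim: "(\<lambda>j. (real j + 1) * m j) \<longlonglongrightarrow> 0"
  proof -
    have "(real j + 1) * m j = (real j + 1) * l j - c" for j by (simp add: m_def right_diff_distrib)
    then show ?thesis using assms by (simp add: LIM_zero)
  qed
  have H: "harm (Suc n) = (\<Sum>j<Suc n. 1 / (real j + 1))" for n
    unfolding harm_def by (rule sum.reindex_bij_witness[of _ Suc "\<lambda>i. i - 1"]) (auto simp: inverse_eq_divide)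
  have lnT: "filterlim (\<lambda>n. ln (real (Suc n))) at_top sequentially"
    by (intro filterlim_compose[OF ln_at_top] filterlim_compose[OF filterlim_real_sequentially filterlim_Suc])
  have "(\<lambda>n. (\<Sum>j<Suc n. m j) / ln (real (Suc n))) \<longlonglongrightarrow> 0"
  proof (rule LIMSEQ_I)
    fix \<epsilon> :: real assume \<epsilon>: "\<epsilon> > 0"
    then have "\<epsilon> / 4 > 0" by simp
    then obtain N where N: "\<And>j. j \<ge> N \<Longrightarrow> \<bar>(real j + 1) * m j\<bar> < \<epsilon> / 4"
      using LIMSEQ_D[OF mlim, of "\<epsilon> / 4"] by auto
    define K where "K = (\<Sum>j<N. \<bar>m j\<bar>)"
    have sum_le: "\<bar>\<Sum>j<Suc n. m j\<bar> \<le> K + \<epsilon> / 4 * harm (Suc n)" for n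
    proof -
      have "\<bar>m j\<bar> \<le> (if j < N then \<bar>m j\<bar> else 0) + \<epsilon> / 4 * (1 / (real j + 1))" for j
      proof (cases "j < N")
        case False
        then have "(real j + 1) * \<bar>m j\<bar> \<le> \<epsilon> / 4" using N[of j] by (simp add: abs_mult)
        then have "\<bar>m j\<bar> \<le> \<epsilon> / 4 / (real j + 1)" by (simp only: pos_le_divide_eq mult.commute)
        then show ?thesis using False by simp
      qed (use \<epsilon> in simp)
      then have "(\<Sum>j<Suc n. \<bar>m j\<bar>) \<le> (\<Sum>j<Suc n. (if j < N then \<bar>m j\<bar> else 0) + \<epsilon> / 4 * (1 / (real j + 1)))"
        by (intro sum_mono)
      also have "\<dots> = (\<Sum>j<Suc n. if j < N then \<bar>m j\<bar> else 0) + \<epsilon> / 4 * harm (Suc n)"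
        unfolding H sum.distrib sum_distrib_left ..
      also have "(\<Sum>j<Suc n. if j < N then \<bar>m j\<bar> else 0) = (\<Sum>j\<in>{..<Suc n} \<inter> {..<N}. \<bar>m j\<bar>)"
        by (subst sum.inter_restrict) (auto intro!: sum.cong)
      also have "\<dots> \<le> K" unfolding K_def by (intro sum_mono2) auto
      finally show ?thesis using sum_abs[of m "{..<Suc n}"] by linarith
    qed
    \<comment> \<open>Relative to the logarithm, this bounds the tail by
      \<open>\<epsilon> / 2\<close>, while \<open>ln > 4 K / \<epsilon>\<close> bounds the head by
      \<open>\<epsilon> / 4\<close>.\<close>
    have "\<forall>\<^sub>F n in sequentially. harm (Suc n) / ln (real (Suc n)) < (2::real)"
      using harm_ln_ratio by (rule order_tendstoD) simp
    moreover have "\<forall>\<^sub>F n in sequentially. ln (real (Suc n)) > max 1 (4 * K / \<epsilon>)"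
      using lnT unfolding filterlim_at_top_dense by blast
    ultimately have "\<forall>\<^sub>F n in sequentially. norm ((\<Sum>j<Suc n. m j) / ln (real (Suc n)) - 0) < \<epsilon>"
    proof eventually_elim
      case (elim n)
      define L where "L = ln (real (Suc n))"
      have L: "L > 1" "4 * K / \<epsilon> < L" using elim(2) by (auto simp: L_def)
      have "harm (Suc n) < 2 * L" using elim(1) L unfolding L_def[symmetric] by (simp add: pos_divide_less_eq)
      then have "\<epsilon> / 4 * harm (Suc n) \<le> \<epsilon> / 4 * (2 * L)" using \<epsilon> by (intro mult_left_mono) auto
      moreover have "4 * K < L * \<epsilon>" using L(2) \<epsilon> by (simp add: pos_divide_less_eq)
      ultimately have "\<bar>\<Sum>j<Suc n. m j\<bar> < \<epsilon> * L" using sum_le[of n] by (simp add: mult.commute)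
      then show ?case using L(1) unfolding L_def[symmetric] by (simp add: pos_divide_less_eq)
    qed
    then show "\<exists>no. \<forall>n\<ge>no. norm ((\<Sum>j<Suc n. m j) / ln (real (Suc n)) - 0) < \<epsilon>"
      by (simp only: eventually_sequentially)
  qed
  moreover have "(\<lambda>n. c * (harm (Suc n) / ln (real (Suc n)))) \<longlonglongrightarrow> c * 1" by (intro tendsto_intros harm_ln_ratio)
  ultimately have "(\<lambda>n. (\<Sum>j<Suc n. m j) / ln (real (Suc n)) + c * (harm (Suc n) / ln (real (Suc n)))) \<longlonglongrightarrow> 0 + c * 1"
    by (rule tendsto_add)
  moreover have "(\<Sum>j<Suc n. m j) / ln (real (Suc n)) + c * (harm (Suc n) / ln (real (Suc n))) = (\<Sum>j<Suc n. l j) / ln (real (Suc n))" for n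
  proof -
    have "(\<Sum>j<Suc n. m j) + c * harm (Suc n) = (\<Sum>j<Suc n. l j)"
      unfolding H sum_distrib_left sum.distrib[symmetric] m_def by (intro sum.cong) auto
    then show ?thesis by (simp only: times_divide_eq_right add_divide_distrib[symmetric])
  qed
  ultimately show ?thesis by simp
qed

lemma dixmier_trace_of_Weyl_operator:
  assumes \<omega>: "extended_limit \<omega>"
    and A: "positive_op A" and d: "diagonalizes A e l" and lim: "(\<lambda>j. real j * l j) \<longlonglongrightarrow> c"
  shows "dixmier_trace \<omega> A = complex_of_real c"
proof -
  have "l \<longlonglongrightarrow> 0" using d by (simp add: diagonalizes_def)
  note lim' = log_mean_convergent[OF inverse_bound_of_convergent(1)[OF lim this]]
  have "(\<lambda>n. complex_of_real ((\<Sum>j<Suc n. l j) / ln (real (Suc n)))) \<longlonglongrightarrow> complex_of_real c"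
    by (intro tendsto_of_real lim')
  then have "(\<lambda>n. (\<Sum>j<Suc n. eigenvalue_seq A j) / complex_of_real (ln (real (Suc n)))) \<longlonglongrightarrow> complex_of_real c"
    unfolding eigenvalue_seq_diagonalizes[OF A d] by (simp only: of_real_divide of_real_sum)
  then show ?thesis unfolding dixmier_trace_def by (rule extended_limit_convergent[OF \<omega>])
qed

section \<open>Unbounded selfadjoint operators\<close>

lemma cinner_eq_dense_right:
  assumes "closure D = UNIV" and "\<And>z. z \<in> D \<Longrightarrow> cinner z x = cinner z y"
  shows "x = y"
  by (rule cinner_eq_dense[OF assms(1)]) (metis assms(2) cinner_commute)

lemma adjoint_op_eq_Some_iff:
  assumes "closure (dom T) = UNIV"
  shows "adjoint_op T y = Some z \<longleftrightarrow> (\<forall>x\<in>dom T. cinner (the (T x)) y = cinner x z)"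
proof -
  have uniq: "z = z'" if "\<forall>x\<in>dom T. cinner (the (T x)) y = cinner x z" "\<forall>x\<in>dom T. cinner (the (T x)) y = cinner x z'" for z z'
    by (rule cinner_eq_dense_right[OF assms]) (use that in metis)
  show ?thesis
  proof
    assume a: "adjoint_op T y = Some z"
    then obtain z' where z': "\<forall>x\<in>dom T. cinner (the (T x)) y = cinner x z'"
      unfolding adjoint_op_def by (meson option.distinct(1))
    then have "(THE z. \<forall>x\<in>dom T. cinner (the (T x)) y = cinner x z) = z'"
      using uniq by (intro the_equality) blast+
    then have "z = z'" using a z' unfolding adjoint_op_def by (auto split: if_splits)
    then show "\<forall>x\<in>dom T. cinner (the (T x)) y = cinner x z" using z' by blast
  next
    assume z: "\<forall>x\<in>dom T. cinner (the (T x)) y = cinner x z"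
    then have "(THE z. \<forall>x\<in>dom T. cinner (the (T x)) y = cinner x z) = z"
      using uniq by (intro the_equality) blast+
    then show "adjoint_op T y = Some z" using z unfolding adjoint_op_def by auto
  qed
qed

text \<open>Density makes the vector in \<open>adjoint_op\<close> unique, which turns
  selfadjointness into a criterion for the graph: a pair belongs to it as soon as it passes the test
  against all vectors of the domain.\<close>

lemma selfadjoint_op_iff:
  "selfadjoint_op T \<longleftrightarrow> linear_op T \<and> closure (dom T) = UNIV \<and>
    (\<forall>y z. T y = Some z \<longleftrightarrow> (\<forall>x\<in>dom T. cinner (the (T x)) y = cinner x z))"
proof -
  have "adjoint_op T = T \<longleftrightarrow> (\<forall>y z. adjoint_op T y = Some z \<longleftrightarrow> T y = Some z)"
    by (metis ext option.exhaust)
  then show ?thesis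
    unfolding selfadjoint_op_def densely_defined_def using adjoint_op_eq_Some_iff by metis
qed

lemma selfadjointD:
  assumes "selfadjoint_op T"
  shows "complex_vector.subspace (dom T)" "closure (dom T) = UNIV"
    "x \<in> dom T \<Longrightarrow> y \<in> dom T \<Longrightarrow> the (T (x + y)) = the (T x) + the (T y)"
    "x \<in> dom T \<Longrightarrow> the (T (c *\<^sub>C x)) = c *\<^sub>C the (T x)"
    "x \<in> dom T \<Longrightarrow> y \<in> dom T \<Longrightarrow> cinner (the (T x)) y = cinner x (the (T y))"
    "(\<And>x. x \<in> dom T \<Longrightarrow> cinner (the (T x)) y = cinner x z) \<Longrightarrow> T y = Some z"
proof -
  have sa: "linear_op T" "closure (dom T) = UNIV"
    "\<And>y z. T y = Some z \<longleftrightarrow> (\<forall>x\<in>dom T. cinner (the (T x)) y = cinner x z)"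
    using assms unfolding selfadjoint_op_iff by auto
  show "complex_vector.subspace (dom T)" "closure (dom T) = UNIV"
    "x \<in> dom T \<Longrightarrow> y \<in> dom T \<Longrightarrow> the (T (x + y)) = the (T x) + the (T y)"
    "x \<in> dom T \<Longrightarrow> the (T (c *\<^sub>C x)) = c *\<^sub>C the (T x)"
    using sa(1,2) by (auto simp: linear_op_def)
  show "cinner (the (T x)) y = cinner x (the (T y))" if "x \<in> dom T" "y \<in> dom T"
  proof -
    have "T y = Some (the (T y))" using that(2) by auto
    then show ?thesis using sa(3) that(1) by blast
  qed
  show "T y = Some z" if "\<And>x. x \<in> dom T \<Longrightarrow> cinner (the (T x)) y = cinner x z"
    unfolding sa(3) using that by blast
qed

lemma selfadjoint_diff:
  assumes "selfadjoint_op T" "x \<in> dom T" "y \<in> dom T"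
  shows "x - y \<in> dom T" "the (T (x - y)) = the (T x) - the (T y)"
proof -
  note D = selfadjointD[OF assms(1)]
  show d: "x - y \<in> dom T" using D(1) assms(2,3) by (rule complex_vector.subspace_diff)
  show "the (T (x - y)) = the (T x) - the (T y)" using D(3)[OF d assms(3)] by simp
qed

lemma selfadjoint_closed:
  assumes T: "selfadjoint_op T" and y: "\<And>n::nat. y n \<in> dom T" "y \<longlonglongrightarrow> l" "(\<lambda>n. the (T (y n))) \<longlonglongrightarrow> m"
  shows "T l = Some m"
proof (rule selfadjointD(6)[OF T])
  fix x assume x: "x \<in> dom T"
  have "(\<lambda>n. cinner (the (T x)) (y n)) \<longlonglongrightarrow> cinner (the (T x)) l"
    by (intro cinner.tendsto tendsto_const y(2))
  moreover have "(\<lambda>n. cinner x (the (T (y n)))) \<longlonglongrightarrow> cinner x m"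
    by (intro cinner.tendsto tendsto_const y(3))
  ultimately show "cinner (the (T x)) l = cinner x m"
    using selfadjointD(5)[OF T x y(1)] LIMSEQ_unique by simp
qed

section \<open>Resolvents and the distance to the spectrum\<close>

definition is_resolvent :: "('a::chilbert_space \<rightharpoonup> 'a) \<Rightarrow> real \<Rightarrow> ('a \<Rightarrow> 'a) \<Rightarrow> bool" where
  "is_resolvent T c A \<longleftrightarrow> bounded_op A \<and> (\<forall>x y. cinner (A x) y = cinner x (A y)) \<and>
    (\<forall>u. A u \<in> dom T \<and> the (T (A u)) - complex_of_real c *\<^sub>C A u = u) \<and>
    (\<forall>x\<in>dom T. A (the (T x) - complex_of_real c *\<^sub>C x) = x)"

lemma is_resolventD:
  assumes "is_resolvent T c A"
  shows "bounded_op A" "cinner (A x) y = cinner x (A y)" "A u \<in> dom T"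
    "the (T (A u)) - complex_of_real c *\<^sub>C A u = u"
    "x \<in> dom T \<Longrightarrow> A (the (T x) - complex_of_real c *\<^sub>C x) = x"
  using assms unfolding is_resolvent_def by simp_all

lemma resolvent_operator:
  assumes T: "selfadjoint_op T" and c: "complex_of_real c \<in> resolvent_set T"
  shows "\<exists>A. is_resolvent T c A"
proof -
  note D = selfadjointD[OF T]
  define B where "B x = the (T x) - complex_of_real c *\<^sub>C x" for x
  obtain K where bij: "bij_betw B (dom T) UNIV" and K: "\<And>x. x \<in> dom T \<Longrightarrow> norm x \<le> K * norm (B x)"
    using c unfolding resolvent_set_def B_def by blast
  define A where "A = inv_into (dom T) B"
  have AB: "A (B x) = x" if "x \<in> dom T" for x
    using bij that unfolding A_def by (simp add: bij_betw_inv_into_left)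
  have BA: "B (A u) = u" "A u \<in> dom T" for u
    using bij unfolding A_def by (auto simp: bij_betw_inv_into_right inv_into_into bij_betw_imp_surj_on)
  have Badd: "B (x + y) = B x + B y" if "x \<in> dom T" "y \<in> dom T" for x y
    using that by (simp add: B_def D(3) scaleC_add_right)
  have Bscl: "B (a *\<^sub>C x) = a *\<^sub>C B x" if "x \<in> dom T" for a x
    using that by (simp add: B_def D(4) scaleC.diff_right scaleC_scaleC mult.commute)
  have Aadd: "A (u + v) = A u + A v" for u v
    using AB[OF complex_vector.subspace_add[OF D(1) BA(2)[of u] BA(2)[of v]]] Badd[OF BA(2) BA(2), of u v]
    by (simp add: BA(1))
  have Ascl: "A (a *\<^sub>C u) = a *\<^sub>C A u" for a u
    using AB[OF complex_vector.subspace_scale[OF D(1) BA(2)[of u]], of a] Bscl[OF BA(2), of a u] by (simp add: BA(1))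
  have Abd: "norm (A u) \<le> K * norm u" for u using K[OF BA(2)[of u]] by (simp add: BA(1))
  have "bounded_op A" by (rule bounded_opI[OF Aadd Ascl Abd])
  moreover have "cinner (A u) v = cinner u (A v)" for u v
  proof -
    have "cinner (A u) (B (A v)) = cinner (B (A u)) (A v)"
      using D(5)[OF BA(2)[of u] BA(2)[of v]] by (simp add: B_def cinner_simps)
    then show ?thesis by (simp add: BA(1))
  qed
  ultimately have "is_resolvent T c A"
    unfolding is_resolvent_def B_def[symmetric] using BA AB by simp
  then show ?thesis by blast
qed

text \<open>The claim amounts to \<open>|A| \<le> 1/d\<close> for the resolvent \<open>A\<close> at
  \<open>c\<close>. If \<open>\<mu> = |A|\<close> were larger, both \<open>A - \<mu>\<close> and
  \<open>A + \<mu>\<close> would be bounded below, hence also \<open>\<mu>^2 - A^2\<close>. As this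
  operator is nonnegative, its form would be bounded below too, so
  \<open>|A v|^2 \<le> (\<mu>^2 - \<epsilon>) |v|^2\<close>, against the choice of
  \<open>\<mu>\<close> as the norm.\<close>

lemma selfadjoint_resolvent_bound:
  assumes T: "selfadjoint_op T" and d: "d > 0"
    and res: "\<And>t. \<bar>t - c\<bar> < d \<Longrightarrow> complex_of_real t \<in> resolvent_set T" and x: "x \<in> dom T"
  shows "d * norm x \<le> norm (the (T x) - complex_of_real c *\<^sub>C x)"
proof -
  have "complex_of_real c \<in> resolvent_set T" using d by (intro res) simp
  from resolvent_operator[OF T this]
  obtain A where resA: "is_resolvent T c A" by blast
  note A = is_resolventD(1)[OF resA] and sym = is_resolventD(2)[OF resA]
    and TA = is_resolventD(3,4)[OF resA] and AT = is_resolventD(5)[OF resA]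
  note As = bounded_op_simps[OF A]
  note Abl = bounded_op_bounded_linear[OF A]
  define \<mu> where "\<mu> = onorm A"
  \<comment> \<open>The point \<open>c + 1/m\<close> lies in the given interval, and
    \<open>T - c - 1/m\<close> applied to \<open>A w\<close> is \<open>-(A w - m w) / m\<close>; so
    its resolvent bound is a lower bound for \<open>A - m\<close>.\<close>
  have below: "\<exists>k>0. \<forall>w. norm w \<le> k * norm (A w - complex_of_real m *\<^sub>C w)" if m: "\<bar>m\<bar> > 1 / d" for m
  proof -
    have m0: "m \<noteq> 0" using m d by auto
    have "\<bar>(c + 1 / m) - c\<bar> < d" using m d m0 by (simp add: field_simps abs_mult)
    then have "complex_of_real (c + 1 / m) \<in> resolvent_set T" by (rule res)
    then obtain K where K: "\<And>y. y \<in> dom T \<Longrightarrow> norm y \<le> K * norm (the (T y) - complex_of_real (c + 1 / m) *\<^sub>C y)"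
      unfolding resolvent_set_def by blast
    define K' where "K' = \<bar>K\<bar>"
    have "norm w \<le> ((K' / \<bar>m\<bar> + 1) / \<bar>m\<bar>) * norm (A w - complex_of_real m *\<^sub>C w)" for w
    proof -
      define y where "y = A w"
      define s where "s = A w - complex_of_real m *\<^sub>C w"
      have w: "w = the (T y) - complex_of_real c *\<^sub>C y" using TA(2)[of w] by (simp add: y_def)
      have "the (T y) - complex_of_real (c + 1 / m) *\<^sub>C y = w - complex_of_real (1 / m) *\<^sub>C y"
        using w by (simp add: scaleC_add_left)
      also have "\<dots> = - (complex_of_real (1 / m) *\<^sub>C s)"
        using m0 by (simp add: s_def y_def scaleC.diff_right scaleC_scaleC scaleC_one)
      finally have "norm (the (T y) - complex_of_real (c + 1 / m) *\<^sub>C y) = norm s / \<bar>m\<bar>"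
        by (simp add: norm_scaleC norm_divide)
      then have "norm y \<le> K * (norm s / \<bar>m\<bar>)" using K[of y] TA(1) by (simp add: y_def)
      also have "\<dots> \<le> K' * (norm s / \<bar>m\<bar>)" unfolding K'_def by (intro mult_right_mono) auto
      finally have y: "norm y \<le> K' * (norm s / \<bar>m\<bar>)" .
      have "complex_of_real m *\<^sub>C w = y - s" by (simp add: s_def y_def)
      then have "\<bar>m\<bar> * norm w = norm (y - s)" by (metis norm_scaleC norm_of_real)
      also have "\<dots> \<le> norm y + norm s" by (rule norm_triangle_ineq4)
      also have "\<dots> \<le> (K' / \<bar>m\<bar> + 1) * norm s" using y by (simp add: algebra_simps)
      finally show ?thesis using m0 unfolding s_def[symmetric] by (simp add: pos_le_divide_eq mult.commute)
    qed
    moreover have "(K' / \<bar>m\<bar> + 1) / \<bar>m\<bar> > 0" using m0 by (simp add: K'_def add_nonneg_pos)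
    ultimately show ?thesis by blast
  qed
  have "\<mu> \<le> 1 / d"
  proof (rule ccontr)
    assume "\<not> ?thesis"
    then have \<mu>: "\<mu> > 1 / d" by simp
    then have \<mu>0: "\<mu> > 0" using d by (metis less_trans zero_less_divide_1_iff)
    obtain k1 where k1: "k1 > 0" "\<And>w. norm w \<le> k1 * norm (A w - complex_of_real \<mu> *\<^sub>C w)"
      using below[of \<mu>] \<mu> \<mu>0 by auto
    obtain k2 where k2: "k2 > 0" "\<And>w. norm w \<le> k2 * norm (A w - complex_of_real (- \<mu>) *\<^sub>C w)"
      using below[of "- \<mu>"] \<mu> \<mu>0 by (metis abs_minus_cancel abs_of_pos)
    define B where "B = (\<lambda>w. complex_of_real (\<mu>\<^sup>2) *\<^sub>C w - A (A w))"
    have Bb: "bounded_op B" unfolding B_def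
      by (rule bounded_op_diff[OF bounded_op_scaleC[OF bounded_op_id] bounded_op_compose[OF A A]])
    have Bsym: "cinner (B v) w = cinner v (B w)" for v w by (simp add: B_def cinner_simps sym)
    have Bq: "Re (cinner (B v) v) = \<mu>\<^sup>2 * (norm v)\<^sup>2 - (norm (A v))\<^sup>2" for v
      by (simp add: B_def cinner_simps sym[of "A v"] Re_cinner_self)
    have An: "norm (A v) \<le> \<mu> * norm v" for v unfolding \<mu>_def by (rule onorm[OF Abl])
    have Bn: "(norm (B v))\<^sup>2 \<le> \<mu>\<^sup>2 * Re (cinner (B v) v)" for v
    proof (rule psd_operator_norm_sq_le[OF Bb Bsym complex_vector.subspace_UNIV UNIV_I _ _ UNIV_I])
      fix v
      have "(norm (A v))\<^sup>2 \<le> (\<mu> * norm v)\<^sup>2" by (rule power_mono[OF An norm_ge_zero])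
      then show "0 \<le> Re (cinner (B v) v)" by (simp add: Bq power_mult_distrib)
      show "Re (cinner (B v) v) \<le> \<mu>\<^sup>2 * (norm v)\<^sup>2" by (simp add: Bq)
    qed
    define k where "k = k1 * k2"
    have k: "k > 0" using k1 k2 by (simp add: k_def)
    \<comment> \<open>\<open>\<mu>^2 - A^2\<close> is \<open>-(A - \<mu>)(A + \<mu>)\<close>, so the
      two lower bounds compose.\<close>
    have Bk: "norm v \<le> k * norm (B v)" for v
    proof -
      define w where "w = A v - complex_of_real (- \<mu>) *\<^sub>C v"
      have "A w - complex_of_real \<mu> *\<^sub>C w = - B v"
        by (simp add: w_def B_def As scaleC_add_right scaleC_scaleC power2_eq_square scaleC.minus_left scaleC.diff_right scaleC.minus_right)
      then have "norm w \<le> k1 * norm (B v)" using k1(2)[of w] by simp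
      then have "k2 * norm w \<le> k2 * (k1 * norm (B v))" using k2(1) by (intro mult_left_mono) auto
      then show ?thesis using k2(2)[of v] unfolding w_def[symmetric] by (simp add: k_def mult.assoc mult.left_commute)
    qed
    \<comment> \<open>Read off from \<open>|v|^2 \<le> k^2 |B v|^2\<close> and
      \<open>|B v|^2 \<le> \<mu>^2 (\<mu>^2 |v|^2 - |A v|^2)\<close>.\<close>
    define \<epsilon> where "\<epsilon> = 1 / (k\<^sup>2 * \<mu>\<^sup>2)"
    have \<epsilon>: "\<epsilon> > 0" using k \<mu>0 by (simp add: \<epsilon>_def)
    have A2: "(norm (A v))\<^sup>2 \<le> (\<mu>\<^sup>2 - \<epsilon>) * (norm v)\<^sup>2" for v
    proof -
      have "(norm v)\<^sup>2 \<le> k\<^sup>2 * (norm (B v))\<^sup>2"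
        using power_mono[OF Bk[of v] norm_ge_zero, of 2] by (simp add: power_mult_distrib)
      also have "\<dots> \<le> k\<^sup>2 * (\<mu>\<^sup>2 * Re (cinner (B v) v))" using Bn[of v] by (intro mult_left_mono) auto
      finally have "(norm v)\<^sup>2 \<le> (k\<^sup>2 * \<mu>\<^sup>2) * (\<mu>\<^sup>2 * (norm v)\<^sup>2 - (norm (A v))\<^sup>2)" by (simp add: Bq mult.assoc)
      then have "(norm v)\<^sup>2 / (k\<^sup>2 * \<mu>\<^sup>2) \<le> \<mu>\<^sup>2 * (norm v)\<^sup>2 - (norm (A v))\<^sup>2"
        using k \<mu>0 by (simp add: pos_divide_le_eq mult.commute)
      then show ?thesis by (simp add: \<epsilon>_def left_diff_distrib)
    qed
    have pos: "0 \<le> \<mu>\<^sup>2 - \<epsilon>"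
    proof (rule ccontr)
      assume "\<not> ?thesis"
      then have neg: "\<mu>\<^sup>2 - \<epsilon> < 0" by simp
      have "A v = 0" for v
      proof -
        have "(norm (A v))\<^sup>2 \<le> 0" using order_trans[OF A2[of v] mult_nonpos_nonneg[OF less_imp_le[OF neg] zero_le_power2]] .
        then show ?thesis by simp
      qed
      then have "\<mu> = 0" unfolding \<mu>_def using onorm_eq_0[OF Abl] by blast
      then show False using \<mu>0 by simp
    qed
    have "norm (A v) \<le> sqrt (\<mu>\<^sup>2 - \<epsilon>) * norm v" for v
    proof (rule power2_le_imp_le)
      show "(norm (A v))\<^sup>2 \<le> (sqrt (\<mu>\<^sup>2 - \<epsilon>) * norm v)\<^sup>2" using A2[of v] pos by (simp add: power_mult_distrib)
    qed (use pos in simp)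
    then have "\<mu> \<le> sqrt (\<mu>\<^sup>2 - \<epsilon>)" unfolding \<mu>_def[symmetric] unfolding \<mu>_def
      using pos by (intro onorm_bound) (simp_all add: \<mu>_def)
    also have "\<dots> < sqrt (\<mu>\<^sup>2)" using \<epsilon> by (intro real_sqrt_less_mono) simp
    finally show False using \<mu>0 by simp
  qed
  moreover have "norm x \<le> \<mu> * norm (the (T x) - complex_of_real c *\<^sub>C x)"
    using onorm[OF Abl, of "the (T x) - complex_of_real c *\<^sub>C x"] by (simp add: AT[OF x] \<mu>_def)
  ultimately have "norm x \<le> (1 / d) * norm (the (T x) - complex_of_real c *\<^sub>C x)"
    by (meson mult_right_mono norm_ge_zero order_trans)
  then show ?thesis using d by (simp add: pos_le_divide_eq mult.commute)
qed

text \<open>For every \<open>t > 0\<close> the point \<open>-t\<close> has distance at least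
  \<open>t\<close> from the spectrum, so \<open>t |x| \<le> |T x + t x|\<close>. Squaring leaves
  \<open>0 \<le> a + 2 t b\<close>, which for large \<open>t\<close> excludes
  \<open>b < 0\<close>.\<close>

lemma selfadjoint_nonneg:
  assumes T: "selfadjoint_op T" and sp: "spectrum T \<subseteq> \<real>\<^sub>\<ge>\<^sub>0" and x: "x \<in> dom T"
  shows "0 \<le> Re (cinner (the (T x)) x)"
proof -
  define a where "a = (norm (the (T x)))\<^sup>2"
  define b where "b = Re (cinner (the (T x)) x)"
  have ineq: "0 \<le> a + 2 * t * b" if t: "t > 0" for t
  proof -
    have "t * norm x \<le> norm (the (T x) - complex_of_real (- t) *\<^sub>C x)"
    proof (rule selfadjoint_resolvent_bound[OF T t _ x])
      fix s assume "\<bar>s - (- t)\<bar> < t"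
      then have "s < 0" by simp
      then have "complex_of_real s \<notin> \<real>\<^sub>\<ge>\<^sub>0" by (simp add: complex_nonneg_Reals_iff)
      then show "complex_of_real s \<in> resolvent_set T" using sp by (auto simp: spectrum_def)
    qed
    then have "(t * norm x)\<^sup>2 \<le> (norm (the (T x) - complex_of_real (- t) *\<^sub>C x))\<^sup>2"
      using t by (intro power_mono) auto
    also have "\<dots> = a + 2 * t * b + (t * norm x)\<^sup>2"
      using t by (simp add: norm_diff_sq norm_add_sq a_def b_def cinner_simps norm_scaleC power_mult_distrib)
    finally show ?thesis by simp
  qed
  show ?thesis unfolding b_def[symmetric]
  proof (rule ccontr)
    assume "\<not> 0 \<le> b"
    then have b: "b < 0" by simp
    have "a \<ge> 0" by (simp add: a_def)
    \<comment> \<open>At this \<open>t\<close> the inequality would read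
      \<open>0 \<le> a - 2 (a + 1)\<close>, with \<open>a \<ge> 0\<close>.\<close>
    have t: "(a + 1) / (- b) > 0" using b \<open>a \<ge> 0\<close> by (intro divide_pos_pos) auto
    have "2 * ((a + 1) / (- b)) * b = - 2 * (a + 1)" using b by simp
    then show False using ineq[OF t] \<open>a \<ge> 0\<close> by simp
  qed
qed

subsection \<open>Square roots of positive selfadjoint operators\<close>

text \<open>With \<open>R = (T + 1)\<^sup>-\<^sup>1\<close>, the bounded operator \<open>X = (R - R\<^sup>2)\<^bsup>1/2\<^esup>\<close> is
  \<open>T\<^bsup>1/2\<^esup> R\<close>, and the graph of \<open>T\<^bsup>1/2\<^esup>\<close> is \<open>{(y, z). X y = R z}\<close>.\<close>

locale sqrt_of_selfadjoint =
  fixes T :: "'a::chilbert_space \<rightharpoonup> 'a" and R X :: "'a \<Rightarrow> 'a"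
  assumes T: "selfadjoint_op T"
    and R: "positive_op R" and T_iff: "\<And>y z. T y = Some z \<longleftrightarrow> R (y + z) = y"
    and X: "positive_op X" and XX: "\<And>u. X (X u) = R u - R (R u)" and XR: "\<And>u. X (R u) = R (X u)"
begin

lemmas Rb = positive_op_bounded[OF R] and Xb = positive_op_bounded[OF X]
lemmas Rs = bounded_op_simps[OF Rb] and Xs = bounded_op_simps[OF Xb]
lemmas Rsym = positive_op_symmetric[OF R] and Xsym = positive_op_symmetric[OF X]

lemma T_R: "T (R u) = Some (u - R u)"
  unfolding T_iff by simp

lemma T_dom: "x \<in> dom T \<longleftrightarrow> x \<in> range R"
  using T_R T_iff by (metis domD domI rangeE rangeI)

lemma R_inj: assumes "R u = R v" shows "u = v"
proof -
  have "Some (u - R v) = Some (v - R v)" using T_R[of u] T_R[of v] unfolding assms by (rule trans[OF sym])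
  then have "u - R v = v - R v" by (rule option.inject[THEN iffD1])
  from arg_cong[OF this, of "\<lambda>t. t + R v"] show ?thesis by simp
qed

lemma R_range_dense: "closure (range R) = UNIV"
proof -
  have "dom T = range R" by (rule set_eqI) (rule T_dom)
  then show ?thesis using selfadjointD(2)[OF T] by simp
qed

text \<open>With \<open>X\<close> as the root of \<open>T\<close> times \<open>R\<close>, this is
  \<open>1 = T R + R\<close> applied to \<open>y\<close>, with one root moved onto \<open>z\<close>.
  It is checked after applying the injective \<open>R\<close>.\<close>

lemma XR_imp:
  assumes "X y = R z" shows "y = X z + R y"
proof (rule R_inj)
  have "R (X z) = R y - R (R y)" using assms XX[of y] by (simp add: XR[symmetric])
  then show "R y = R (X z + R y)" by (simp add: Rs)
qed

definition S :: "'a \<rightharpoonup> 'a" where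
  "S = (\<lambda>y. if \<exists>z. X y = R z then Some (THE z. X y = R z) else None)"

lemma S_iff: "S y = Some z \<longleftrightarrow> X y = R z"
proof -
  have uniq: "w = w'" if "X y = R w" "X y = R w'" for w w' using that R_inj[of w w'] by simp
  have *: "(THE z. X y = R z) = w" if "X y = R w" for w
    using that uniq by (intro the_equality) blast+
  show ?thesis
  proof (cases "\<exists>w. X y = R w")
    case True
    then obtain w where w: "X y = R w" by blast
    then have "S y = Some w" using * unfolding S_def by auto
    moreover have "X y = R z \<longleftrightarrow> w = z" using w uniq[of w z] by auto
    ultimately show ?thesis by simp
  next
    case False
    then show ?thesis by (simp add: S_def)
  qed
qed

lemma S_dom:
  assumes "y \<in> dom S" shows "X y = R (the (S y))"
proof -
  obtain z where "S y = Some z" using assms by blast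
  then show ?thesis using S_iff[of y z] by simp
qed

lemma S_R: "S (R u) = Some (X u)"
  by (simp add: S_iff XR)

text \<open>Symmetry comes from replacing \<open>y\<close> by \<open>X z + R y\<close>. Conversely,
  testing the adjoint relation on the vectors \<open>R u\<close>, where \<open>S\<close> is
  \<open>X u\<close>, already yields \<open>X y = R z\<close>.\<close>

lemma S_selfadjoint: "selfadjoint_op S"
  unfolding selfadjoint_op_iff
proof (intro conjI allI iffI ballI)
  have memI: "y \<in> dom S" "the (S y) = z" if "X y = R z" for y z using that S_iff[of y z] by auto
  show "linear_op S"
    unfolding linear_op_def complex_vector.subspace_def
  proof (intro conjI ballI allI)
    show "0 \<in> dom S" by (rule memI[of _ 0]) (simp add: Rs Xs)
    fix x y c assume x: "x \<in> dom S"
    show "c *\<^sub>C x \<in> dom S" "the (S (c *\<^sub>C x)) = c *\<^sub>C the (S x)"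
      using memI[of "c *\<^sub>C x" "c *\<^sub>C the (S x)"] S_dom[OF x] by (simp_all add: Rs Xs)
    assume y: "y \<in> dom S"
    show "x + y \<in> dom S" "the (S (x + y)) = the (S x) + the (S y)"
      using memI[of "x + y" "the (S x) + the (S y)"] S_dom[OF x] S_dom[OF y] by (simp_all add: Rs Xs)
  qed
  have "range R \<subseteq> dom S" using S_R by auto
  then show "closure (dom S) = UNIV" using R_range_dense closure_mono by (metis top.extremum_uniqueI)
next
  fix y z x assume "S y = Some z" and x: "x \<in> dom S"
  then have yz: "X y = R z" by (simp add: S_iff)
  define w where "w = the (S x)"
  have xw: "X x = R w" using S_dom[OF x] by (simp add: w_def)
  have "cinner w y = cinner (X w) z + cinner (R w) y"
    by (subst XR_imp[OF yz]) (simp add: cinner_simps Xsym Rsym)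
  also have "cinner (R w) y = cinner x (R z)" by (simp add: xw[symmetric] Xsym yz)
  also have "cinner (X w) z + cinner x (R z) = cinner (X w + R x) z" by (simp add: cinner_simps Rsym)
  also have "X w + R x = x" using XR_imp[OF xw] by simp
  finally show "cinner (the (S x)) y = cinner x z" by (simp add: w_def)
next
  fix y z assume a: "\<forall>x\<in>dom S. cinner (the (S x)) y = cinner x z"
  have "cinner u (X y) = cinner u (R z)" for u
    using a[rule_format, of "R u"] S_R[of u] by (auto simp: Xsym Rsym)
  then show "S y = Some z" unfolding S_iff by (rule cinner_all_eq_right)
qed

text \<open>For \<open>z = S y\<close> the inner product of \<open>z\<close> and \<open>y\<close> is
  the sum of the nonnegative forms of \<open>X\<close> at \<open>z\<close> and at
  \<open>y\<close>.\<close>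

lemma S_nonneg: assumes y: "y \<in> dom S" shows "cinner (the (S y)) y \<in> \<real>\<^sub>\<ge>\<^sub>0"
proof -
  define z where "z = the (S y)"
  have yz: "X y = R z" using S_dom[OF y] by (simp add: z_def)
  have "cinner z y = cinner (X z) z + cinner z (R y)"
    by (subst XR_imp[OF yz]) (simp add: cinner_simps Xsym)
  also have "cinner z (R y) = cinner (X y) y" by (simp add: yz Rsym)
  finally show ?thesis using X by (auto simp: z_def positive_op_def)
qed

lemma S_comp: "S \<circ>\<^sub>m S = T"
proof
  fix y
  have "(S \<circ>\<^sub>m S) y = Some w \<longleftrightarrow> T y = Some w" for w
  proof
    assume "(S \<circ>\<^sub>m S) y = Some w"
    then obtain z where z: "S y = Some z" "S z = Some w" by (auto simp: map_comp_Some_iff)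
    then have "X y = R z" "X z = R w" by (auto simp: S_iff)
    then have "R (y + w) = y" using XR_imp[of y z] by (simp add: Rs add.commute)
    then show "T y = Some w" by (simp add: T_iff)
  next
    assume "T y = Some w"
    then have y: "R (y + w) = y" by (simp add: T_iff)
    have "S y = Some (X (y + w))" using S_R[of "y + w"] y by simp
    moreover have "S (X (y + w)) = Some w"
      unfolding S_iff XX using y by (metis Rs(4) add_diff_cancel_left')
    ultimately show "(S \<circ>\<^sub>m S) y = Some w" by (simp add: map_comp_Some_iff)
  qed
  then show "(S \<circ>\<^sub>m S) y = T y" by (metis option.exhaust)
qed

text \<open>The composition \<open>Y\<close> of \<open>S'\<close> after \<open>R\<close> is bounded
  and positive with \<open>Y^2 = R - R^2\<close>, so \<open>Y = X\<close> by uniqueness for bounded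
  operators. The graph of \<open>S'\<close> is then recovered from \<open>X\<close> and
  \<open>R\<close>.\<close>

lemma S_unique:
  assumes S': "selfadjoint_op S'" and pos: "\<And>x. x \<in> dom S' \<Longrightarrow> cinner (the (S' x)) x \<in> \<real>\<^sub>\<ge>\<^sub>0"
    and comp: "S' \<circ>\<^sub>m S' = T"
  shows "S' = S"
proof -
  note D = selfadjointD[OF S']
  have T2: "T y = Some w \<longleftrightarrow> (\<exists>z. S' y = Some z \<and> S' z = Some w)" for y w
    using fun_cong[OF comp, of y] by (auto simp: map_comp_Some_iff)
  define Y where "Y u = the (S' (R u))" for u
  have SR: "S' (R u) = Some (Y u)" "S' (Y u) = Some (u - R u)" for u
    using T_R[of u] unfolding T2 Y_def by auto
  have dR: "R u \<in> dom S'" "Y u \<in> dom S'" for u using SR by auto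
  have Yadd: "Y (u + v) = Y u + Y v" and Yscl: "Y (c *\<^sub>C u) = c *\<^sub>C Y u" for u v c
    unfolding Y_def by (simp_all add: Rs D(3,4) dR)
  have Ysym: "cinner (Y u) v = cinner u (Y v)" and Yn: "(norm (Y u))\<^sup>2 = Re (cinner (R u) (u - R u))" for u v
  proof -
    have *: "cinner (Y u) (R v) = cinner (R u) (Y v)" for u v
      using D(5)[OF dR(1)[of u] dR(1)[of v]] by (simp add: Y_def)
    have **: "cinner (u - R u) (R v) = cinner (Y u) (Y v)" for u v
      using D(5)[OF dR(2)[of u] dR(1)[of v]] SR by simp
    show "(norm (Y u))\<^sup>2 = Re (cinner (R u) (u - R u))"
      using **[of u u] by (simp add: Re_cinner_self[symmetric] cinner_simps Rsym)
    have t: "cinner (u - R u) (Y v) = cinner (Y u) (v - R v)"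
      using D(5)[OF dR(2)[of u] dR(2)[of v]] SR by simp
    show "cinner (Y u) v = cinner u (Y v)" using t *[of u v] by (simp add: cinner_simps)
  qed
  have "bounded_op Y"
  proof -
    obtain K where K: "K > 0" "\<And>x. norm (R x) \<le> K * norm x" using bounded_op_pos_bound[OF Rb] by blast
    have "norm (Y u) \<le> sqrt K * norm u" for u
    proof (rule power2_le_imp_le)
      have "(norm (Y u))\<^sup>2 \<le> Re (cinner (R u) u)"
        by (simp add: Yn cinner_simps Re_cinner_self)
      also have "\<dots> \<le> norm (R u) * norm u" using complex_Re_le_cmod cinner_Cauchy_Schwarz order_trans by blast
      also have "\<dots> \<le> K * norm u * norm u" by (intro mult_right_mono K) auto
      finally show "(norm (Y u))\<^sup>2 \<le> (sqrt K * norm u)\<^sup>2" 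
        unfolding power_mult_distrib using K(1) by (simp add: power2_eq_square[of "norm u"] mult.assoc)
    qed (use K in simp)
    then show ?thesis by (intro bounded_opI[OF Yadd Yscl])
  qed
  moreover have "0 \<le> Re (cinner (Y u) u)" for u
  proof -
    have "cinner (Y u) u = cinner (Y u) (R u) + cinner (Y u) (u - R u)" by (simp add: cinner_simps)
    moreover have "cinner (Y u) (u - R u) = cinner (the (S' (Y u))) (Y u)"
      using Ysym D(5)[OF dR(2) dR(2), of u u] SR by simp
    moreover have "cinner (Y u) (R u) = cinner (the (S' (R u))) (R u)" by (simp add: SR)
    ultimately show ?thesis using pos[OF dR(1)[of u]] pos[OF dR(2)[of u]]
      by (simp add: complex_nonneg_Reals_iff)
  qed
  ultimately have Yp: "positive_op Y" by (intro positive_opI Ysym)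
  \<comment> \<open>\<open>T\<close> and \<open>S'\<close> commute, \<open>T\<close> being the
    square of \<open>S'\<close>; the characterization of the graph of \<open>T\<close> by
    \<open>R\<close> converts this into commutation with \<open>R\<close>.\<close>
  have comm: "R (Y u) = Y (R u)" for u
  proof -
    have "S' (Y (R u)) = Some (R u - R (R u))" by (rule SR(2))
    moreover have "S' (R u - R (R u)) = Some (Y u - Y (R u))"
      using selfadjoint_diff[OF S' dR(1)[of u] dR(1)[of "R u"]] SR by (metis domD option.sel)
    ultimately have "T (Y (R u)) = Some (Y u - Y (R u))" unfolding T2 by blast
    then show ?thesis by (simp add: T_iff)
  qed
  have "Y (Y u) = R u - R (R u)" for u
  proof (rule R_inj)
    show "R (Y (Y u)) = R (R u - R (R u))"
    proof -
      have "R (Y (Y u)) = Y (R (Y u))" by (rule comm)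
      also have "\<dots> = Y (Y (R u))" by (simp add: comm)
      also have "Y (Y (R u)) = the (S' (R (Y (R u))))" by (simp add: Y_def)
      also have "R (Y (R u)) = Y (R (R u))" by (rule comm)
      also have "the (S' (Y (R (R u)))) = R (R u) - R (R (R u))" by (simp add: SR)
      finally show ?thesis by (simp add: Rs)
    qed
  qed
  then have YX: "Y = X" by (intro positive_sqrt_unique[OF Yp X]) (simp add: XX)
  have "S' y = Some z \<longleftrightarrow> S y = Some z" for y z
  proof
    assume yz: "S' y = Some z"
    then have yd: "y \<in> dom S'" by auto
    have "cinner u (X y) = cinner u (R z)" for u
    proof -
      have "cinner (Y u) y = cinner (R u) z" using D(5)[OF dR(1)[of u] yd] yz SR by simp
      then show ?thesis by (simp add: YX Xsym Rsym)
    qed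
    then show "S y = Some z" unfolding S_iff by (rule cinner_all_eq_right)
  next
    assume "S y = Some z"
    then have yz: "X y = R z" by (simp add: S_iff)
    have y: "y = Y z + R y" using XR_imp[OF yz] by (simp add: YX)
    have "S' (Y z + R y) = Some ((z - R z) + Y y)"
      using complex_vector.subspace_add[OF D(1) dR(2)[of z] dR(1)[of y]] D(3)[OF dR(2)[of z] dR(1)[of y]] SR
      by (metis domD option.sel)
    moreover have "(z - R z) + Y y = z" using yz by (simp add: YX)
    ultimately show "S' y = Some z" using y by simp
  qed
  then show ?thesis by (intro ext) (metis option.exhaust)
qed

lemma sqrt_op_eq: "sqrt_op T = S"
  unfolding sqrt_op_def
proof (rule the_equality)
  show "selfadjoint_op S \<and> (\<forall>x\<in>dom S. cinner (the (S x)) x \<in> \<real>\<^sub>\<ge>\<^sub>0) \<and> S \<circ>\<^sub>m S = T"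
    by (intro conjI ballI S_selfadjoint S_nonneg S_comp)
  fix S' assume S': "selfadjoint_op S' \<and> (\<forall>x\<in>dom S'. cinner (the (S' x)) x \<in> \<real>\<^sub>\<ge>\<^sub>0) \<and> S' \<circ>\<^sub>m S' = T"
  show "S' = S"
    by (rule S_unique[OF S'[THEN conjunct1] bspec[OF S'[THEN conjunct2, THEN conjunct1]]
          S'[THEN conjunct2, THEN conjunct2]])
qed

text \<open>\<open>dom T\<close> is a core of \<open>S\<close>: approximate \<open>z = S y\<close>
  by vectors \<open>R (u n)\<close> of the dense range and put \<open>f n = R (X (u n) + y)\<close>.
  Then \<open>f n\<close> tends to \<open>X z + R y = y\<close>, and its image under
  \<open>S\<close> tends to \<open>z - R z + R z\<close>.\<close>

lemma S_core:
  assumes y: "y \<in> dom S"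
  shows "\<exists>f. (\<forall>n::nat. f n \<in> dom T \<and> f n \<in> dom S) \<and> f \<longlonglongrightarrow> y \<and> (\<lambda>n. the (S (f n))) \<longlonglongrightarrow> the (S y)"
proof -
  define z where "z = the (S y)"
  have yz: "X y = R z" using S_dom[OF y] by (simp add: z_def)
  have "z \<in> closure (range R)" using R_range_dense by simp
  then obtain g where g: "\<And>n. g n \<in> range R" "g \<longlonglongrightarrow> z" unfolding closure_sequential by blast
  have "\<exists>u. \<forall>n. g n = R (u n)" using g(1) by (intro choice) (auto simp: image_iff)
  then obtain u where u: "\<And>n. g n = R (u n)" by blast
  define f where "f n = R (X (u n) + y)" for n
  have f: "f n = X (g n) + R y" for n by (simp add: f_def u Rs XR)
  have Sf: "S (f n) = Some (g n - R (g n) + R z)" for n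
    unfolding f_def S_R by (simp add: Xs XX u yz)
  have "f \<longlonglongrightarrow> X z + R y"
    unfolding f[abs_def] by (intro tendsto_intros bounded_op_tendsto[OF Xb] g)
  then have "f \<longlonglongrightarrow> y" using XR_imp[OF yz] by simp
  moreover have "(\<lambda>n. g n - R (g n) + R z) \<longlonglongrightarrow> z - R z + R z"
    by (intro tendsto_intros bounded_op_tendsto[OF Rb] g)
  moreover have "f n \<in> dom T" "f n \<in> dom S" for n using Sf[of n] T_dom by (auto simp: f_def)
  ultimately show ?thesis by (intro exI[of _ f]) (simp add: Sf z_def)
qed

lemma S_norm: "x \<in> dom T \<Longrightarrow> x \<in> dom S \<and> complex_of_real ((norm (the (S x)))\<^sup>2) = cinner (the (T x)) x"
proof -
  assume x: "x \<in> dom T"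
  then obtain z where z: "S x = Some z" "S z = Some (the (T x))"
    using fun_cong[OF S_comp, of x] by (auto simp: map_comp_Some_iff)
  then have "cinner (the (T x)) x = cinner z z"
    using selfadjointD(5)[OF S_selfadjoint, of z x] by auto
  then show ?thesis using z by (auto simp: cinner_self)
qed

end

text \<open>\<open>R\<close> is the resolvent at \<open>-1\<close>. The form of
  \<open>R - R^2\<close> at \<open>u\<close> is the form of \<open>T\<close> at \<open>R u\<close>,
  hence nonnegative, so a bounded root \<open>X\<close> exists; it commutes with \<open>R\<close>
  because \<open>R\<close> commutes with \<open>R - R^2\<close>.\<close>

lemma sqrt_of_selfadjoint_exists:
  assumes T: "selfadjoint_op T" and pos: "\<And>x. x \<in> dom T \<Longrightarrow> 0 \<le> Re (cinner (the (T x)) x)"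
    and res: "complex_of_real (-1) \<in> resolvent_set T"
  shows "\<exists>R X. sqrt_of_selfadjoint T R X"
proof -
  obtain R where resR: "is_resolvent T (-1) R" using resolvent_operator[OF T res] by blast
  note R = is_resolventD(1)[OF resR] and sym = is_resolventD(2)[OF resR]
    and TR = is_resolventD(3,4)[OF resR] and RT = is_resolventD(5)[OF resR]
  have TR': "the (T (R u)) = u - R u" for u
    using TR(2)[of u] by (simp add: scaleC.minus_left scaleC_one algebra_simps)
  have RT': "R (x + the (T x)) = x" if "x \<in> dom T" for x
    using RT[OF that] by (simp add: scaleC.minus_left scaleC_one add.commute)
  have iff: "T y = Some z \<longleftrightarrow> R (y + z) = y" for y z
  proof
    assume "T y = Some z"
    then show "R (y + z) = y" using RT'[of y] by auto
  next
    assume "R (y + z) = y"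
    then show "T y = Some z" using TR(1)[of "y + z"] TR'[of "y + z"] by auto
  qed
  have q: "Re (cinner (R u) u) = (norm (R u))\<^sup>2 + Re (cinner (the (T (R u))) (R u))" for u
    using cinner_commute[of "R u" u]
    by (simp add: TR' cinner_simps Re_cinner_self)
  have Rp: "positive_op R"
    by (rule positive_opI[OF R sym]) (simp add: q pos[OF TR(1)])
  define N where "N = (\<lambda>u. R u - R (R u))"
  have "positive_op N"
  proof (rule positive_opI)
    show "bounded_op N" unfolding N_def by (rule bounded_op_diff[OF R bounded_op_compose[OF R R]])
    show "cinner (N x) y = cinner x (N y)" for x y by (simp add: N_def cinner_simps sym)
    show "0 \<le> Re (cinner (N u) u)" for u
      using pos[OF TR(1)[of u]] q[of u] sym[of "R u" u] by (simp add: N_def cinner_simps Re_cinner_self)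
  qed
  then obtain X where X: "positive_op X" "\<And>u. X (X u) = N u"
    "\<And>B. bounded_op B \<Longrightarrow> (\<forall>x. B (N x) = N (B x)) \<Longrightarrow> \<forall>x. B (X x) = X (B x)"
    using positive_sqrt_exists[of N] by blast
  have "\<forall>x. R (X x) = X (R x)" by (rule X(3)[OF R]) (simp add: N_def bounded_op_simps[OF R])
  then have "sqrt_of_selfadjoint T R X"
    using T Rp iff X(1,2) by unfold_locales (auto simp: N_def)
  then show ?thesis by blast
qed

section \<open>The form domain\<close>

text \<open>A sequence in \<open>C\<close> that converges in the graph of \<open>A\<close> is Cauchy
  in the graph of \<open>B\<close> by the norm comparison, and \<open>B\<close> is closed. It is
  used in both directions between the roots of \<open>H\<close> and of \<open>H + 1\<close>.\<close>

lemma selfadjoint_graph_transfer: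
  assumes A: "selfadjoint_op A" and B: "selfadjoint_op B" and C: "complex_vector.subspace C"
    and CA: "C \<subseteq> dom A" and CB: "C \<subseteq> dom B"
    and le: "\<And>x. x \<in> C \<Longrightarrow> (norm (the (B x)))\<^sup>2 \<le> (norm (the (A x)))\<^sup>2 + (norm x)\<^sup>2"
    and f: "\<And>n::nat. f n \<in> C" "f \<longlonglongrightarrow> y" "(\<lambda>n. the (A (f n))) \<longlonglongrightarrow> the (A y)"
  shows "y \<in> dom B" "(\<lambda>n. the (B (f n))) \<longlonglongrightarrow> the (B y)"
proof -
  have "Cauchy (\<lambda>n. the (B (f n)))"
  proof (rule CauchyI)
    fix e :: real assume e: "e > 0"
    then have e2: "e / 2 > 0" by simp
    obtain M1 where M1: "\<And>m n. m \<ge> M1 \<Longrightarrow> n \<ge> M1 \<Longrightarrow> norm (f m - f n) < e / 2"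
      using CauchyD[OF LIMSEQ_imp_Cauchy[OF f(2)] e2] by blast
    obtain M2 where M2: "\<And>m n. m \<ge> M2 \<Longrightarrow> n \<ge> M2 \<Longrightarrow> norm (the (A (f m)) - the (A (f n))) < e / 2"
      using CauchyD[OF LIMSEQ_imp_Cauchy[OF f(3)] e2] by blast
    have "norm (the (B (f m)) - the (B (f n))) < e" if "m \<ge> max M1 M2" "n \<ge> max M1 M2" for m n
    proof -
      have d: "f m - f n \<in> C" using C f(1) by (intro complex_vector.subspace_diff)
      have fA: "f k \<in> dom A" "f k \<in> dom B" for k using f(1)[of k] CA CB by auto
      have "(norm (the (B (f m)) - the (B (f n))))\<^sup>2 \<le> (norm (the (A (f m)) - the (A (f n))))\<^sup>2 + (norm (f m - f n))\<^sup>2"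
        using le[OF d] selfadjoint_diff(2)[OF A fA(1)[of m] fA(1)[of n]] selfadjoint_diff(2)[OF B fA(2)[of m] fA(2)[of n]]
        by simp
      also have "\<dots> \<le> (e / 2)\<^sup>2 + (e / 2)\<^sup>2"
        using M1[of m n] M2[of m n] that by (intro add_mono power_mono) auto
      also have "\<dots> < e\<^sup>2" using e by (simp add: power2_eq_square field_simps)
      finally show ?thesis using e by (simp add: power2_less_imp_less)
    qed
    then show "\<exists>M. \<forall>m\<ge>M. \<forall>n\<ge>M. norm (the (B (f m)) - the (B (f n))) < e" by blast
  qed
  then obtain m where m: "(\<lambda>n. the (B (f n))) \<longlonglongrightarrow> m" using Cauchy_convergent convergent_def by blast
  have "f n \<in> dom B" for n using f(1)[of n] CB by auto
  from selfadjoint_closed[OF B this f(2) m] have "B y = Some m" .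
  then show "y \<in> dom B" "(\<lambda>n. the (B (f n))) \<longlonglongrightarrow> the (B y)" using m by auto
qed

lemma shift_op_Some_iff: "shift_op T c y = Some z \<longleftrightarrow> T y = Some (z - c *\<^sub>C y)"
  by (cases "T y") (auto simp: shift_op_def algebra_simps)

lemma dom_shift_op: "dom (shift_op T c) = dom T"
  by (auto simp: shift_op_def dom_def)

lemma the_shift_op: "x \<in> dom T \<Longrightarrow> the (shift_op T c x) = the (T x) + c *\<^sub>C x"
  by (auto simp: shift_op_def)

lemma selfadjoint_shift_op:
  assumes T: "selfadjoint_op T"
  shows "selfadjoint_op (shift_op T 1)"
  unfolding selfadjoint_op_iff
proof (intro conjI allI)
  note D = selfadjointD[OF T]
  show "closure (dom (shift_op T 1)) = UNIV" using D(2) by (simp add: dom_shift_op)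
  show "linear_op (shift_op T 1)"
    unfolding linear_op_def dom_shift_op
  proof (intro conjI ballI allI D(1))
    fix x y c assume x: "x \<in> dom T"
    show "the (shift_op T 1 (c *\<^sub>C x)) = c *\<^sub>C the (shift_op T 1 x)"
      using x complex_vector.subspace_scale[OF D(1) x, of c]
      by (simp add: the_shift_op D(4) scaleC_add_right scaleC_one)
    assume y: "y \<in> dom T"
    show "the (shift_op T 1 (x + y)) = the (shift_op T 1 x) + the (shift_op T 1 y)"
      using x y complex_vector.subspace_add[OF D(1) x y]
      by (simp add: the_shift_op D(3) scaleC_add_right)
  qed
  fix y z
  have iff: "T y = Some w \<longleftrightarrow> (\<forall>x\<in>dom T. cinner (the (T x)) y = cinner x w)" for w
    using T unfolding selfadjoint_op_iff by blast
  show "shift_op T 1 y = Some z \<longleftrightarrow> (\<forall>x\<in>dom (shift_op T 1). cinner (the (shift_op T 1 x)) y = cinner x z)"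
    unfolding shift_op_Some_iff iff dom_shift_op
    by (intro ball_cong refl) (auto simp: the_shift_op cinner_simps scaleC_one algebra_simps)
qed

locale zero_in_discrete_spectrum = sqrt_of_selfadjoint H R X
  for H :: "'a::chilbert_space \<rightharpoonup> 'a" and R X :: "'a \<Rightarrow> 'a" +
  assumes sp: "spectrum H \<subseteq> \<real>\<^sub>\<ge>\<^sub>0" and disc: "0 \<in> discrete_spectrum H"
begin

lemma shift_sqrt_exists: "\<exists>R1 X1. sqrt_of_selfadjoint (shift_op H 1) R1 X1"
proof (rule sqrt_of_selfadjoint_exists[OF selfadjoint_shift_op[OF T]])
  fix x assume "x \<in> dom (shift_op H 1)"
  then have x: "x \<in> dom H" by (simp add: dom_shift_op)
  then show "0 \<le> Re (cinner (the (shift_op H 1 x)) x)"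
    using selfadjoint_nonneg[OF T sp x] by (simp add: the_shift_op scaleC_one cinner_add_left Re_cinner_self)
next
  have "- 2 \<notin> (\<real>\<^sub>\<ge>\<^sub>0 :: complex set)" by (simp add: complex_nonneg_Reals_iff)
  then have "- 2 \<in> resolvent_set H" using sp by (auto simp: spectrum_def)
  moreover have "the (shift_op H 1 x) - complex_of_real (- 1) *\<^sub>C x = the (H x) - (- 2) *\<^sub>C x" if "x \<in> dom H" for x
  proof -
    have "(2::complex) *\<^sub>C x = x + x" using scaleC_add_left[of 1 1 x] by (simp add: scaleC_one)
    then show ?thesis using that by (simp add: the_shift_op scaleC.minus_left scaleC_one add.assoc)
  qed
  ultimately show "complex_of_real (- 1) \<in> resolvent_set (shift_op H 1)"
    unfolding resolvent_set_def dom_shift_op by (simp cong: bij_betw_cong)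
qed

text \<open>\<open>dom H\<close> is a core of both roots, and on it the squared norms of their
  values differ by \<open>|x|^2\<close>; closing up gives the same domain and the same
  identity.\<close>

lemma Hplus_eq: "Hplus H = dom S"
  and norm_plus_sq: "\<xi> \<in> dom S \<Longrightarrow> (norm_plus H \<xi>)\<^sup>2 = (norm (the (S \<xi>)))\<^sup>2 + (norm \<xi>)\<^sup>2"
proof -
  obtain R1 X1 where "sqrt_of_selfadjoint (shift_op H 1) R1 X1" using shift_sqrt_exists by blast
  then interpret sh: sqrt_of_selfadjoint "shift_op H 1" R1 X1 .
  have dH: "complex_vector.subspace (dom H)" by (rule selfadjointD(1)[OF T])
  have HS: "x \<in> dom S" "x \<in> dom sh.S" if "x \<in> dom H" for x
    using S_norm[OF that] sh.S_norm[of x] that by (auto simp: dom_shift_op)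
  have nrm: "(norm (the (sh.S x)))\<^sup>2 = (norm (the (S x)))\<^sup>2 + (norm x)\<^sup>2" if x: "x \<in> dom H" for x
  proof -
    have "complex_of_real ((norm (the (sh.S x)))\<^sup>2) = cinner (the (H x)) x + cinner x x"
      using sh.S_norm[of x] x by (simp add: dom_shift_op the_shift_op scaleC_one cinner_add_left)
    also have "\<dots> = complex_of_real ((norm (the (S x)))\<^sup>2 + (norm x)\<^sup>2)"
      using S_norm[OF x] by (simp add: cinner_self)
    finally show ?thesis by (simp only: of_real_eq_iff)
  qed
  have fwd: "y \<in> dom sh.S \<and> (norm (the (sh.S y)))\<^sup>2 = (norm (the (S y)))\<^sup>2 + (norm y)\<^sup>2" if y: "y \<in> dom S" for y
  proof -
    obtain f where f: "\<And>n. f n \<in> dom H" "f \<longlonglongrightarrow> y" "(\<lambda>n. the (S (f n))) \<longlonglongrightarrow> the (S y)"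
      using S_core[OF y] by blast
    note tr = selfadjoint_graph_transfer[OF S_selfadjoint sh.S_selfadjoint dH _ _ _ f]
    have 1: "y \<in> dom sh.S" "(\<lambda>n. the (sh.S (f n))) \<longlonglongrightarrow> the (sh.S y)"
      by (rule tr; use HS nrm in auto)+
    have "(\<lambda>n. (norm (the (sh.S (f n))))\<^sup>2) \<longlonglongrightarrow> (norm (the (sh.S y)))\<^sup>2" by (intro tendsto_intros 1)
    moreover have "(\<lambda>n. (norm (the (S (f n))))\<^sup>2 + (norm (f n))\<^sup>2) \<longlonglongrightarrow> (norm (the (S y)))\<^sup>2 + (norm y)\<^sup>2"
      by (intro tendsto_intros f)
    ultimately show ?thesis using 1 nrm[OF f(1)] LIMSEQ_unique by simp
  qed
  have bwd: "y \<in> dom S" if y: "y \<in> dom sh.S" for y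
  proof -
    obtain f where f: "\<And>n. f n \<in> dom H" "f \<longlonglongrightarrow> y" "(\<lambda>n. the (sh.S (f n))) \<longlonglongrightarrow> the (sh.S y)"
      using sh.S_core[OF y] unfolding dom_shift_op by blast
    show ?thesis
      by (rule selfadjoint_graph_transfer(1)[OF sh.S_selfadjoint S_selfadjoint dH _ _ _ f]) (use HS nrm in auto)
  qed
  show "Hplus H = dom S" unfolding Hplus_def sh.sqrt_op_eq using fwd bwd by blast
  show "(norm_plus H \<xi>)\<^sup>2 = (norm (the (S \<xi>)))\<^sup>2 + (norm \<xi>)\<^sup>2" if "\<xi> \<in> dom S"
    unfolding norm_plus_def sh.sqrt_op_eq using fwd[OF that] by blast
qed

lemma norm_plus_nonneg: "0 \<le> norm_plus H \<xi>"
  by (simp add: norm_plus_def)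

lemma norm_le_norm_plus: "\<xi> \<in> dom S \<Longrightarrow> norm \<xi> \<le> norm_plus H \<xi>"
  by (rule power2_le_imp_le) (simp_all add: norm_plus_sq norm_plus_nonneg)

lemmas S_sub = selfadjointD(1)[OF S_selfadjoint] and S_dense = selfadjointD(2)[OF S_selfadjoint]
  and S_add = selfadjointD(3)[OF S_selfadjoint] and S_scale = selfadjointD(4)[OF S_selfadjoint]
  and S_sym = selfadjointD(5)[OF S_selfadjoint] and S_diff = selfadjoint_diff[OF S_selfadjoint]

section \<open>The kernel of \<open>H\<close>, its complement and the spectral gap\<close>

definition Ker :: "'a set" where "Ker = ker_op H"

definition G :: "'a set" where "G = orth_compl Ker"

lemma ker_iff: "w \<in> Ker \<longleftrightarrow> R w = w"
proof -
  have "w \<in> Ker \<longleftrightarrow> H w = Some 0" by (auto simp: Ker_def)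
  then show ?thesis by (simp add: T_iff)
qed

lemma subspace_ker: "complex_vector.subspace (Ker)"
  by (auto simp: complex_vector.subspace_def ker_iff Rs)

lemma closed_ker: "closed (Ker)"
  unfolding closed_sequential_limits ker_iff
proof (intro allI impI)
  fix x l assume a: "(\<forall>n. R (x n) = x n) \<and> x \<longlonglongrightarrow> l"
  then have "(\<lambda>n. R (x n)) \<longlonglongrightarrow> R l" by (intro bounded_op_tendsto[OF Rb]) simp
  moreover have "(\<lambda>n. R (x n)) \<longlonglongrightarrow> l" using a by simp
  ultimately show "R l = l" by (rule LIMSEQ_unique)
qed

lemma G_ker: "x \<in> G \<Longrightarrow> k \<in> Ker \<Longrightarrow> cinner x k = 0"
  unfolding G_def by (rule mem_orth_complD)

lemma G_Int_ker: "x \<in> G \<Longrightarrow> x \<in> Ker \<Longrightarrow> x = 0"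
  unfolding G_def using orth_compl_Int by blast

lemma G_sub: "complex_vector.subspace G" and G_closed: "closed G"
  unfolding G_def by (rule subspace_orth_compl closed_orth_compl)+

lemma X_ker: assumes k: "k \<in> Ker" shows "X k = 0"
proof -
  have "cinner (X k) (X k) = cinner (X (X k)) k" by (simp add: Xsym)
  also have "X (X k) = 0" using k unfolding ker_iff by (simp add: XX)
  finally show ?thesis by (simp add: cinner_self cinner.zero_left)
qed

lemma S_ker: "k \<in> Ker \<Longrightarrow> S k = Some 0"
  by (simp add: S_iff X_ker Rs)

lemma S_zero_ker: assumes "S w = Some 0" shows "w \<in> Ker"
proof -
  have "R w - R (R w) = 0" using assms XX[of w] by (simp add: S_iff Rs Xs)
  then have "R w = R (R w)" by simp
  then show ?thesis unfolding ker_iff using R_inj by metis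
qed

lemma G_I: "(\<And>k. k \<in> Ker \<Longrightarrow> cinner x k = 0) \<Longrightarrow> x \<in> G"
  unfolding G_def orth_compl_def by blast

lemma R_G: "x \<in> G \<Longrightarrow> R x \<in> G"
  by (rule G_I) (simp add: ker_iff Rsym G_ker)

lemma X_G: "x \<in> G \<Longrightarrow> X x \<in> G"
  by (rule G_I) (simp add: Xsym X_ker cinner.zero_right)

lemma S_G: assumes "\<xi> \<in> dom S" shows "the (S \<xi>) \<in> G"
proof (rule G_I)
  fix k assume k: "k \<in> Ker"
  then have "k \<in> dom S" using S_ker by blast
  then show "cinner (the (S \<xi>)) k = 0" using S_sym[OF assms] S_ker[OF k] by (simp add: cinner.zero_right)
qed

text \<open>If no spectrum lies in the open interval from \<open>0\<close> to
  \<open>\<epsilon>\<close>, the resolvent bound at the midpoint with radius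
  \<open>\<epsilon> / 2\<close> becomes, after squaring, \<open>|H x|^2 \<ge> \<epsilon>\<close>
  times the form of \<open>H\<close> at \<open>x\<close>. Inserting \<open>R x\<close> and
  \<open>H R = 1 - R\<close> gives the bounded version with
  \<open>\<eta> = \<epsilon> / (1 + \<epsilon>)\<close>.\<close>

lemma spectral_gap: "\<exists>\<eta>>0. \<eta> < 1 \<and> (\<forall>x. \<eta> * Re (cinner (x - R x) x) \<le> (norm (x - R x))\<^sup>2)"
proof -
  have "0 isolated_in spectrum H" using disc by (simp add: discrete_spectrum_def)
  then obtain \<epsilon> where \<epsilon>: "\<epsilon> > 0" "\<And>y. y \<in> spectrum H \<Longrightarrow> dist 0 y < \<epsilon> \<Longrightarrow> y = 0"
    unfolding isolated_in_dist_Ex_iff by blast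
  have bound: "(norm (the (H x)))\<^sup>2 \<ge> \<epsilon> * Re (cinner (the (H x)) x)" if x: "x \<in> dom H" for x
  proof -
    have "\<epsilon> / 2 * norm x \<le> norm (the (H x) - complex_of_real (\<epsilon> / 2) *\<^sub>C x)"
    proof (rule selfadjoint_resolvent_bound[OF T _ _ x])
      fix t assume "\<bar>t - \<epsilon> / 2\<bar> < \<epsilon> / 2"
      then have "0 < t" "t < \<epsilon>" unfolding abs_less_iff by linarith+
      then show "complex_of_real t \<in> resolvent_set H"
        using \<epsilon>(2)[of "complex_of_real t"] by (auto simp: spectrum_def dist_norm)
    qed (use \<epsilon> in simp)
    then have "(\<epsilon> / 2 * norm x)\<^sup>2 \<le> (norm (the (H x) - complex_of_real (\<epsilon> / 2) *\<^sub>C x))\<^sup>2"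
      using \<epsilon> by (intro power_mono) auto
    also have "\<dots> = (norm (the (H x)))\<^sup>2 - \<epsilon> * Re (cinner (the (H x)) x) + (\<epsilon> / 2 * norm x)\<^sup>2"
    proof -
      have 1: "norm (complex_of_real (\<epsilon> / 2) *\<^sub>C x) = \<epsilon> / 2 * norm x"
        unfolding norm_scaleC norm_of_real using \<epsilon>(1) by simp
      have 2: "cinner (the (H x)) (complex_of_real (\<epsilon> / 2) *\<^sub>C x) = complex_of_real (\<epsilon> / 2) * cinner (the (H x)) x"
        by (simp add: cinner_scaleC_right)
      show ?thesis unfolding norm_diff_sq 1 2 by simp
    qed
    finally show ?thesis by simp
  qed
  have "\<epsilon> / (1 + \<epsilon>) * Re (cinner (x - R x) x) \<le> (norm (x - R x))\<^sup>2" for x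
  proof -
    have "\<epsilon> * Re (cinner (x - R x) (R x)) \<le> (norm (x - R x))\<^sup>2"
      using bound[of "R x"] T_R[of x] by auto
    moreover have "Re (cinner (x - R x) (R x)) = Re (cinner (x - R x) x) - (norm (x - R x))\<^sup>2"
      unfolding Re_cinner_self[symmetric] by (simp add: cinner.diff_right)
    ultimately have "\<epsilon> * Re (cinner (x - R x) x) \<le> (1 + \<epsilon>) * (norm (x - R x))\<^sup>2"
      by (simp add: algebra_simps)
    then show ?thesis using \<epsilon>(1) by (simp add: pos_divide_le_eq mult.commute)
  qed
  moreover have "\<epsilon> / (1 + \<epsilon>) > 0" "\<epsilon> / (1 + \<epsilon>) < 1" using \<epsilon>(1) by simp_all
  ultimately show ?thesis by blast
qed

text \<open>For \<open>N = 1 - R\<close> the gap reads \<open>N^2 \<ge> \<eta> N\<close>. This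
  becomes \<open>N \<ge> \<eta>\<close> on the range of \<open>N\<close> and, by continuity, on its
  closure, which contains \<open>G\<close>.\<close>

lemma gap_on_G: "\<exists>\<eta>>0. \<eta> < 1 \<and> (\<forall>z\<in>G. \<eta> * (norm z)\<^sup>2 \<le> Re (cinner (z - R z) z))"
proof -
  obtain \<eta> where \<eta>: "\<eta> > 0" "\<eta> < 1" and gap: "\<And>x. \<eta> * Re (cinner (x - R x) x) \<le> (norm (x - R x))\<^sup>2"
    using spectral_gap by blast
  define N where "N = (\<lambda>x. x - R x)"
  have Nb: "bounded_op N" unfolding N_def by (intro bounded_op_diff bounded_op_id Rb)
  note Ns = bounded_op_simps[OF Nb]
  have Nsym: "cinner (N x) y = cinner x (N y)" for x y by (simp add: N_def cinner_simps Rsym)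
  have N0: "0 \<le> Re (cinner (N x) x)" for x
  proof -
    have "cinner (N x) x = cinner (N x) (R x) + cinner (N x) (N x)" by (simp add: N_def cinner_simps)
    moreover have "0 \<le> Re (cinner (N x) (R x))"
      using selfadjoint_nonneg[OF T sp, of "R x"] T_R[of x] by (auto simp: N_def)
    ultimately show ?thesis by (simp add: Re_cinner_self)
  qed
  have psd: "psd_form_on UNIV (\<lambda>x y. cinner (N x) y)"
    by (rule psd_form_on_operator[OF Nb Nsym complex_vector.subspace_UNIV N0])
  \<comment> \<open>Cauchy-Schwarz for the form of \<open>N\<close> at the pair \<open>x\<close>,
    \<open>N x\<close>, combined with the gap at \<open>x\<close>.\<close>
  have rng: "\<eta> * (norm (N x))\<^sup>2 \<le> Re (cinner (N (N x)) (N x))" for x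
  proof (cases "N x = 0")
    case False
    define a where "a = (norm (N x))\<^sup>2"
    define b where "b = Re (cinner (N (N x)) (N x))"
    have a: "a > 0" using False by (simp add: a_def)
    have b: "b \<ge> 0" using N0 by (simp add: b_def)
    have "a\<^sup>2 = (cmod (cinner (N x) (N x)))\<^sup>2" by (simp add: a_def cinner_self norm_power)
    also have "\<dots> \<le> Re (cinner (N x) x) * b"
      unfolding b_def by (rule psd_form_Cauchy_Schwarz[OF psd]) simp_all
    finally have "\<eta> * a\<^sup>2 \<le> (\<eta> * Re (cinner (N x) x)) * b" using \<eta>(1) by (simp add: mult.assoc)
    also have "\<dots> \<le> a * b" using gap[of x] b by (intro mult_right_mono) (simp_all add: N_def a_def)
    finally have "a * (\<eta> * a) \<le> a * b" by (simp add: power2_eq_square mult.left_commute)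
    then show ?thesis using a by (simp add: a_def b_def)
  qed (simp add: Ns cinner.zero_left)
  define M where "M = closure (range N)"
  have rs: "complex_vector.subspace (range N)"
    unfolding complex_vector.subspace_def
    by (metis (no_types, lifting) Ns(1) Ns(2) Ns(3) rangeE rangeI)
  have M: "complex_vector.subspace M" "closed M" unfolding M_def using closure_subspaceC[OF rs] by auto
  have "\<eta> * (norm z)\<^sup>2 \<le> Re (cinner (N z) z)" if z: "z \<in> G" for z
  proof -
    \<comment> \<open>The component of \<open>z\<close> orthogonal to the range of \<open>N\<close>
      lies in the kernel of \<open>H\<close> and also in \<open>G\<close>; so it vanishes and
      \<open>z\<close> is a limit of vectors \<open>N x\<close>.\<close>
    obtain m where m: "m \<in> M" "z - m \<in> orth_compl M" using orthogonal_projection_exists[OF M] by blast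
    have "cinner (N (z - m)) y = 0" for y
    proof -
      have "N y \<in> M" unfolding M_def using closure_subset by (intro subsetD[OF closure_subset] rangeI)
      then show ?thesis using mem_orth_complD[OF m(2), of "N y"] by (simp add: Nsym)
    qed
    then have "N (z - m) = 0" by (intro cinner_all_eq) (simp add: cinner.zero_left)
    then have ker: "z - m \<in> Ker" unfolding ker_iff N_def by simp
    have "range N \<subseteq> G"
    proof (intro subsetI)
      fix w assume "w \<in> range N"
      then obtain y where y: "w = N y" by blast
      show "w \<in> G"
      proof (rule G_I)
        fix k assume "k \<in> Ker"
        then have "N k = 0" by (simp only: ker_iff N_def) simp
        then show "cinner w k = 0" by (simp add: y Nsym cinner.zero_right)
      qed
    qed
    then have "M \<subseteq> G" unfolding M_def by (rule closure_minimal[OF _ G_closed])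
    then have "z - m \<in> G" using m(1) z G_sub by (intro complex_vector.subspace_diff) auto
    then have "z = m" using G_Int_ker ker by force
    then have "z \<in> closure (range N)" using m(1) by (simp add: M_def)
    then obtain f where f: "\<And>n. f n \<in> range N" "f \<longlonglongrightarrow> z" unfolding closure_sequential by blast
    have "\<eta> * (norm (f n))\<^sup>2 \<le> Re (cinner (N (f n)) (f n))" for n using f(1)[of n] rng by auto
    moreover have "(\<lambda>n. \<eta> * (norm (f n))\<^sup>2) \<longlonglongrightarrow> \<eta> * (norm z)\<^sup>2" by (intro tendsto_intros f)
    moreover have "(\<lambda>n. Re (cinner (N (f n)) (f n))) \<longlonglongrightarrow> Re (cinner (N z) z)"
      by (intro tendsto_Re cinner.tendsto bounded_op_tendsto[OF Nb] f)
    ultimately show ?thesis by (intro LIMSEQ_le) auto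
  qed
  then show ?thesis using \<eta> by (auto simp: N_def)
qed

text \<open>On \<open>G = (ker H)\<^sup>\<bottom>\<close> the operator \<open>1 - R\<close> is invertible, since \<open>R\<close> is a contraction there; the
  solution \<open>p\<close> of \<open>(1 - R) p = X x\<close> then satisfies \<open>X p = R x\<close>, that is \<open>H\<^bsup>1/2\<^esup> p = x\<close>.\<close>

lemma S_onto_G: "\<exists>C\<ge>0. \<forall>x\<in>G. \<exists>p\<in>G. S p = Some x \<and> norm p \<le> C * norm x"
proof -
  obtain \<eta> where \<eta>: "\<eta> > 0" "\<eta> < 1" and gap: "\<And>z. z \<in> G \<Longrightarrow> \<eta> * (norm z)\<^sup>2 \<le> Re (cinner (z - R z) z)"
    using gap_on_G by blast
  have Rup: "Re (cinner (R z) z) \<le> (1 - \<eta>) * (norm z)\<^sup>2" if "z \<in> G" for z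
    using gap[OF that] by (simp add: cinner.diff_left Re_cinner_self algebra_simps)
  have Rn: "norm (R z) \<le> (1 - \<eta>) * norm z" if z: "z \<in> G" for z
  proof (rule power2_le_imp_le)
    have "(norm (R z))\<^sup>2 \<le> (1 - \<eta>) * Re (cinner (R z) z)"
      by (rule psd_operator_norm_sq_le[OF Rb Rsym G_sub R_G positive_op_nonneg[OF R] Rup z])
    also have "\<dots> \<le> (1 - \<eta>) * ((1 - \<eta>) * (norm z)\<^sup>2)" using \<eta> Rup[OF z] by (intro mult_left_mono) auto
    finally show "(norm (R z))\<^sup>2 \<le> ((1 - \<eta>) * norm z)\<^sup>2"
      by (simp add: power_mult_distrib power2_eq_square[of "1 - \<eta>"] mult.assoc)
  qed (use \<eta> in simp)
  obtain K where K: "K > 0" "\<And>x. norm (X x) \<le> K * norm x" using bounded_op_pos_bound[OF Xb] by blast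
  have "\<exists>p\<in>G. S p = Some x \<and> norm p \<le> (K / \<eta>) * norm x" if x: "x \<in> G" for x
  proof -
    have "\<exists>!p\<in>G. X x + R p = p"
    proof (rule Banach_fix[of G "1 - \<eta>" "\<lambda>p. X x + R p"])
      show "complete G" using G_closed by (simp add: complete_eq_closed)
      show "G \<noteq> {}" using x by blast
      show "(\<lambda>p. X x + R p) ` G \<subseteq> G" using X_G[OF x] R_G G_sub by (auto intro: complex_vector.subspace_add)
      fix p q assume "p \<in> G" "q \<in> G"
      then have "p - q \<in> G" using G_sub by (intro complex_vector.subspace_diff)
      then show "dist (X x + R p) (X x + R q) \<le> (1 - \<eta>) * dist p q"
        using Rn[of "p - q"] by (simp add: dist_norm Rs)
    qed (use \<eta> in auto)
    then obtain p where p: "p \<in> G" "X x + R p = p" by blast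
    \<comment> \<open>Applying \<open>X\<close> to the fixed point equation shows
      \<open>R w = w\<close>, so the defect \<open>w\<close> lies in the kernel; it also lies in
      \<open>G\<close>, hence is \<open>0\<close>.\<close>
    define w where "w = X p - R x"
    have "X (X x) = X p - X (R p)"
    proof -
      have "X p = X (X x) + X (R p)" by (subst p(2)[symmetric]) (simp add: Xs)
      then show ?thesis by simp
    qed
    then have "R w = w" unfolding w_def by (simp add: Rs XX XR algebra_simps)
    then have "w \<in> Ker" by (simp only: ker_iff)
    moreover have "w \<in> G" unfolding w_def using X_G[OF p(1)] R_G[OF x] G_sub by (intro complex_vector.subspace_diff)
    ultimately have "w = 0" using G_Int_ker by blast
    then have Sp: "S p = Some x" by (simp add: S_iff w_def)
    have "norm p \<le> norm (X x) + norm (R p)" using norm_triangle_ineq[of "X x" "R p"] p(2) by simp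
    then have "\<eta> * norm p \<le> K * norm x" using Rn[OF p(1)] K(2)[of x] by (simp add: algebra_simps)
    then have "norm p \<le> (K / \<eta>) * norm x" using \<eta>(1) by (simp add: pos_le_divide_eq mult.commute)
    then show ?thesis using p(1) Sp by blast
  qed
  moreover have "0 \<le> K / \<eta>" using K \<eta> by simp
  ultimately show ?thesis by blast
qed

section \<open>The partial inverse of the square root\<close>

definition inv_sqrt_rel :: "'a \<Rightarrow> 'a \<Rightarrow> bool" where
  "inv_sqrt_rel x p \<longleftrightarrow> p \<in> G \<and> (\<exists>k\<in>Ker. x - k \<in> G \<and> S p = Some (x - k))"

lemma inv_sqrt_rel_unique:
  assumes "inv_sqrt_rel x p" "inv_sqrt_rel x q" shows "p = q"
proof -
  obtain k l where k: "p \<in> G" "k \<in> Ker" "x - k \<in> G" "S p = Some (x - k)"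
    and l: "q \<in> G" "l \<in> Ker" "x - l \<in> G" "S q = Some (x - l)"
    using assms unfolding inv_sqrt_rel_def by blast
  have "k - l \<in> Ker" using k(2) l(2) by (rule complex_vector.subspace_diff[OF subspace_ker])
  moreover have "k - l \<in> G" using complex_vector.subspace_diff[OF G_sub l(3) k(3)] by simp
  ultimately have "k = l" using G_Int_ker by force
  have pq: "p \<in> dom S" "q \<in> dom S" using k(4) l(4) by blast+
  have "S (p - q) = Some 0"
    using S_diff[OF pq] k(4) l(4) \<open>k = l\<close> by auto
  then have "p - q \<in> Ker" by (rule S_zero_ker)
  moreover have "p - q \<in> G" using k(1) l(1) by (rule complex_vector.subspace_diff[OF G_sub])
  ultimately show "p = q" using G_Int_ker by force
qed

lemma inv_sqrt_rel_exists: "\<exists>C\<ge>0. \<forall>x. \<exists>p. inv_sqrt_rel x p \<and> norm p \<le> C * norm x"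
proof -
  obtain C where C: "C \<ge> 0" "\<And>x. x \<in> G \<Longrightarrow> \<exists>p\<in>G. S p = Some x \<and> norm p \<le> C * norm x"
    using S_onto_G by blast
  have "\<exists>p. inv_sqrt_rel x p \<and> norm p \<le> C * norm x" for x
  proof -
    obtain k where k: "k \<in> Ker" "x - k \<in> G"
      using orthogonal_projection_exists[OF subspace_ker closed_ker, of x] unfolding G_def by blast
    obtain p where p: "p \<in> G" "S p = Some (x - k)" "norm p \<le> C * norm (x - k)" using C(2)[OF k(2)] by blast
    have "(norm x)\<^sup>2 = (norm (x - k))\<^sup>2 + (norm k)\<^sup>2"
      using norm_add_sq[of "x - k" k] G_ker[OF k(2,1)] by simp
    then have "(norm (x - k))\<^sup>2 \<le> (norm x)\<^sup>2" by simp
    then have "norm (x - k) \<le> norm x" by (rule power2_le_imp_le) simp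
    then have "norm p \<le> C * norm x" using p(3) C(1) by (meson mult_left_mono order_trans)
    then show ?thesis using p k unfolding inv_sqrt_rel_def by blast
  qed
  then show ?thesis using C(1) by blast
qed

lemma inv_sqrt_rel_add:
  assumes "inv_sqrt_rel x p" "inv_sqrt_rel y q" shows "inv_sqrt_rel (x + y) (p + q)"
proof -
  obtain k l where k: "p \<in> G" "k \<in> Ker" "x - k \<in> G" "S p = Some (x - k)"
    and l: "q \<in> G" "l \<in> Ker" "y - l \<in> G" "S q = Some (y - l)"
    using assms unfolding inv_sqrt_rel_def by blast
  have e: "x + y - (k + l) = (x - k) + (y - l)" by simp
  have pq: "p \<in> dom S" "q \<in> dom S" using k(4) l(4) by blast+
  have "S (p + q) = Some ((x - k) + (y - l))"
    using complex_vector.subspace_add[OF S_sub pq] S_add[OF pq] k(4) l(4) by auto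
  then show ?thesis unfolding inv_sqrt_rel_def
    using complex_vector.subspace_add[OF G_sub] complex_vector.subspace_add[OF subspace_ker] k l
    by (intro conjI bexI[of _ "k + l"]) (simp_all only: e)
qed

lemma inv_sqrt_rel_scale:
  assumes "inv_sqrt_rel x p" shows "inv_sqrt_rel (c *\<^sub>C x) (c *\<^sub>C p)"
proof -
  obtain k where k: "p \<in> G" "k \<in> Ker" "x - k \<in> G" "S p = Some (x - k)"
    using assms unfolding inv_sqrt_rel_def by blast
  have e: "c *\<^sub>C x - c *\<^sub>C k = c *\<^sub>C (x - k)" by (simp add: scaleC.diff_right)
  have p: "p \<in> dom S" using k(4) by blast
  have "S (c *\<^sub>C p) = Some (c *\<^sub>C (x - k))"
    using complex_vector.subspace_scale[OF S_sub p, of c] S_scale[OF p, of c] k(4) by auto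
  then show ?thesis unfolding inv_sqrt_rel_def
    using complex_vector.subspace_scale[OF G_sub] complex_vector.subspace_scale[OF subspace_ker] k
    by (intro conjI bexI[of _ "c *\<^sub>C k"]) (simp_all only: e)
qed

text \<open>The relation splits \<open>x\<close> into a kernel part \<open>k\<close> and a part in
  \<open>G\<close> and inverts \<open>S\<close> on the latter. It is single valued and compatible
  with the linear operations, so it defines a linear map; the defining properties of
  \<open>inv_sqrt\<close> fix such a map on the kernel and on \<open>G\<close>, hence
  everywhere.\<close>

lemma inv_sqrt_rel_iff: "inv_sqrt_rel x (inv_sqrt H x)"
  and inv_sqrt_clinear: "clinear (inv_sqrt H)"
proof -
  define P where "P x = (THE p. inv_sqrt_rel x p)" for x
  have P: "inv_sqrt_rel x (P x)" for x
    unfolding P_def using inv_sqrt_rel_exists inv_sqrt_rel_unique by (metis the_equality)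
  have Peq: "P x = p" if "inv_sqrt_rel x p" for x p
    using inv_sqrt_rel_unique[OF P that] .
  have Plin: "clinear P" unfolding clinear_iff
    using Peq[OF inv_sqrt_rel_add[OF P P]] Peq[OF inv_sqrt_rel_scale[OF P]] by simp
  have G0: "0 \<in> G" by (rule complex_vector.subspace_0[OF G_sub])
  have K0: "0 \<in> Ker" by (rule complex_vector.subspace_0[OF subspace_ker])
  have Pker: "P x = 0" if "x \<in> Ker" for x
    by (rule Peq) (use that G0 S_ker[OF K0] in \<open>auto simp: inv_sqrt_rel_def intro!: bexI[of _ x]\<close>)
  have PG: "P x \<in> G \<and> S (P x) = Some x" if x: "x \<in> G" for x
  proof -
    obtain p where p: "p \<in> G" "S p = Some x" using S_onto_G x by blast
    have "P x = p" by (rule Peq) (use p x K0 in \<open>auto simp: inv_sqrt_rel_def intro!: bexI[of _ 0]\<close>)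
    then show ?thesis using p by simp
  qed
  have "inv_sqrt H = P"
    unfolding inv_sqrt_def Ker_def[symmetric] G_def[symmetric] sqrt_op_eq
  proof (rule the_equality)
    show "clinear P \<and> (\<forall>x\<in>Ker. P x = 0) \<and> (\<forall>x\<in>G. P x \<in> G \<and> S (P x) = Some x)"
      using Plin Pker PG by blast
    fix Q assume Q: "clinear Q \<and> (\<forall>x\<in>Ker. Q x = 0) \<and> (\<forall>x\<in>G. Q x \<in> G \<and> S (Q x) = Some x)"
    show "Q = P"
    proof
      fix x
      obtain k where k: "k \<in> Ker" "x - k \<in> G" using P[of x] unfolding inv_sqrt_rel_def by blast
      have "Q x = Q (x - k)" using clinear_simps(4)[of Q x k] Q k(1) by simp
      then have "inv_sqrt_rel x (Q x)" unfolding inv_sqrt_rel_def using Q k by auto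
      then show "Q x = P x" using Peq by simp
    qed
  qed
  then show "inv_sqrt_rel x (inv_sqrt H x)" "clinear (inv_sqrt H)" using P Plin by simp_all
qed

lemma inv_sqrt_bounded: "\<exists>C\<ge>0. \<forall>x. norm (inv_sqrt H x) \<le> C * norm x"
  using inv_sqrt_rel_exists inv_sqrt_rel_unique[OF inv_sqrt_rel_iff] by metis

lemma inv_sqrt_dom: "inv_sqrt H x \<in> dom S"
  using inv_sqrt_rel_iff[of x] unfolding inv_sqrt_rel_def by blast+

lemma S_inv_sqrt: assumes "x \<in> G" shows "S (inv_sqrt H x) = Some x"
proof -
  obtain k where k: "k \<in> Ker" "x - k \<in> G" "S (inv_sqrt H x) = Some (x - k)"
    using inv_sqrt_rel_iff[of x] unfolding inv_sqrt_rel_def by blast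
  have "k \<in> G" using complex_vector.subspace_diff[OF G_sub assms k(2)] by simp
  then show ?thesis using k G_Int_ker by force
qed

lemma inv_sqrt_S: assumes "\<xi> \<in> G" "\<xi> \<in> dom S" shows "inv_sqrt H (the (S \<xi>)) = \<xi>"
proof (rule inv_sqrt_rel_unique[OF inv_sqrt_rel_iff])
  show "inv_sqrt_rel (the (S \<xi>)) \<xi>"
    unfolding inv_sqrt_rel_def using assms S_G[OF assms(2)] complex_vector.subspace_0[OF subspace_ker]
    by (intro conjI bexI[of _ 0]) auto
qed

lemma inv_sqrt_ker: assumes "k \<in> Ker" shows "inv_sqrt H k = 0"
proof (rule inv_sqrt_rel_unique[OF inv_sqrt_rel_iff])
  show "inv_sqrt_rel k 0"
    unfolding inv_sqrt_rel_def
    using assms complex_vector.subspace_0[OF subspace_ker] complex_vector.subspace_0[OF G_sub] S_ker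
    by (intro conjI bexI[of _ k]) auto
qed

text \<open>\<open>S\<close> after \<open>inv_sqrt H\<close> is the orthogonal projection onto
  \<open>G\<close>, which drops the kernel part \<open>k\<close>.\<close>

lemma norm_S_inv_sqrt: "norm (the (S (inv_sqrt H x))) \<le> norm x"
proof -
  obtain k where k: "k \<in> Ker" "x - k \<in> G" "S (inv_sqrt H x) = Some (x - k)"
    using inv_sqrt_rel_iff[of x] unfolding inv_sqrt_rel_def by blast
  have "(norm x)\<^sup>2 = (norm (x - k))\<^sup>2 + (norm k)\<^sup>2"
    using norm_add_sq[of "x - k" k] G_ker[OF k(2,1)] by simp
  then have "(norm (x - k))\<^sup>2 \<le> (norm x)\<^sup>2" by simp
  then have "norm (x - k) \<le> norm x" by (rule power2_le_imp_le) simp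
  then show ?thesis using k(3) by simp
qed

lemma finite_span_ker: "\<exists>B. finite B \<and> Ker \<subseteq> complex_vector.span B"
proof -
  have "eigenspace H 0 = Ker" by (auto simp: eigenspace_def Ker_def)
  then show ?thesis using disc by (simp add: discrete_spectrum_def cfinite_dim_def)
qed

end

lemma zero_in_discrete_spectrum_exists:
  assumes "selfadjoint_op H" "spectrum H \<subseteq> \<real>\<^sub>\<ge>\<^sub>0" "0 \<in> discrete_spectrum H"
  shows "\<exists>R X. zero_in_discrete_spectrum H R X"
proof -
  have "complex_of_real (- 1) \<in> resolvent_set H"
    using assms(2) by (auto simp: spectrum_def complex_nonneg_Reals_iff)
  then obtain R X where "sqrt_of_selfadjoint H R X"
    using sqrt_of_selfadjoint_exists[OF assms(1) selfadjoint_nonneg[OF assms(1,2)]] by blast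
  then have "zero_in_discrete_spectrum H R X"
    using assms(2,3) by (simp add: zero_in_discrete_spectrum_def zero_in_discrete_spectrum_axioms_def)
  then show ?thesis by blast
qed

section \<open>The Birman-Schwinger principle\<close>

text \<open>Density of \<open>D\<close> makes the representing vector unique, so the definite
  description in \<open>form_op\<close> may be read as its defining property.\<close>

lemma form_op_Some_iff:
  assumes "closure D = UNIV"
  shows "form_op D q \<xi> = Some \<zeta> \<longleftrightarrow> \<xi> \<in> D \<and> (\<forall>\<eta>\<in>D. q \<xi> \<eta> = cinner \<zeta> \<eta>)"
proof -
  have uniq: "\<zeta> = \<zeta>'" if "\<forall>\<eta>\<in>D. q \<xi> \<eta> = cinner \<zeta> \<eta>" "\<forall>\<eta>\<in>D. q \<xi> \<eta> = cinner \<zeta>' \<eta>" for \<zeta> \<zeta>'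
    by (rule cinner_eq_dense[OF assms]) (use that in metis)
  have the: "(THE \<zeta>. \<forall>\<eta>\<in>D. q \<xi> \<eta> = cinner \<zeta> \<eta>) = \<zeta>" if "\<forall>\<eta>\<in>D. q \<xi> \<eta> = cinner \<zeta> \<eta>" for \<zeta>
    using that uniq by (intro the_equality) blast+
  show ?thesis
  proof (cases "\<xi> \<in> D \<and> (\<exists>\<zeta>. \<forall>\<eta>\<in>D. q \<xi> \<eta> = cinner \<zeta> \<eta>)")
    case True
    then obtain \<zeta>' where z: "\<forall>\<eta>\<in>D. q \<xi> \<eta> = cinner \<zeta>' \<eta>" by blast
    then have "form_op D q \<xi> = Some \<zeta>'" using True the unfolding form_op_def by presburger
    moreover have "(\<forall>\<eta>\<in>D. q \<xi> \<eta> = cinner \<zeta> \<eta>) \<longleftrightarrow> \<zeta>' = \<zeta>" using z uniq by blast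
    ultimately show ?thesis using True by simp
  next
    case False
    then show ?thesis unfolding form_op_def by auto
  qed
qed

text \<open>All but finitely many fibres over the negative reals are empty; the sum collapses to the
  values actually taken and counts every index once.\<close>

lemma infsum_enat_card_fibers:
  fixes t :: "nat \<Rightarrow> real"
  assumes "\<And>i. i < r \<Longrightarrow> t i < 0"
  shows "(\<Sum>\<^sub>\<infinity>s\<in>{..<0}. enat (card {i. i < r \<and> t i = s})) = enat r"
proof -
  let ?g = "\<lambda>s. enat (card {i. i < r \<and> t i = s})"
  have zero: "?g s = 0" if "s \<notin> t ` {..<r}" for s
  proof -
    have "{i. i < r \<and> t i = s} = {}" using that by blast
    then show ?thesis by (simp add: zero_enat_def)
  qed
  have "infsum ?g {..<0} = infsum ?g (t ` {..<r})"
    by (rule infsum_cong_neutral) (use zero assms in auto)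
  also have "\<dots> = (\<Sum>s\<in>t ` {..<r}. ?g s)" by (rule infsum_finite) simp
  also have "\<dots> = enat (\<Sum>s\<in>t ` {..<r}. card {i. i < r \<and> t i = s})"
    by (simp only: of_nat_eq_enat[symmetric] of_nat_sum)
  also have "(\<Sum>s\<in>t ` {..<r}. card {i. i < r \<and> t i = s}) = (\<Sum>s\<in>t ` {..<r}. \<Sum>i\<in>{x. x \<in> {..<r} \<and> t x = s}. 1)"
    by simp
  also have "\<dots> = (\<Sum>i\<in>{..<r}. 1)" by (rule sum.image_gen[symmetric]) simp
  finally show ?thesis by simp
qed

lemma norm_diff_sq_le: "(norm (x - y))\<^sup>2 \<le> 2 * (norm x)\<^sup>2 + 2 * (norm (y::'a::chilbert_space))\<^sup>2"
  using parallelogram[of x y] zero_le_power2[of "norm (x + y)"] by linarith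

locale form_perturbation = zero_in_discrete_spectrum H R X
  for H :: "'a::chilbert_space \<rightharpoonup> 'a" and R X +
  fixes V :: "'a \<Rightarrow> 'a \<Rightarrow> complex" and e :: "nat \<Rightarrow> 'a" and l :: "nat \<Rightarrow> real"
  assumes V: "bounded_plus_minus H V" and Vs: "symmetric_form H V"
    and Vc: "form_compact H V" and Vn: "nonneg_form H V"
    and A: "positive_op (birman_schwinger H V)" and d: "diagonalizes (birman_schwinger H V) e l"
begin

abbreviation D :: "'a set" where "D \<equiv> dom S"
abbreviation S' :: "'a \<Rightarrow> 'a" where "S' \<xi> \<equiv> the (S \<xi>)"
abbreviation P :: "'a \<Rightarrow> 'a" where "P \<equiv> inv_sqrt H"
abbreviation A :: "'a \<Rightarrow> 'a" where "A \<equiv> birman_schwinger H V"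
abbreviation np :: "'a \<Rightarrow> real" where "np \<equiv> norm_plus H"

lemma D_add: "\<xi> \<in> D \<Longrightarrow> \<eta> \<in> D \<Longrightarrow> \<xi> + \<eta> \<in> D" and D_scale: "\<xi> \<in> D \<Longrightarrow> c *\<^sub>C \<xi> \<in> D"
  and D_diff: "\<xi> \<in> D \<Longrightarrow> \<eta> \<in> D \<Longrightarrow> \<xi> - \<eta> \<in> D"
  using S_sub complex_vector.subspace_add complex_vector.subspace_scale complex_vector.subspace_diff by blast+

lemma V_add: "\<xi> \<in> D \<Longrightarrow> \<xi>' \<in> D \<Longrightarrow> \<eta> \<in> D \<Longrightarrow> V (\<xi> + \<xi>') \<eta> = V \<xi> \<eta> + V \<xi>' \<eta>"
  and V_scale: "\<xi> \<in> D \<Longrightarrow> \<eta> \<in> D \<Longrightarrow> V (c *\<^sub>C \<xi>) \<eta> = c * V \<xi> \<eta>"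
  and V_Hminus: "\<xi> \<in> D \<Longrightarrow> V \<xi> \<in> Hminus H"
  using V unfolding bounded_plus_minus_def Hplus_eq by simp_all

lemma V_sym: "\<xi> \<in> D \<Longrightarrow> \<eta> \<in> D \<Longrightarrow> V \<xi> \<eta> = cnj (V \<eta> \<xi>)"
  using Vs unfolding symmetric_form_def Hplus_eq by blast

lemma V_add_right: "\<xi> \<in> D \<Longrightarrow> \<eta> \<in> D \<Longrightarrow> \<eta>' \<in> D \<Longrightarrow> V \<xi> (\<eta> + \<eta>') = V \<xi> \<eta> + V \<xi> \<eta>'"
  and V_scale_right: "\<xi> \<in> D \<Longrightarrow> \<eta> \<in> D \<Longrightarrow> V \<xi> (c *\<^sub>C \<eta>) = cnj c * V \<xi> \<eta>"
  using V_Hminus[of \<xi>] unfolding Hminus_def Hplus_eq by simp_all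

lemma V_nonneg: "\<xi> \<in> D \<Longrightarrow> 0 \<le> Re (V \<xi> \<xi>)"
  using Vn nonneg_Reals_Im_Re unfolding nonneg_form_def Hplus_eq by blast

lemma V_diff: assumes "\<xi> \<in> D" "\<xi>' \<in> D" "\<eta> \<in> D" shows "V (\<xi> - \<xi>') \<eta> = V \<xi> \<eta> - V \<xi>' \<eta>"
  using V_add[OF D_diff[OF assms(1,2)] assms(2,3)] by simp

lemma V_diff_right: assumes "\<xi> \<in> D" "\<eta> \<in> D" "\<eta>' \<in> D" shows "V \<xi> (\<eta> - \<eta>') = V \<xi> \<eta> - V \<xi> \<eta>'"
  using V_add_right[OF assms(1) D_diff[OF assms(2,3)] assms(3)] by simp

lemma np_scale: assumes "\<xi> \<in> D" shows "np (c *\<^sub>C \<xi>) = cmod c * np \<xi>"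
proof -
  have "(np (c *\<^sub>C \<xi>))\<^sup>2 = (cmod c * np \<xi>)\<^sup>2"
    unfolding power_mult_distrib norm_plus_sq[OF assms] norm_plus_sq[OF D_scale[OF assms]] S_scale[OF assms]
    by (simp add: norm_scaleC power_mult_distrib distrib_left)
  then show ?thesis by (simp add: norm_plus_nonneg power2_eq_iff_nonneg)
qed

text \<open>The supremum in \<open>norm_minus\<close> is meaningful only over a bounded set, which
  the bound in \<open>Hminus\<close> provides; homogeneity carries the estimate from the unit ball
  to all of \<open>D\<close>.\<close>

lemma Hminus_bound:
  assumes f: "f \<in> Hminus H" and \<eta>: "\<eta> \<in> D"
  shows "cmod (f \<eta>) \<le> norm_minus H f * np \<eta>"
proof -
  obtain K where K: "\<And>\<eta>. \<eta> \<in> D \<Longrightarrow> cmod (f \<eta>) \<le> K * np \<eta>"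
    and fs: "\<And>c \<eta>. \<eta> \<in> D \<Longrightarrow> f (c *\<^sub>C \<eta>) = cnj c * f \<eta>"
    using f unfolding Hminus_def Hplus_eq by blast
  let ?B = "{\<eta> \<in> D. np \<eta> \<le> 1}"
  have "bdd_above ((\<lambda>\<eta>. cmod (f \<eta>)) ` ?B)"
  proof (rule bdd_aboveI2)
    fix \<eta> assume \<eta>: "\<eta> \<in> ?B"
    have "cmod (f \<eta>) \<le> K * np \<eta>" using K \<eta> by blast
    also have "\<dots> \<le> \<bar>K\<bar> * 1" using \<eta> norm_plus_nonneg by (intro mult_mono) auto
    finally show "cmod (f \<eta>) \<le> \<bar>K\<bar> * 1" .
  qed
  then have up: "cmod (f \<eta>) \<le> norm_minus H f" if "\<eta> \<in> ?B" for \<eta>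
    unfolding norm_minus_def Hplus_eq using that by (intro cSUP_upper)
  show ?thesis
  proof (cases "np \<eta> = 0")
    case True
    then show ?thesis using K[OF \<eta>] by simp
  next
    case False
    then have p: "np \<eta> > 0" using norm_plus_nonneg[of \<eta>] by simp
    define c where "c = complex_of_real (1 / np \<eta>)"
    have cc: "cmod c = 1 / np \<eta>" using p by (simp add: c_def norm_divide)
    have "c *\<^sub>C \<eta> \<in> ?B" using D_scale[OF \<eta>, of c] np_scale[OF \<eta>, of c] p by (simp add: cc)
    from up[OF this] have "1 / np \<eta> * cmod (f \<eta>) \<le> norm_minus H f"
      by (simp add: fs[OF \<eta>] norm_mult cc)
    then show ?thesis using p by (simp add: pos_divide_le_eq)
  qed
qed

lemma V_bound: "\<exists>C\<ge>0. \<forall>\<xi>\<in>D. \<forall>\<eta>\<in>D. cmod (V \<xi> \<eta>) \<le> C * np \<xi> * np \<eta>"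
proof -
  obtain K where K: "\<And>\<xi>. \<xi> \<in> D \<Longrightarrow> norm_minus H (V \<xi>) \<le> K * np \<xi>"
    using V unfolding bounded_plus_minus_def Hplus_eq by blast
  have "cmod (V \<xi> \<eta>) \<le> \<bar>K\<bar> * np \<xi> * np \<eta>" if "\<xi> \<in> D" "\<eta> \<in> D" for \<xi> \<eta>
  proof -
    have "norm_minus H (V \<xi>) \<le> \<bar>K\<bar> * np \<xi>"
      using K[OF that(1)] mult_right_mono[OF abs_ge_self[of K] norm_plus_nonneg[of \<xi>]] by linarith
    then have "norm_minus H (V \<xi>) * np \<eta> \<le> \<bar>K\<bar> * np \<xi> * np \<eta>" by (intro mult_right_mono norm_plus_nonneg)
    then show ?thesis using Hminus_bound[OF V_Hminus[OF that(1)] that(2)] by linarith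
  qed
  then show ?thesis by (intro exI[of _ "\<bar>K\<bar>"]) simp
qed

lemma np_P: "\<exists>C\<ge>0. \<forall>x. np (P x) \<le> C * norm x"
proof -
  obtain C where C: "C \<ge> 0" "\<And>x. norm (P x) \<le> C * norm x" using inv_sqrt_bounded by blast
  have "np (P x) \<le> (C + 1) * norm x" for x
  proof (rule power2_le_imp_le)
    have "(np (P x))\<^sup>2 \<le> (norm x)\<^sup>2 + (C * norm x)\<^sup>2"
      unfolding norm_plus_sq[OF inv_sqrt_dom] by (intro add_mono power_mono norm_S_inv_sqrt C) auto
    also have "\<dots> = (1 + C\<^sup>2) * (norm x)\<^sup>2" by (simp add: power_mult_distrib distrib_right)
    also have "\<dots> \<le> (C + 1)\<^sup>2 * (norm x)\<^sup>2" using C(1) by (intro mult_right_mono) (simp_all add: power2_sum)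
    finally show "(np (P x))\<^sup>2 \<le> ((C + 1) * norm x)\<^sup>2" by (simp add: power_mult_distrib)
  qed (use C in simp)
  then show ?thesis using C(1) by (intro exI[of _ "C + 1"]) simp
qed

lemmas P_lin = clinear_simps[OF inv_sqrt_clinear]

text \<open>Boundedness of \<open>V\<close>, and of \<open>P\<close> into the form domain, makes
  Riesz representation applicable, so that the definite description in \<open>dual_ext\<close>
  denotes the representing vector.\<close>

lemma cinner_A: "cinner (A \<xi>) \<eta> = V (P \<xi>) (P \<eta>)"
proof -
  obtain C where C: "C \<ge> 0" "\<And>x. np (P x) \<le> C * norm x" using np_P by blast
  obtain K where K: "K \<ge> 0" "\<And>\<xi> \<eta>. \<xi> \<in> D \<Longrightarrow> \<eta> \<in> D \<Longrightarrow> cmod (V \<xi> \<eta>) \<le> K * np \<xi> * np \<eta>"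
    using V_bound by blast
  note PD = inv_sqrt_dom
  have "\<exists>\<zeta>. \<forall>\<eta>. cinner \<zeta> \<eta> = V (P \<xi>) (P \<eta>)"
  proof (rule Riesz_antilinear)
    fix x y c
    show "V (P \<xi>) (P (x + y)) = V (P \<xi>) (P x) + V (P \<xi>) (P y)" by (simp add: P_lin(1) V_add_right PD)
    show "V (P \<xi>) (P (c *\<^sub>C x)) = cnj c * V (P \<xi>) (P x)" by (simp add: P_lin(2) V_scale_right PD)
    have "cmod (V (P \<xi>) (P x)) \<le> K * np (P \<xi>) * np (P x)" by (rule K(2)[OF PD PD])
    also have "\<dots> \<le> K * np (P \<xi>) * (C * norm x)" using K(1) norm_plus_nonneg by (intro mult_left_mono C(2)) simp
    finally show "cmod (V (P \<xi>) (P x)) \<le> K * np (P \<xi>) * C * norm x" by (simp add: mult.assoc)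
  qed
  then obtain \<zeta> where z: "\<forall>\<eta>. cinner \<zeta> \<eta> = V (P \<xi>) (P \<eta>)" by blast
  have "A \<xi> = \<zeta>" unfolding birman_schwinger_def dual_ext_def
  proof (rule the_equality[of _ \<zeta>])
    fix \<zeta>' assume "\<forall>\<eta>. cinner \<zeta>' \<eta> = V (P \<xi>) (P \<eta>)"
    then show "\<zeta>' = \<zeta>" using z by (intro cinner_all_eq) simp
  qed (rule z)
  then show ?thesis using z by simp
qed

lemma D_sum: assumes "finite I" "\<And>i. i \<in> I \<Longrightarrow> w i \<in> D"
  shows "(\<Sum>i\<in>I. c i *\<^sub>C w i) \<in> D" "S' (\<Sum>i\<in>I. c i *\<^sub>C w i) = (\<Sum>i\<in>I. c i *\<^sub>C S' (w i))"
    "\<eta> \<in> D \<Longrightarrow> V (\<Sum>i\<in>I. c i *\<^sub>C w i) \<eta> = (\<Sum>i\<in>I. c i * V (w i) \<eta>)"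
proof -
  have 0: "0 \<in> D" by (rule complex_vector.subspace_0[OF S_sub])
  have "(\<Sum>i\<in>I. c i *\<^sub>C w i) \<in> D \<and> S' (\<Sum>i\<in>I. c i *\<^sub>C w i) = (\<Sum>i\<in>I. c i *\<^sub>C S' (w i)) \<and>
    (\<eta> \<in> D \<longrightarrow> V (\<Sum>i\<in>I. c i *\<^sub>C w i) \<eta> = (\<Sum>i\<in>I. c i * V (w i) \<eta>))"
    using assms
  proof (induction I rule: finite_induct)
    case empty
    show ?case using 0 S_scale[OF 0, of 0] V_scale[OF 0, of \<eta> 0] by simp
  next
    case (insert i I)
    then have w: "w i \<in> D" and I: "(\<Sum>i\<in>I. c i *\<^sub>C w i) \<in> D" by simp_all
    show ?case using insert D_add[OF D_scale[OF w] I] S_add[OF D_scale[OF w] I] S_scale[OF w]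
        V_add[OF D_scale[OF w] I, of \<eta>] V_scale[OF w, of \<eta>] by simp
  qed
  then show "(\<Sum>i\<in>I. c i *\<^sub>C w i) \<in> D" "S' (\<Sum>i\<in>I. c i *\<^sub>C w i) = (\<Sum>i\<in>I. c i *\<^sub>C S' (w i))"
    "\<eta> \<in> D \<Longrightarrow> V (\<Sum>i\<in>I. c i *\<^sub>C w i) \<eta> = (\<Sum>i\<in>I. c i * V (w i) \<eta>)" by simp_all
qed

lemma Ae: "A (e n) = complex_of_real (l n) *\<^sub>C e n" and l0: "0 \<le> l n" and l_anti: "antimono l"
  and l_lim: "l \<longlonglongrightarrow> 0" and e_on: "orthonormal_or_zero e" and e0: "e n = 0 \<Longrightarrow> l n = 0"
  and A_tail: "(\<forall>i<n. cinner x (e i) = 0) \<Longrightarrow> Re (cinner (A x) x) \<le> l n * (norm x)\<^sup>2"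
  using d unfolding diagonalizes_def by simp_all

subsection \<open>Form boundedness with arbitrarily small bound\<close>

text \<open>\<open>v\<close> may lie outside the domain of \<open>S\<close>, but some
  \<open>g\<close> in the domain is close to it, and on \<open>g\<close> the operator can be moved
  to the other side: the distance gives the small coefficient, \<open>|S g|\<close> the constant.
  The tolerance \<open>sqrt (\<delta> / 2)\<close> accounts for
  \<open>(a + b)^2 \<le> 2 a^2 + 2 b^2\<close>.\<close>

lemma S_functional_small:
  assumes "\<delta> > 0" shows "\<exists>C\<ge>0. \<forall>\<xi>\<in>D. (cmod (cinner (S' \<xi>) v))\<^sup>2 \<le> \<delta> * (norm (S' \<xi>))\<^sup>2 + C * (norm \<xi>)\<^sup>2"
proof -
  have "sqrt (\<delta> / 2) > 0" using assms by simp
  moreover have "v \<in> closure D" using S_dense by simp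
  ultimately obtain g where g: "g \<in> D" "dist g v < sqrt (\<delta> / 2)" unfolding closure_approachable by blast
  have "(cmod (cinner (S' \<xi>) v))\<^sup>2 \<le> \<delta> * (norm (S' \<xi>))\<^sup>2 + (2 * (norm (S' g))\<^sup>2) * (norm \<xi>)\<^sup>2" if x: "\<xi> \<in> D" for \<xi>
  proof -
    define a where "a = norm (S' \<xi>) * sqrt (\<delta> / 2)"
    define b where "b = norm \<xi> * norm (S' g)"
    have "cinner (S' \<xi>) v = cinner (S' \<xi>) (v - g) + cinner \<xi> (S' g)"
      by (simp add: cinner.diff_right S_sym[OF x g(1)])
    then have "cmod (cinner (S' \<xi>) v) \<le> cmod (cinner (S' \<xi>) (v - g)) + cmod (cinner \<xi> (S' g))"
      by (simp add: norm_triangle_ineq)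
    also have "\<dots> \<le> norm (S' \<xi>) * norm (v - g) + b"
      unfolding b_def by (intro add_mono cinner_Cauchy_Schwarz)
    also have "\<dots> \<le> a + b" unfolding a_def using g(2) by (intro add_right_mono mult_left_mono) (simp_all add: dist_norm norm_minus_commute)
    finally have "(cmod (cinner (S' \<xi>) v))\<^sup>2 \<le> (a + b)\<^sup>2" by (intro power_mono) simp_all
    also have "\<dots> \<le> 2 * a\<^sup>2 + 2 * b\<^sup>2" using zero_le_power2[of "a - b"] by (simp add: power2_diff power2_sum)
    also have "2 * a\<^sup>2 = \<delta> * (norm (S' \<xi>))\<^sup>2" using assms by (simp add: a_def power_mult_distrib)
    also have "2 * b\<^sup>2 = (2 * (norm (S' g))\<^sup>2) * (norm \<xi>)\<^sup>2" by (simp add: b_def power_mult_distrib)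
    finally show ?thesis .
  qed
  then show ?thesis by (intro exI[of _ "2 * (norm (S' g))\<^sup>2"]) simp
qed

text \<open>Orthogonally to the first \<open>n\<close> eigenvectors the form of \<open>A\<close> is
  bounded by \<open>l n < \<epsilon> / 2\<close>; the remaining finitely many directions enter
  through the functionals \<open>cinner (S' \<xi>) (e j)\<close>, which are relatively
  small.\<close>

lemma A_quadratic_small:
  assumes "\<epsilon> > 0" shows "\<exists>C\<ge>0. \<forall>\<xi>\<in>D. Re (cinner (A (S' \<xi>)) (S' \<xi>)) \<le> \<epsilon> * (norm (S' \<xi>))\<^sup>2 + C * (norm \<xi>)\<^sup>2"
proof -
  obtain K where K: "K > 0" "\<And>x. Re (cinner (A x) x) \<le> K * (norm x)\<^sup>2" using positive_op_bound[OF A] by blast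
  have "\<forall>\<^sub>F n in sequentially. l n < \<epsilon> / 2" using order_tendstoD(2)[OF l_lim, of "\<epsilon> / 2"] assms by simp
  then obtain n where n: "l n < \<epsilon> / 2" by (auto simp: eventually_sequentially)
  \<comment> \<open>The budget \<open>\<epsilon> / 2\<close> is shared by \<open>n\<close>
    directions, each weighted with the form bound \<open>K\<close>; \<open>n + 1\<close> keeps the
    quotient meaningful for \<open>n = 0\<close>.\<close>
  define \<delta> where "\<delta> = \<epsilon> / (2 * K * (real n + 1))"
  have \<delta>: "\<delta> > 0" using assms K by (simp add: \<delta>_def)
  have K\<delta>: "K * (real n * \<delta>) \<le> \<epsilon> / 2"
  proof -
    have "K * (real n * \<delta>) = \<epsilon> / 2 * (real n / (real n + 1))" using K(1) by (simp add: \<delta>_def)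
    also have "\<dots> \<le> \<epsilon> / 2 * 1" using assms by (intro mult_left_mono) simp_all
    finally show ?thesis by simp
  qed
  have "\<forall>j. \<exists>C\<ge>0. \<forall>\<xi>\<in>D. (cmod (cinner (S' \<xi>) (e j)))\<^sup>2 \<le> \<delta> * (norm (S' \<xi>))\<^sup>2 + C * (norm \<xi>)\<^sup>2"
    using S_functional_small[OF \<delta>] by blast
  then obtain C where C: "\<And>j. C j \<ge> 0"
    "\<And>j \<xi>. \<xi> \<in> D \<Longrightarrow> (cmod (cinner (S' \<xi>) (e j)))\<^sup>2 \<le> \<delta> * (norm (S' \<xi>))\<^sup>2 + C j * (norm \<xi>)\<^sup>2" by metis
  have "Re (cinner (A (S' \<xi>)) (S' \<xi>)) \<le> \<epsilon> * (norm (S' \<xi>))\<^sup>2 + (K * (\<Sum>j<n. C j)) * (norm \<xi>)\<^sup>2" if x: "\<xi> \<in> D" for \<xi>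
  proof -
    define \<eta> where "\<eta> = S' \<xi>"
    define s where "s = (\<Sum>j<n. cinner \<eta> (e j) *\<^sub>C e j)"
    define \<eta>' where "\<eta>' = \<eta> - s"
    note As = bounded_op_simps[OF positive_op_bounded[OF A]]
    have co: "cinner s (e j) = (if j \<in> {..<n} \<and> e j \<noteq> 0 then cinner \<eta> (e j) else 0)" for j
      unfolding s_def by (rule orthonormal_sum_coeff) (use orthonormal_or_zeroD[OF e_on] in auto)
    have orth: "cinner \<eta>' (e j) = 0" if "j < n" for j
      using co[of j] that by (cases "e j = 0") (simp_all add: \<eta>'_def cinner.diff_left cinner.zero_right)
    have As_sum: "A s = (\<Sum>j<n. (cinner \<eta> (e j) * complex_of_real (l j)) *\<^sub>C e j)"
    proof -
      have "A (\<Sum>j\<in>J. cinner \<eta> (e j) *\<^sub>C e j) = (\<Sum>j\<in>J. (cinner \<eta> (e j) * complex_of_real (l j)) *\<^sub>C e j)" if "finite J" for J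
        using that by (induction J rule: finite_induct) (simp_all add: As Ae scaleC_scaleC)
      then show ?thesis by (simp add: s_def)
    qed
    have c1: "cinner \<eta>' (A s) = 0" unfolding As_sum cinner.sum_right cinner_scaleC_right using orth by simp
    have c2: "cinner (A \<eta>') s = 0" using positive_op_symmetric[OF A, of \<eta>' s] c1 by simp
    have c3: "cinner (A s) \<eta>' = 0" using c1 cinner_swap_zero by blast
    have c4: "cinner \<eta>' s = 0" unfolding s_def cinner.sum_right cinner_scaleC_right using orth by simp
    have "A \<eta> = A s + A \<eta>'" by (simp add: \<eta>'_def As)
    moreover have "\<eta> = s + \<eta>'" by (simp add: \<eta>'_def)
    ultimately have "cinner (A \<eta>) \<eta> = cinner (A s) s + cinner (A \<eta>') \<eta>'"
      using c2 c3 by (simp add: cinner_add_left cinner_add_right)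
    then have "Re (cinner (A \<eta>) \<eta>) \<le> K * (norm s)\<^sup>2 + l n * (norm \<eta>')\<^sup>2"
      using K(2)[of s] A_tail[of n \<eta>'] orth by simp
    also have "l n * (norm \<eta>')\<^sup>2 \<le> \<epsilon> / 2 * (norm \<eta>)\<^sup>2"
    proof (rule mult_mono)
      have "(norm \<eta>)\<^sup>2 = (norm \<eta>')\<^sup>2 + (norm s)\<^sup>2"
        using norm_add_sq[of \<eta>' s] c4 by (simp add: \<eta>'_def)
      then show "(norm \<eta>')\<^sup>2 \<le> (norm \<eta>)\<^sup>2" by simp
    qed (use n assms in simp_all)
    also have "K * (norm s)\<^sup>2 \<le> K * (\<Sum>j<n. \<delta> * (norm \<eta>)\<^sup>2 + C j * (norm \<xi>)\<^sup>2)"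
    proof (rule mult_left_mono)
      have "(norm s)\<^sup>2 \<le> (\<Sum>j<n. (cmod (cinner \<eta> (e j)))\<^sup>2)"
        unfolding s_def by (rule norm_sq_orthonormal_sum(1)[OF e_on]) simp
      also have "\<dots> \<le> (\<Sum>j<n. \<delta> * (norm \<eta>)\<^sup>2 + C j * (norm \<xi>)\<^sup>2)"
        unfolding \<eta>_def by (intro sum_mono C(2) x)
      finally show "(norm s)\<^sup>2 \<le> (\<Sum>j<n. \<delta> * (norm \<eta>)\<^sup>2 + C j * (norm \<xi>)\<^sup>2)" .
    qed (use K in simp)
    also have "K * (\<Sum>j<n. \<delta> * (norm \<eta>)\<^sup>2 + C j * (norm \<xi>)\<^sup>2) = K * (real n * \<delta>) * (norm \<eta>)\<^sup>2 + (K * (\<Sum>j<n. C j)) * (norm \<xi>)\<^sup>2"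
      by (simp add: sum.distrib sum_distrib_right distrib_left mult.assoc)
    also have "K * (real n * \<delta>) * (norm \<eta>)\<^sup>2 \<le> \<epsilon> / 2 * (norm \<eta>)\<^sup>2" using K\<delta> by (intro mult_right_mono) simp_all
    finally show ?thesis unfolding \<eta>_def by simp
  qed
  moreover have "0 \<le> K * (\<Sum>j<n. C j)" using K C(1) by (simp add: sum_nonneg)
  ultimately show ?thesis by blast
qed

text \<open>On the component \<open>x1\<close> in \<open>G\<close>, \<open>V\<close> is the form of
  \<open>A\<close> at \<open>S' x1\<close>; on the kernel the form norm is the Hilbert norm, so
  \<open>V\<close> is bounded there. Nonnegativity of \<open>V\<close> at \<open>x1 - k\<close>
  absorbs the mixed terms.\<close>

lemma V_form_bounded:
  assumes "\<epsilon> > 0" shows "\<exists>C\<ge>0. \<forall>\<xi>\<in>D. Re (V \<xi> \<xi>) \<le> \<epsilon> * (norm (S' \<xi>))\<^sup>2 + C * (norm \<xi>)\<^sup>2"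
proof -
  have "\<epsilon> / 2 > 0" using assms by simp
  from A_quadratic_small[OF this] obtain C where C: "C \<ge> 0"
    "\<And>\<xi>. \<xi> \<in> D \<Longrightarrow> Re (cinner (A (S' \<xi>)) (S' \<xi>)) \<le> \<epsilon> / 2 * (norm (S' \<xi>))\<^sup>2 + C * (norm \<xi>)\<^sup>2" by blast
  obtain K where K: "K \<ge> 0" "\<And>\<xi> \<eta>. \<xi> \<in> D \<Longrightarrow> \<eta> \<in> D \<Longrightarrow> cmod (V \<xi> \<eta>) \<le> K * np \<xi> * np \<eta>"
    using V_bound by blast
  have "Re (V \<xi> \<xi>) \<le> \<epsilon> * (norm (S' \<xi>))\<^sup>2 + (2 * C + 2 * K) * (norm \<xi>)\<^sup>2" if x: "\<xi> \<in> D" for \<xi>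
  proof -
    obtain k where k: "k \<in> Ker" "\<xi> - k \<in> G"
      using orthogonal_projection_exists[OF subspace_ker closed_ker, of \<xi>] unfolding G_def by blast
    define x1 where "x1 = \<xi> - k"
    have Sk: "S k = Some 0" by (rule S_ker[OF k(1)])
    then have kD: "k \<in> D" by blast
    have x1: "x1 \<in> D" "x1 \<in> G" using D_diff[OF x kD] k(2) by (simp_all add: x1_def)
    have Sx1: "S' x1 = S' \<xi>" using S_diff(2)[OF x kD] Sk by (simp add: x1_def)
    have nx: "(norm \<xi>)\<^sup>2 = (norm x1)\<^sup>2 + (norm k)\<^sup>2"
      using norm_add_sq[of x1 k] G_ker[OF x1(2) k(1)] by (simp add: x1_def)
    have "Re (V x1 x1) = Re (cinner (A (S' x1)) (S' x1))"
      using inv_sqrt_S[OF x1(2,1)] by (simp add: cinner_A)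
    also have "\<dots> \<le> \<epsilon> / 2 * (norm (S' \<xi>))\<^sup>2 + C * (norm x1)\<^sup>2" using C(2)[OF x1(1)] by (simp add: Sx1)
    also have "\<dots> \<le> \<epsilon> / 2 * (norm (S' \<xi>))\<^sup>2 + C * (norm \<xi>)\<^sup>2"
      using C(1) nx by (intro add_left_mono mult_left_mono) simp_all
    finally have V1: "Re (V x1 x1) \<le> \<epsilon> / 2 * (norm (S' \<xi>))\<^sup>2 + C * (norm \<xi>)\<^sup>2" .
    have "Re (V k k) \<le> K * np k * np k" using K(2)[OF kD kD] complex_Re_le_cmod order_trans by blast
    also have "\<dots> = K * (norm k)\<^sup>2" using norm_plus_sq[OF kD] Sk by (simp add: power2_eq_square mult.assoc)
    also have "\<dots> \<le> K * (norm \<xi>)\<^sup>2" using K(1) nx by (intro mult_left_mono) simp_all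
    finally have V2: "Re (V k k) \<le> K * (norm \<xi>)\<^sup>2" .
    have dk: "x1 - k \<in> D" using D_diff[OF x1(1) kD] .
    have "V (x1 - k) (x1 - k) = V x1 x1 - V x1 k - V k x1 + V k k"
      by (simp add: V_diff[OF x1(1) kD dk] V_diff_right[OF x1(1) x1(1) kD] V_diff_right[OF kD x1(1) kD])
    moreover have "V (x1 + k) (x1 + k) = V x1 x1 + V x1 k + V k x1 + V k k"
      using V_add[OF x1(1) kD D_add[OF x1(1) kD]]
      by (simp add: V_add_right[OF x1(1) x1(1) kD] V_add_right[OF kD x1(1) kD])
    moreover have "x1 + k = \<xi>" by (simp add: x1_def)
    ultimately have "Re (V \<xi> \<xi>) \<le> 2 * Re (V x1 x1) + 2 * Re (V k k)" using V_nonneg[OF dk] by simp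
    then show ?thesis using V1 V2 by (simp add: algebra_simps)
  qed
  then show ?thesis using C(1) K(1) by (intro exI[of _ "2 * C + 2 * K"]) simp
qed

subsection \<open>Negative eigenvalues of the form sum\<close>

context
  fixes h :: real
  assumes h: "h > 0"
begin

definition q :: "'a \<Rightarrow> 'a \<Rightarrow> complex" where
  "q \<xi> \<eta> = complex_of_real (h\<^sup>2) * cinner (S' \<xi>) (S' \<eta>) - V \<xi> \<eta>"

lemma schroedinger_eq: "schroedinger H V h = form_op D q"
  unfolding schroedinger_def Hplus_eq Q_op_def sqrt_op_eq q_def[abs_def] ..

lemma q_add: "\<xi> \<in> D \<Longrightarrow> \<xi>' \<in> D \<Longrightarrow> \<eta> \<in> D \<Longrightarrow> q (\<xi> + \<xi>') \<eta> = q \<xi> \<eta> + q \<xi>' \<eta>"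
  and q_scale: "\<xi> \<in> D \<Longrightarrow> \<eta> \<in> D \<Longrightarrow> q (c *\<^sub>C \<xi>) \<eta> = c * q \<xi> \<eta>"
  by (simp_all add: q_def S_add S_scale V_add V_scale cinner_add_left cinner_scaleC_left algebra_simps)

lemma q_sym: assumes "\<xi> \<in> D" "\<eta> \<in> D" shows "q \<xi> \<eta> = cnj (q \<eta> \<xi>)"
  unfolding q_def complex_cnj_diff complex_cnj_mult complex_cnj_complex_of_real
  by (simp only: V_sym[OF assms, symmetric] cinner_commute[of "S' \<xi>" "S' \<eta>", symmetric])

lemma q_sum: assumes "finite I" "\<And>i. i \<in> I \<Longrightarrow> w i \<in> D" "\<eta> \<in> D"
  shows "q (\<Sum>i\<in>I. c i *\<^sub>C w i) \<eta> = (\<Sum>i\<in>I. c i * q (w i) \<eta>)"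
proof -
  have 1: "S' (\<Sum>i\<in>I. c i *\<^sub>C w i) = (\<Sum>i\<in>I. c i *\<^sub>C S' (w i))"
    by (rule D_sum(2)[OF assms(1,2)])
  have 2: "V (\<Sum>i\<in>I. c i *\<^sub>C w i) \<eta> = (\<Sum>i\<in>I. c i * V (w i) \<eta>)"
    by (rule D_sum(3)[OF assms])
  show ?thesis unfolding q_def 1 2
    by (simp add: cinner.sum_left cinner_scaleC_left sum_distrib_left right_diff_distrib sum_subtractf mult.left_commute)
qed

text \<open>Representability of the functional by \<open>c \<xi>\<close> is contained in the weak
  equation, so the operator domain disappears from the later arguments.\<close>

lemma eigenspace_iff:
  "\<xi> \<in> eigenspace (schroedinger H V h) c \<longleftrightarrow> \<xi> \<in> D \<and> (\<forall>\<eta>\<in>D. q \<xi> \<eta> = c * cinner \<xi> \<eta>)"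
proof -
  have "\<xi> \<in> eigenspace (schroedinger H V h) c \<longleftrightarrow> schroedinger H V h \<xi> = Some (c *\<^sub>C \<xi>)"
    by (auto simp: eigenspace_def)
  also have "\<dots> \<longleftrightarrow> \<xi> \<in> D \<and> (\<forall>\<eta>\<in>D. q \<xi> \<eta> = cinner (c *\<^sub>C \<xi>) \<eta>)"
    unfolding schroedinger_eq by (rule form_op_Some_iff[OF S_dense])
  finally show ?thesis by (simp add: cinner_scaleC_left)
qed

text \<open>The values \<open>t i\<close> may repeat, so the length \<open>r\<close> counts
  multiplicities; at \<open>r = 0\<close> the conditions are void and provide a starting
  family.\<close>

definition neg_eigen_family :: "nat \<Rightarrow> (nat \<Rightarrow> 'a) \<Rightarrow> (nat \<Rightarrow> real) \<Rightarrow> bool" where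
  "neg_eigen_family r w t \<longleftrightarrow>
     (\<forall>i<r. norm (w i) = 1 \<and> t i < 0 \<and> w i \<in> D \<and> (\<forall>\<eta>\<in>D. q (w i) \<eta> = complex_of_real (t i) * cinner (w i) \<eta>)) \<and>
     (\<forall>i<r. \<forall>j<r. i \<noteq> j \<longrightarrow> cinner (w i) (w j) = 0)"

lemma neg_eigen_familyD:
  assumes "neg_eigen_family r w t"
  shows "i < r \<Longrightarrow> norm (w i) = 1" "i < r \<Longrightarrow> t i < 0" "i < r \<Longrightarrow> w i \<in> D"
    "i < r \<Longrightarrow> \<eta> \<in> D \<Longrightarrow> q (w i) \<eta> = complex_of_real (t i) * cinner (w i) \<eta>"
    "i < r \<Longrightarrow> j < r \<Longrightarrow> i \<noteq> j \<Longrightarrow> cinner (w i) (w j) = 0"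
  using assms unfolding neg_eigen_family_def by blast+

lemma neg_eigen_family_coeff:
  assumes F: "neg_eigen_family r w t" and I: "I \<subseteq> {..<r}" and j: "j \<in> I"
  shows "cinner (\<Sum>i\<in>I. c i *\<^sub>C w i) (w j) = c j"
proof -
  have fin: "finite I" using I by (rule finite_subset) simp
  have "cinner (\<Sum>i\<in>I. c i *\<^sub>C w i) (w j) = (\<Sum>i\<in>I. if i = j then c j else 0)"
    unfolding cinner.sum_left cinner_scaleC_left
  proof (rule sum.cong[OF refl])
    fix i assume i: "i \<in> I"
    then have "i < r" "j < r" using I j by auto
    then show "c i * cinner (w i) (w j) = (if i = j then c j else 0)"
      using neg_eigen_familyD(1,5)[OF F] by (simp add: cinner_self)
  qed
  then show ?thesis using fin j by simp
qed

lemma neg_eigen_family_extend: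
  assumes F: "neg_eigen_family r w t" and x: "norm x = 1" "m < 0" "x \<in> D"
    and ev: "\<And>\<eta>. \<eta> \<in> D \<Longrightarrow> q x \<eta> = complex_of_real m * cinner x \<eta>"
    and orth: "\<And>i. i < r \<Longrightarrow> cinner x (w i) = 0"
  shows "neg_eigen_family (Suc r) (w(r := x)) (t(r := m))"
  unfolding neg_eigen_family_def
proof (intro conjI allI impI)
  fix i assume i: "i < Suc r"
  show "norm ((w(r := x)) i) = 1" "(t(r := m)) i < 0" "(w(r := x)) i \<in> D"
    "\<forall>\<eta>\<in>D. q ((w(r := x)) i) \<eta> = complex_of_real ((t(r := m)) i) * cinner ((w(r := x)) i) \<eta>"
    using neg_eigen_familyD(1-4)[OF F, of i] x ev i by (cases "i = r"; simp add: less_Suc_eq)+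
  fix j assume j: "j < Suc r" and ij: "i \<noteq> j"
  have "cinner (w i) x = 0" if "i < r" for i using orth[OF that] cinner_swap_zero by blast
  then show "cinner ((w(r := x)) i) ((w(r := x)) j) = 0"
    using neg_eigen_familyD(5)[OF F, of i j] orth i j ij
    by (cases "i = r"; cases "j = r"; simp add: less_Suc_eq)
qed

text \<open>In a longer family, \<open>n\<close> conditions make \<open>S' \<xi>\<close> orthogonal
  to the first \<open>n\<close> eigenvectors of \<open>A\<close>, and \<open>card B\<close>
  conditions make \<open>\<xi>\<close> orthogonal to the kernel. For such a combination
  \<open>q\<close> is nonnegative because \<open>l n \<le> h^2\<close>, although \<open>q\<close> is
  negative definite on the span of the \<open>w i\<close>.\<close>

lemma neg_eigen_family_upper:
  assumes F: "neg_eigen_family r w t" and B: "finite B" "Ker \<subseteq> complex_vector.span B" and n: "l n \<le> h\<^sup>2"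
  shows "r \<le> n + card B"
proof (rule ccontr)
  assume "\<not> ?thesis"
  then have "card ({..<n} <+> B) < card {..<r}" using B by (simp add: card_Plus)
  moreover have "finite ({..<n} <+> B)" using B by simp
  ultimately obtain c where c: "\<exists>i\<in>{..<r}. c i \<noteq> 0"
    "\<forall>j\<in>{..<n} <+> B. (\<Sum>i\<in>{..<r}. c i * (case j of Inl j \<Rightarrow> cinner (S' (w i)) (e j) | Inr b \<Rightarrow> cinner (w i) b)) = 0"
    using homogeneous_system_nontrivial[of "{..<n} <+> B" "{..<r}"
        "\<lambda>i j. case j of Inl j \<Rightarrow> cinner (S' (w i)) (e j) | Inr b \<Rightarrow> cinner (w i) b"] by blast
  note FD = neg_eigen_familyD[OF F]
  define \<xi> where "\<xi> = (\<Sum>i\<in>{..<r}. c i *\<^sub>C w i)"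
  define \<eta> where "\<eta> = S' \<xi>"
  have wD: "w i \<in> D" if "i \<in> {..<r}" for i using that FD(3) by simp
  have x: "\<xi> \<in> D" unfolding \<xi>_def using wD by (intro D_sum(1)) simp_all
  have \<eta>: "\<eta> = (\<Sum>i\<in>{..<r}. c i *\<^sub>C S' (w i))" unfolding \<eta>_def \<xi>_def using wD by (intro D_sum(2)) simp_all
  have "cinner \<eta> (e j) = 0" if "j < n" for j
    using bspec[OF c(2), OF InlI, of j] that by (simp add: \<eta> cinner.sum_left cinner_scaleC_left)
  then have tail: "Re (cinner (A \<eta>) \<eta>) \<le> l n * (norm \<eta>)\<^sup>2" by (intro A_tail) simp
  have "cinner \<xi> b = 0" if "b \<in> B" for b
    using bspec[OF c(2), OF InrI, of b] that by (simp add: \<xi>_def cinner.sum_left cinner_scaleC_left)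
  then have "B \<subseteq> {y. cinner \<xi> y = 0}" by blast
  moreover have "complex_vector.subspace {y. cinner \<xi> y = 0}"
    by (simp add: complex_vector.subspace_def cinner_add_right cinner_scaleC_right cinner.zero_right)
  ultimately have "complex_vector.span B \<subseteq> {y. cinner \<xi> y = 0}" by (rule complex_vector.span_minimal)
  then have xG: "\<xi> \<in> G" using B(2) by (intro G_I) blast
  have "V \<xi> \<xi> = cinner (A \<eta>) \<eta>" using inv_sqrt_S[OF xG x] by (simp add: cinner_A \<eta>_def)
  then have "Re (q \<xi> \<xi>) = h\<^sup>2 * (norm \<eta>)\<^sup>2 - Re (cinner (A \<eta>) \<eta>)"
    unfolding q_def \<eta>_def[symmetric] by (simp add: cinner_self)
  moreover have "l n * (norm \<eta>)\<^sup>2 \<le> h\<^sup>2 * (norm \<eta>)\<^sup>2" using n by (intro mult_right_mono) simp_all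
  ultimately have pos: "0 \<le> Re (q \<xi> \<xi>)" using tail by linarith
  have "q \<xi> \<xi> = (\<Sum>i\<in>{..<r}. c i * q (w i) \<xi>)" by (subst \<xi>_def, rule q_sum) (use wD x in simp_all)
  also have "\<dots> = (\<Sum>i\<in>{..<r}. complex_of_real (t i * (cmod (c i))\<^sup>2))"
  proof (rule sum.cong[OF refl])
    fix i assume i: "i \<in> {..<r}"
    have "cinner \<xi> (w i) = c i" unfolding \<xi>_def using i by (intro neg_eigen_family_coeff[OF F]) simp_all
    then have "cinner (w i) \<xi> = cnj (c i)" using cinner_commute[of "w i" \<xi>] by simp
    then show "c i * q (w i) \<xi> = complex_of_real (t i * (cmod (c i))\<^sup>2)"
      unfolding of_real_mult complex_norm_square using FD(4)[of i \<xi>] i x by simp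
  qed
  finally have "Re (q \<xi> \<xi>) = (\<Sum>i\<in>{..<r}. t i * (cmod (c i))\<^sup>2)" by (simp only: of_real_sum[symmetric] Re_complex_of_real)
  also have "\<dots> < 0"
  proof -
    obtain i where i: "i \<in> {..<r}" "c i \<noteq> 0" using c(1) by blast
    have "0 < (\<Sum>i\<in>{..<r}. - (t i * (cmod (c i))\<^sup>2))"
    proof (rule sum_pos2[of _ i])
      show "0 < - (t i * (cmod (c i))\<^sup>2)" using i FD(2)[of i] by (simp add: mult_neg_pos)
      fix j assume "j \<in> {..<r}"
      then show "0 \<le> - (t j * (cmod (c j))\<^sup>2)" using FD(2)[of j] by (simp add: mult_nonpos_nonneg)
    qed (use i in simp_all)
    then show ?thesis by (simp add: sum_negf)
  qed
  finally show False using pos by simp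
qed

text \<open>The infimum \<open>m < 0\<close> of \<open>q\<close> on the unit sphere of the orthogonal complement of the \<open>w\<^sub>i\<close> is
  attained: for a minimizing sequence the form \<open>q - m\<close> tends to \<open>0\<close>, and \<open>h\<^sup>2 Q\<^sub>H - m\<close>, an equivalent
  norm on the form domain, differs from it by the compact form \<open>V\<close>.\<close>

lemma minimizer_exists:
  assumes F: "neg_eigen_family r w t" and x0: "\<xi>0 \<in> D" "\<And>i. i < r \<Longrightarrow> cinner \<xi>0 (w i) = 0" "Re (q \<xi>0 \<xi>0) < 0"
  shows "\<exists>\<zeta> m. norm \<zeta> = 1 \<and> m < 0 \<and> \<zeta> \<in> D \<and> (\<forall>i<r. cinner \<zeta> (w i) = 0) \<and>
    (\<forall>\<eta>\<in>D. q \<zeta> \<eta> = complex_of_real m * cinner \<zeta> \<eta>)"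
proof -
  note FD = neg_eigen_familyD[OF F]
  define E where "E = {\<xi> \<in> D. \<forall>i<r. cinner \<xi> (w i) = 0}"
  have ED: "\<xi> \<in> D" if "\<xi> \<in> E" for \<xi> using that by (simp add: E_def)
  have E: "complex_vector.subspace E"
    using complex_vector.subspace_0[OF S_sub]
    by (simp add: complex_vector.subspace_def E_def D_add D_scale cinner_add_left cinner_scaleC_left cinner.zero_left)
  have h2: "h\<^sup>2 / 2 > 0" using h by simp
  \<comment> \<open>A relative bound of one half: \<open>q\<close> becomes bounded below, and
    \<open>S'\<close> stays bounded along a minimizing sequence.\<close>
  obtain C where C: "C \<ge> 0" "\<And>\<xi>. \<xi> \<in> D \<Longrightarrow> Re (V \<xi> \<xi>) \<le> h\<^sup>2 / 2 * (norm (S' \<xi>))\<^sup>2 + C * (norm \<xi>)\<^sup>2"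
    using V_form_bounded[OF h2] by blast
  have Req: "Re (q \<xi> \<xi>) = h\<^sup>2 * (norm (S' \<xi>))\<^sup>2 - Re (V \<xi> \<xi>)" for \<xi>
    by (simp add: q_def cinner_self)
  have qlow: "h\<^sup>2 / 2 * (norm (S' \<xi>))\<^sup>2 - C * (norm \<xi>)\<^sup>2 \<le> Re (q \<xi> \<xi>)" if "\<xi> \<in> D" for \<xi>
  proof -
    have "h\<^sup>2 * (norm (S' \<xi>))\<^sup>2 = h\<^sup>2 / 2 * (norm (S' \<xi>))\<^sup>2 + h\<^sup>2 / 2 * (norm (S' \<xi>))\<^sup>2" by simp
    then show ?thesis using C(2)[OF that] unfolding Req by linarith
  qed
  have qscale: "Re (q (complex_of_real a *\<^sub>C \<xi>) (complex_of_real a *\<^sub>C \<xi>)) = a\<^sup>2 * Re (q \<xi> \<xi>)" if "\<xi> \<in> D" for a \<xi>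
    using that V_scale[OF that D_scale[OF that]] V_scale_right[OF that that]
    by (simp add: Req S_scale norm_scaleC power_mult_distrib power2_eq_square algebra_simps)
  define U where "U = {\<xi> \<in> E. norm \<xi> = 1}"
  define u where "u \<xi> = complex_of_real (1 / norm \<xi>) *\<^sub>C \<xi>" for \<xi> :: 'a
  have uU: "u \<xi> \<in> U" if "\<xi> \<in> E" "\<xi> \<noteq> 0" for \<xi>
    using that complex_vector.subspace_scale[OF E] by (simp add: U_def u_def norm_scaleC norm_divide)
  have qu: "Re (q (u \<xi>) (u \<xi>)) = Re (q \<xi> \<xi>) / (norm \<xi>)\<^sup>2" if "\<xi> \<in> D" for \<xi>
    unfolding u_def qscale[OF that] by (simp add: power_divide)
  define m where "m = (INF \<xi>\<in>U. Re (q \<xi> \<xi>))"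
  have bdd: "bdd_below ((\<lambda>\<xi>. Re (q \<xi> \<xi>)) ` U)"
  proof (rule bdd_belowI2)
    fix \<xi> assume "\<xi> \<in> U"
    then have x: "\<xi> \<in> D" "norm \<xi> = 1" using ED by (simp_all add: U_def)
    have "0 \<le> h\<^sup>2 / 2 * (norm (S' \<xi>))\<^sup>2" by simp
    then have "- (C * (norm \<xi>)\<^sup>2) \<le> Re (q \<xi> \<xi>)" using qlow[OF x(1)] by linarith
    then show "- C \<le> Re (q \<xi> \<xi>)" by (simp add: x(2))
  qed
  have mU: "m \<le> Re (q \<xi> \<xi>)" if "\<xi> \<in> U" for \<xi> unfolding m_def using bdd that by (rule cINF_lower)
  have x0E: "\<xi>0 \<in> E" using x0 by (simp add: E_def)
  have x00: "\<xi>0 \<noteq> 0"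
  proof
    assume "\<xi>0 = 0"
    then show False using x0(3) qscale[OF x0(1), of 0] by simp
  qed
  have ne: "U \<noteq> {}" using uU[OF x0E x00] by blast
  have m0: "m < 0"
  proof -
    have "m \<le> Re (q (u \<xi>0) (u \<xi>0))" by (rule mU[OF uU[OF x0E x00]])
    also have "\<dots> < 0" using x0(3) x00 by (simp add: qu[OF x0(1)] divide_neg_pos)
    finally show ?thesis .
  qed
  have mE: "m * (norm \<xi>)\<^sup>2 \<le> Re (q \<xi> \<xi>)" if "\<xi> \<in> E" for \<xi>
  proof (cases "\<xi> = 0")
    case True
    then show ?thesis using qscale[OF ED[OF that], of 0] by simp
  next
    case False
    then show ?thesis using mU[OF uU[OF that False]] by (simp add: qu[OF ED[OF that]] pos_le_divide_eq)
  qed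
  define s where "s \<xi> \<eta> = q \<xi> \<eta> - complex_of_real m * cinner \<xi> \<eta>" for \<xi> \<eta>
  have ssym: "s \<xi> \<eta> = cnj (s \<eta> \<xi>)" if "\<xi> \<in> D" "\<eta> \<in> D" for \<xi> \<eta>
    unfolding s_def complex_cnj_diff complex_cnj_mult complex_cnj_complex_of_real
    by (simp only: q_sym[OF that, symmetric] cinner_commute[of \<xi> \<eta>, symmetric])
  have Res: "Re (s \<xi> \<xi>) = Re (q \<xi> \<xi>) - m * (norm \<xi>)\<^sup>2" for \<xi> by (simp add: s_def cinner_self)
  have psd: "psd_form_on E s"
    unfolding psd_form_on_def
  proof (intro conjI ballI allI)
    fix x y assume "x \<in> E" "y \<in> E"
    then show "s x y = cnj (s y x)" using ED by (intro ssym)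
  next
    fix x assume "x \<in> E"
    then show "0 \<le> Re (s x x)" using mE by (simp add: Res)
  qed (use E ED in \<open>simp_all add: s_def q_add q_scale cinner_add_left cinner_scaleC_left algebra_simps\<close>)
  have "\<exists>x\<in>U. Re (q x x) < m + 1 / real (Suc n)" for n
    using cINF_less_iff[OF ne bdd, of "m + 1 / real (Suc n)"] by (simp add: m_def)
  then obtain y where y: "\<And>n. y n \<in> U" "\<And>n. Re (q (y n) (y n)) < m + 1 / real (Suc n)" by metis
  have yE: "y n \<in> E" and yD: "y n \<in> D" and y1: "norm (y n) = 1" for n
    using y(1)[of n] ED by (simp_all add: U_def)
  have sy: "Re (s (y n) (y n)) \<le> 1 / real (Suc n)" for n using y(2)[of n] by (simp add: Res y1)
  have Sy: "(norm (S' (y n)))\<^sup>2 \<le> 2 / h\<^sup>2 * (1 + C)" for n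
  proof -
    have "1 / real (Suc n) \<le> 1" by simp
    then have "h\<^sup>2 / 2 * (norm (S' (y n)))\<^sup>2 \<le> 1 + C * (norm (y n))\<^sup>2"
      using qlow[OF yD[of n]] y(2)[of n] m0 by linarith
    then have "2 / h\<^sup>2 * (h\<^sup>2 / 2 * (norm (S' (y n)))\<^sup>2) \<le> 2 / h\<^sup>2 * (1 + C)"
      unfolding y1 by (intro mult_left_mono) simp_all
    then show ?thesis using h by simp
  qed
  define K where "K = sqrt (2 / h\<^sup>2 * (1 + C) + 1)"
  have K0: "0 \<le> 2 / h\<^sup>2 * (1 + C) + 1" using C(1) by simp
  have Ky: "np (y n) \<le> K" for n
  proof (rule power2_le_imp_le)
    show "(np (y n))\<^sup>2 \<le> K\<^sup>2" unfolding norm_plus_sq[OF yD] K_def real_sqrt_pow2[OF K0] using Sy[of n] by (simp add: y1)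
  qed (use K0 in \<open>simp add: K_def\<close>)
  have K: "K \<ge> 0" using K0 by (simp add: K_def)
  obtain \<rho> f where \<rho>: "strict_mono \<rho>" "f \<in> Hminus H" "(\<lambda>n. norm_minus H (\<lambda>\<eta>. V (y (\<rho> n)) \<eta> - f \<eta>)) \<longlonglongrightarrow> 0"
    using Vc yD Ky unfolding form_compact_def Hplus_eq by blast
  define x where "x n = y (\<rho> n)" for n
  have xE: "x n \<in> E" and xD: "x n \<in> D" and x1: "norm (x n) = 1" and Kx: "np (x n) \<le> K" for n
    using yE yD y1 Ky by (simp_all add: x_def)
  define \<sigma> where "\<sigma> n = 1 / real (Suc (\<rho> n))" for n
  have sx: "Re (s (x n) (x n)) \<le> \<sigma> n" for n using sy[of "\<rho> n"] by (simp add: x_def \<sigma>_def)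
  have \<sigma>0: "\<sigma> n \<ge> 0" for n by (simp add: \<sigma>_def)
  have \<sigma>: "\<sigma> \<longlonglongrightarrow> 0"
  proof -
    have "(\<lambda>n. 1 / real (Suc n)) \<longlonglongrightarrow> 0" using LIMSEQ_inverse_real_of_nat by (simp add: inverse_eq_divide)
    from LIMSEQ_subseq_LIMSEQ[OF this \<rho>(1)] show ?thesis by (simp add: comp_def \<sigma>_def[abs_def])
  qed
  define \<epsilon> where "\<epsilon> n = norm_minus H (\<lambda>\<eta>. V (x n) \<eta> - f \<eta>)" for n
  have \<epsilon>: "\<epsilon> \<longlonglongrightarrow> 0" using \<rho>(3) by (simp add: \<epsilon>_def[abs_def] x_def)
  have Vf: "cmod (V (x n) \<eta> - f \<eta>) \<le> \<epsilon> n * np \<eta>" if \<eta>: "\<eta> \<in> D" for n \<eta>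
    unfolding \<epsilon>_def
  proof (rule Hminus_bound[OF _ \<eta>])
    obtain K1 where K1: "\<And>\<eta>. \<eta> \<in> D \<Longrightarrow> cmod (V (x n) \<eta>) \<le> K1 * np \<eta>"
      using V_Hminus[OF xD[of n]] unfolding Hminus_def Hplus_eq by blast
    obtain K2 where K2: "\<And>\<eta>. \<eta> \<in> D \<Longrightarrow> cmod (f \<eta>) \<le> K2 * np \<eta>"
      using \<rho>(2) unfolding Hminus_def Hplus_eq by blast
    have "cmod (V (x n) \<eta> - f \<eta>) \<le> (K1 + K2) * np \<eta>" if "\<eta> \<in> D" for \<eta>
      using norm_triangle_ineq4[of "V (x n) \<eta>" "f \<eta>"] K1[OF that] K2[OF that] by (simp add: distrib_right)
    then have ex: "\<exists>K. \<forall>\<eta>\<in>D. cmod (V (x n) \<eta> - f \<eta>) \<le> K * np \<eta>" by blast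
    have f1: "f (\<eta> + \<eta>') = f \<eta> + f \<eta>'" if "\<eta> \<in> D" "\<eta>' \<in> D" for \<eta> \<eta>'
      using \<rho>(2) that unfolding Hminus_def Hplus_eq by blast
    have f2: "f (c *\<^sub>C \<eta>) = cnj c * f \<eta>" if "\<eta> \<in> D" for c \<eta>
      using \<rho>(2) that unfolding Hminus_def Hplus_eq by blast
    show "(\<lambda>\<eta>. V (x n) \<eta> - f \<eta>) \<in> Hminus H"
      unfolding Hminus_def Hplus_eq using ex
      by (simp add: f1 f2 V_add_right[OF xD] V_scale_right[OF xD] right_diff_distrib)
  qed
  \<comment> \<open>The sum of \<open>s\<close> and \<open>V\<close> on the diagonal. At a
    difference \<open>x n - x k\<close> both are small: \<open>s\<close> by Cauchy-Schwarz, since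
    \<open>s\<close> at \<open>x n\<close> tends to \<open>0\<close>, and \<open>V\<close> because
    the functionals \<open>V (x n)\<close> converge to \<open>f\<close>.\<close>
  define p where "p \<xi> = h\<^sup>2 * (norm (S' \<xi>))\<^sup>2 - m * (norm \<xi>)\<^sup>2" for \<xi>
  have p_s: "p \<xi> = Re (s \<xi> \<xi>) + Re (V \<xi> \<xi>)" for \<xi> by (simp add: p_def Res Req)
  define K1 where "K1 = (h\<^sup>2 - m) * (2 * K)\<^sup>2"
  have hm: "0 \<le> h\<^sup>2 - m" using m0 zero_le_power2[of h] by linarith
  have np2: "np (x n - x k) \<le> 2 * K" for n k
  proof (rule power2_le_imp_le)
    have SS: "(norm (S' (x n) - S' (x k)))\<^sup>2 + (norm (x n - x k))\<^sup>2 \<le> 2 * (np (x n))\<^sup>2 + 2 * (np (x k))\<^sup>2"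
      using add_mono[OF norm_diff_sq_le[of "S' (x n)" "S' (x k)"] norm_diff_sq_le[of "x n" "x k"]]
      unfolding norm_plus_sq[OF xD] by (simp add: algebra_simps)
    also have "\<dots> \<le> 2 * K\<^sup>2 + 2 * K\<^sup>2"
      by (intro add_mono mult_left_mono power_mono Kx norm_plus_nonneg) simp_all
    finally show "(np (x n - x k))\<^sup>2 \<le> (2 * K)\<^sup>2"
      unfolding norm_plus_sq[OF D_diff[OF xD xD]] S_diff(2)[OF xD xD] by (simp add: power_mult_distrib)
  qed (use K in simp)
  have p_le: "p \<xi> \<le> (h\<^sup>2 - m) * (np \<xi>)\<^sup>2" if "\<xi> \<in> D" for \<xi>
  proof -
    have "m * (norm (S' \<xi>))\<^sup>2 \<le> 0" using m0 by (simp add: mult_nonpos_nonneg)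
    moreover have "0 \<le> h\<^sup>2 * (norm \<xi>)\<^sup>2" by simp
    ultimately show ?thesis unfolding p_def norm_plus_sq[OF that] left_diff_distrib distrib_left by linarith
  qed
  define a where "a n = sqrt (\<sigma> n) * sqrt K1 + \<epsilon> n * (2 * K)" for n
  have a: "a \<longlonglongrightarrow> 0"
  proof -
    have "a \<longlonglongrightarrow> sqrt 0 * sqrt K1 + 0 * (2 * K)"
      unfolding a_def[abs_def] by (intro tendsto_intros \<sigma> \<epsilon>)
    then show ?thesis by simp
  qed
  have s_bound: "cmod (s (x n) \<eta>) \<le> sqrt (\<sigma> n) * sqrt (Re (s \<eta> \<eta>))" if "\<eta> \<in> E" for n \<eta>
  proof -
    have "(cmod (s (x n) \<eta>))\<^sup>2 \<le> Re (s (x n) (x n)) * Re (s \<eta> \<eta>)"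
      by (rule psd_form_Cauchy_Schwarz[OF psd xE that])
    also have "\<dots> \<le> \<sigma> n * Re (s \<eta> \<eta>)"
      using sx[of n] mE[OF that] by (intro mult_right_mono) (simp_all add: Res)
    finally have "cmod (s (x n) \<eta>) \<le> sqrt (\<sigma> n * Re (s \<eta> \<eta>))" by (rule real_le_rsqrt)
    then show ?thesis by (simp add: real_sqrt_mult)
  qed
  have p_diff: "p (x n - x k) \<le> a n + a k" for n k
  proof -
    define \<delta> where "\<delta> = x n - x k"
    have dE: "\<delta> \<in> E" unfolding \<delta>_def by (rule complex_vector.subspace_diff[OF E xE xE])
    note dD = ED[OF dE]
    have sd: "sqrt (Re (s \<delta> \<delta>)) \<le> sqrt K1"
    proof (rule real_sqrt_le_mono)
      have "Re (s \<delta> \<delta>) \<le> p \<delta>" using V_nonneg[OF dD] by (simp add: p_s)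
      also have "\<dots> \<le> (h\<^sup>2 - m) * (np \<delta>)\<^sup>2" by (rule p_le[OF dD])
      also have "\<dots> \<le> K1" unfolding K1_def \<delta>_def
        by (intro mult_left_mono power_mono np2 norm_plus_nonneg hm)
      finally show "Re (s \<delta> \<delta>) \<le> K1" .
    qed
    have sb: "cmod (s (x j) \<delta>) \<le> sqrt (\<sigma> j) * sqrt K1" for j
      using order_trans[OF s_bound[OF dE] mult_left_mono[OF sd]] \<sigma>0 by simp
    have \<epsilon>n: "\<epsilon> j * np \<delta> \<le> \<epsilon> j * (2 * K)" for j
    proof (rule mult_left_mono)
      \<comment> \<open>The sign of this supremum is read off from the estimate at
        \<open>x j\<close>, whose form norm is at least \<open>1\<close>.\<close>
      have "norm_minus H (\<lambda>\<eta>. V (x j) \<eta> - f \<eta>) \<ge> 0"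
      proof (cases "\<epsilon> j \<ge> 0")
        case False
        have "0 \<le> \<epsilon> j * np (x j)" using Vf[OF xD[of j], of j] norm_ge_zero order_trans by blast
        moreover have "np (x j) \<ge> 1" using norm_le_norm_plus[OF xD[of j]] by (simp add: x1)
        ultimately show ?thesis using False by (simp add: zero_le_mult_iff)
      qed (simp add: \<epsilon>_def)
      then show "0 \<le> \<epsilon> j" by (simp add: \<epsilon>_def)
    qed (simp add: \<delta>_def np2)
    have sdiff: "s \<delta> \<delta> = s (x n) \<delta> - s (x k) \<delta>"
    proof -
      have "q (\<delta> + x k) \<delta> = q \<delta> \<delta> + q (x k) \<delta>" by (rule q_add[OF dD xD dD])
      then show ?thesis by (simp add: s_def \<delta>_def cinner.diff_left algebra_simps)
    qed
    have Vdiff: "V \<delta> \<delta> = (V (x n) \<delta> - f \<delta>) - (V (x k) \<delta> - f \<delta>)"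
      using V_diff[OF xD xD dD, of n k] by (simp add: \<delta>_def)
    have "Re (s \<delta> \<delta>) \<le> cmod (s (x n) \<delta>) + cmod (s (x k) \<delta>)"
      unfolding sdiff using complex_Re_le_cmod norm_triangle_ineq4 order_trans by blast
    moreover have "Re (V \<delta> \<delta>) \<le> cmod (V (x n) \<delta> - f \<delta>) + cmod (V (x k) \<delta> - f \<delta>)"
      unfolding Vdiff using complex_Re_le_cmod norm_triangle_ineq4 order_trans by blast
    ultimately have "p \<delta> \<le> a n + a k"
      using sb[of n] sb[of k] Vf[OF dD, of n] Vf[OF dD, of k] \<epsilon>n[of n] \<epsilon>n[of k]
      unfolding p_s a_def by linarith
    then show ?thesis by (simp add: \<delta>_def)
  qed
  \<comment> \<open>Both coefficients of \<open>p\<close> are positive as \<open>m < 0\<close>, so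
    \<open>p\<close> dominates a multiple of the squared form norm.\<close>
  define c0 where "c0 = min (h\<^sup>2) (- m)"
  have c0: "c0 > 0" using h m0 by (simp add: c0_def)
  have p_ge: "c0 * (np \<xi>)\<^sup>2 \<le> p \<xi>" if "\<xi> \<in> D" for \<xi>
  proof -
    have "c0 * (norm (S' \<xi>))\<^sup>2 \<le> h\<^sup>2 * (norm (S' \<xi>))\<^sup>2" "c0 * (norm \<xi>)\<^sup>2 \<le> (- m) * (norm \<xi>)\<^sup>2"
      by (intro mult_right_mono; simp add: c0_def)+
    then show ?thesis unfolding norm_plus_sq[OF that] p_def by (simp add: distrib_left)
  qed
  have small: "\<exists>N. \<forall>n\<ge>N. \<forall>k\<ge>N. np (x n - x k) < b" if b: "b > 0" for b
  proof -
    have "c0 * b\<^sup>2 / 2 > 0" using c0 b by simp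
    then have "\<forall>\<^sub>F n in sequentially. a n < c0 * b\<^sup>2 / 2" by (rule order_tendstoD(2)[OF a])
    then obtain N where N: "\<And>n. n \<ge> N \<Longrightarrow> a n < c0 * b\<^sup>2 / 2" unfolding eventually_sequentially by blast
    have "np (x n - x k) < b" if "n \<ge> N" "k \<ge> N" for n k
    proof -
      have "c0 * (np (x n - x k))\<^sup>2 < c0 * b\<^sup>2"
        using p_ge[OF D_diff[OF xD xD], of n k] p_diff[of n k] N[OF that(1)] N[OF that(2)] by linarith
      then have "(np (x n - x k))\<^sup>2 < b\<^sup>2" using c0 by simp
      then show ?thesis using b by (simp add: power2_less_imp_less)
    qed
    then show ?thesis by blast
  qed
  have normS: "norm (S' \<xi>) \<le> np \<xi>" if "\<xi> \<in> D" for \<xi>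
    by (rule power2_le_imp_le) (simp_all add: norm_plus_sq[OF that] norm_plus_nonneg)
  have "Cauchy x"
  proof (rule CauchyI)
    fix b :: real assume "b > 0"
    from small[OF this] show "\<exists>M. \<forall>m\<ge>M. \<forall>n\<ge>M. norm (x m - x n) < b"
      using norm_le_norm_plus[OF D_diff[OF xD xD]] le_less_trans by blast
  qed
  then obtain \<zeta> where \<zeta>: "x \<longlonglongrightarrow> \<zeta>" using Cauchy_convergent convergent_def by blast
  have "Cauchy (\<lambda>n. S' (x n))"
  proof (rule CauchyI)
    fix b :: real assume "b > 0"
    from small[OF this] show "\<exists>M. \<forall>m\<ge>M. \<forall>n\<ge>M. norm (S' (x m) - S' (x n)) < b"
      using normS[OF D_diff[OF xD xD]] unfolding S_diff(2)[OF xD xD] using le_less_trans by blast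
  qed
  then obtain z where z: "(\<lambda>n. S' (x n)) \<longlonglongrightarrow> z" using Cauchy_convergent convergent_def by blast
  have S\<zeta>: "S \<zeta> = Some z" by (rule selfadjoint_closed[OF S_selfadjoint xD \<zeta> z])
  then have \<zeta>D: "\<zeta> \<in> D" by blast
  have \<zeta>1: "norm \<zeta> = 1" using LIMSEQ_unique[OF tendsto_norm[OF \<zeta>]] by (simp add: x1)
  have \<zeta>w: "cinner \<zeta> (w i) = 0" if "i < r" for i
  proof -
    have "(\<lambda>n. cinner (x n) (w i)) \<longlonglongrightarrow> cinner \<zeta> (w i)" by (intro cinner.tendsto tendsto_const \<zeta>)
    moreover have "cinner (x n) (w i) = 0" for n using xE[of n] that by (simp add: E_def)
    ultimately show ?thesis by (simp add: LIMSEQ_const_iff)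
  qed
  obtain KV where KV: "KV \<ge> 0" "\<And>\<xi> \<eta>. \<xi> \<in> D \<Longrightarrow> \<eta> \<in> D \<Longrightarrow> cmod (V \<xi> \<eta>) \<le> KV * np \<xi> * np \<eta>"
    using V_bound by blast
  have np0: "(\<lambda>n. np (x n - \<zeta>)) \<longlonglongrightarrow> 0"
  proof -
    have "(\<lambda>n. sqrt ((norm (S' (x n) - z))\<^sup>2 + (norm (x n - \<zeta>))\<^sup>2)) \<longlonglongrightarrow> sqrt ((norm (z - z))\<^sup>2 + (norm (\<zeta> - \<zeta>))\<^sup>2)"
      by (intro tendsto_intros z \<zeta>)
    moreover have "sqrt ((norm (S' (x n) - z))\<^sup>2 + (norm (x n - \<zeta>))\<^sup>2) = np (x n - \<zeta>)" for n
      using norm_plus_sq[OF D_diff[OF xD \<zeta>D], of n] S_diff(2)[OF xD \<zeta>D, of n] S\<zeta> norm_plus_nonneg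
      by (metis option.sel real_sqrt_unique)
    ultimately show ?thesis by simp
  qed
  have s_zero: "s \<zeta> \<eta> = 0" if \<eta>: "\<eta> \<in> E" for \<eta>
  proof -
    note \<eta>D = ED[OF \<eta>]
    have "(\<lambda>n. V (x n) \<eta> - V \<zeta> \<eta>) \<longlonglongrightarrow> 0"
    proof (rule Lim_null_comparison)
      show "\<forall>\<^sub>F n in sequentially. norm (V (x n) \<eta> - V \<zeta> \<eta>) \<le> KV * np (x n - \<zeta>) * np \<eta>"
        using KV(2)[OF D_diff[OF xD \<zeta>D] \<eta>D] V_diff[OF xD \<zeta>D \<eta>D] by simp
      have "(\<lambda>n. KV * np (x n - \<zeta>) * np \<eta>) \<longlonglongrightarrow> KV * 0 * np \<eta>" by (intro tendsto_intros np0)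
      then show "(\<lambda>n. KV * np (x n - \<zeta>) * np \<eta>) \<longlonglongrightarrow> 0" by simp
    qed
    then have "(\<lambda>n. V (x n) \<eta>) \<longlonglongrightarrow> V \<zeta> \<eta>" by (simp add: LIM_zero_iff)
    moreover have "z = S' \<zeta>" using S\<zeta> by simp
    ultimately have "(\<lambda>n. s (x n) \<eta>) \<longlonglongrightarrow> s \<zeta> \<eta>"
      unfolding s_def q_def using z \<zeta> by (intro tendsto_intros cinner.tendsto) simp_all
    moreover have "(\<lambda>n. s (x n) \<eta>) \<longlonglongrightarrow> 0"
    proof (rule Lim_null_comparison)
      show "\<forall>\<^sub>F n in sequentially. norm (s (x n) \<eta>) \<le> sqrt (\<sigma> n) * sqrt (Re (s \<eta> \<eta>))" using s_bound[OF \<eta>] by simp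
      have "(\<lambda>n. sqrt (\<sigma> n) * sqrt (Re (s \<eta> \<eta>))) \<longlonglongrightarrow> sqrt 0 * sqrt (Re (s \<eta> \<eta>))" by (intro tendsto_intros \<sigma>)
      then show "(\<lambda>n. sqrt (\<sigma> n) * sqrt (Re (s \<eta> \<eta>))) \<longlonglongrightarrow> 0" by simp
    qed
    ultimately show ?thesis by (rule LIMSEQ_unique)
  qed
  have "q \<zeta> \<eta> = complex_of_real m * cinner \<zeta> \<eta>" if \<eta>: "\<eta> \<in> D" for \<eta>
  proof -
    \<comment> \<open>\<open>\<eta> - g\<close> is orthogonal to the \<open>w i\<close>, where the
      equation is already known. On each \<open>w i\<close> both sides vanish, because
      \<open>w i\<close> is an eigenvector orthogonal to \<open>\<zeta>\<close>.\<close>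
    define g where "g = (\<Sum>i\<in>{..<r}. cinner \<eta> (w i) *\<^sub>C w i)"
    have wD: "w i \<in> D" if "i \<in> {..<r}" for i using that FD(3) by simp
    have gD: "g \<in> D" unfolding g_def using wD by (intro D_sum(1)) simp_all
    have "cinner g (w i) = cinner \<eta> (w i)" if "i < r" for i
      unfolding g_def using that by (intro neg_eigen_family_coeff[OF F]) simp_all
    then have E': "\<eta> - g \<in> E" using D_diff[OF \<eta> gD] by (simp add: E_def cinner.diff_left)
    have "s (w i) \<zeta> = 0" if "i < r" for i
    proof -
      have "cinner (w i) \<zeta> = 0" using \<zeta>w[OF that] cinner_swap_zero by blast
      then show ?thesis using FD(4)[OF that \<zeta>D] by (simp add: s_def)
    qed
    moreover have "s g \<zeta> = (\<Sum>i\<in>{..<r}. cinner \<eta> (w i) * s (w i) \<zeta>)"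
    proof -
      have "q g \<zeta> = (\<Sum>i\<in>{..<r}. cinner \<eta> (w i) * q (w i) \<zeta>)"
        unfolding g_def using wD \<zeta>D by (intro q_sum) simp_all
      then show ?thesis unfolding s_def
        by (simp add: g_def cinner.sum_left cinner_scaleC_left sum_distrib_left right_diff_distrib sum_subtractf mult.left_commute)
    qed
    ultimately have sg: "s g \<zeta> = 0" by simp
    have "s (\<eta> - g) \<zeta> = 0" using ssym[OF ED[OF E'] \<zeta>D] s_zero[OF E'] by simp
    moreover have "s \<eta> \<zeta> = s (\<eta> - g) \<zeta> + s g \<zeta>"
      using q_add[OF D_diff[OF \<eta> gD] gD \<zeta>D] by (simp add: s_def cinner.diff_left algebra_simps)
    ultimately have "s \<eta> \<zeta> = 0" using sg by simp
    then have "s \<zeta> \<eta> = 0" using ssym[OF \<zeta>D \<eta>] by simp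
    then show ?thesis by (simp add: s_def)
  qed
  then show ?thesis using \<zeta>1 m0 \<zeta>D \<zeta>w by blast
qed

text \<open>If \<open>r < n\<close>, some nontrivial combination \<open>\<eta>\<close> of
  \<open>n\<close> eigenvectors of \<open>A\<close> above \<open>h^2\<close> has
  \<open>\<xi> = P \<eta>\<close> orthogonal to all \<open>w i\<close>, and \<open>q\<close> is
  negative at \<open>\<xi>\<close>; the minimizer then extends the family. Only the \<open>r\<close>
  orthogonality conditions are spent, so the kernel costs nothing on this side.\<close>

lemma neg_eigen_family_lower:
  assumes F: "neg_eigen_family r w t" and max: "\<And>w' t'. \<not> neg_eigen_family (Suc r) w' t'"
    and n: "\<And>j. j < n \<Longrightarrow> h\<^sup>2 < l j"
  shows "n \<le> r"
proof (rule ccontr)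
  assume "\<not> ?thesis"
  then have rn: "r < n" by simp
  obtain c where c: "\<exists>j\<in>{..<n}. c j \<noteq> 0" "\<And>i. i < r \<Longrightarrow> (\<Sum>j\<in>{..<n}. c j * cinner (P (e j)) (w i)) = 0"
    using homogeneous_system_nontrivial[of "{..<r}" "{..<n}" "\<lambda>j i. cinner (P (e j)) (w i)"] rn by auto
  define \<eta> where "\<eta> = (\<Sum>j\<in>{..<n}. c j *\<^sub>C e j)"
  define \<xi> where "\<xi> = P \<eta>"
  have ej: "e j \<noteq> 0" if "j \<in> {..<n}" for j
  proof
    assume "e j = 0"
    then show False using n[of j] that e0[of j] by simp
  qed
  \<comment> \<open>An eigenvector with nonzero eigenvalue lies in the range of \<open>A\<close>,
    which is orthogonal to the kernel because \<open>P\<close> vanishes there.\<close>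
  have eG: "e j \<in> G" if "j \<in> {..<n}" for j
  proof (rule G_I)
    fix k assume k: "k \<in> Ker"
    have V0: "V (P (e j)) 0 = 0"
      using V_scale_right[OF inv_sqrt_dom inv_sqrt_dom, of "e j" 0 0] by simp
    have "complex_of_real (l j) * cinner (e j) k = cinner (A (e j)) k" by (simp add: Ae cinner_scaleC_left)
    also have "\<dots> = 0" by (simp add: cinner_A inv_sqrt_ker[OF k] V0)
    finally show "cinner (e j) k = 0" using n[of j] that by (simp add: power2_eq_square) (metis less_irrefl mult_zero_left not_square_less_zero)
  qed
  have "\<eta> \<in> G" unfolding \<eta>_def using eG G_sub
    by (intro complex_vector.subspace_sum complex_vector.subspace_scale) simp_all
  then have S\<xi>: "S \<xi> = Some \<eta>" unfolding \<xi>_def by (rule S_inv_sqrt)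
  then have xD: "\<xi> \<in> D" by blast
  have "P (\<Sum>j\<in>J. c j *\<^sub>C e j) = (\<Sum>j\<in>J. c j *\<^sub>C P (e j))" if "finite J" for J
    using that by (induction J rule: finite_induct) (simp_all add: P_lin)
  then have \<xi>: "\<xi> = (\<Sum>j\<in>{..<n}. c j *\<^sub>C P (e j))" by (simp add: \<xi>_def \<eta>_def)
  have orth: "cinner \<xi> (w i) = 0" if "i < r" for i
    using c(2)[OF that] by (simp add: \<xi> cinner.sum_left cinner_scaleC_left)
  have "l (n - 1) * (norm \<eta>)\<^sup>2 \<le> Re (cinner (A \<eta>) \<eta>)"
    unfolding \<eta>_def
  proof (rule diagonalizes_quadratic_ge[OF e_on d A])
    fix j assume "j \<in> {..<n}"
    then have "j \<le> n - 1" using rn by simp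
    then show "l (n - 1) \<le> l j" by (rule antimonoD[OF l_anti])
  qed (use ej in simp_all)
  moreover have "h\<^sup>2 < l (n - 1)" using n[of "n - 1"] rn by simp
  moreover have n\<eta>: "(norm \<eta>)\<^sup>2 > 0"
  proof -
    have "(norm \<eta>)\<^sup>2 = (\<Sum>j\<in>{..<n}. (cmod (c j))\<^sup>2)"
      unfolding \<eta>_def using ej by (intro norm_sq_orthonormal_sum(2)[OF e_on]) simp_all
    moreover obtain j where "j \<in> {..<n}" "c j \<noteq> 0" using c(1) by blast
    then have "(\<Sum>j\<in>{..<n}. (cmod (c j))\<^sup>2) > 0" by (intro sum_pos2[of _ j]) simp_all
    ultimately show ?thesis by simp
  qed
  ultimately have "h\<^sup>2 * (norm \<eta>)\<^sup>2 < Re (cinner (A \<eta>) \<eta>)"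
    using mult_strict_right_mono[of "h\<^sup>2" "l (n - 1)" "(norm \<eta>)\<^sup>2"] by linarith
  then have "Re (q \<xi> \<xi>) < 0"
    unfolding q_def using S\<xi> by (simp add: cinner_A \<xi>_def cinner_self)
  from minimizer_exists[OF F xD orth this] obtain \<zeta> m where "norm \<zeta> = 1" "m < 0" "\<zeta> \<in> D"
    "\<And>i. i < r \<Longrightarrow> cinner \<zeta> (w i) = 0" "\<And>\<eta>. \<eta> \<in> D \<Longrightarrow> q \<zeta> \<eta> = complex_of_real m * cinner \<zeta> \<eta>" by blast
  from neg_eigen_family_extend[OF F this(1-3,5,4)] max show False by blast
qed

text \<open>For \<open>s < 0\<close> the \<open>w i\<close> with \<open>t i = s\<close> span the
  eigenspace: an eigenvector orthogonal to them is orthogonal to the other \<open>w i\<close> as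
  well, by symmetry of \<open>q\<close> and distinct eigenvalues, and if nonzero would extend the
  maximal family.\<close>

lemma N_minus_eq:
  assumes F: "neg_eigen_family r w t" and max: "\<And>w' t'. \<not> neg_eigen_family (Suc r) w' t'"
  shows "N_minus (schroedinger H V h) = enat r"
proof -
  note FD = neg_eigen_familyD[OF F]
  let ?E = "\<lambda>s. eigenspace (schroedinger H V h) (complex_of_real s)"
  have dim: "cdim_enat (?E s) = enat (card {i. i < r \<and> t i = s})" if s: "s < 0" for s
  proof -
    define I where "I = {i. i < r \<and> t i = s}"
    have I: "I \<subseteq> {..<r}" "finite I" unfolding I_def by auto
    have Esub: "complex_vector.subspace (?E s)"
      unfolding complex_vector.subspace_def
    proof (intro conjI ballI allI)
      show "0 \<in> ?E s"
        using complex_vector.subspace_0[OF S_sub] q_scale[of 0 _ 0] by (simp add: eigenspace_iff cinner.zero_left)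
      fix x y c assume x: "x \<in> ?E s"
      then show "c *\<^sub>C x \<in> ?E s" by (auto simp: eigenspace_iff D_scale q_scale cinner_scaleC_left)
      assume "y \<in> ?E s"
      with x show "x + y \<in> ?E s"
        by (auto simp: eigenspace_iff D_add q_add cinner_add_left distrib_left)
    qed
    have wE: "w ` I \<subseteq> ?E s"
    proof (rule image_subsetI)
      fix i assume "i \<in> I"
      then have "i < r" "t i = s" by (simp_all add: I_def)
      then show "w i \<in> ?E s" unfolding eigenspace_iff using FD(3,4) by simp
    qed
    have "?E s = complex_vector.span (w ` I)"
    proof
      show "complex_vector.span (w ` I) \<subseteq> ?E s" by (rule complex_vector.span_minimal[OF wE Esub])
      show "?E s \<subseteq> complex_vector.span (w ` I)"
      proof
        fix x assume x: "x \<in> ?E s"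
        define p where "p = (\<Sum>i\<in>I. cinner x (w i) *\<^sub>C w i)"
        have pspan: "p \<in> complex_vector.span (w ` I)" unfolding p_def
          by (intro complex_vector.span_sum complex_vector.span_scale complex_vector.span_base imageI)
        have "p \<in> ?E s" using pspan complex_vector.span_minimal[OF wE Esub] by blast
        then have yE: "x - p \<in> ?E s" using x Esub by (intro complex_vector.subspace_diff)
        define y where "y = x - p"
        have y: "y \<in> D" "\<And>\<eta>. \<eta> \<in> D \<Longrightarrow> q y \<eta> = complex_of_real s * cinner y \<eta>"
          using yE unfolding eigenspace_iff y_def by blast+
        have orth: "cinner y (w i) = 0" if i: "i < r" for i
        proof (cases "t i = s")
          case True
          then have "i \<in> I" using i by (simp add: I_def)
          then show ?thesis using neg_eigen_family_coeff[OF F I(1)] by (simp add: y_def p_def cinner.diff_left)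
        next
          case False
          have "complex_of_real s * cinner y (w i) = q y (w i)" using y(2)[OF FD(3)[OF i]] by simp
          also have "\<dots> = cnj (q (w i) y)" by (rule q_sym[OF y(1) FD(3)[OF i]])
          also have "\<dots> = complex_of_real (t i) * cinner y (w i)"
            using FD(4)[OF i y(1)] cinner_commute[of y "w i"] by simp
          finally show ?thesis using False by simp
        qed
        have "y = 0"
        proof (rule ccontr)
          assume y0: "y \<noteq> 0"
          define c where "c = complex_of_real (1 / norm y)"
          have "norm (c *\<^sub>C y) = 1" using y0 by (simp add: c_def norm_scaleC norm_divide)
          moreover have "c *\<^sub>C y \<in> D" by (rule D_scale[OF y(1)])
          moreover have "q (c *\<^sub>C y) \<eta> = complex_of_real s * cinner (c *\<^sub>C y) \<eta>" if "\<eta> \<in> D" for \<eta>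
            using y that by (simp add: q_scale cinner_scaleC_left)
          moreover have "cinner (c *\<^sub>C y) (w i) = 0" if "i < r" for i using orth[OF that] by (simp add: cinner_scaleC_left)
          ultimately have "neg_eigen_family (Suc r) (w(r := c *\<^sub>C y)) (t(r := s))"
            using s by (intro neg_eigen_family_extend[OF F])
          then show False using max by blast
        qed
        then have "x = p" by (simp add: y_def)
        then show "x \<in> complex_vector.span (w ` I)" using pspan by simp
      qed
    qed
    moreover have "cdim_enat (complex_vector.span (w ` I)) = enat (card I)"
      by (rule orthonormal_family_dim[OF I(2)]) (use FD(1,5) in \<open>simp_all add: I_def\<close>)
    ultimately show ?thesis by (simp add: I_def)
  qed
  have "N_minus (schroedinger H V h) = (\<Sum>\<^sub>\<infinity>s\<in>{..<0}. enat (card {i. i < r \<and> t i = s}))"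
    unfolding N_minus_def by (rule infsum_cong) (simp add: dim)
  also have "\<dots> = enat r" by (rule infsum_enat_card_fibers[OF FD(2)])
  finally show ?thesis .
qed

text \<open>The bound on lengths lets a family of maximal length exist.
  \<open>LEAST j. l j \<le> h\<^sup>2\<close> is the number of eigenvalues of \<open>A\<close>
  strictly above \<open>h^2\<close>, as \<open>l\<close> is non-increasing and starts at index
  \<open>0\<close>.\<close>

theorem N_minus_bounds:
  assumes B: "finite B" "Ker \<subseteq> complex_vector.span B"
  shows "\<exists>r. N_minus (schroedinger H V h) = enat r \<and> (LEAST j. l j \<le> h\<^sup>2) \<le> r \<and> r \<le> (LEAST j. l j \<le> h\<^sup>2) + card B"
proof -
  define n where "n = (LEAST j. l j \<le> h\<^sup>2)"
  have "\<forall>\<^sub>F j in sequentially. l j < h\<^sup>2" using order_tendstoD(2)[OF l_lim, of "h\<^sup>2"] h by simp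
  then obtain j where "l j < h\<^sup>2" unfolding eventually_sequentially by blast
  then have "l j \<le> h\<^sup>2" by simp
  then have n1: "l n \<le> h\<^sup>2" unfolding n_def by (rule LeastI)
  have n2: "h\<^sup>2 < l j" if "j < n" for j using not_less_Least[of j "\<lambda>j. l j \<le> h\<^sup>2"] that by (simp add: n_def)
  have "neg_eigen_family 0 (\<lambda>_. 0) (\<lambda>_. 0)" by (simp add: neg_eigen_family_def)
  then have ex: "\<exists>w t. neg_eigen_family 0 w t" by blast
  have bd: "\<forall>r. (\<exists>w t. neg_eigen_family r w t) \<longrightarrow> r < Suc (n + card B)"
    using neg_eigen_family_upper[OF _ B n1] le_imp_less_Suc by blast
  obtain r where r: "\<exists>w t. neg_eigen_family r w t" "\<And>r'. (\<exists>w t. neg_eigen_family r' w t) \<Longrightarrow> r' \<le> r"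
    using ex_has_greatest_nat[of "\<lambda>r. \<exists>w t. neg_eigen_family r w t" 0 "\<lambda>r. r" "Suc (n + card B)", OF ex bd] by blast
  obtain w t where F: "neg_eigen_family r w t" using r(1) by blast
  have max: "\<not> neg_eigen_family (Suc r) w' t'" for w' t' using r(2)[of "Suc r"] by auto
  show ?thesis unfolding n_def[symmetric]
    using N_minus_eq[OF F max] neg_eigen_family_lower[OF F max n2] neg_eigen_family_upper[OF F B n1] by blast
qed

end

end

section \<open>Weyl asymptotics\<close>

text \<open>For the least index \<open>n > 0\<close> one has \<open>l n \<le> s < l (n - 1)\<close>,
  hence \<open>n l n \<le> s n \<le> n l (n - 1)\<close>. The right side is
  \<open>(j + 1) l j\<close> at \<open>j = n - 1\<close>, so the two outer terms have the same limit
  when \<open>n\<close> grows.\<close>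

lemma counting_function_asymptotics:
  assumes anti: "antimono l" and l0: "\<And>j. 0 \<le> l j" and lz: "l \<longlonglongrightarrow> 0" and lim: "(\<lambda>j. real j * l j) \<longlonglongrightarrow> c"
  shows "((\<lambda>s. s * real (LEAST j. l j \<le> s)) \<longlongrightarrow> c) (at_right 0)"
proof (rule tendstoI)
  fix \<epsilon>' :: real assume "\<epsilon>' > 0"
  define \<epsilon> where "\<epsilon> = \<epsilon>' / 2"
  have \<epsilon>: "\<epsilon> > 0" "\<epsilon> < \<epsilon>'" using \<open>\<epsilon>' > 0\<close> by (simp_all add: \<epsilon>_def)
  have c0: "0 \<le> c" using LIMSEQ_le_const[OF lim, of 0] l0 by simp
  obtain N1 where N1: "\<And>j. j \<ge> N1 \<Longrightarrow> norm (real j * l j - c) < \<epsilon>" using LIMSEQ_D[OF lim \<epsilon>(1)] by blast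
  obtain N2 where N2: "\<And>j. j \<ge> N2 \<Longrightarrow> norm ((real j + 1) * l j - c) < \<epsilon>"
    using LIMSEQ_D[OF inverse_bound_of_convergent(1)[OF lim lz] \<epsilon>(1)] by blast
  define N where "N = max N1 N2"
  \<comment> \<open>The first bound makes \<open>s n\<close> small for \<open>n \<le> N\<close>. The
    second forces \<open>n > N\<close> unless \<open>l N = 0\<close>, in which case
    \<open>c < \<epsilon>\<close>.\<close>
  define b where "b = min (\<epsilon> / (real N + 1)) (if l N > 0 then l N else 1)"
  have b: "b > 0" using \<epsilon> by (simp add: b_def)
  have "\<bar>s * real (LEAST j. l j \<le> s) - c\<bar> \<le> \<epsilon>" if s: "0 < s" "s < b" for s
  proof -
    define n where "n = (LEAST j. l j \<le> s)"
    have "\<forall>\<^sub>F j in sequentially. l j < s" using order_tendstoD(2)[OF lz, of s] s by simp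
    then obtain j where "l j < s" unfolding eventually_sequentially by blast
    then have "l j \<le> s" by simp
    then have n1: "l n \<le> s" unfolding n_def by (rule LeastI)
    have n2: "s < l j" if "j < n" for j using not_less_Least[of j "\<lambda>j. l j \<le> s"] that by (simp add: n_def)
    have up: "s * real n \<le> c + \<epsilon>"
    proof (cases "n \<le> N")
      case True
      have "s * real n \<le> \<epsilon> / (real N + 1) * (real N + 1)"
        using s True by (intro mult_mono) (simp_all add: b_def)
      then show ?thesis using c0 by simp
    next
      case False
      then have "s \<le> l (n - 1)" using n2[of "n - 1"] by simp
      then have "s * real n \<le> l (n - 1) * real n" by (rule mult_right_mono) simp
      also have "\<dots> = (real (n - 1) + 1) * l (n - 1)" using False by simp
      also have "\<dots> \<le> c + \<epsilon>"
      proof -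
        have "N2 \<le> n - 1" using False by (simp add: N_def)
        from N2[OF this] show ?thesis unfolding real_norm_def by linarith
      qed
      finally show ?thesis .
    qed
    have lo: "c - \<epsilon> \<le> s * real n"
    proof (cases "n \<ge> N")
      case True
      then have "c - \<epsilon> \<le> real n * l n" using N1[of n] by (simp add: N_def)
      also have "\<dots> \<le> real n * s" using n1 by (rule mult_left_mono) simp
      finally show ?thesis by (simp add: mult.commute)
    next
      case False
      then have "l N \<le> l n" by (intro antimonoD[OF anti]) simp
      then have "l N \<le> s" using n1 by simp
      then have "\<not> l N > 0" using s by (auto simp: b_def)
      then have "l N = 0" using l0[of N] by simp
      then have "c < \<epsilon>" using N1[of N] c0 by (simp add: N_def)
      moreover have "0 \<le> s * real n" using s by simp
      ultimately show ?thesis by linarith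
    qed
    show ?thesis using up lo unfolding n_def by linarith
  qed
  then have "\<forall>s>0. s < b \<longrightarrow> dist (s * real (LEAST j. l j \<le> s)) c < \<epsilon>'"
    using \<epsilon>(2) unfolding dist_real_def using le_less_trans by blast
  then show "\<forall>\<^sub>F s in at_right 0. dist (s * real (LEAST j. l j \<le> s)) c < \<epsilon>'"
    unfolding eventually_at_right_field using b by blast
qed

theorem proposition7p3:
  fixes H :: "'a::chilbert_space \<rightharpoonup> 'a"
    and V :: "'a \<Rightarrow> 'a \<Rightarrow> complex"
  assumes "separable_space (euclidean :: 'a topology)"
    and "\<not> cfinite_dim (UNIV :: 'a set)"
    and "selfadjoint_op H"
    and "spectrum H \<subseteq> \<real>\<^sub>\<ge>\<^sub>0"
    and "0 \<in> spectrum H"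
    and "0 \<in> discrete_spectrum H"
    and "bounded_plus_minus H V"
    and "symmetric_form H V"
    and "form_compact H V"
    and "nonneg_form H V"
    and "weyl_operator (birman_schwinger H V)"
  shows "strongly_measurable (birman_schwinger H V) \<and>
    measurable_op (birman_schwinger H V) \<and>
    (\<exists>L::real. nc_integral (birman_schwinger H V) = complex_of_real L \<and>
      ((\<lambda>h. ereal (h\<^sup>2) * ereal_of_enat (N_minus (schroedinger H V h)))
        \<longlongrightarrow> ereal L) (at_right 0))"
proof -
  let ?A = "birman_schwinger H V"
  have A: "positive_op ?A" "?A \<in> \<L>\<^sub>1\<^sub>\<infinity>" "convergent (\<lambda>j. of_nat j * eigenvalue_seq ?A j)"
    using assms(11) by (simp_all add: weyl_operator_def)
  have "compact_op ?A" using A(2) by (simp add: weak_trace_class_def)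
  then obtain e l where d: "diagonalizes ?A e l" using compact_positive_diagonalizable[OF A(1)] by blast
  have l: "\<And>j. 0 \<le> l j" "antimono l" "l \<longlonglongrightarrow> 0" using d by (simp_all add: diagonalizes_def)
  have "convergent (\<lambda>j. complex_of_real (real j * l j))"
    using A(3) unfolding eigenvalue_seq_diagonalizes[OF A(1) d] by simp
  then obtain z where "(\<lambda>j. complex_of_real (real j * l j)) \<longlonglongrightarrow> z" unfolding convergent_def by blast
  then have "(\<lambda>j. Re (complex_of_real (real j * l j))) \<longlonglongrightarrow> Re z" by (rule tendsto_Re)
  then have lim: "(\<lambda>j. real j * l j) \<longlonglongrightarrow> Re z" by simp
  define L where "L = Re z"
  note lim = lim[folded L_def]
  have strong: "strongly_measurable ?A"
    unfolding strongly_measurable_def using A(2) trace_of_Weyl_operator[OF _ _ A(1) d lim] by blast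
  have dix: "dixmier_trace \<omega> ?A = complex_of_real L" if "extended_limit \<omega>" for \<omega>
    by (rule dixmier_trace_of_Weyl_operator[OF that A(1) d lim])
  have meas: "measurable_op ?A" unfolding measurable_op_def using A(2) dix by blast
  have nc: "nc_integral ?A = complex_of_real L"
    unfolding nc_integral_def
  proof (rule the_equality)
    \<comment> \<open>Existence of one extended limit rules out that every \<open>c\<close>
      satisfies the description vacuously.\<close>
    obtain \<omega> :: "(nat \<Rightarrow> complex) \<Rightarrow> complex" where \<omega>: "extended_limit \<omega>" using extended_limit_exists by blast
    fix c assume "\<forall>\<omega>. extended_limit \<omega> \<longrightarrow> dixmier_trace \<omega> ?A = c"
    then show "c = complex_of_real L" using \<omega> dix[OF \<omega>] by metis
  qed (use dix in blast)
  obtain R X where Z: "zero_in_discrete_spectrum H R X"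
    using zero_in_discrete_spectrum_exists[OF assms(3,4,6)] by blast
  then interpret zero_in_discrete_spectrum H R X .
  interpret form_perturbation H R X V e l
    by unfold_locales (rule assms A(1) d)+
  obtain B where B: "finite B" "Ker \<subseteq> complex_vector.span B" using finite_span_ker by blast
  define n where "n s = (LEAST j. l j \<le> s)" for s
  define r where "r h = the_enat (N_minus (schroedinger H V h))" for h
  have r: "N_minus (schroedinger H V h) = enat (r h)" "n (h\<^sup>2) \<le> r h" "r h \<le> n (h\<^sup>2) + card B" if h: "h > 0" for h
  proof -
    obtain k where "N_minus (schroedinger H V h) = enat k" "n (h\<^sup>2) \<le> k" "k \<le> n (h\<^sup>2) + card B"
      using N_minus_bounds[OF h B] unfolding n_def by blast
    then show "N_minus (schroedinger H V h) = enat (r h)" "n (h\<^sup>2) \<le> r h" "r h \<le> n (h\<^sup>2) + card B"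
      by (simp_all add: r_def)
  qed
  have pos: "\<forall>\<^sub>F h in at_right 0. h > (0::real)" by (rule eventually_at_right_less)
  have h0: "((\<lambda>h::real. h\<^sup>2) \<longlongrightarrow> 0\<^sup>2) (at_right 0)" by (intro tendsto_intros)
  have "filterlim (\<lambda>h::real. h\<^sup>2) (at_right 0) (at_right 0)"
    unfolding filterlim_at using h0 pos by (auto elim: eventually_mono)
  from filterlim_compose[OF counting_function_asymptotics[OF l(2,1,3) lim] this]
  have nlim: "((\<lambda>h. h\<^sup>2 * real (n (h\<^sup>2))) \<longlongrightarrow> L) (at_right 0)" unfolding n_def .
  \<comment> \<open>The kernel enters through the constant \<open>card B\<close> alone, which the
    factor \<open>h^2\<close> removes in the limit.\<close>
  have "((\<lambda>h. h\<^sup>2 * real (n (h\<^sup>2)) + h\<^sup>2 * real (card B)) \<longlongrightarrow> L + 0\<^sup>2 * real (card B)) (at_right 0)"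
    by (intro tendsto_add nlim tendsto_mult h0 tendsto_const)
  then have ulim: "((\<lambda>h. h\<^sup>2 * real (n (h\<^sup>2)) + h\<^sup>2 * real (card B)) \<longlongrightarrow> L) (at_right 0)" by simp
  have rlim: "((\<lambda>h. h\<^sup>2 * real (r h)) \<longlongrightarrow> L) (at_right 0)"
  proof (rule tendsto_sandwich[OF _ _ nlim ulim])
    show "\<forall>\<^sub>F h in at_right 0. h\<^sup>2 * real (n (h\<^sup>2)) \<le> h\<^sup>2 * real (r h)"
      using pos by eventually_elim (simp add: r(2) mult_left_mono)
    show "\<forall>\<^sub>F h in at_right 0. h\<^sup>2 * real (r h) \<le> h\<^sup>2 * real (n (h\<^sup>2)) + h\<^sup>2 * real (card B)"
      using pos
    proof eventually_elim
      case (elim h)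
      have "real (r h) \<le> real (n (h\<^sup>2) + card B)" using r(3)[OF elim] by (rule of_nat_mono)
      then have "h\<^sup>2 * real (r h) \<le> h\<^sup>2 * real (n (h\<^sup>2) + card B)" by (rule mult_left_mono) simp
      then show ?case by (simp add: distrib_left)
    qed
  qed
  have "((\<lambda>h. ereal (h\<^sup>2) * ereal_of_enat (N_minus (schroedinger H V h))) \<longlongrightarrow> ereal L) (at_right 0)"
  proof (rule Lim_transform_eventually[OF tendsto_ereal[OF rlim]])
    show "\<forall>\<^sub>F h in at_right 0. ereal (h\<^sup>2 * real (r h)) = ereal (h\<^sup>2) * ereal_of_enat (N_minus (schroedinger H V h))"
      using pos by eventually_elim (simp add: r(1))
  qed
  then show ?thesis using strong meas nc by blast
qed

end
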